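(* Let $G$ be a finite group. The assignment $(H,B)\mapsto \mathcal{L}_{(H,B)}$ is a bijection from the set of pairs $(H,B)$, where $H$ is a normal Abelian subgroup of $G$ and $B$ is an alternating $G$-invariant bicharacter on $H$, onto the set of Lagrangian subcategories of the representation category $\mathrm{Rep}(D(G))$ of the Drinfeld double $D(G)$.
   Context: $k$ is an algebraically closed field of characteristic zero; representations are finite-dimensional over $k$. **The category $\mathrm{Rep}(D(G))$.** It is a modular category, equivalent to the center of the category of $G$-graded vector spaces. Its objects are finite-dimensional $G$-graded vector spaces $V=\bigoplus_{x\in G}V_x$ with a linear $G$-action such that $gV_x=V_{gxg^{-1}}$. The tensor product has the diagonal action and grading $(V\otimes W)_z=\bigoplus_{xy=z}V_x\otimes W_y$. The braiding is $v\otimes w\mapsto (x\cdot w)\otimes v$ for $v\in V_x$. The twist $\theta$ acts on $V_x$ by the action of $x$. The dimension $d(V)$ is the vector space dimension. Let $R$ be a set of representatives of the conjugacy classes of $G$, let $K_a$ be the conjugacy class of $a$ and $C_G(a)$ its centralizer. Isomorphism classes of simple objects are identified with the set $\Gamma$ of pairs $(a,\chi)$, $a\in R$, $\chi$ an irreducible character of $C_G(a)$; the object $(a,\chi)$ is supported on $K_a$ and its component $V_a$ affords $\chi$. One has $d(a,\chi)=|K_a|\deg\chi$ and the twist on $(a,\chi)$ is the scalar $\chi(a)/\deg\chi$. **Lagrangian subcategories.** A fusion subcategory of a modular category $\mathcal{C}$ is a full subcategory closed under isomorphism, direct sums, direct summands, tensor products and duals and containing the unit. For a full subcategory $\mathcal{D}$,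 $\dim(\mathcal{D})=\sum_X d(X)^2$, the sum over isomorphism classes of simple objects of $\mathcal{D}$. A fusion subcategory $\mathcal{D}\subseteq\mathcal{C}$ is isotropic if the twist restricts to the identity on $\mathcal{D}$, and Lagrangian if it is isotropic and $\dim(\mathcal{D})^2=\dim(\mathcal{C})$. **Bicharacters.** An alternating bicharacter on an Abelian group $H$ is a map $B:H\times H\to k^\times$ multiplicative in each variable with $B(h,h)=1$ for all $h\in H$. It is $G$-invariant if $B(ghg^{-1},gh'g^{-1})=B(h,h')$ for all $g\in G$, $h,h'\in H$. **The subcategory $\mathcal{L}_{(H,B)}$.** It is the full Abelian subcategory of $\mathrm{Rep}(D(G))$ generated by (that is, whose objects are the finite direct sums of) the simple objects $(a,\chi)\in\Gamma$ with $a\in H\cap R$ and $\chi(h)=B(a,h)\deg\chi$ for all $h\in H$. *)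

theory Defs
  imports
    "Jordan_Normal_Form.VS_Connect"
    "HOL-Algebra.Coset"
begin

subsection \<open>Matrix representations and characters\<close>

text \<open>
  Every finite-dimensional vector space over the field is isomorphic to the space
  \<^term>\<open>carrier_vec n\<close> of column vectors for some \<open>n\<close>, so representations are taken on these spaces.
\<close>

abbreviation vsubspace :: "nat \<Rightarrow> 'k::field vec set \<Rightarrow> bool" where
  "vsubspace n U \<equiv> VectorSpace.subspace class_ring U (module_vec TYPE('k) n)"

abbreviation vspan :: "nat \<Rightarrow> 'k::field vec set \<Rightarrow> 'k vec set" where
  "vspan n S \<equiv> LinearCombinations.module.span class_ring (module_vec TYPE('k) n) S"

definition mat_trace :: "'k::field mat \<Rightarrow> 'k" where
  "mat_trace A = (\<Sum>i<dim_row A. A $$ (i, i))"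

text \<open>\<open>C\<close> is the carrier of a subgroup of \<open>G\<close>; only the values of \<open>\<rho>\<close> on \<open>C\<close> matter.\<close>

definition mat_rep :: "('g, 'b) monoid_scheme \<Rightarrow> 'g set \<Rightarrow> nat \<Rightarrow> ('g \<Rightarrow> 'k::field mat) \<Rightarrow> bool" where
  "mat_rep G C n \<rho> \<longleftrightarrow>
     (\<forall>g\<in>C. \<rho> g \<in> carrier_mat n n) \<and>
     \<rho> \<one>\<^bsub>G\<^esub> = 1\<^sub>m n \<and>
     (\<forall>g\<in>C. \<forall>h\<in>C. \<rho> (g \<otimes>\<^bsub>G\<^esub> h) = \<rho> g * \<rho> h)"

definition irr_mat_rep :: "('g, 'b) monoid_scheme \<Rightarrow> 'g set \<Rightarrow> nat \<Rightarrow> ('g \<Rightarrow> 'k::field mat) \<Rightarrow> bool" where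
  "irr_mat_rep G C n \<rho> \<longleftrightarrow>
     mat_rep G C n \<rho> \<and> n > 0 \<and>
     (\<forall>U. vsubspace n U \<and> (\<forall>g\<in>C. \<forall>u\<in>U. \<rho> g *\<^sub>v u \<in> U) \<longrightarrow> U = {0\<^sub>v n} \<or> U = carrier_vec n)"

text \<open>Characters are extensional functions: they are \<^const>\<open>undefined\<close> off \<open>C\<close>.\<close>

definition rep_char :: "'g set \<Rightarrow> ('g \<Rightarrow> 'k::field mat) \<Rightarrow> 'g \<Rightarrow> 'k" where
  "rep_char C \<rho> = (\<lambda>g\<in>C. mat_trace (\<rho> g))"

definition irr_chars :: "('g, 'b) monoid_scheme \<Rightarrow> 'g set \<Rightarrow> ('g \<Rightarrow> 'k::field) set" where
  "irr_chars G C = {rep_char C \<rho> | n \<rho>. irr_mat_rep G C n \<rho>}"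

text \<open>The degree as an element of the field, which has characteristic zero where this is used.\<close>

definition char_deg :: "('g, 'b) monoid_scheme \<Rightarrow> ('g \<Rightarrow> 'k) \<Rightarrow> 'k" where
  "char_deg G \<chi> = \<chi> \<one>\<^bsub>G\<^esub>"


subsection \<open>Objects and morphisms of the category\<close>

record ('g, 'k) dgrep =
  dg_dim :: nat
  dg_comp :: "'g \<Rightarrow> 'k vec set"
  dg_act :: "'g \<Rightarrow> 'k mat"

text \<open>
  An object lives on \<^term>\<open>carrier_vec n\<close> with \<open>n\<close> its dimension. Values of \<^const>\<open>dg_comp\<close> and
  \<^const>\<open>dg_act\<close> outside the group are irrelevant: objects that differ only there are isomorphic, and
  all subcategories considered are closed under isomorphism.
\<close>

text \<open>\<open>f x\<close> is the homogeneous component of degree \<open>x\<close> of the vector \<open>v\<close>.\<close>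

definition dg_decomp :: "('g, 'b) monoid_scheme \<Rightarrow> ('g, 'k::field) dgrep \<Rightarrow> 'k vec \<Rightarrow> ('g \<Rightarrow> 'k vec) \<Rightarrow> bool" where
  "dg_decomp G V v f \<longleftrightarrow>
     f \<in> (\<Pi>\<^sub>E x\<in>carrier G. dg_comp V x) \<and> v = finsum_vec TYPE('k) (dg_dim V) f (carrier G)"

definition dg_obj :: "('g, 'b) monoid_scheme \<Rightarrow> ('g, 'k::field) dgrep \<Rightarrow> bool" where
  "dg_obj G V \<longleftrightarrow>
     (\<forall>x\<in>carrier G. vsubspace (dg_dim V) (dg_comp V x)) \<and>
     (\<forall>v\<in>carrier_vec (dg_dim V). \<exists>!f. dg_decomp G V v f) \<and>
     mat_rep G (carrier G) (dg_dim V) (dg_act V) \<and>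
     (\<forall>g\<in>carrier G. \<forall>x\<in>carrier G.
        (\<lambda>v. dg_act V g *\<^sub>v v) ` dg_comp V x = dg_comp V (g \<otimes>\<^bsub>G\<^esub> x \<otimes>\<^bsub>G\<^esub> inv\<^bsub>G\<^esub> g))"

definition dg_hom :: "('g, 'b) monoid_scheme \<Rightarrow> ('g, 'k::field) dgrep \<Rightarrow> ('g, 'k) dgrep \<Rightarrow> 'k mat set" where
  "dg_hom G V W = {T \<in> carrier_mat (dg_dim W) (dg_dim V).
     (\<forall>g\<in>carrier G. T * dg_act V g = dg_act W g * T) \<and>
     (\<forall>x\<in>carrier G. \<forall>v\<in>dg_comp V x. T *\<^sub>v v \<in> dg_comp W x)}"

definition dg_iso :: "('g, 'b) monoid_scheme \<Rightarrow> ('g, 'k::field) dgrep \<Rightarrow> ('g, 'k) dgrep \<Rightarrow> bool" where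
  "dg_iso G V W \<longleftrightarrow>
     (\<exists>T\<in>dg_hom G V W. \<exists>S\<in>dg_hom G W V. S * T = 1\<^sub>m (dg_dim V) \<and> T * S = 1\<^sub>m (dg_dim W))"

definition dg_subobject :: "('g, 'b) monoid_scheme \<Rightarrow> ('g, 'k::field) dgrep \<Rightarrow> 'k vec set \<Rightarrow> bool" where
  "dg_subobject G V U \<longleftrightarrow>
     vsubspace (dg_dim V) U \<and>
     (\<forall>g\<in>carrier G. \<forall>u\<in>U. dg_act V g *\<^sub>v u \<in> U) \<and>
     (\<forall>u\<in>U. \<forall>f. dg_decomp G V u f \<longrightarrow> (\<forall>x\<in>carrier G. f x \<in> U))"

definition dg_simple :: "('g, 'b) monoid_scheme \<Rightarrow> ('g, 'k::field) dgrep \<Rightarrow> bool" where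
  "dg_simple G V \<longleftrightarrow>
     dg_obj G V \<and> dg_dim V > 0 \<and>
     (\<forall>U. dg_subobject G V U \<longrightarrow> U = {0\<^sub>v (dg_dim V)} \<or> U = carrier_vec (dg_dim V))"

definition dg_twist :: "('g, 'b) monoid_scheme \<Rightarrow> ('g, 'k::field) dgrep \<Rightarrow> 'k vec \<Rightarrow> 'k vec" where
  "dg_twist G V v =
     finsum_vec TYPE('k) (dg_dim V) (\<lambda>x. dg_act V x *\<^sub>v (THE f. dg_decomp G V v f) x) (carrier G)"


subsection \<open>Operations on objects\<close>

definition dg_zero :: "('g, 'k::field) dgrep" where
  "dg_zero = \<lparr>dg_dim = 0, dg_comp = (\<lambda>x. {0\<^sub>v 0}), dg_act = (\<lambda>g. 1\<^sub>m 0)\<rparr>"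

definition dg_unit :: "('g, 'b) monoid_scheme \<Rightarrow> ('g, 'k::field) dgrep" where
  "dg_unit G = \<lparr>dg_dim = 1,
     dg_comp = (\<lambda>x. if x = \<one>\<^bsub>G\<^esub> then carrier_vec 1 else {0\<^sub>v 1}),
     dg_act = (\<lambda>g. 1\<^sub>m 1)\<rparr>"

definition dg_sum :: "('g, 'k::field) dgrep \<Rightarrow> ('g, 'k) dgrep \<Rightarrow> ('g, 'k) dgrep" where
  "dg_sum V W = \<lparr>dg_dim = dg_dim V + dg_dim W,
     dg_comp = (\<lambda>x. {v @\<^sub>v w | v w. v \<in> dg_comp V x \<and> w \<in> dg_comp W x}),
     dg_act = (\<lambda>g. four_block_mat
        (dg_act V g) (0\<^sub>m (dg_dim V) (dg_dim W))
        (0\<^sub>m (dg_dim W) (dg_dim V)) (dg_act W g))\<rparr>"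

text \<open>
  The tensor product of \<^term>\<open>carrier_vec n\<close> and \<^term>\<open>carrier_vec m\<close> is realised as
  \<^term>\<open>carrier_vec (n * m)\<close>, the basis vector with index \<open>i * m + j\<close> being the tensor product
  of the basis vectors with indices \<open>i\<close> and \<open>j\<close>.
\<close>

definition tensor_vec :: "'k::field vec \<Rightarrow> 'k vec \<Rightarrow> 'k vec" where
  "tensor_vec v w = vec (dim_vec v * dim_vec w)
     (\<lambda>i. v $ (i div dim_vec w) * w $ (i mod dim_vec w))"

definition tensor_mat :: "'k::field mat \<Rightarrow> 'k mat \<Rightarrow> 'k mat" where
  "tensor_mat A B = mat (dim_row A * dim_row B) (dim_col A * dim_col B)
     (\<lambda>(i, j). A $$ (i div dim_row B, j div dim_col B) * B $$ (i mod dim_row B, j mod dim_col B))"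

definition dg_tensor :: "('g, 'b) monoid_scheme \<Rightarrow> ('g, 'k::field) dgrep \<Rightarrow> ('g, 'k) dgrep \<Rightarrow> ('g, 'k) dgrep" where
  "dg_tensor G V W = \<lparr>dg_dim = dg_dim V * dg_dim W,
     dg_comp = (\<lambda>z. vspan (dg_dim V * dg_dim W)
        {tensor_vec v w | v w x y. x \<in> carrier G \<and> y \<in> carrier G \<and> x \<otimes>\<^bsub>G\<^esub> y = z \<and>
           v \<in> dg_comp V x \<and> w \<in> dg_comp W y}),
     dg_act = (\<lambda>g. tensor_mat (dg_act V g) (dg_act W g))\<rparr>"

text \<open>
  A vector \<open>f\<close> of the dual object stands for the linear form \<open>v \<mapsto> f \<bullet> v\<close>. The component of degree
  \<open>x\<close> consists of the forms supported on the component of degree \<open>x\<inverse>\<close>, and the action is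
  contragredient.
\<close>

definition dg_dual :: "('g, 'b) monoid_scheme \<Rightarrow> ('g, 'k::field) dgrep \<Rightarrow> ('g, 'k) dgrep" where
  "dg_dual G V = \<lparr>dg_dim = dg_dim V,
     dg_comp = (\<lambda>x. {f \<in> carrier_vec (dg_dim V).
        \<forall>y\<in>carrier G. y \<noteq> inv\<^bsub>G\<^esub> x \<longrightarrow> (\<forall>v\<in>dg_comp V y. f \<bullet> v = 0)}),
     dg_act = (\<lambda>g. transpose_mat (dg_act V (inv\<^bsub>G\<^esub> g)))\<rparr>"


subsection \<open>Lagrangian subcategories\<close>

text \<open>A full subcategory is given by its set of objects.\<close>

definition fusion_subcategory :: "('g, 'b) monoid_scheme \<Rightarrow> ('g, 'k::field) dgrep set \<Rightarrow> bool" where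
  "fusion_subcategory G D \<longleftrightarrow>
     D \<subseteq> Collect (dg_obj G) \<and>
     (\<forall>V W. V \<in> D \<and> dg_obj G W \<and> dg_iso G V W \<longrightarrow> W \<in> D) \<and>
     (\<forall>V\<in>D. \<forall>W\<in>D. dg_sum V W \<in> D) \<and>
     (\<forall>V W. dg_obj G V \<and> dg_obj G W \<and> dg_sum V W \<in> D \<longrightarrow> V \<in> D \<and> W \<in> D) \<and>
     (\<forall>V\<in>D. \<forall>W\<in>D. dg_tensor G V W \<in> D) \<and>
     (\<forall>V\<in>D. dg_dual G V \<in> D) \<and>
     dg_unit G \<in> D"

definition simple_classes :: "('g, 'b) monoid_scheme \<Rightarrow> ('g, 'k::field) dgrep set \<Rightarrow> ('g, 'k) dgrep set set" where
  "simple_classes G D =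
     {V \<in> D. dg_simple G V} // {(V, W). V \<in> D \<and> W \<in> D \<and> dg_simple G V \<and> dg_simple G W \<and> dg_iso G V W}"

text \<open>All members of an isomorphism class have the same dimension, selected here by \<^const>\<open>the_elem\<close>.\<close>

definition cat_dim :: "('g, 'b) monoid_scheme \<Rightarrow> ('g, 'k::field) dgrep set \<Rightarrow> nat" where
  "cat_dim G D = (\<Sum>X\<in>simple_classes G D. (the_elem (dg_dim ` X))\<^sup>2)"

definition isotropic :: "('g, 'b) monoid_scheme \<Rightarrow> ('g, 'k::field) dgrep set \<Rightarrow> bool" where
  "isotropic G D \<longleftrightarrow> fusion_subcategory G D \<and>
     (\<forall>V\<in>D. \<forall>v\<in>carrier_vec (dg_dim V). dg_twist G V v = v)"

definition lagrangian :: "('g, 'b) monoid_scheme \<Rightarrow> ('g, 'k::field) dgrep set \<Rightarrow> bool" where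
  "lagrangian G D \<longleftrightarrow> isotropic G D \<and>
     (cat_dim G D)\<^sup>2 = cat_dim G (Collect (dg_obj G) :: ('g, 'k) dgrep set)"


subsection \<open>The simple objects and the subcategories attached to bicharacters\<close>

definition conj_class :: "('g, 'b) monoid_scheme \<Rightarrow> 'g \<Rightarrow> 'g set" where
  "conj_class G a = {g \<otimes>\<^bsub>G\<^esub> a \<otimes>\<^bsub>G\<^esub> inv\<^bsub>G\<^esub> g | g. g \<in> carrier G}"

definition centralizer :: "('g, 'b) monoid_scheme \<Rightarrow> 'g \<Rightarrow> 'g set" where
  "centralizer G a = {g \<in> carrier G. g \<otimes>\<^bsub>G\<^esub> a = a \<otimes>\<^bsub>G\<^esub> g}"

definition conj_class_reps :: "('g, 'b) monoid_scheme \<Rightarrow> 'g set \<Rightarrow> bool" where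
  "conj_class_reps G R \<longleftrightarrow> R \<subseteq> carrier G \<and> (\<forall>x\<in>carrier G. \<exists>!a. a \<in> R \<and> x \<in> conj_class G a)"

definition simple_labels :: "('g, 'b) monoid_scheme \<Rightarrow> 'g set \<Rightarrow> ('g \<times> ('g \<Rightarrow> 'k::field)) set" where
  "simple_labels G R = {(a, \<chi>). a \<in> R \<and> \<chi> \<in> irr_chars G (centralizer G a)}"

text \<open>
  The component of degree \<open>a\<close> affords \<open>\<chi>\<close>: the columns of \<open>T\<close> form a basis of that component, and
  \<open>\<tau> g\<close> is the matrix of the action of \<open>g\<close> on it in this basis.
\<close>

definition comp_affords :: "('g, 'b) monoid_scheme \<Rightarrow> ('g, 'k::field) dgrep \<Rightarrow> 'g \<Rightarrow> ('g \<Rightarrow> 'k) \<Rightarrow> bool" where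
  "comp_affords G V a \<chi> \<longleftrightarrow> (\<exists>m \<tau> T.
     mat_rep G (centralizer G a) m \<tau> \<and>
     T \<in> carrier_mat (dg_dim V) m \<and>
     bij_betw (\<lambda>v. T *\<^sub>v v) (carrier_vec m) (dg_comp V a) \<and>
     (\<forall>g\<in>centralizer G a. dg_act V g * T = T * \<tau> g) \<and>
     \<chi> = rep_char (centralizer G a) \<tau>)"

text \<open>\<open>V\<close> belongs to the isomorphism class of simple objects identified with \<open>(a, \<chi>)\<close>.\<close>

definition has_label :: "('g, 'b) monoid_scheme \<Rightarrow> ('g, 'k::field) dgrep \<Rightarrow> 'g \<times> ('g \<Rightarrow> 'k) \<Rightarrow> bool" where
  "has_label G V = (\<lambda>(a, \<chi>). dg_simple G V \<and>
     (\<forall>x\<in>carrier G - conj_class G a. dg_comp V x = {0\<^sub>v (dg_dim V)}) \<and>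
     comp_affords G V a \<chi>)"

text \<open>Bicharacters are extensional, so that equality of functions is equality on \<open>H \<times> H\<close>.\<close>

definition alternating_bichar :: "('g, 'b) monoid_scheme \<Rightarrow> 'g set \<Rightarrow> ('g \<times> 'g \<Rightarrow> 'k::field) \<Rightarrow> bool" where
  "alternating_bichar G H B \<longleftrightarrow>
     B \<in> (H \<times> H \<rightarrow>\<^sub>E UNIV - {0}) \<and>
     (\<forall>h1\<in>H. \<forall>h2\<in>H. \<forall>h\<in>H. B (h1 \<otimes>\<^bsub>G\<^esub> h2, h) = B (h1, h) * B (h2, h)) \<and>
     (\<forall>h\<in>H. \<forall>h1\<in>H. \<forall>h2\<in>H. B (h, h1 \<otimes>\<^bsub>G\<^esub> h2) = B (h, h1) * B (h, h2)) \<and>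
     (\<forall>h\<in>H. B (h, h) = 1)"

definition invariant_bichar :: "('g, 'b) monoid_scheme \<Rightarrow> 'g set \<Rightarrow> ('g \<times> 'g \<Rightarrow> 'k::field) \<Rightarrow> bool" where
  "invariant_bichar G H B \<longleftrightarrow>
     (\<forall>g\<in>carrier G. \<forall>h\<in>H. \<forall>h'\<in>H.
        B (g \<otimes>\<^bsub>G\<^esub> h \<otimes>\<^bsub>G\<^esub> inv\<^bsub>G\<^esub> g, g \<otimes>\<^bsub>G\<^esub> h' \<otimes>\<^bsub>G\<^esub> inv\<^bsub>G\<^esub> g) = B (h, h'))"

definition bichar_labels :: "('g, 'b) monoid_scheme \<Rightarrow> 'g set \<Rightarrow> 'g set \<Rightarrow> ('g \<times> 'g \<Rightarrow> 'k::field)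
    \<Rightarrow> ('g \<times> ('g \<Rightarrow> 'k)) set" where
  "bichar_labels G R H B =
     {(a, \<chi>) \<in> simple_labels G R. a \<in> H \<inter> R \<and> (\<forall>h\<in>H. \<chi> h = B (a, h) * char_deg G \<chi>)}"

definition bichar_subcategory :: "('g, 'b) monoid_scheme \<Rightarrow> 'g set \<Rightarrow> 'g set \<Rightarrow> ('g \<times> 'g \<Rightarrow> 'k::field)
    \<Rightarrow> ('g, 'k) dgrep set" where
  "bichar_subcategory G R H B =
     {V. dg_obj G V \<and> (\<exists>Ws. (\<forall>W\<in>set Ws. \<exists>l\<in>bichar_labels G R H B. has_label G W l) \<and>
        dg_iso G V (foldr dg_sum Ws dg_zero))}"

end

theory Submission
  imports Defs "Jordan_Normal_Form.Char_Poly"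
begin

text \<open>
  In a Lagrangian subcategory the twists of \<open>V\<close>, \<open>W\<close> and \<open>V \<otimes> W\<close> are trivial, hence so is the double
  braiding. For \<open>v\<close> of degree \<open>x\<close> and \<open>w\<close> of degree \<open>y\<close> this says that \<open>x\<close> and \<open>y\<close> commute and that
  \<open>y v \<otimes> x w = v \<otimes> w\<close>, so \<open>y\<close> acts on all components of degree \<open>x\<close> by one scalar \<open>B (x, y)\<close>. The degrees
  that occur form an Abelian normal subgroup \<open>H\<close>, and \<open>B\<close> is an alternating invariant bicharacter on it.
  Thus the subcategory is contained in the category \<open>L\<close> of all objects supported on \<open>H\<close> on which \<open>H\<close>
  acts through \<open>B\<close>, and it equals \<open>L\<close> because both have dimension \<open>|G|\<close>.

  The dimensions come from the regular object, of dimension \<open>|G|\<^sup>2\<close>, which by orthogonality of characters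
  contains every simple object as often as its dimension. The central idempotent that cuts out \<open>L\<close> acts
  as 1 on the simple objects in \<open>L\<close> and as 0 on the others, so its trace on the regular object,
  which is \<open>|G|\<close>, is the dimension of \<open>L\<close>. Its trace on the components of degree \<open>a\<close> is
  \<open>|G| / |H|\<close> for each \<open>a\<close> in \<open>H\<close>, so every such degree occurs in \<open>L\<close>; hence \<open>L\<close> determines \<open>H\<close> and \<open>B\<close>.
\<close>

section \<open>Finitely supported infinite matrices\<close>

text \<open>Isotropy constrains one object at a time; it relates two objects only when applied to
  their tensor product. A nonzero pure tensor determines its factors up to reciprocal scalars, and
  testing all objects against one fixed vector of degree y makes the resulting scalar uniform.
  \<open>cat_dim\<close> sums over isomorphism classes that are not known beforehand to be finite in
  number. A decomposition of the regular object, kept as a list with repetitions, settles finiteness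
  and turns every dimension into a sum over list positions. The whole category gets dimension |G|^2,
  which is where the dimension |G| of a Lagrangian subcategory comes from, and nested subcategories
  can be compared position by position. Labels are kept apart from all this:
  \<open>bichar_objects\<close> describes the subcategory by the action alone. Matching the two
  descriptions needs the irreducibility of a component of a simple object over the centralizer, and
  in the other direction a passage from character values to operators: in characteristic zero an
  idempotent whose trace is the full dimension is the identity.\<close>

text \<open>
  Matrices and column vectors of all sizes are embedded in one non-unital ring, so that the ring laws
  carry no side conditions on dimensions; \<open>fm_one n\<close> is the idempotent that stands for the identity of size \<open>n\<close>.
\<close>

typedef (overloaded) 'a fmat =
  "{f :: nat \<Rightarrow> nat \<Rightarrow> 'a::zero. \<exists>n. \<forall>i j. n \<le> i \<or> n \<le> j \<longrightarrow> f i j = 0}"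
  morphisms fm_nth Abs_fmat
  by (rule exI[of _ "\<lambda>_ _. 0"]) auto

setup_lifting type_definition_fmat

lemma fmat_eqI: "(\<And>i j. fm_nth A i j = fm_nth B i j) \<Longrightarrow> A = B"
  by (metis ext fm_nth_inject)

lemma fm_bound: "\<exists>n. \<forall>i j. n \<le> i \<or> n \<le> j \<longrightarrow> fm_nth A i j = 0"
  using fm_nth[of A] by simp

instantiation fmat :: (ring) ring
begin

lift_definition zero_fmat :: "'a fmat" is "\<lambda>_ _. 0" by auto
lift_definition plus_fmat :: "'a fmat \<Rightarrow> 'a fmat \<Rightarrow> 'a fmat" is "\<lambda>f g i j. f i j + g i j"
proof -
  fix f g :: "nat \<Rightarrow> nat \<Rightarrow> 'a"
  assume "\<exists>n. \<forall>i j. n \<le> i \<or> n \<le> j \<longrightarrow> f i j = 0" "\<exists>n. \<forall>i j. n \<le> i \<or> n \<le> j \<longrightarrow> g i j = 0"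
  then obtain n m where "\<forall>i j. n \<le> i \<or> n \<le> j \<longrightarrow> f i j = 0" "\<forall>i j. m \<le> i \<or> m \<le> j \<longrightarrow> g i j = 0" by blast
  then show "\<exists>n. \<forall>i j. n \<le> i \<or> n \<le> j \<longrightarrow> f i j + g i j = 0"
    by (intro exI[of _ "max n m"]) auto
qed
lift_definition minus_fmat :: "'a fmat \<Rightarrow> 'a fmat \<Rightarrow> 'a fmat" is "\<lambda>f g i j. f i j - g i j"
proof -
  fix f g :: "nat \<Rightarrow> nat \<Rightarrow> 'a"
  assume "\<exists>n. \<forall>i j. n \<le> i \<or> n \<le> j \<longrightarrow> f i j = 0" "\<exists>n. \<forall>i j. n \<le> i \<or> n \<le> j \<longrightarrow> g i j = 0"
  then obtain n m where "\<forall>i j. n \<le> i \<or> n \<le> j \<longrightarrow> f i j = 0" "\<forall>i j. m \<le> i \<or> m \<le> j \<longrightarrow> g i j = 0" by blast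
  then show "\<exists>n. \<forall>i j. n \<le> i \<or> n \<le> j \<longrightarrow> f i j - g i j = 0"
    by (intro exI[of _ "max n m"]) auto
qed
lift_definition uminus_fmat :: "'a fmat \<Rightarrow> 'a fmat" is "\<lambda>f i j. - f i j" by auto
text \<open>The index set is the support of row i of the left factor, which is finite; a sum over
  all natural numbers would be 0 by convention.\<close>

lift_definition times_fmat :: "'a fmat \<Rightarrow> 'a fmat \<Rightarrow> 'a fmat"
  is "\<lambda>f g i j. \<Sum>k | f i k \<noteq> 0. f i k * g k j"
proof -
  fix f g :: "nat \<Rightarrow> nat \<Rightarrow> 'a"
  assume "\<exists>n. \<forall>i j. n \<le> i \<or> n \<le> j \<longrightarrow> f i j = 0" "\<exists>n. \<forall>i j. n \<le> i \<or> n \<le> j \<longrightarrow> g i j = 0"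
  then obtain n m where "\<forall>i j. n \<le> i \<or> n \<le> j \<longrightarrow> f i j = 0" "\<forall>i j. m \<le> i \<or> m \<le> j \<longrightarrow> g i j = 0" by blast
  then show "\<exists>n. \<forall>i j. n \<le> i \<or> n \<le> j \<longrightarrow> (\<Sum>k | f i k \<noteq> 0. f i k * g k j) = 0"
    by (intro exI[of _ "max n m"]) auto
qed

text \<open>The cut-off may come from the columns of \<open>A\<close> or from the rows of
  \<open>B\<close>; associativity and the two distributive laws each choose the side on which one
  common bound serves all terms.\<close>

lemma fm_nth_times:
  fixes A B :: "'a fmat"
  assumes "\<And>k. k \<ge> n \<Longrightarrow> fm_nth A i k * fm_nth B k j = 0"
  shows "fm_nth (A * B) i j = (\<Sum>k<n. fm_nth A i k * fm_nth B k j)"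
proof -
  obtain m where m: "\<forall>i j. m \<le> i \<or> m \<le> j \<longrightarrow> fm_nth A i j = 0" using fm_bound by blast
  have "fm_nth (A * B) i j = (\<Sum>k | fm_nth A i k \<noteq> 0. fm_nth A i k * fm_nth B k j)"
    by (simp add: times_fmat.rep_eq)
  also have "\<dots> = (\<Sum>k<max m n. fm_nth A i k * fm_nth B k j)"
    using m by (intro sum.mono_neutral_left) (auto simp: not_le[symmetric])
  also have "\<dots> = (\<Sum>k<n. fm_nth A i k * fm_nth B k j)"
    using assms by (intro sum.mono_neutral_right) auto
  finally show ?thesis .
qed

lemma fm_mult_assoc_aux: "A * B * C = A * (B * (C :: 'a fmat))"
proof (rule fmat_eqI)
  fix i j
  obtain m where m: "\<forall>i j. m \<le> i \<or> m \<le> j \<longrightarrow> fm_nth A i j = 0" using fm_bound by blast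
  obtain n where n: "\<forall>i j. n \<le> i \<or> n \<le> j \<longrightarrow> fm_nth C i j = 0" using fm_bound by blast
  have 1: "fm_nth (A * B) i k = (\<Sum>l<m. fm_nth A i l * fm_nth B l k)" for k
    using m by (intro fm_nth_times) auto
  have 2: "fm_nth (B * C) k j = (\<Sum>l<n. fm_nth B k l * fm_nth C l j)" for k
    using n by (intro fm_nth_times) auto
  have "fm_nth (A * B * C) i j = (\<Sum>k<n. fm_nth (A * B) i k * fm_nth C k j)"
    using n by (intro fm_nth_times) auto
  also have "\<dots> = (\<Sum>l<m. fm_nth A i l * fm_nth (B * C) l j)"
    unfolding 1 2 sum_distrib_left sum_distrib_right
    by (subst sum.swap) (simp add: mult.assoc)
  also have "\<dots> = fm_nth (A * (B * C)) i j"
    using m by (intro fm_nth_times[symmetric]) auto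
  finally show "fm_nth (A * B * C) i j = fm_nth (A * (B * C)) i j" .
qed

instance
proof
  fix A B C :: "'a fmat"
  show "A * B * C = A * (B * C)" by (rule fm_mult_assoc_aux)
  show "A + B + C = A + (B + C)" by transfer (simp add: add.assoc)
  show "A + B = B + A" by transfer (simp add: add.commute)
  show "0 + A = A" by transfer simp
  show "- A + A = 0" by transfer simp
  show "A - B = A + - B" by transfer simp
  show "(A + B) * C = A * C + B * C"
  proof (rule fmat_eqI)
    fix i j
    obtain n where n: "\<forall>i j. n \<le> i \<or> n \<le> j \<longrightarrow> fm_nth C i j = 0" using fm_bound by blast
    have "fm_nth (X * C) i j = (\<Sum>l<n. fm_nth X i l * fm_nth C l j)" for X
      using n by (intro fm_nth_times) auto
    then show "fm_nth ((A + B) * C) i j = fm_nth (A * C + B * C) i j"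
      by (simp add: plus_fmat.rep_eq sum.distrib distrib_right)
  qed
  show "A * (B + C) = A * B + A * C"
  proof (rule fmat_eqI)
    fix i j
    obtain n where n: "\<forall>i j. n \<le> i \<or> n \<le> j \<longrightarrow> fm_nth A i j = 0" using fm_bound by blast
    have "fm_nth (A * X) i j = (\<Sum>l<n. fm_nth A i l * fm_nth X l j)" for X
      using n by (intro fm_nth_times) auto
    then show "fm_nth (A * (B + C)) i j = fm_nth (A * B + A * C) i j"
      by (simp add: plus_fmat.rep_eq sum.distrib distrib_left)
  qed
qed

end

lemma fm_nth_sum: "fm_nth (sum f S) i j = (\<Sum>x\<in>S. fm_nth (f x) i j)"
  by (induction S rule: infinite_finite_induct) (auto simp: zero_fmat.rep_eq plus_fmat.rep_eq)

lemmas fm_nth_simps = zero_fmat.rep_eq plus_fmat.rep_eq minus_fmat.rep_eq uminus_fmat.rep_eq fm_nth_sum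

section \<open>Identities, scalar multiples, transposes and traces of finitely supported
  matrices\<close>

definition fm_of_fun :: "nat \<Rightarrow> nat \<Rightarrow> (nat \<Rightarrow> nat \<Rightarrow> 'a) \<Rightarrow> 'a::zero fmat" where
  "fm_of_fun n m f = Abs_fmat (\<lambda>i j. if i < n \<and> j < m then f i j else 0)"

lemma fm_nth_of_fun [simp]: "fm_nth (fm_of_fun n m f) i j = (if i < n \<and> j < m then f i j else 0)"
  unfolding fm_of_fun_def
  by (subst Abs_fmat_inverse) (auto intro!: exI[of _ "max n m"])

text \<open>Carriers are nested: a matrix also lies in the carriers of all larger sizes. Column
  vectors of length n are the elements of \<open>fm_carrier n 1\<close>.\<close>

definition fm_carrier :: "nat \<Rightarrow> nat \<Rightarrow> 'a::zero fmat set" where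
  "fm_carrier n m = {A. \<forall>i j. fm_nth A i j \<noteq> 0 \<longrightarrow> i < n \<and> j < m}"

lemma fm_carrierD: "A \<in> fm_carrier n m \<Longrightarrow> n \<le> i \<or> m \<le> j \<Longrightarrow> fm_nth A i j = 0"
  unfolding fm_carrier_def using leD by blast

lemma fm_of_fun_carrier [simp]: "fm_of_fun n m f \<in> fm_carrier n m"
  by (auto simp: fm_carrier_def split: if_splits)

lemma fm_carrier_mono: "A \<in> fm_carrier n m \<Longrightarrow> n \<le> n' \<Longrightarrow> m \<le> m' \<Longrightarrow> A \<in> fm_carrier n' m'"
  unfolding fm_carrier_def by fastforce

definition fm_one :: "nat \<Rightarrow> 'a::zero_neq_one fmat" where
  "fm_one n = fm_of_fun n n (\<lambda>i j. if i = j then 1 else 0)"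

definition fm_scale :: "'a \<Rightarrow> 'a::mult_zero fmat \<Rightarrow> 'a fmat" where
  "fm_scale c A = Abs_fmat (\<lambda>i j. c * fm_nth A i j)"

lemma fm_nth_scale [simp]: "fm_nth (fm_scale c A) i j = c * fm_nth A i j"
proof -
  obtain n where n: "\<forall>i j. n \<le> i \<or> n \<le> j \<longrightarrow> fm_nth A i j = 0" using fm_bound by blast
  show ?thesis unfolding fm_scale_def
    by (subst Abs_fmat_inverse) (use n in \<open>auto intro!: exI[of _ n]\<close>)
qed

text \<open>Summing over the nonzero diagonal entries makes the trace independent of the size in
  which the matrix is viewed.\<close>

definition fm_trace :: "'a::comm_monoid_add fmat \<Rightarrow> 'a" where
  "fm_trace A = (\<Sum>i | fm_nth A i i \<noteq> 0. fm_nth A i i)"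

definition fm_transpose :: "'a::zero fmat \<Rightarrow> 'a fmat" where
  "fm_transpose A = Abs_fmat (\<lambda>i j. fm_nth A j i)"

lemma fm_nth_transpose [simp]: "fm_nth (fm_transpose A) i j = fm_nth A j i"
proof -
  obtain n where n: "\<forall>i j. n \<le> i \<or> n \<le> j \<longrightarrow> fm_nth A i j = 0" using fm_bound by blast
  show ?thesis unfolding fm_transpose_def
    by (subst Abs_fmat_inverse) (use n in \<open>auto intro!: exI[of _ n]\<close>)
qed

lemma fm_nth_one [simp]: "fm_nth (fm_one n) i j = (if i = j \<and> i < n then 1 else 0)"
  by (auto simp: fm_one_def)

lemma fm_nth_times_left:
  "A \<in> fm_carrier n m \<Longrightarrow> fm_nth (A * B) i j = (\<Sum>k<m. fm_nth A i k * fm_nth B k j)"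
  for A :: "'a::ring fmat"
  by (intro fm_nth_times) (simp add: fm_carrierD)

lemma fm_nth_times_right:
  "B \<in> fm_carrier m n \<Longrightarrow> fm_nth (A * B) i j = (\<Sum>k<m. fm_nth A i k * fm_nth B k j)"
  for A :: "'a::ring fmat"
  by (intro fm_nth_times) (simp add: fm_carrierD)

context
  fixes A B :: "'a::ring fmat"
begin

lemma fm_zero_carrier [simp]: "(0::'a fmat) \<in> fm_carrier n m"
  by (simp add: fm_carrier_def fm_nth_simps)

lemma fm_add_carrier [simp]:
  "A \<in> fm_carrier n m \<Longrightarrow> B \<in> fm_carrier n m \<Longrightarrow> A + B \<in> fm_carrier n m"
  unfolding fm_carrier_def by (simp add: fm_nth_simps) (metis add_0)

lemma fm_minus_carrier [simp]:
  "A \<in> fm_carrier n m \<Longrightarrow> B \<in> fm_carrier n m \<Longrightarrow> A - B \<in> fm_carrier n m"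
  unfolding fm_carrier_def by (simp add: fm_nth_simps) (metis diff_0_right)

lemma fm_scale_carrier [simp]: "A \<in> fm_carrier n m \<Longrightarrow> fm_scale c A \<in> fm_carrier n m"
  unfolding fm_carrier_def by (simp) (metis mult_zero_right)

lemma fm_mult_carrier [simp]:
  "A \<in> fm_carrier n m \<Longrightarrow> B \<in> fm_carrier m k \<Longrightarrow> A * B \<in> fm_carrier n k"
  unfolding fm_carrier_def[of n k]
  by (auto simp: fm_nth_times_left not_le[symmetric] intro!: sum.neutral)
    (use fm_carrierD in fastforce)+

end

lemma fm_sum_carrier [simp]:
  "(\<And>x. x \<in> S \<Longrightarrow> f x \<in> fm_carrier n m) \<Longrightarrow> sum f S \<in> fm_carrier n m"
  for f :: "'b \<Rightarrow> 'a::ring fmat"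
  by (induction S rule: infinite_finite_induct) auto

lemma fm_one_carrier [simp]: "fm_one n \<in> fm_carrier n n"
  by (simp add: fm_one_def)

lemma fm_transpose_carrier [simp]: "A \<in> fm_carrier n m \<Longrightarrow> fm_transpose A \<in> fm_carrier m n"
  unfolding fm_carrier_def by simp

lemma fm_scale_simps [simp]:
  fixes A B :: "'a::comm_ring fmat"
  shows "fm_scale c A * B = fm_scale c (A * B)"
    and "A * fm_scale c B = fm_scale c (A * B)"
    and "fm_scale c (fm_scale d A) = fm_scale (c * d) A"
    and "fm_scale c 0 = (0 :: 'a fmat)"
    and "fm_scale 0 A = 0"
proof -
  show "fm_scale c A * B = fm_scale c (A * B)"
  proof (rule fmat_eqI)
    fix i j
    obtain n where n: "\<forall>i j. n \<le> i \<or> n \<le> j \<longrightarrow> fm_nth A i j = 0" using fm_bound by blast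
    have "fm_nth (fm_scale c A * B) i j = (\<Sum>k<n. c * fm_nth A i k * fm_nth B k j)"
      using n by (subst fm_nth_times) auto
    moreover have "fm_nth (A * B) i j = (\<Sum>k<n. fm_nth A i k * fm_nth B k j)"
      using n by (intro fm_nth_times) auto
    ultimately show "fm_nth (fm_scale c A * B) i j = fm_nth (fm_scale c (A * B)) i j"
      by (simp add: sum_distrib_left mult.assoc)
  qed
  show "A * fm_scale c B = fm_scale c (A * B)"
  proof (rule fmat_eqI)
    fix i j
    obtain n where n: "\<forall>i j. n \<le> i \<or> n \<le> j \<longrightarrow> fm_nth A i j = 0" using fm_bound by blast
    have "fm_nth (A * X) i j = (\<Sum>k<n. fm_nth A i k * fm_nth X k j)" for X
      using n by (intro fm_nth_times) auto
    then show "fm_nth (A * fm_scale c B) i j = fm_nth (fm_scale c (A * B)) i j"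
      by (simp add: sum_distrib_left mult.left_commute)
  qed
qed (auto intro!: fmat_eqI simp: fm_nth_simps mult.assoc)

lemma fm_scale_1 [simp]: "fm_scale 1 A = A" for A :: "'a::comm_ring_1 fmat"
  by (auto intro!: fmat_eqI)

lemma fm_scale_add: "fm_scale c (A + B) = fm_scale c A + fm_scale c B" for A :: "'a::ring fmat"
  by (auto intro!: fmat_eqI simp: fm_nth_simps distrib_left)

lemma fm_scale_sum: "fm_scale c (sum f S) = (\<Sum>x\<in>S. fm_scale c (f x))" for c :: "'a::ring"
  by (auto intro!: fmat_eqI simp: fm_nth_simps sum_distrib_left)

lemma fm_scale_sum_left: "(\<Sum>x\<in>S. fm_scale (f x) A) = fm_scale (sum f S) A" for A :: "'a::ring fmat"
  by (auto intro!: fmat_eqI simp: fm_nth_simps sum_distrib_right)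

lemma fm_scale_eq_0_iff: "fm_scale c A = 0 \<longleftrightarrow> c = 0 \<or> A = 0" for A :: "'a::field fmat"
proof
  assume "fm_scale c A = 0"
  then have "fm_nth (fm_scale c A) i j = 0" for i j by (simp add: zero_fmat.rep_eq)
  then show "c = 0 \<or> A = 0" by (auto intro!: fmat_eqI simp: zero_fmat.rep_eq)
qed auto

lemma fm_one_mult [simp]: "A \<in> fm_carrier n m \<Longrightarrow> fm_one n * A = A"
  for A :: "'a::ring_1 fmat"
proof (rule fmat_eqI)
  fix i j assume A: "A \<in> fm_carrier n m"
  have "fm_nth (fm_one n * A) i j = (\<Sum>k<n. if k = i then fm_nth A i j else 0)"
    by (subst fm_nth_times_left[OF fm_one_carrier], rule sum.cong) auto
  then show "fm_nth (fm_one n * A) i j = fm_nth A i j"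
    using fm_carrierD[OF A, of i j] by (simp add: not_less)
qed

lemma fm_mult_one [simp]: "A \<in> fm_carrier n m \<Longrightarrow> A * fm_one m = A"
  for A :: "'a::ring_1 fmat"
proof (rule fmat_eqI)
  fix i j assume A: "A \<in> fm_carrier n m"
  have "fm_nth (A * fm_one m) i j = (\<Sum>k<m. if k = j then fm_nth A i j else 0)"
    by (subst fm_nth_times_right[OF fm_one_carrier], rule sum.cong) auto
  then show "fm_nth (A * fm_one m) i j = fm_nth A i j"
    using fm_carrierD[OF A, of i j] by (simp add: not_less)
qed

lemma fm_one_zero [simp]: "fm_one 0 = (0 :: 'a::ring_1 fmat)"
  by (rule fmat_eqI) (simp add: fm_nth_simps)

lemma fm_carrier_0 [simp]: "A \<in> fm_carrier 0 m \<longleftrightarrow> A = 0" "A \<in> fm_carrier m 0 \<longleftrightarrow> A = 0"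
  for A :: "'a::ring fmat"
  by (auto simp: fm_carrier_def fm_nth_simps intro!: fmat_eqI)

lemma fm_one_eq_0_iff [simp]: "fm_one n = (0::'a::ring_1 fmat) \<longleftrightarrow> n = 0"
proof
  assume "fm_one n = (0::'a fmat)"
  then have "fm_nth (fm_one n :: 'a fmat) 0 0 = 0" by (simp add: fm_nth_simps)
  then show "n = 0" by (simp split: if_splits)
qed simp

lemma fm_transpose_mult: "fm_transpose (A * B) = fm_transpose B * fm_transpose A"
  for A :: "'a::comm_ring fmat"
proof (rule fmat_eqI)
  fix i j
  obtain n where n: "\<forall>i j. n \<le> i \<or> n \<le> j \<longrightarrow> fm_nth A i j = 0" using fm_bound by blast
  have "fm_nth (fm_transpose (A * B)) i j = (\<Sum>k<n. fm_nth A j k * fm_nth B k i)"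
    using n by (simp, subst fm_nth_times) auto
  moreover have "fm_nth (fm_transpose B * fm_transpose A) i j = (\<Sum>k<n. fm_nth B k i * fm_nth A j k)"
    using n by (subst fm_nth_times) auto
  ultimately show "fm_nth (fm_transpose (A * B)) i j = fm_nth (fm_transpose B * fm_transpose A) i j"
    by (simp add: mult.commute)
qed

lemma fm_transpose_simps [simp]:
  "fm_transpose (fm_transpose B) = B"
  "fm_transpose (fm_one n) = fm_one n"
  "fm_transpose (0::'a::ring fmat) = 0"
  "fm_transpose (sum f S) = (\<Sum>x\<in>S. fm_transpose (f x))"
  "fm_transpose (fm_scale c A) = fm_scale c (fm_transpose A)"
  for f :: "'b \<Rightarrow> 'a::ring fmat" and A :: "'a fmat"
  by (auto intro!: fmat_eqI simp: fm_nth_simps)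

lemma fm_trace_carrier: "A \<in> fm_carrier n m \<Longrightarrow> fm_trace A = (\<Sum>i<n. fm_nth A i i)"
  unfolding fm_trace_def
  by (intro sum.mono_neutral_left) (auto simp: not_le[symmetric] fm_carrierD)

lemma fm_carrier_ex: "\<exists>n. A \<in> fm_carrier n n"
proof -
  obtain n where n: "\<forall>i j. n \<le> i \<or> n \<le> j \<longrightarrow> fm_nth A i j = 0" using fm_bound by blast
  then show ?thesis unfolding fm_carrier_def by (auto simp: not_le[symmetric])
qed

lemma fm_carrier_ex2: "\<exists>n. A \<in> fm_carrier n n \<and> B \<in> fm_carrier n n"
proof -
  obtain n m where "A \<in> fm_carrier n n" "B \<in> fm_carrier m m" using fm_carrier_ex by metis
  then show ?thesis by (intro exI[of _ "max n m"]) (auto intro: fm_carrier_mono)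
qed

lemma fm_trace_add: "fm_trace (A + B) = fm_trace A + fm_trace B" for A :: "'a::ring fmat"
proof -
  obtain n where "A \<in> fm_carrier n n" "B \<in> fm_carrier n n" using fm_carrier_ex2 by blast
  then show ?thesis by (simp add: fm_trace_carrier[of _ n n] fm_nth_simps sum.distrib)
qed

lemma fm_trace_0 [simp]: "fm_trace (0 :: 'a::ring fmat) = 0"
  by (simp add: fm_trace_def fm_nth_simps)

lemma fm_trace_sum: "fm_trace (sum f S) = (\<Sum>x\<in>S. fm_trace (f x))" for f :: "'b \<Rightarrow> 'a::ring fmat"
  by (induction S rule: infinite_finite_induct) (auto simp: fm_trace_add)

lemma fm_trace_scale [simp]: "fm_trace (fm_scale c A) = c * fm_trace A" for A :: "'a::ring fmat"
proof -
  obtain n where "A \<in> fm_carrier n n" using fm_carrier_ex by blast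
  then show ?thesis by (simp add: fm_trace_carrier[of _ n n] sum_distrib_left)
qed

lemma fm_trace_one [simp]: "fm_trace (fm_one n :: 'a::ring_1 fmat) = of_nat n"
  by (simp add: fm_trace_carrier[OF fm_one_carrier])

text \<open>Both factors are padded to one square size, so rectangular factors are included. In
  particular an idempotent \<open>A * B\<close> with \<open>B * A = fm_one r\<close> has trace
  r.\<close>

lemma fm_trace_commute: "fm_trace (A * B) = fm_trace (B * A)" for A :: "'a::comm_ring fmat"
proof -
  obtain n where n: "A \<in> fm_carrier n n" "B \<in> fm_carrier n n" using fm_carrier_ex2 by blast
  have "fm_trace (A * B) = (\<Sum>i<n. \<Sum>k<n. fm_nth A i k * fm_nth B k i)"
    using n by (subst fm_trace_carrier[of _ n n]) (auto simp: fm_nth_times_left)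
  also have "\<dots> = (\<Sum>k<n. \<Sum>i<n. fm_nth B k i * fm_nth A i k)"
    by (subst sum.swap) (simp add: mult.commute)
  also have "\<dots> = fm_trace (B * A)"
    using n by (subst fm_trace_carrier[of _ n n]) (auto simp: fm_nth_times_left)
  finally show ?thesis .
qed

section \<open>Translation between ordinary matrices or vectors and finitely supported ones\<close>

definition fm_of_mat :: "'a::zero mat \<Rightarrow> 'a fmat" where
  "fm_of_mat A = fm_of_fun (dim_row A) (dim_col A) (\<lambda>i j. A $$ (i, j))"

definition mat_of_fm :: "nat \<Rightarrow> nat \<Rightarrow> 'a::zero fmat \<Rightarrow> 'a mat" where
  "mat_of_fm n m A = mat n m (\<lambda>(i, j). fm_nth A i j)"

definition fm_of_vec :: "'a::zero vec \<Rightarrow> 'a fmat" where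
  "fm_of_vec v = fm_of_fun (dim_vec v) 1 (\<lambda>i j. v $ i)"

definition vec_of_fm :: "nat \<Rightarrow> 'a::zero fmat \<Rightarrow> 'a vec" where
  "vec_of_fm n A = vec n (\<lambda>i. fm_nth A i 0)"

lemma fm_of_mat_carrier [simp]: "A \<in> carrier_mat n m \<Longrightarrow> fm_of_mat A \<in> fm_carrier n m"
  by (auto simp: fm_of_mat_def)

lemma fm_of_vec_carrier [simp]: "v \<in> carrier_vec n \<Longrightarrow> fm_of_vec v \<in> fm_carrier n 1"
  by (auto simp: fm_of_vec_def simp del: One_nat_def)

lemma mat_of_fm_carrier [simp]: "mat_of_fm n m A \<in> carrier_mat n m"
  by (simp add: mat_of_fm_def)

lemma vec_of_fm_carrier [simp]: "vec_of_fm n A \<in> carrier_vec n"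
  by (simp add: vec_of_fm_def)

lemma fm_of_mat_of_fm [simp]: "A \<in> fm_carrier n m \<Longrightarrow> fm_of_mat (mat_of_fm n m A) = A"
  by (rule fmat_eqI) (auto simp: fm_of_mat_def mat_of_fm_def not_le[symmetric] fm_carrierD)

lemma fm_of_vec_of_fm [simp]: "A \<in> fm_carrier n 1 \<Longrightarrow> fm_of_vec (vec_of_fm n A) = A"
proof (rule fmat_eqI)
  fix i j assume "A \<in> fm_carrier n 1"
  then show "fm_nth (fm_of_vec (vec_of_fm n A)) i j = fm_nth A i j"
    by (cases j) (auto simp: fm_of_vec_def vec_of_fm_def fm_carrierD not_less)
qed

lemma mat_of_fm_of_mat [simp]: "A \<in> carrier_mat n m \<Longrightarrow> mat_of_fm n m (fm_of_mat A) = A"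
  by (auto simp: fm_of_mat_def mat_of_fm_def)

lemma vec_of_fm_of_vec [simp]: "v \<in> carrier_vec n \<Longrightarrow> vec_of_fm n (fm_of_vec v) = v"
  by (auto simp: fm_of_vec_def vec_of_fm_def)

lemma fm_of_mat_inj: "A \<in> carrier_mat n m \<Longrightarrow> B \<in> carrier_mat n m \<Longrightarrow> fm_of_mat A = fm_of_mat B \<longleftrightarrow> A = B"
  by (metis mat_of_fm_of_mat)

lemma fm_of_vec_inj: "v \<in> carrier_vec n \<Longrightarrow> w \<in> carrier_vec n \<Longrightarrow> fm_of_vec v = fm_of_vec w \<longleftrightarrow> v = w"
  by (metis vec_of_fm_of_vec)

lemma fm_of_mat_mult:
  fixes A :: "'a::ring mat"
  assumes A: "A \<in> carrier_mat n m" and B: "B \<in> carrier_mat m k"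
  shows "fm_of_mat (A * B) = fm_of_mat A * fm_of_mat B"
proof (rule fmat_eqI)
  fix i j
  show "fm_nth (fm_of_mat (A * B)) i j = fm_nth (fm_of_mat A * fm_of_mat B) i j"
    using A B by (subst fm_nth_times_left[OF fm_of_mat_carrier[OF A]])
      (auto simp: fm_of_mat_def scalar_prod_def atLeast0LessThan)
qed

lemma fm_of_vec_mult:
  fixes A :: "'a::ring mat"
  assumes A: "A \<in> carrier_mat n m" and v: "v \<in> carrier_vec m"
  shows "fm_of_vec (A *\<^sub>v v) = fm_of_mat A * fm_of_vec v"
proof (rule fmat_eqI)
  fix i j
  show "fm_nth (fm_of_vec (A *\<^sub>v v)) i j = fm_nth (fm_of_mat A * fm_of_vec v) i j"
    using A v by (subst fm_nth_times_left[OF fm_of_mat_carrier[OF A]])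
      (auto simp: fm_of_mat_def fm_of_vec_def scalar_prod_def atLeast0LessThan)
qed

lemma fm_of_mat_one [simp]: "fm_of_mat (1\<^sub>m n) = fm_one n"
  by (rule fmat_eqI) (auto simp: fm_of_mat_def)

lemma fm_of_vec_zero [simp]: "fm_of_vec (0\<^sub>v n) = (0 :: 'a::ring fmat)"
  by (rule fmat_eqI) (auto simp: fm_of_vec_def fm_nth_simps)

lemma fm_of_vec_add: "v \<in> carrier_vec n \<Longrightarrow> w \<in> carrier_vec n \<Longrightarrow> fm_of_vec (v + w) = fm_of_vec v + fm_of_vec w"
  for v :: "'a::ring vec"
  by (rule fmat_eqI) (auto simp: fm_of_vec_def fm_nth_simps)

lemma fm_of_vec_smult: "fm_of_vec (c \<cdot>\<^sub>v v) = fm_scale c (fm_of_vec v)"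
  for v :: "'a::ring vec"
  by (rule fmat_eqI) (auto simp: fm_of_vec_def fm_nth_simps)

lemma fm_of_mat_transpose: "fm_of_mat (transpose_mat A) = fm_transpose (fm_of_mat A)"
  by (rule fmat_eqI) (auto simp: fm_of_mat_def)

lemma fm_trace_of_mat: "A \<in> carrier_mat n n \<Longrightarrow> fm_trace (fm_of_mat A) = mat_trace A"
  for A :: "'a::field mat"
  by (subst fm_trace_carrier[OF fm_of_mat_carrier]) (auto simp: fm_of_mat_def mat_trace_def)

lemma fm_of_vec_finsum:
  fixes f :: "'b \<Rightarrow> 'a::ring vec"
  assumes "finite S" "\<And>x. x \<in> S \<Longrightarrow> f x \<in> carrier_vec n"
  shows "fm_of_vec (finsum_vec TYPE('a) n f S) = (\<Sum>x\<in>S. fm_of_vec (f x))"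
proof (rule fmat_eqI)
  fix i j
  have "finsum_vec TYPE('a) n f S \<in> carrier_vec n"
    using assms by (intro finsum_vec_closed) auto
  then have d: "dim_vec (finsum_vec TYPE('a) n f S) = n" by auto
  have "fm_nth (\<Sum>x\<in>S. fm_of_vec (f x)) i j = (\<Sum>x\<in>S. if i < n \<and> j < 1 then f x $ i else 0)"
    unfolding fm_nth_sum by (rule sum.cong) (use carrier_vecD[OF assms(2)] in \<open>auto simp: fm_of_vec_def\<close>)
  moreover have "i < n \<Longrightarrow> finsum_vec TYPE('a) n f S $ i = (\<Sum>x\<in>S. f x $ i)"
    using assms by (intro index_finsum_vec) auto
  ultimately show "fm_nth (fm_of_vec (finsum_vec TYPE('a) n f S)) i j = fm_nth (\<Sum>x\<in>S. fm_of_vec (f x)) i j"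
    by (auto simp: fm_of_vec_def d)
qed

section \<open>One-sided inverses, subspaces and idempotents\<close>

lemma fm_left_right_inverse:
  fixes A B :: "'a::field fmat"
  assumes A: "A \<in> fm_carrier n n" and B: "B \<in> fm_carrier n n" and BA: "B * A = fm_one n"
  shows "A * B = fm_one n"
proof -
  have "fm_of_mat (mat_of_fm n n B * mat_of_fm n n A) = fm_of_mat (1\<^sub>m n)"
    unfolding fm_of_mat_mult[OF mat_of_fm_carrier mat_of_fm_carrier] using A B BA by simp
  then have "mat_of_fm n n B * mat_of_fm n n A = 1\<^sub>m n"
    using fm_of_mat_inj[of _ n n] mult_carrier_mat mat_of_fm_carrier one_carrier_mat by metis
  then have "mat_of_fm n n A * mat_of_fm n n B = 1\<^sub>m n"
    by (rule mat_mult_left_right_inverse[OF mat_of_fm_carrier mat_of_fm_carrier])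
  then have "fm_of_mat (mat_of_fm n n A * mat_of_fm n n B) = fm_one n" by simp
  then show "A * B = fm_one n"
    unfolding fm_of_mat_mult[OF mat_of_fm_carrier mat_of_fm_carrier] using A B by simp
qed

text \<open>If n < r, both factors may be viewed as r by r matrices, so \<open>A * B\<close> would
  be \<open>fm_one r\<close> as well; but \<open>A * B\<close> has no entry at position (n, n),
  where \<open>fm_one r\<close> has a 1.\<close>

lemma fm_left_inverse_le:
  fixes A B :: "'a::field fmat"
  assumes A: "A \<in> fm_carrier n r" and B: "B \<in> fm_carrier r n" and BA: "B * A = fm_one r"
  shows "r \<le> n"
proof (rule ccontr)
  assume "\<not> r \<le> n"
  then have n: "n < r" by simp
  have A': "A \<in> fm_carrier r r" and B': "B \<in> fm_carrier r r"
    using fm_carrier_mono[OF A] fm_carrier_mono[OF B] n by auto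
  have "A * B = fm_one r" using A' B' BA by (rule fm_left_right_inverse)
  then have "fm_nth (A * B) n n = 1" using n by simp
  moreover have "fm_nth (A * B) n n = 0" using fm_mult_carrier[OF A B] by (simp add: fm_carrierD)
  ultimately show False by simp
qed

lemma fm_column_nth: "A \<in> fm_carrier n m \<Longrightarrow> i < m \<Longrightarrow> fm_nth (A * fm_of_fun m 1 (\<lambda>k _. if k = i then 1 else 0)) j 0 = fm_nth A j i"
  for A :: "'a::ring_1 fmat"
proof -
  assume A: "A \<in> fm_carrier n m" and i: "i < m"
  have "fm_nth (A * fm_of_fun m 1 (\<lambda>k _. if k = i then 1 else 0)) j 0
      = (\<Sum>k<m. if k = i then fm_nth A j i else 0)"
    by (subst fm_nth_times_left[OF A], rule sum.cong) auto
  then show "fm_nth (A * fm_of_fun m 1 (\<lambda>k _. if k = i then 1 else 0)) j 0 = fm_nth A j i"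
    using i by simp
qed

lemma fm_eq_columnI:
  fixes A B :: "'a::ring_1 fmat"
  assumes A: "A \<in> fm_carrier n m" and B: "B \<in> fm_carrier n m"
    and eq: "\<And>v. v \<in> fm_carrier m 1 \<Longrightarrow> A * v = B * v"
  shows "A = B"
proof (rule fmat_eqI)
  fix i j
  let ?e = "fm_of_fun m 1 (\<lambda>k _. if k = j then 1 else 0) :: 'a fmat"
  show "fm_nth A i j = fm_nth B i j"
  proof (cases "j < m")
    case True
    have "A * ?e = B * ?e" by (intro eq) simp
    then have "fm_nth (A * ?e) i 0 = fm_nth (B * ?e) i 0" by simp
    then show ?thesis using fm_column_nth[OF A True] fm_column_nth[OF B True] by simp
  next
    case False
    then show ?thesis using fm_carrierD[OF A] fm_carrierD[OF B] by simp
  qed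
qed

definition fm_subspace :: "nat \<Rightarrow> 'a::ring fmat set \<Rightarrow> bool" where
  "fm_subspace n U \<longleftrightarrow> U \<subseteq> fm_carrier n 1 \<and> 0 \<in> U \<and> (\<forall>u\<in>U. \<forall>v\<in>U. u + v \<in> U) \<and> (\<forall>c. \<forall>u\<in>U. fm_scale c u \<in> U)"

text \<open>A nonzero vector in the kernel of \<open>B\<close> is independent of the columns of
  \<open>A\<close>, so it can be appended as column number r. The left inverse is extended by a
  linear form that kills \<open>A\<close> and takes the value 1 on \<open>u\<close>.\<close>

lemma fm_append_column:
  fixes A B :: "'a::field fmat"
  assumes A: "A \<in> fm_carrier n r" and B: "B \<in> fm_carrier r n" and BA: "B * A = fm_one r"
    and u: "u \<in> fm_carrier n 1" and Bu: "B * u = 0" and u0: "u \<noteq> 0"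
  shows "\<exists>A' B'. A' \<in> fm_carrier n (Suc r) \<and> B' \<in> fm_carrier (Suc r) n \<and> B' * A' = fm_one (Suc r) \<and>
    (\<forall>v\<in>fm_carrier (Suc r) 1. \<exists>c. \<exists>w\<in>fm_carrier r 1. A' * v = A * w + fm_scale c u)"
proof -
  obtain i0 j0 where ij: "fm_nth u i0 j0 \<noteq> 0" using u0 by (metis fmat_eqI zero_fmat.rep_eq)
  then have "j0 = 0" and i0: "i0 < n" using u unfolding fm_carrier_def by auto
  define d where "d = fm_nth u i0 0"
  have d0: "d \<noteq> 0" using ij \<open>j0 = 0\<close> d_def by simp
  \<comment> \<open>The coordinate form at a nonzero entry of \<open>u\<close>, normalised to the
    value 1 on \<open>u\<close>; \<open>E\<close> is the row that selects the new column.\<close>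
  define e where "e = fm_of_fun 1 n (\<lambda>_ k. if k = i0 then 1 / d else 0)"
  define E where "E = fm_of_fun 1 (Suc r) (\<lambda>_ k. if k = r then 1 else (0::'a))"
  \<comment> \<open>Precomposing with the projection \<open>fm_one n - A * B\<close> makes the form
    vanish on \<open>A\<close> and keeps its value on \<open>u\<close>, because
    \<open>B * u = 0\<close>.\<close>
  define c where "c = e * (fm_one n - A * B)"
  have e: "e \<in> fm_carrier 1 n" and E: "E \<in> fm_carrier 1 (Suc r)" by (simp_all add: e_def E_def del: One_nat_def)
  have c: "c \<in> fm_carrier 1 n" unfolding c_def using e A B by (simp del: One_nat_def)
  have I: "fm_one n * A = A" "fm_one n * u = u" using A u by simp_all
  have cA: "c * A = 0"
    using fm_mult_one[OF A] by (simp add: c_def mult.assoc left_diff_distrib BA I)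
  have eu: "e * u = fm_one 1"
  proof (rule fmat_eqI)
    fix i j
    have "fm_nth (e * u) i j = (\<Sum>k<n. if k = i0 then (if i = 0 then fm_nth u i0 j / d else 0) else 0)"
      by (subst fm_nth_times_left[OF e], rule sum.cong) (auto simp: e_def)
    also have "\<dots> = fm_nth (fm_one 1) i j"
      using i0 d0 fm_carrierD[OF u, of i0 j] by (cases "j = 0") (auto simp: d_def)
    finally show "fm_nth (e * u) i j = fm_nth (fm_one 1) i j" .
  qed
  have cu: "c * u = fm_one 1"
    using eu by (simp add: c_def mult.assoc left_diff_distrib Bu I)
  have Er: "E * fm_transpose E = fm_one 1"
  proof (rule fmat_eqI)
    fix i j
    have "fm_nth (E * fm_transpose E) i j = (\<Sum>k<Suc r. if k = r then (if i = 0 \<and> j = 0 then 1 else 0) else 0)"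
      by (subst fm_nth_times_left[OF E], rule sum.cong) (auto simp: E_def)
    also have "\<dots> = fm_nth (fm_one 1) i j" by auto
    finally show "fm_nth (E * fm_transpose E) i j = fm_nth (fm_one 1) i j" .
  qed
  have EE: "fm_transpose E * E = fm_one (Suc r) - fm_one r"
  proof (rule fmat_eqI)
    fix i j
    show "fm_nth (fm_transpose E * E) i j = fm_nth (fm_one (Suc r) - fm_one r) i j"
      by (subst fm_nth_times_right[OF E]) (auto simp: E_def fm_nth_simps)
  qed
  define A' where "A' = A + u * E"
  define B' where "B' = B + fm_transpose E * c"
  have A': "A' \<in> fm_carrier n (Suc r)" unfolding A'_def
    using fm_carrier_mono[OF A] fm_mult_carrier[OF u E] by simp
  have B': "B' \<in> fm_carrier (Suc r) n" unfolding B'_def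
    using fm_carrier_mono[OF B] fm_mult_carrier[OF fm_transpose_carrier[OF E] c] by simp
  have uE: "fm_one 1 * E = E" using E by (rule fm_one_mult)
  have 1: "B * (u * E) = 0" "c * (u * E) = E"
    using Bu cu uE by (simp_all add: mult.assoc[symmetric])
  have "B' * A' = fm_one (Suc r)"
    unfolding A'_def B'_def by (simp add: ring_distribs mult.assoc BA cA 1 EE)
  moreover have "\<exists>c. \<exists>w\<in>fm_carrier r 1. A' * v = A * w + fm_scale c u" if v: "v \<in> fm_carrier (Suc r) 1" for v
  proof -
    have "A * v = A * (fm_one r * v)" using fm_mult_one[OF A] by (simp add: mult.assoc[symmetric])
    moreover have "fm_one r * v \<in> fm_carrier r 1"
    proof -
      have "fm_one r \<in> fm_carrier r (Suc r)" by (rule fm_carrier_mono[OF fm_one_carrier]) auto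
      then show ?thesis using v by (rule fm_mult_carrier)
    qed
    moreover have "u * (E * v) = fm_scale (fm_nth (E * v) 0 0) u"
    proof -
      have "E * v \<in> fm_carrier 1 1" using E v by (rule fm_mult_carrier)
      then have "E * v = fm_scale (fm_nth (E * v) 0 0) (fm_one 1)"
        by (intro fmat_eqI) (auto simp: fm_carrier_def)
      then have "u * (E * v) = fm_scale (fm_nth (E * v) 0 0) (u * fm_one 1)" by (metis fm_scale_simps(2))
      then show ?thesis using u by simp
    qed
    ultimately have "A' * v = A * (fm_one r * v) + fm_scale (fm_nth (E * v) 0 0) u" "fm_one r * v \<in> fm_carrier r 1"
      unfolding A'_def by (simp_all add: distrib_right mult.assoc)
    then show ?thesis by blast
  qed
  ultimately show ?thesis using A' B' by blast
qed

text \<open>A left-invertible matrix with columns in \<open>U\<close> has at most n columns, so one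
  with the greatest number exists. If its columns did not span \<open>U\<close>,
  \<open>fm_append_column\<close> would provide a further one. The result presents every subspace as
  the fixed space of an idempotent.\<close>

lemma fm_subspace_factor:
  fixes U :: "'a::field fmat set"
  assumes U: "fm_subspace n U"
  obtains r A B where "A \<in> fm_carrier n r" "B \<in> fm_carrier r n" "B * A = fm_one r"
    "U = {v \<in> fm_carrier n 1. A * B * v = v}"
proof -
  define P where "P r \<longleftrightarrow> (\<exists>A B. A \<in> fm_carrier n r \<and> B \<in> fm_carrier r n \<and> B * A = fm_one r \<and>
    (\<forall>v\<in>fm_carrier r 1. A * v \<in> U))" for r
  have zero: "P 0"
    unfolding P_def
  proof (intro exI conjI ballI)
    show "(0::'a fmat) * 0 = fm_one 0" by simp
    show "(0::'a fmat) * v \<in> U" for v using U by (simp add: fm_subspace_def)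
  qed simp_all
  have bound: "r \<le> n" if "P r" for r
  proof -
    from that obtain A B :: "'a fmat" where "A \<in> fm_carrier n r" "B \<in> fm_carrier r n" "B * A = fm_one r"
      unfolding P_def by auto
    then show ?thesis by (rule fm_left_inverse_le)
  qed
  define r where "r = Greatest P"
  have r: "P r" unfolding r_def by (rule GreatestI_nat[of P 0 n]) (use zero bound in auto)
  have max: "r' \<le> r" if "P r'" for r' unfolding r_def
    by (rule Greatest_le_nat[of P r' n]) (use that bound in auto)
  from r obtain A B where A: "A \<in> fm_carrier n r" and B: "B \<in> fm_carrier r n" and BA: "B * A = fm_one r"
    and AU: "\<And>v. v \<in> fm_carrier r 1 \<Longrightarrow> A * v \<in> U" unfolding P_def by blast
  have "A * B * u = u" if uU: "u \<in> U" for u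
  proof (rule ccontr)
    assume ne: "A * B * u \<noteq> u"
    have u: "u \<in> fm_carrier n 1" using U uU unfolding fm_subspace_def by blast
    \<comment> \<open>The part of \<open>u\<close> that the projection \<open>A * B\<close> misses:
      it stays in \<open>U\<close> and lies in the kernel of \<open>B\<close>.\<close>
    define u' where "u' = u - A * (B * u)"
    have u': "u' \<in> fm_carrier n 1" unfolding u'_def by (intro fm_minus_carrier u fm_mult_carrier[OF A] fm_mult_carrier[OF B])
    have Bu: "B * u \<in> fm_carrier r 1" using B u by (rule fm_mult_carrier)
    have neg: "u' = u + fm_scale (-1) (A * (B * u))"
      unfolding u'_def by (rule fmat_eqI) (simp add: fm_nth_simps)
    have u'U: "u' \<in> U"
      unfolding neg using U uU AU[OF Bu] unfolding fm_subspace_def by blast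
    have "B * u' = B * u - (B * A) * (B * u)" unfolding u'_def by (simp add: right_diff_distrib mult.assoc)
    then have "B * u' = 0" using Bu BA by simp
    moreover have "u' \<noteq> 0" using ne unfolding u'_def by (auto simp: mult.assoc)
    ultimately obtain A' B' where 1: "A' \<in> fm_carrier n (Suc r)" "B' \<in> fm_carrier (Suc r) n" "B' * A' = fm_one (Suc r)"
      "\<forall>v\<in>fm_carrier (Suc r) 1. \<exists>c. \<exists>w\<in>fm_carrier r 1. A' * v = A * w + fm_scale c u'"
      using fm_append_column[OF A B BA u'] by blast
    have "\<forall>v\<in>fm_carrier (Suc r) 1. A' * v \<in> U"
    proof
      fix v :: "'a fmat" assume "v \<in> fm_carrier (Suc r) 1"
      then obtain c w where "w \<in> fm_carrier r 1" "A' * v = A * w + fm_scale c u'" using 1(4) by blast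
      then show "A' * v \<in> U" using AU u'U U unfolding fm_subspace_def by metis
    qed
    then have "P (Suc r)" unfolding P_def using 1 by blast
    then show False using max by fastforce
  qed
  moreover have "v \<in> U" if "v \<in> fm_carrier n 1" "A * B * v = v" for v
    using AU[of "B * v"] fm_mult_carrier[OF B that(1)] that(2) by (simp add: mult.assoc)
  moreover have "U \<subseteq> fm_carrier n 1" using U unfolding fm_subspace_def by blast
  ultimately have "U = {v \<in> fm_carrier n 1. A * B * v = v}" by blast
  then show ?thesis using that A B BA by blast
qed

text \<open>The factorization of the image of \<open>E\<close> yields an idempotent
  \<open>A * B\<close> with the same image but possibly another kernel. Replacing \<open>B\<close>
  by \<open>B * E\<close> corrects the kernel and keeps the left inverse, since
  \<open>E * A = A\<close>.\<close>

lemma fm_idempotent_factor: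
  fixes E :: "'a::field fmat"
  assumes E: "E \<in> fm_carrier n n" and EE: "E * E = E"
  obtains r A B where "A \<in> fm_carrier n r" "B \<in> fm_carrier r n" "B * A = fm_one r" "A * B = E"
proof -
  have "fm_subspace n {v \<in> fm_carrier n 1. E * v = v}"
    unfolding fm_subspace_def by (auto simp: distrib_left simp del: One_nat_def)
  then obtain r A B where A: "A \<in> fm_carrier n r" and B: "B \<in> fm_carrier r n" and BA: "B * A = fm_one r"
    and eq: "{v \<in> fm_carrier n 1. E * v = v} = {v \<in> fm_carrier n 1. A * B * v = v}"
    by (rule fm_subspace_factor)
  have AB: "A * B \<in> fm_carrier n n" using A B by simp
  have idem: "A * B * (A * B) = A * B"
  proof -
    have "A * B * (A * B) = A * (B * A) * B" by (simp add: mult.assoc)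
    then show ?thesis using fm_mult_one[OF A] BA by simp
  qed
  have 1: "A * B * E = E"
  proof (rule fm_eq_columnI)
    fix v :: "'a fmat" assume v: "v \<in> fm_carrier n 1"
    have "E * v \<in> {v \<in> fm_carrier n 1. E * v = v}"
      using fm_mult_carrier[OF E v] by (simp add: mult.assoc[symmetric] EE)
    then have "A * B * (E * v) = E * v" unfolding eq by blast
    then show "A * B * E * v = E * v" by (simp add: mult.assoc)
  qed (use E AB in auto)
  have 2: "E * (A * B) = A * B"
  proof (rule fm_eq_columnI)
    fix v :: "'a fmat" assume v: "v \<in> fm_carrier n 1"
    have "A * B * v \<in> {v \<in> fm_carrier n 1. A * B * v = v}"
      using fm_mult_carrier[OF AB v] idem by (simp add: mult.assoc[symmetric])
    then have "E * (A * B * v) = A * B * v" unfolding eq[symmetric] by blast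
    then show "E * (A * B) * v = A * B * v" by (simp add: mult.assoc)
  qed (use E AB in auto)
  have "E * A = A"
  proof -
    have "E * A = E * (A * (B * A))" using fm_mult_one[OF A] BA by simp
    also have "\<dots> = E * (A * B) * A" by (simp add: mult.assoc)
    also have "\<dots> = A" using 2 BA fm_mult_one[OF A] by (simp add: mult.assoc)
    finally show ?thesis .
  qed
  then have "B * E * A = fm_one r" using BA by (simp add: mult.assoc)
  moreover have "A * (B * E) = E" using 1 by (simp add: mult.assoc)
  ultimately show ?thesis using that[OF A fm_mult_carrier[OF B E]] by blast
qed

section \<open>Graded modules as families of matrices\<close>

lemma vsubspace_iff:
  "vsubspace n U \<longleftrightarrow> U \<subseteq> carrier_vec n \<and> 0\<^sub>v n \<in> U \<and> (\<forall>u\<in>U. \<forall>v\<in>U. u + v \<in> U) \<and>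
     (\<forall>c. \<forall>u\<in>U. c \<cdot>\<^sub>v u \<in> U)" for U :: "'a::field vec set"
proof -
  have v: "vectorspace (class_ring :: 'a ring) (module_vec TYPE('a) n)" by (rule vec_vs)
  have m: "Module.module (class_ring :: 'a ring) (module_vec TYPE('a) n)" by (rule vec_module)
  show ?thesis
    unfolding VectorSpace.subspace_def submodule_def using v m
    by (auto simp: module_vec_def class_field_def)
qed

lemma fm_of_mat_eqI:
  "fm_of_mat A = fm_of_mat B \<Longrightarrow> A \<in> carrier_mat n m \<Longrightarrow> B \<in> carrier_mat n m \<Longrightarrow> A = B"
  by (simp add: fm_of_mat_inj)

lemma fm_of_vec_eqI:
  "fm_of_vec v = fm_of_vec w \<Longrightarrow> v \<in> carrier_vec n \<Longrightarrow> w \<in> carrier_vec n \<Longrightarrow> v = w"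
  by (simp add: fm_of_vec_inj)

lemma fm_square_mult_carrier [simp]:
  "A \<in> fm_carrier n n \<Longrightarrow> B \<in> fm_carrier n m \<Longrightarrow> A * B \<in> fm_carrier n m"
  "C \<in> fm_carrier m n \<Longrightarrow> A \<in> fm_carrier n n \<Longrightarrow> C * A \<in> fm_carrier m n"
  for A :: "'a::ring fmat"
  by (rule fm_mult_carrier; assumption)+

lemma vsubspace_fm_subspace:
  "vsubspace n U \<Longrightarrow> fm_subspace n (fm_of_vec ` U)" for U :: "'a::field vec set"
  unfolding vsubspace_iff fm_subspace_def
proof (intro conjI ballI allI)
  assume U: "U \<subseteq> carrier_vec n \<and> 0\<^sub>v n \<in> U \<and> (\<forall>u\<in>U. \<forall>v\<in>U. u + v \<in> U) \<and> (\<forall>c. \<forall>u\<in>U. c \<cdot>\<^sub>v u \<in> U)"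
  show "fm_of_vec ` U \<subseteq> fm_carrier n 1" using U fm_of_vec_carrier by blast
  show "0 \<in> fm_of_vec ` U" using U fm_of_vec_zero by (metis image_eqI)
  show "u + v \<in> fm_of_vec ` U" if uv: "u \<in> fm_of_vec ` U" "v \<in> fm_of_vec ` U" for u v
  proof -
    from uv obtain u' v' where "u' \<in> U" "v' \<in> U" "u = fm_of_vec u'" "v = fm_of_vec v'" by blast
    then show ?thesis using U fm_of_vec_add[of u' n v'] by (metis image_eqI subsetD)
  qed
  show "fm_scale c u \<in> fm_of_vec ` U" if u: "u \<in> fm_of_vec ` U" for c u
  proof -
    from u obtain u' where "u' \<in> U" "u = fm_of_vec u'" by blast
    then show ?thesis using U fm_of_vec_smult[of c u'] by (metis image_eqI)
  qed
qed

lemma fm_subspace_vsubspace: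
  "fm_subspace n U \<Longrightarrow> vsubspace n {v \<in> carrier_vec n. fm_of_vec v \<in> U}" for U :: "'a::field fmat set"
  unfolding vsubspace_iff fm_subspace_def by (auto simp: fm_of_vec_add fm_of_vec_smult)

lemma fm_vec_set_eq: "U \<subseteq> fm_carrier n 1 \<Longrightarrow> fm_of_vec ` {v \<in> carrier_vec n. fm_of_vec v \<in> U} = U"
  by (auto simp: image_iff intro!: bexI[of _ "vec_of_fm n _"]) (metis One_nat_def fm_of_vec_of_fm subsetD vec_of_fm_carrier)

lemma fm_of_vec_mem_image: "U \<subseteq> carrier_vec n \<Longrightarrow> v \<in> carrier_vec n \<Longrightarrow> fm_of_vec v \<in> fm_of_vec ` U \<longleftrightarrow> v \<in> U"
  by (auto simp: image_iff) (metis fm_of_vec_inj subsetD)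

lemma fm_subspace_sum:
  "fm_subspace n U \<Longrightarrow> (\<And>x. x \<in> S \<Longrightarrow> f x \<in> U) \<Longrightarrow> sum f S \<in> U"
  by (induction S rule: infinite_finite_induct) (auto simp: fm_subspace_def)

text \<open>The columns of the matrix are the images of the unit vectors. Linearity is asked on the
  carrier only, so the lemma applies to functions obtained by definite description, such as
  homogeneous components and inverse maps.\<close>

lemma fm_linear_matrix:
  fixes f :: "'a::field fmat \<Rightarrow> 'a fmat"
  assumes car: "\<And>v. v \<in> fm_carrier n 1 \<Longrightarrow> f v \<in> fm_carrier m 1"
    and add: "\<And>u v. u \<in> fm_carrier n 1 \<Longrightarrow> v \<in> fm_carrier n 1 \<Longrightarrow> f (u + v) = f u + f v"
    and scale: "\<And>c v. v \<in> fm_carrier n 1 \<Longrightarrow> f (fm_scale c v) = fm_scale c (f v)"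
  shows "\<exists>A\<in>fm_carrier m n. \<forall>v\<in>fm_carrier n 1. A * v = f v"
proof -
  define e where "e i = fm_of_fun n 1 (\<lambda>k _. if k = i then 1 else (0::'a))" for i
  define A where "A = fm_of_fun m n (\<lambda>i j. fm_nth (f (e j)) i 0)"
  have e: "e i \<in> fm_carrier n 1" for i unfolding e_def by (rule fm_of_fun_carrier)
  have f0: "f 0 = 0" using scale[of 0 0] by (simp del: One_nat_def)
  have fsum: "f (sum g S) = (\<Sum>i\<in>S. f (g i))" if "\<And>i. g i \<in> fm_carrier n 1" for g and S :: "nat set"
    using that by (induction S rule: infinite_finite_induct) (simp_all add: f0 add del: One_nat_def)
  have "A * v = f v" if v: "v \<in> fm_carrier n 1" for v
  proof -
    have "v = (\<Sum>j<n. fm_scale (fm_nth v j 0) (e j))"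
    proof (rule fmat_eqI)
      fix i k
      have "fm_nth (\<Sum>j<n. fm_scale (fm_nth v j 0) (e j)) i k = (\<Sum>j<n. if j = i then (if k = 0 then fm_nth v i 0 else 0) else 0)"
        unfolding fm_nth_sum by (rule sum.cong) (auto simp: e_def)
      also have "\<dots> = fm_nth v i k"
        using fm_carrierD[OF v, of i k] by (auto simp: not_less)
      finally show "fm_nth v i k = fm_nth (\<Sum>j<n. fm_scale (fm_nth v j 0) (e j)) i k" ..
    qed
    then have "f v = (\<Sum>j<n. f (fm_scale (fm_nth v j 0) (e j)))"
      using fsum[of "\<lambda>j. fm_scale (fm_nth v j 0) (e j)" "{..<n}"] e by (metis fm_scale_carrier)
    then have fv: "f v = (\<Sum>j<n. fm_scale (fm_nth v j 0) (f (e j)))" using scale e by simp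
    show ?thesis
    proof (rule fmat_eqI)
      fix i k
      have A: "A \<in> fm_carrier m n" unfolding A_def by simp
      have fe: "fm_nth (f (e j)) i k = 0" if "\<not> i < m \<or> k \<noteq> 0" for j
        using fm_carrierD[OF car[OF e], of i k] that by auto
      have "fm_nth (f v) i k = (\<Sum>j<n. fm_nth v j 0 * fm_nth (f (e j)) i k)"
        unfolding fv fm_nth_sum by simp
      also have "\<dots> = (\<Sum>j<n. fm_nth A i j * fm_nth v j k)"
        using fm_carrierD[OF v, of _ k] fe by (intro sum.cong refl, cases k) (auto simp: A_def)
      also have "\<dots> = fm_nth (A * v) i k" using fm_nth_times_left[OF A] by simp
      finally show "fm_nth (A * v) i k = fm_nth (f v) i k" ..
    qed
  qed
  moreover have "A \<in> fm_carrier m n" unfolding A_def by simp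
  ultimately show ?thesis by blast
qed

text \<open>The grading is encoded by the family \<open>p\<close> of projections onto the homogeneous components.\<close>

definition dg_module :: "('g, 'b) monoid_scheme \<Rightarrow> nat \<Rightarrow> ('g \<Rightarrow> 'k::field fmat) \<Rightarrow> ('g \<Rightarrow> 'k fmat) \<Rightarrow> bool" where
  "dg_module G n p r \<longleftrightarrow>
     (\<forall>g\<in>carrier G. r g \<in> fm_carrier n n) \<and> r \<one>\<^bsub>G\<^esub> = fm_one n \<and>
     (\<forall>g\<in>carrier G. \<forall>h\<in>carrier G. r (g \<otimes>\<^bsub>G\<^esub> h) = r g * r h) \<and>
     (\<forall>x\<in>carrier G. p x \<in> fm_carrier n n) \<and>
     (\<forall>x\<in>carrier G. \<forall>y\<in>carrier G. p x * p y = (if x = y then p x else 0)) \<and>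
     (\<Sum>x\<in>carrier G. p x) = fm_one n \<and>
     (\<forall>g\<in>carrier G. \<forall>x\<in>carrier G. r g * p x = p (g \<otimes>\<^bsub>G\<^esub> x \<otimes>\<^bsub>G\<^esub> inv\<^bsub>G\<^esub> g) * r g)"

text \<open>Links an object, which stores its components as subspaces, to a family of projections
  with those subspaces as images. The family is constrained on \<open>carrier G\<close> only, where
  it is determined by the object.\<close>

definition dg_realizes :: "('g, 'b) monoid_scheme \<Rightarrow> ('g, 'k::field) dgrep \<Rightarrow> ('g \<Rightarrow> 'k fmat) \<Rightarrow> bool" where
  "dg_realizes G V p \<longleftrightarrow>
     (\<forall>g\<in>carrier G. dg_act V g \<in> carrier_mat (dg_dim V) (dg_dim V)) \<and>
     dg_module G (dg_dim V) p (\<lambda>g. fm_of_mat (dg_act V g)) \<and>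
     (\<forall>x\<in>carrier G. dg_comp V x = {v \<in> carrier_vec (dg_dim V). p x * fm_of_vec v = fm_of_vec v})"

definition dg_proj :: "('g, 'b) monoid_scheme \<Rightarrow> ('g, 'k::field) dgrep \<Rightarrow> 'g \<Rightarrow> 'k fmat" where
  "dg_proj G V = (SOME p. dg_realizes G V p)"

abbreviation dg_mat :: "('g, 'k::field) dgrep \<Rightarrow> 'g \<Rightarrow> 'k fmat" where
  "dg_mat V g \<equiv> fm_of_mat (dg_act V g)"

section \<open>Conjugation in a finite group, and the equivalence of gradings with families of
  projections\<close>

locale finite_group = group G for G (structure) +
  assumes finite_carrier [simp]: "finite (carrier G)"
begin

abbreviation conjg :: "'a \<Rightarrow> 'a \<Rightarrow> 'a" where
  "conjg g x \<equiv> g \<otimes> x \<otimes> inv g"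

lemma conj_conj: "g \<in> carrier G \<Longrightarrow> h \<in> carrier G \<Longrightarrow> x \<in> carrier G \<Longrightarrow> conjg g (conjg h x) = conjg (g \<otimes> h) x"
  by (simp add: inv_mult_group m_assoc)

lemma conj_inv_conj [simp]: "g \<in> carrier G \<Longrightarrow> x \<in> carrier G \<Longrightarrow> conjg (inv g) (conjg g x) = x"
  by (subst conj_conj) auto

lemma conj_conj_inv [simp]: "g \<in> carrier G \<Longrightarrow> x \<in> carrier G \<Longrightarrow> conjg g (conjg (inv g) x) = x"
  by (subst conj_conj) auto

lemma conj_simps [simp]:
  "g \<in> carrier G \<Longrightarrow> x \<in> carrier G \<Longrightarrow> inv g \<otimes> conjg g x \<otimes> g = x"
  "g \<in> carrier G \<Longrightarrow> x \<in> carrier G \<Longrightarrow> conjg g (inv g \<otimes> x \<otimes> g) = x"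
  using conj_inv_conj[of g x] conj_conj_inv[of g x] by simp_all

lemma conj_eq_iff [simp]: "g \<in> carrier G \<Longrightarrow> x \<in> carrier G \<Longrightarrow> y \<in> carrier G \<Longrightarrow> conjg g x = conjg g y \<longleftrightarrow> x = y"
  by (metis conj_inv_conj)

lemma conj_mult: "g \<in> carrier G \<Longrightarrow> x \<in> carrier G \<Longrightarrow> y \<in> carrier G \<Longrightarrow> conjg g x \<otimes> conjg g y = conjg g (x \<otimes> y)"
  by (simp add: m_assoc) (simp add: m_assoc[symmetric])

lemma conj_inv: "g \<in> carrier G \<Longrightarrow> x \<in> carrier G \<Longrightarrow> inv (conjg g x) = conjg g (inv x)"
  by (simp add: inv_mult_group m_assoc)

lemma sum_conj: "g \<in> carrier G \<Longrightarrow> (\<Sum>x\<in>carrier G. f (conjg g x)) = (\<Sum>x\<in>carrier G. f x)"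
  by (rule sum.reindex_bij_witness[of _ "conjg (inv g)" "conjg g"]) auto

lemma sum_mult_left: "g \<in> carrier G \<Longrightarrow> (\<Sum>x\<in>carrier G. f (g \<otimes> x)) = (\<Sum>x\<in>carrier G. f x)"
  by (rule sum.reindex_bij_witness[of _ "\<lambda>x. inv g \<otimes> x" "\<lambda>x. g \<otimes> x"]) (auto simp: m_assoc[symmetric])

text \<open>Applying \<open>p x\<close> to a decomposition of \<open>v\<close> isolates the term of
  degree x by orthogonality, which gives uniqueness; the vectors \<open>p x * v\<close> do form a
  decomposition because the projections add up to the identity.\<close>

lemma dg_decomp_iff:
  fixes V :: "('a, 'k::field) dgrep"
  assumes V: "dg_realizes G V p" and v: "v \<in> carrier_vec (dg_dim V)"
  shows "dg_decomp G V v f \<longleftrightarrow> f = (\<lambda>x\<in>carrier G. vec_of_fm (dg_dim V) (p x * fm_of_vec v))"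
proof -
  let ?n = "dg_dim V"
  have p: "\<And>x. x \<in> carrier G \<Longrightarrow> p x \<in> fm_carrier ?n ?n"
    and pp: "\<And>x y. x \<in> carrier G \<Longrightarrow> y \<in> carrier G \<Longrightarrow> p x * p y = (if x = y then p x else 0)"
    and psum: "(\<Sum>x\<in>carrier G. p x) = fm_one ?n"
    and comp: "\<And>x. x \<in> carrier G \<Longrightarrow> dg_comp V x = {v \<in> carrier_vec ?n. p x * fm_of_vec v = fm_of_vec v}"
    using V unfolding dg_realizes_def dg_module_def by auto
  have v': "fm_of_vec v \<in> fm_carrier ?n 1" using v by (rule fm_of_vec_carrier)
  have pv: "p x * fm_of_vec v \<in> fm_carrier ?n 1" if "x \<in> carrier G" for x
    using p[OF that] v' by (rule fm_mult_carrier)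
  show ?thesis
  proof
    assume d: "dg_decomp G V v f"
    have f: "f x \<in> carrier_vec ?n" "p x * fm_of_vec (f x) = fm_of_vec (f x)" if "x \<in> carrier G" for x
      using d that unfolding dg_decomp_def PiE_def Pi_def comp[OF that, symmetric]
      using comp[OF that] by auto
    have "v = finsum_vec TYPE('k) ?n f (carrier G)" using d unfolding dg_decomp_def by blast
    then have vs: "fm_of_vec v = (\<Sum>x\<in>carrier G. fm_of_vec (f x))" using f by (simp add: fm_of_vec_finsum)
    have "p x * fm_of_vec v = fm_of_vec (f x)" if x: "x \<in> carrier G" for x
    proof -
      have "p x * fm_of_vec v = (\<Sum>y\<in>carrier G. p x * fm_of_vec (f y))" unfolding vs by (simp add: sum_distrib_left)
      also have "\<dots> = (\<Sum>y\<in>carrier G. p x * (p y * fm_of_vec (f y)))" using f by simp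
      also have "\<dots> = (\<Sum>y\<in>carrier G. if y = x then fm_of_vec (f x) else 0)"
      proof (rule sum.cong)
        fix y assume y: "y \<in> carrier G"
        have "p x * (p y * fm_of_vec (f y)) = (if x = y then p x else 0) * fm_of_vec (f y)"
          using pp[OF x y] by (simp add: mult.assoc[symmetric])
        then show "p x * (p y * fm_of_vec (f y)) = (if y = x then fm_of_vec (f x) else 0)"
          using f(2)[OF x] by auto
      qed simp
      also have "\<dots> = fm_of_vec (f x)" using x by simp
      finally show ?thesis .
    qed
    moreover have "f \<in> extensional (carrier G)" using d unfolding dg_decomp_def PiE_def by blast
    ultimately show "f = (\<lambda>x\<in>carrier G. vec_of_fm ?n (p x * fm_of_vec v))"
      using f by (intro ext) (auto simp: extensional_def)
  next
    assume f: "f = (\<lambda>x\<in>carrier G. vec_of_fm ?n (p x * fm_of_vec v))"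
    have fcomp: "f x \<in> dg_comp V x" if "x \<in> carrier G" for x
      using that pv[OF that] pp[OF that that] by (simp add: f comp mult.assoc[symmetric] del: One_nat_def)
    have fv: "fm_of_vec v = fm_of_vec (finsum_vec TYPE('k) ?n f (carrier G))"
      using pv v' by (subst fm_of_vec_finsum) (auto simp: f sum_distrib_right[symmetric] psum simp del: One_nat_def)
    have "finsum_vec TYPE('k) ?n f (carrier G) \<in> carrier_vec ?n"
      by (rule finsum_vec_closed) (auto simp: f)
    then have "v = finsum_vec TYPE('k) ?n f (carrier G)"
      using fv fm_of_vec_inj[OF v] by blast
    moreover have "f \<in> extensional (carrier G)" unfolding f by simp
    ultimately show "dg_decomp G V v f"
      unfolding dg_decomp_def PiE_def using fcomp by blast
  qed
qed

lemma dg_realizes_obj: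
  fixes V :: "('a, 'k::field) dgrep"
  assumes V: "dg_realizes G V p"
  shows "dg_obj G V"
  unfolding dg_obj_def
proof (intro conjI ballI)
  let ?n = "dg_dim V"
  have act: "\<And>g. g \<in> carrier G \<Longrightarrow> dg_act V g \<in> carrier_mat ?n ?n"
    and r1: "dg_mat V \<one> = fm_one ?n"
    and rm: "\<And>g h. g \<in> carrier G \<Longrightarrow> h \<in> carrier G \<Longrightarrow> dg_mat V (g \<otimes> h) = dg_mat V g * dg_mat V h"
    and p: "\<And>x. x \<in> carrier G \<Longrightarrow> p x \<in> fm_carrier ?n ?n"
    and rp: "\<And>g x. g \<in> carrier G \<Longrightarrow> x \<in> carrier G \<Longrightarrow> dg_mat V g * p x = p (conjg g x) * dg_mat V g"
    and comp: "\<And>x. x \<in> carrier G \<Longrightarrow> dg_comp V x = {v \<in> carrier_vec ?n. p x * fm_of_vec v = fm_of_vec v}"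
    using V unfolding dg_realizes_def dg_module_def by auto
  show "vsubspace ?n (dg_comp V x)" if x: "x \<in> carrier G" for x
    unfolding comp[OF x] vsubspace_iff by (auto simp: fm_of_vec_add fm_of_vec_smult distrib_left)
  show "\<exists>!f. dg_decomp G V v f" if "v \<in> carrier_vec ?n" for v
    unfolding dg_decomp_iff[OF V that] by simp
  show "mat_rep G (carrier G) ?n (dg_act V)"
    unfolding mat_rep_def
  proof (intro conjI ballI)
    show "dg_act V \<one> = 1\<^sub>m ?n" using r1 act[OF one_closed] by (metis fm_of_mat_inj fm_of_mat_one one_carrier_mat)
    show "dg_act V (g \<otimes> h) = dg_act V g * dg_act V h" if gh: "g \<in> carrier G" "h \<in> carrier G" for g h
    proof (rule fm_of_mat_eqI)
      show "fm_of_mat (dg_act V (g \<otimes> h)) = fm_of_mat (dg_act V g * dg_act V h)"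
        using rm[OF gh] fm_of_mat_mult[OF act[OF gh(1)] act[OF gh(2)]] by simp
    qed (use act gh mult_carrier_mat[OF act[OF gh(1)] act[OF gh(2)]] in auto)
  qed (rule act)
  have sub: "dg_act V g *\<^sub>v v \<in> dg_comp V (conjg g x)" if g: "g \<in> carrier G" and x: "x \<in> carrier G" and v: "v \<in> dg_comp V x" for g x v
  proof -
    have "p (conjg g x) * (dg_mat V g * fm_of_vec v) = dg_mat V g * (p x * fm_of_vec v)"
      using rp[OF g x] by (simp add: mult.assoc[symmetric])
    then show ?thesis
      using v g x act[OF g] by (simp add: comp fm_of_vec_mult[of _ ?n ?n])
  qed
  show "(\<lambda>v. dg_act V g *\<^sub>v v) ` dg_comp V x = dg_comp V (conjg g x)" if g: "g \<in> carrier G" and x: "x \<in> carrier G" for g x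
  proof
    show "(\<lambda>v. dg_act V g *\<^sub>v v) ` dg_comp V x \<subseteq> dg_comp V (conjg g x)" using sub g x by blast
    show "dg_comp V (conjg g x) \<subseteq> (\<lambda>v. dg_act V g *\<^sub>v v) ` dg_comp V x"
    proof
      fix v assume v: "v \<in> dg_comp V (conjg g x)"
      have vc: "v \<in> carrier_vec ?n" using v g x by (simp add: comp)
      define w where "w = dg_act V (inv g) *\<^sub>v v"
      have wc: "w \<in> carrier_vec ?n" unfolding w_def using act[of "inv g"] g vc by simp
      have "w \<in> dg_comp V x" unfolding w_def using sub[of "inv g" "conjg g x" v] g x v by simp
      moreover have "dg_act V g *\<^sub>v w = v"
      proof -
        have "fm_of_vec (dg_act V g *\<^sub>v w) = dg_mat V g * (dg_mat V (inv g) * fm_of_vec v)"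
          unfolding w_def using fm_of_vec_mult[OF act[OF g] wc] fm_of_vec_mult[OF act vc, of "inv g"] g by (simp add: w_def)
        also have "\<dots> = fm_of_vec v"
          using arg_cong[OF rm[of g "inv g"], of "\<lambda>X. X * fm_of_vec v"] g r1 fm_of_vec_carrier[OF vc]
          by (simp add: mult.assoc del: One_nat_def)
        finally show ?thesis by (rule fm_of_vec_eqI[OF _ mult_mat_vec_carrier[OF act[OF g] wc] vc])
      qed
      ultimately show "v \<in> (\<lambda>v. dg_act V g *\<^sub>v v) ` dg_comp V x" by blast
    qed
  qed
qed

text \<open>Uniqueness of the homogeneous decomposition makes each component depend linearly on the
  vector, so it is given by a matrix; these matrices are the projections.\<close>

lemma dg_obj_realizes:
  fixes V :: "('a, 'k::field) dgrep"
  assumes V: "dg_obj G V"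
  shows "\<exists>p. dg_realizes G V p"
proof -
  let ?n = "dg_dim V"
  define U where "U x = fm_of_vec ` dg_comp V x" for x
  have sub: "\<And>x. x \<in> carrier G \<Longrightarrow> vsubspace ?n (dg_comp V x)"
    and ex1: "\<And>v. v \<in> carrier_vec ?n \<Longrightarrow> \<exists>!f. dg_decomp G V v f"
    and mrep: "mat_rep G (carrier G) ?n (dg_act V)"
    and actc: "\<And>g x. g \<in> carrier G \<Longrightarrow> x \<in> carrier G \<Longrightarrow> (\<lambda>v. dg_act V g *\<^sub>v v) ` dg_comp V x = dg_comp V (conjg g x)"
    using V unfolding dg_obj_def by auto
  have act: "\<And>g. g \<in> carrier G \<Longrightarrow> dg_act V g \<in> carrier_mat ?n ?n"
    using mrep unfolding mat_rep_def by blast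
  have compc: "dg_comp V x \<subseteq> carrier_vec ?n" if "x \<in> carrier G" for x using sub[OF that] unfolding vsubspace_iff by blast
  have Usub: "fm_subspace ?n (U x)" if "x \<in> carrier G" for x
    unfolding U_def by (rule vsubspace_fm_subspace[OF sub[OF that]])
  have Uc: "u \<in> fm_carrier ?n 1" if "x \<in> carrier G" "u \<in> U x" for x u using Usub that unfolding fm_subspace_def by blast
  define D where "D v f \<longleftrightarrow> f \<in> (\<Pi>\<^sub>E x\<in>carrier G. U x) \<and> v = sum f (carrier G)" for v f
  have D1: "\<exists>!f. D v f" if v: "v \<in> fm_carrier ?n 1" for v
  proof -
    let ?v = "vec_of_fm ?n v"
    have v': "?v \<in> carrier_vec ?n" by simp
    have key: "dg_decomp G V ?v (\<lambda>x\<in>carrier G. vec_of_fm ?n (f x))" if D: "D v f" for f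
    proof -
      have fU: "f x \<in> U x" if "x \<in> carrier G" for x using D that unfolding D_def by blast
      have fc: "vec_of_fm ?n (f x) \<in> dg_comp V x \<and> fm_of_vec (vec_of_fm ?n (f x)) = f x" if x: "x \<in> carrier G" for x
      proof -
        obtain w where w: "w \<in> dg_comp V x" "f x = fm_of_vec w" using fU[OF x] unfolding U_def by blast
        have wc: "w \<in> carrier_vec ?n" using w(1) compc[OF x] by blast
        have "vec_of_fm ?n (f x) = w" using vec_of_fm_of_vec[OF wc] w(2) by simp
        then show ?thesis using w by simp
      qed
      have "fm_of_vec (finsum_vec TYPE('k) ?n (\<lambda>x\<in>carrier G. vec_of_fm ?n (f x)) (carrier G)) = v"
        using D fc unfolding D_def by (subst fm_of_vec_finsum) auto
      moreover have "finsum_vec TYPE('k) ?n (\<lambda>x\<in>carrier G. vec_of_fm ?n (f x)) (carrier G) \<in> carrier_vec ?n"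
        by (rule finsum_vec_closed) auto
      ultimately have "?v = finsum_vec TYPE('k) ?n (\<lambda>x\<in>carrier G. vec_of_fm ?n (f x)) (carrier G)"
        by (intro fm_of_vec_eqI[of _ _ ?n]) (simp_all add: v del: One_nat_def)
      then show ?thesis unfolding dg_decomp_def using fc by auto
    qed
    obtain f where f: "dg_decomp G V ?v f" using ex1[OF v'] by blast
    have fc: "f x \<in> dg_comp V x" "f x \<in> carrier_vec ?n" if "x \<in> carrier G" for x
      using f compc[OF that] that unfolding dg_decomp_def by auto
    have "D v (\<lambda>x\<in>carrier G. fm_of_vec (f x))"
    proof -
      have "fm_of_vec ?v = (\<Sum>x\<in>carrier G. fm_of_vec (f x))"
        using f fm_of_vec_finsum[OF finite_carrier fc(2)] unfolding dg_decomp_def by simp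
      then show ?thesis unfolding D_def using v fc by (auto simp: U_def simp del: One_nat_def)
    qed
    moreover have "f1 = f2" if "D v f1" "D v f2" for f1 f2
    proof
      fix x
      have eq: "(\<lambda>x\<in>carrier G. vec_of_fm ?n (f1 x)) = (\<lambda>x\<in>carrier G. vec_of_fm ?n (f2 x))"
        using key[OF that(1)] key[OF that(2)] ex1[OF v'] by blast
      show "f1 x = f2 x"
      proof (cases "x \<in> carrier G")
        case True
        then have eq': "vec_of_fm ?n (f1 x) = vec_of_fm ?n (f2 x)" using fun_cong[OF eq, of x] by simp
        have "f1 x \<in> fm_carrier ?n 1" "f2 x \<in> fm_carrier ?n 1"
          using that True Uc unfolding D_def by blast+
        then show ?thesis using arg_cong[OF eq', of fm_of_vec] fm_of_vec_of_fm by (metis (no_types))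
      next
        case False
        then show ?thesis using that unfolding D_def PiE_def extensional_def by auto
      qed
    qed
    ultimately show ?thesis by blast
  qed
  define c where "c v = (THE f. D v f)" for v
  have c: "D v (c v)" if "v \<in> fm_carrier ?n 1" for v unfolding c_def by (rule theI'[OF D1[OF that]])
  \<comment> \<open>The form in which uniqueness is used: any family of homogeneous vectors with sum
    \<open>v\<close> is the family of components. Additivity, homogeneity and the values on
    homogeneous vectors all follow by exhibiting such a family.\<close>
  have cI: "c v x = f x" if v: "v \<in> fm_carrier ?n 1" and f: "\<And>x. x \<in> carrier G \<Longrightarrow> f x \<in> U x" "v = sum f (carrier G)" and x: "x \<in> carrier G" for v f x
  proof -
    have "D v (restrict f (carrier G))" unfolding D_def using f by auto
    then have "c v = restrict f (carrier G)" using c[OF v] D1[OF v] by blast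
    then show ?thesis using x by simp
  qed
  have cU: "c v x \<in> U x" if "v \<in> fm_carrier ?n 1" "x \<in> carrier G" for v x
    using c[OF that(1)] that(2) unfolding D_def by blast
  have csum: "v = (\<Sum>x\<in>carrier G. c v x)" if "v \<in> fm_carrier ?n 1" for v
    using c[OF that] unfolding D_def by blast
  have "\<exists>A\<in>fm_carrier ?n ?n. \<forall>v\<in>fm_carrier ?n 1. A * v = c v x" if x: "x \<in> carrier G" for x
  proof (rule fm_linear_matrix)
    show "c v x \<in> fm_carrier ?n 1" if "v \<in> fm_carrier ?n 1" for v using cU[OF that x] Uc x by blast
    show "c (u + v) x = c u x + c v x" if uv: "u \<in> fm_carrier ?n 1" "v \<in> fm_carrier ?n 1" for u v
    proof (rule cI)
      show "c u x + c v x \<in> U x" if "x \<in> carrier G" for x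
        using cU[OF uv(1) that] cU[OF uv(2) that] Usub[OF that] unfolding fm_subspace_def by blast
      show "u + v = (\<Sum>x\<in>carrier G. c u x + c v x)"
        using csum[OF uv(1)] csum[OF uv(2)] by (simp add: sum.distrib)
    qed (use uv x in auto)
    show "c (fm_scale a v) x = fm_scale a (c v x)" if v: "v \<in> fm_carrier ?n 1" for a v
    proof (rule cI)
      show "fm_scale a (c v x) \<in> U x" if "x \<in> carrier G" for x
        using cU[OF v that] Usub[OF that] unfolding fm_subspace_def by blast
      show "fm_scale a v = (\<Sum>x\<in>carrier G. fm_scale a (c v x))"
        using arg_cong[OF csum[OF v], of "fm_scale a"] by (simp add: fm_scale_sum)
    qed (use v x in auto)
  qed
  then obtain p where p: "\<And>x. x \<in> carrier G \<Longrightarrow> p x \<in> fm_carrier ?n ?n"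
    and pv: "\<And>x v. x \<in> carrier G \<Longrightarrow> v \<in> fm_carrier ?n 1 \<Longrightarrow> p x * v = c v x" by metis
  have pU: "p x * u = (if x = y then u else 0)" if x: "x \<in> carrier G" and y: "y \<in> carrier G" and u: "u \<in> U y" for x y u
  proof -
    have uc: "u \<in> fm_carrier ?n 1" using Uc y u by blast
    have "c u x = (if x = y then u else 0)"
      by (rule cI[OF uc]) (use Usub x y u in \<open>auto simp: fm_subspace_def\<close>)
    then show ?thesis using pv[OF x uc] by simp
  qed
  have "dg_realizes G V p"
    unfolding dg_realizes_def dg_module_def
  proof (intro conjI ballI)
    show one: "dg_mat V \<one> = fm_one ?n" using mrep unfolding mat_rep_def by simp
    show "dg_mat V (g \<otimes> h) = dg_mat V g * dg_mat V h" if gh: "g \<in> carrier G" "h \<in> carrier G" for g h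
      using mrep gh fm_of_mat_mult[OF act[OF gh(1)] act[OF gh(2)]] unfolding mat_rep_def by simp
    show pp: "p x * p y = (if x = y then p x else 0)" if xy: "x \<in> carrier G" "y \<in> carrier G" for x y
    proof (rule fm_eq_columnI)
      show "p x * p y * v = (if x = y then p x else 0) * v" if v: "v \<in> fm_carrier ?n 1" for v
        using pU[OF xy cU[OF v xy(2)]] pv[OF xy(2) v] by (simp add: mult.assoc)
    qed (use p xy in auto)
    show psum: "(\<Sum>x\<in>carrier G. p x) = fm_one ?n"
    proof (rule fm_eq_columnI[of _ ?n ?n])
      show "(\<Sum>x\<in>carrier G. p x) * v = fm_one ?n * v" if v: "v \<in> fm_carrier ?n 1" for v
        using csum[OF v] pv[OF _ v] v by (simp add: sum_distrib_right del: One_nat_def)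
    qed (use p in auto)
    show "dg_mat V g * p x = p (conjg g x) * dg_mat V g" if gx: "g \<in> carrier G" "x \<in> carrier G" for g x
    proof -
      \<comment> \<open>On a vector of degree y the action of g lands in degree
        \<open>conjg g y\<close>, so the projection keeps it or kills it. Summing over y gives the
        commutation rule.\<close>
      have key: "p (conjg g x) * (dg_mat V g * p y) = (if x = y then dg_mat V g * p y else 0)" if y: "y \<in> carrier G" for y
      proof (rule fm_eq_columnI)
        fix v :: "'k fmat" assume v: "v \<in> fm_carrier ?n 1"
        have "dg_mat V g * (p y * v) \<in> U (conjg g y)"
        proof -
          have "p y * v \<in> U y" using pv[OF y v] cU[OF v y] by simp
          then obtain w where w: "w \<in> dg_comp V y" "p y * v = fm_of_vec w" unfolding U_def by blast
          have "dg_mat V g * (p y * v) = fm_of_vec (dg_act V g *\<^sub>v w)"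
            unfolding w(2) using compc[OF y] w(1) by (intro fm_of_vec_mult[OF act[OF gx(1)], symmetric]) auto
          then show ?thesis unfolding U_def actc[OF gx(1) y, symmetric] using w(1) by blast
        qed
        then have "p (conjg g x) * (dg_mat V g * (p y * v)) = (if x = y then dg_mat V g * (p y * v) else 0)"
          using pU[of "conjg g x" "conjg g y"] gx y by simp
        then show "p (conjg g x) * (dg_mat V g * p y) * v = (if x = y then dg_mat V g * p y else 0) * v"
          by (simp add: mult.assoc split: if_splits)
      qed (use p y gx act in \<open>auto intro!: fm_mult_carrier[of _ ?n ?n]\<close>)
      have "p (conjg g x) * dg_mat V g = p (conjg g x) * (dg_mat V g * (\<Sum>y\<in>carrier G. p y))"
        unfolding psum using fm_mult_one[OF fm_of_mat_carrier[OF act[OF gx(1)]]] by simp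
      also have "\<dots> = (\<Sum>y\<in>carrier G. p (conjg g x) * (dg_mat V g * p y))"
        by (simp add: sum_distrib_left)
      also have "\<dots> = dg_mat V g * p x"
        using key gx by simp
      finally show ?thesis ..
    qed
    show "dg_comp V x = {v \<in> carrier_vec ?n. p x * fm_of_vec v = fm_of_vec v}" if x: "x \<in> carrier G" for x
    proof
      show "dg_comp V x \<subseteq> {v \<in> carrier_vec ?n. p x * fm_of_vec v = fm_of_vec v}"
        using compc[OF x] pU[OF x x] by (auto simp: U_def)
      show "{v \<in> carrier_vec ?n. p x * fm_of_vec v = fm_of_vec v} \<subseteq> dg_comp V x"
      proof
        fix v assume "v \<in> {v \<in> carrier_vec ?n. p x * fm_of_vec v = fm_of_vec v}"
        then have v: "v \<in> carrier_vec ?n" "p x * fm_of_vec v = fm_of_vec v" by auto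
        have "fm_of_vec v \<in> U x" using pv[OF x fm_of_vec_carrier[OF v(1)]] cU[OF fm_of_vec_carrier[OF v(1)] x] v(2) by simp
        then show "v \<in> dg_comp V x" unfolding U_def using fm_of_vec_mem_image[OF compc[OF x] v(1)] by blast
      qed
    qed
  qed (use act p in auto)
  then show ?thesis by blast
qed

lemma dg_realizes_proj: "dg_obj G V \<Longrightarrow> dg_realizes G V (dg_proj G V)"
  for V :: "('a, 'k::field) dgrep"
  unfolding dg_proj_def by (rule someI_ex[OF dg_obj_realizes])

text \<open>Equal images give \<open>p x * q x = q x\<close>. Expanding \<open>p x\<close> against
  the sum of all \<open>q y\<close>, orthogonality of the \<open>p\<close> leaves only y =
  x.\<close>

lemma dg_realizes_unique:
  fixes V :: "('a, 'k::field) dgrep"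
  assumes p: "dg_realizes G V p" and q: "dg_realizes G V q" and x: "x \<in> carrier G"
  shows "p x = q x"
proof -
  let ?n = "dg_dim V"
  have P: "\<And>x. x \<in> carrier G \<Longrightarrow> p x \<in> fm_carrier ?n ?n" "\<And>x y. x \<in> carrier G \<Longrightarrow> y \<in> carrier G \<Longrightarrow> p x * p y = (if x = y then p x else 0)"
    and cp: "\<And>x. x \<in> carrier G \<Longrightarrow> dg_comp V x = {v \<in> carrier_vec ?n. p x * fm_of_vec v = fm_of_vec v}"
    using p unfolding dg_realizes_def dg_module_def by auto
  have Q: "\<And>x. x \<in> carrier G \<Longrightarrow> q x \<in> fm_carrier ?n ?n" "\<And>x y. x \<in> carrier G \<Longrightarrow> y \<in> carrier G \<Longrightarrow> q x * q y = (if x = y then q x else 0)"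
    and cq: "\<And>x. x \<in> carrier G \<Longrightarrow> dg_comp V x = {v \<in> carrier_vec ?n. q x * fm_of_vec v = fm_of_vec v}"
    and qs: "(\<Sum>x\<in>carrier G. q x) = fm_one ?n"
    using q unfolding dg_realizes_def dg_module_def by auto
  have pq: "p x * q x = q x" if x: "x \<in> carrier G" for x
  proof (rule fm_eq_columnI)
    fix v :: "'k fmat" assume v: "v \<in> fm_carrier ?n 1"
    have qv: "q x * v \<in> fm_carrier ?n 1" using Q(1)[OF x] v by (rule fm_mult_carrier)
    have "vec_of_fm ?n (q x * v) \<in> dg_comp V x"
      unfolding cq[OF x] using qv Q(2)[OF x x] by (simp add: mult.assoc[symmetric] del: One_nat_def)
    then have "p x * (q x * v) = q x * v"
      unfolding cp[OF x] using qv by (simp del: One_nat_def)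
    then show "p x * q x * v = q x * v" by (simp add: mult.assoc)
  qed (use P(1)[OF x] Q(1)[OF x] in \<open>auto intro: fm_mult_carrier\<close>)
  have "p x = p x * (\<Sum>y\<in>carrier G. q y)" unfolding qs using P(1)[OF x] by simp
  also have "\<dots> = (\<Sum>y\<in>carrier G. p x * (p y * q y))" using pq by (simp add: sum_distrib_left)
  also have "\<dots> = (\<Sum>y\<in>carrier G. if y = x then q x else 0)"
  proof (rule sum.cong)
    fix y assume y: "y \<in> carrier G"
    have "p x * (p y * q y) = (if x = y then p x else 0) * q y"
      using P(2)[OF x y] by (simp add: mult.assoc[symmetric])
    then show "p x * (p y * q y) = (if y = x then q x else 0)" using pq[OF x] by auto
  qed simp
  also have "\<dots> = q x" using x by simp
  finally show ?thesis .
qed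

end

section \<open>Morphisms and subobjects through projections, block sums and eigenvectors\<close>

definition fm_hom :: "('g, 'b) monoid_scheme \<Rightarrow> ('g, 'k::field) dgrep \<Rightarrow> ('g, 'k) dgrep \<Rightarrow> 'k fmat set" where
  "fm_hom G V W = {T \<in> fm_carrier (dg_dim W) (dg_dim V).
     (\<forall>g\<in>carrier G. T * dg_mat V g = dg_mat W g * T) \<and>
     (\<forall>x\<in>carrier G. T * dg_proj G V x = dg_proj G W x * T)}"

definition fm_subobject :: "('g, 'b) monoid_scheme \<Rightarrow> ('g, 'k::field) dgrep \<Rightarrow> 'k fmat set \<Rightarrow> bool" where
  "fm_subobject G V U \<longleftrightarrow> fm_subspace (dg_dim V) U \<and>
     (\<forall>g\<in>carrier G. \<forall>u\<in>U. dg_mat V g * u \<in> U) \<and> (\<forall>x\<in>carrier G. \<forall>u\<in>U. dg_proj G V x * u \<in> U)"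

definition dg_of_fm :: "nat \<Rightarrow> ('g \<Rightarrow> 'k fmat) \<Rightarrow> ('g \<Rightarrow> 'k fmat) \<Rightarrow> ('g, 'k::field) dgrep" where
  "dg_of_fm n p r = \<lparr>dg_dim = n, dg_comp = (\<lambda>x. {v \<in> carrier_vec n. p x * fm_of_vec v = fm_of_vec v}),
     dg_act = (\<lambda>g. mat_of_fm n n (r g))\<rparr>"

text \<open>The inclusion of the second summand; its transpose is the projection onto that
  summand.\<close>

definition fm_shift :: "nat \<Rightarrow> nat \<Rightarrow> 'a::zero_neq_one fmat" where
  "fm_shift n m = fm_of_fun (n + m) m (\<lambda>i j. if i = n + j then 1 else 0)"

text \<open>Since carriers are nested, the first block already sits in the top left corner; only the
  second has to be moved.\<close>

definition fm_block :: "nat \<Rightarrow> nat \<Rightarrow> 'a::ring_1 fmat \<Rightarrow> 'a fmat \<Rightarrow> 'a fmat" where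
  "fm_block n m A D = A + fm_shift n m * D * fm_transpose (fm_shift n m)"

lemma fm_one_mult_square [simp]:
  "A \<in> fm_carrier n n \<Longrightarrow> fm_one n * A = A" "A \<in> fm_carrier n n \<Longrightarrow> A * fm_one n = A"
  for A :: "'a::ring_1 fmat"
  by (rule fm_one_mult fm_mult_one; assumption)+

lemma fm_shift_carrier [simp]: "fm_shift n m \<in> fm_carrier (n + m) m"
  by (simp add: fm_shift_def)

lemma fm_nth_shift [simp]: "fm_nth (fm_shift n m) i j = (if i = n + j \<and> j < m then 1 else 0)"
  by (auto simp: fm_shift_def)

lemma fm_nth_shift_mult:
  "D \<in> fm_carrier m k \<Longrightarrow> fm_nth (fm_shift n m * D) i j = (if n \<le> i then fm_nth D (i - n) j else 0)"
  for D :: "'a::ring_1 fmat"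
proof -
  assume D: "D \<in> fm_carrier m k"
  have "fm_nth (fm_shift n m * D) i j = (\<Sum>l<m. if l = i - n then (if n \<le> i then fm_nth D (i - n) j else 0) else 0)"
    by (subst fm_nth_times_left[OF fm_shift_carrier], rule sum.cong) auto
  then show ?thesis using fm_carrierD[OF D, of "i - n" j] by auto
qed

lemma fm_transpose_shift_mult:
  "fm_transpose (fm_shift n m) * fm_shift n m = (fm_one m :: 'a::comm_ring_1 fmat)"
proof (rule fmat_eqI)
  fix i j
  have "fm_nth (fm_transpose (fm_shift n m) * fm_shift n m :: 'a fmat) i j
     = (\<Sum>l<n + m. if l = n + j then (if i = j \<and> i < m then 1 else 0) else 0)"
    by (subst fm_nth_times_right[OF fm_shift_carrier], rule sum.cong) auto
  then show "fm_nth (fm_transpose (fm_shift n m) * fm_shift n m :: 'a fmat) i j = fm_nth (fm_one m) i j"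
    by auto
qed

lemma fm_shift_mult_transpose:
  "fm_shift n m * fm_transpose (fm_shift n m) = (fm_one (n + m) - fm_one n :: 'a::comm_ring_1 fmat)"
proof (rule fmat_eqI)
  fix i j
  show "fm_nth (fm_shift n m * fm_transpose (fm_shift n m)) i j = fm_nth (fm_one (n + m) - fm_one n :: 'a fmat) i j"
    by (subst fm_nth_shift_mult[of _ m "n + m"]) (auto simp: fm_nth_simps)
qed

lemma fm_mult_shift_zero [simp]: "A \<in> fm_carrier k n \<Longrightarrow> A * fm_shift n m = 0"
  for A :: "'a::ring_1 fmat"
proof (rule fmat_eqI)
  fix i j assume A: "A \<in> fm_carrier k n"
  show "fm_nth (A * fm_shift n m) i j = fm_nth 0 i j"
    by (subst fm_nth_times_left[OF A]) (auto simp: fm_nth_simps intro!: sum.neutral)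
qed

lemma fm_transpose_shift_zero [simp]: "A \<in> fm_carrier n k \<Longrightarrow> fm_transpose (fm_shift n m) * A = 0"
  for A :: "'a::comm_ring_1 fmat"
proof -
  assume "A \<in> fm_carrier n k"
  then have "fm_transpose (fm_transpose A * fm_shift n m) = 0"
    by (simp only: fm_mult_shift_zero[OF fm_transpose_carrier] fm_transpose_simps)
  then show ?thesis unfolding fm_transpose_mult by simp
qed

lemma fm_block_carrier [simp]:
  "A \<in> fm_carrier n n \<Longrightarrow> D \<in> fm_carrier m m \<Longrightarrow> fm_block n m A D \<in> fm_carrier (n + m) (n + m)"
  unfolding fm_block_def
  using fm_carrier_mono[of A n n "n + m" "n + m"]
  by (auto intro!: fm_add_carrier fm_mult_carrier[where m = m])

lemma fm_block_mult:
  fixes A :: "'a::comm_ring_1 fmat"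
  assumes "A \<in> fm_carrier n n" "A' \<in> fm_carrier n n" "D \<in> fm_carrier m m" "D' \<in> fm_carrier m m"
  shows "fm_block n m A D * fm_block n m A' D' = fm_block n m (A * A') (D * D')"
proof -
  let ?S = "fm_shift n m :: 'a fmat"
  have 1: "A * (?S * X) = 0" for X using assms by (simp add: mult.assoc[symmetric])
  have 2: "fm_transpose ?S * A' = 0" using assms by simp
  have 3: "fm_transpose ?S * (?S * X) = fm_one m * X" for X
    by (simp add: mult.assoc[symmetric] fm_transpose_shift_mult)
  have 4: "fm_one m * (D' * X) = D' * X" for X using assms by (simp add: mult.assoc[symmetric])
  show ?thesis
    unfolding fm_block_def by (simp add: ring_distribs mult.assoc 1 2 3 4)
qed

lemma fm_block_one: "fm_block n m (fm_one n) (fm_one m) = (fm_one (n + m) :: 'a::comm_ring_1 fmat)"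
  unfolding fm_block_def fm_mult_one[OF fm_shift_carrier] fm_shift_mult_transpose by simp

lemma fm_block_sum: "(\<Sum>x\<in>X. fm_block n m (f x) (g x)) = fm_block n m (sum f X) (sum g X)"
  unfolding fm_block_def by (simp add: sum.distrib sum_distrib_left sum_distrib_right)

lemma fm_block_zero [simp]: "fm_block n m 0 0 = 0"
  unfolding fm_block_def by simp

lemma fm_of_mat_four_block:
  fixes A :: "'a::comm_ring_1 mat"
  assumes A: "A \<in> carrier_mat n n" and D: "D \<in> carrier_mat m m"
  shows "fm_of_mat (four_block_mat A (0\<^sub>m n m) (0\<^sub>m m n) D) = fm_block n m (fm_of_mat A) (fm_of_mat D)"
proof (rule fmat_eqI)
  fix i j
  let ?S = "fm_shift n m :: 'a fmat"
  have SD: "?S * fm_of_mat D \<in> fm_carrier (n + m) m"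
    by (rule fm_mult_carrier[OF fm_shift_carrier fm_of_mat_carrier[OF D]])
  have "fm_nth (?S * fm_of_mat D * fm_transpose ?S) i j = fm_nth (fm_transpose (?S * fm_transpose (?S * fm_of_mat D))) i j"
    by (simp add: fm_transpose_mult)
  also have "\<dots> = (if n \<le> j then fm_nth (?S * fm_of_mat D) i (j - n) else 0)"
    using fm_nth_shift_mult[OF fm_transpose_carrier[OF SD]] by simp
  also have "\<dots> = (if n \<le> i \<and> n \<le> j then fm_nth (fm_of_mat D) (i - n) (j - n) else 0)"
    using fm_nth_shift_mult[OF fm_of_mat_carrier[OF D]] by simp
  finally show "fm_nth (fm_of_mat (four_block_mat A (0\<^sub>m n m) (0\<^sub>m m n) D)) i j
      = fm_nth (fm_block n m (fm_of_mat A) (fm_of_mat D)) i j"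
    using A D unfolding fm_block_def
    by (auto simp: fm_of_mat_def fm_nth_simps)
qed

lemma fm_of_vec_append:
  fixes v :: "'a::comm_ring_1 vec"
  assumes v: "v \<in> carrier_vec n" and w: "w \<in> carrier_vec m"
  shows "fm_of_vec (v @\<^sub>v w) = fm_of_vec v + fm_shift n m * fm_of_vec w"
proof (rule fmat_eqI)
  fix i j
  show "fm_nth (fm_of_vec (v @\<^sub>v w)) i j = fm_nth (fm_of_vec v + fm_shift n m * fm_of_vec w) i j"
    using v w fm_nth_shift_mult[OF fm_of_vec_carrier[OF w], of n i j]
    by (auto simp: fm_of_vec_def fm_nth_simps)
qed

text \<open>Over an algebraically closed field the characteristic polynomial, whose degree n is
  positive, has a root.\<close>

lemma fm_eigenvector:
  fixes T :: "'k::alg_closed_field fmat"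
  assumes T: "T \<in> fm_carrier n n" and n: "n > 0"
  shows "\<exists>c. \<exists>v\<in>fm_carrier n 1. v \<noteq> 0 \<and> T * v = fm_scale c v"
proof -
  let ?A = "mat_of_fm n n T"
  have A: "?A \<in> carrier_mat n n" by simp
  have "degree (char_poly ?A) = n" using degree_monic_char_poly[OF A] by simp
  then obtain c where "poly (char_poly ?A) c = 0" using alg_closed_imp_poly_has_root n by metis
  then have "eigenvalue ?A c" using eigenvalue_root_char_poly[OF A] by simp
  then obtain v where v: "v \<in> carrier_vec n" "v \<noteq> 0\<^sub>v n" "?A *\<^sub>v v = c \<cdot>\<^sub>v v"
    unfolding eigenvalue_def eigenvector_def carrier_matD(1)[OF A] by blast
  have "T * fm_of_vec v = fm_scale c (fm_of_vec v)"
    using fm_of_vec_mult[OF A v(1)] T v(3) by (simp add: fm_of_vec_smult)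
  moreover have "fm_of_vec v \<noteq> 0" using v(1,2) fm_of_vec_inj[of v n "0\<^sub>v n"] by auto
  ultimately show ?thesis using fm_of_vec_carrier[OF v(1)] by blast
qed

section \<open>The twist, simplicity, isomorphisms and direct sums through projections\<close>

context finite_group
begin

context
  fixes V :: "('a, 'k::field) dgrep"
  assumes V: "dg_obj G V"
begin

lemma obj_act_carrier: "g \<in> carrier G \<Longrightarrow> dg_act V g \<in> carrier_mat (dg_dim V) (dg_dim V)"
  using dg_realizes_proj[OF V] unfolding dg_realizes_def by blast

lemma obj_mat_carrier [simp]: "g \<in> carrier G \<Longrightarrow> dg_mat V g \<in> fm_carrier (dg_dim V) (dg_dim V)"
  using obj_act_carrier by simp

lemma obj_mat_one [simp]: "dg_mat V \<one> = fm_one (dg_dim V)"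
  using dg_realizes_proj[OF V] unfolding dg_realizes_def dg_module_def by blast

lemma obj_mat_mult: "g \<in> carrier G \<Longrightarrow> h \<in> carrier G \<Longrightarrow> dg_mat V (g \<otimes> h) = dg_mat V g * dg_mat V h"
  using dg_realizes_proj[OF V] unfolding dg_realizes_def dg_module_def by blast

lemma obj_proj_carrier [simp]: "x \<in> carrier G \<Longrightarrow> dg_proj G V x \<in> fm_carrier (dg_dim V) (dg_dim V)"
  using dg_realizes_proj[OF V] unfolding dg_realizes_def dg_module_def by blast

lemma obj_proj_mult: "x \<in> carrier G \<Longrightarrow> y \<in> carrier G \<Longrightarrow> dg_proj G V x * dg_proj G V y = (if x = y then dg_proj G V x else 0)"
  using dg_realizes_proj[OF V] unfolding dg_realizes_def dg_module_def by blast

lemma obj_proj_mult_left: "x \<in> carrier G \<Longrightarrow> y \<in> carrier G \<Longrightarrow> dg_proj G V x * (dg_proj G V y * X) = (if x = y then dg_proj G V x * X else 0)"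
  using obj_proj_mult by (simp add: mult.assoc[symmetric])

lemma obj_proj_sum: "(\<Sum>x\<in>carrier G. dg_proj G V x) = fm_one (dg_dim V)"
  using dg_realizes_proj[OF V] unfolding dg_realizes_def dg_module_def by blast

lemma obj_mat_proj: "g \<in> carrier G \<Longrightarrow> x \<in> carrier G \<Longrightarrow> dg_mat V g * dg_proj G V x = dg_proj G V (conjg g x) * dg_mat V g"
  using dg_realizes_proj[OF V] unfolding dg_realizes_def dg_module_def by blast

lemma obj_comp: "x \<in> carrier G \<Longrightarrow> dg_comp V x = {v \<in> carrier_vec (dg_dim V). dg_proj G V x * fm_of_vec v = fm_of_vec v}"
  using dg_realizes_proj[OF V] unfolding dg_realizes_def by blast

lemma obj_mat_inv: "g \<in> carrier G \<Longrightarrow> dg_mat V g * dg_mat V (inv g) = fm_one (dg_dim V)"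
  "g \<in> carrier G \<Longrightarrow> dg_mat V (inv g) * dg_mat V g = fm_one (dg_dim V)"
  by (simp_all add: obj_mat_mult[symmetric])

lemma obj_proj_zero_conj:
  assumes g: "g \<in> carrier G" and x: "x \<in> carrier G" and z: "dg_proj G V x = 0"
  shows "dg_proj G V (conjg g x) = 0"
proof -
  have "dg_proj G V (conjg g x) = dg_proj G V (conjg g x) * (dg_mat V g * dg_mat V (inv g))"
    using obj_mat_inv(1)[OF g] g x by simp
  also have "\<dots> = dg_mat V g * dg_proj G V x * dg_mat V (inv g)"
    using obj_mat_proj[OF g x] by (simp add: mult.assoc)
  finally show ?thesis using z by simp
qed

lemma comp_eq_zero_iff: "x \<in> carrier G \<Longrightarrow> dg_comp V x = {0\<^sub>v (dg_dim V)} \<longleftrightarrow> dg_proj G V x = 0"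
proof
  assume x: "x \<in> carrier G" and z: "dg_comp V x = {0\<^sub>v (dg_dim V)}"
  show "dg_proj G V x = 0"
  proof (rule fm_eq_columnI[of _ "dg_dim V" "dg_dim V"])
    fix v :: "'k fmat" assume v: "v \<in> fm_carrier (dg_dim V) 1"
    have w: "dg_proj G V x * v \<in> fm_carrier (dg_dim V) 1" using x v by simp
    then have "vec_of_fm (dg_dim V) (dg_proj G V x * v) \<in> dg_comp V x"
      using x obj_proj_mult[OF x x] by (simp add: obj_comp mult.assoc[symmetric] del: One_nat_def)
    then have "vec_of_fm (dg_dim V) (dg_proj G V x * v) = 0\<^sub>v (dg_dim V)" using z by blast
    then have "fm_of_vec (vec_of_fm (dg_dim V) (dg_proj G V x * v)) = 0" by simp
    then show "dg_proj G V x * v = 0 * v" using w by (simp del: One_nat_def)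
  qed (use obj_proj_carrier[OF x] in auto)
next
  assume x: "x \<in> carrier G" and z: "dg_proj G V x = 0"
  show "dg_comp V x = {0\<^sub>v (dg_dim V)}"
    unfolding obj_comp[OF x] z by (auto intro: fm_of_vec_eqI)
qed

lemma dg_twist_fm:
  assumes v: "v \<in> carrier_vec (dg_dim V)"
  shows "fm_of_vec (dg_twist G V v) = (\<Sum>x\<in>carrier G. dg_mat V x * dg_proj G V x) * fm_of_vec v"
    and "dg_twist G V v \<in> carrier_vec (dg_dim V)"
proof -
  let ?f = "\<lambda>x\<in>carrier G. vec_of_fm (dg_dim V) (dg_proj G V x * fm_of_vec v)"
  have the: "(THE f. dg_decomp G V v f) = ?f"
    unfolding dg_decomp_iff[OF dg_realizes_proj[OF V] v] by simp
  have car: "dg_act V x *\<^sub>v ?f x \<in> carrier_vec (dg_dim V)" if "x \<in> carrier G" for x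
    using that by (simp add: mult_mat_vec_carrier[OF obj_act_carrier])
  have "fm_of_vec (dg_twist G V v) = (\<Sum>x\<in>carrier G. fm_of_vec (dg_act V x *\<^sub>v ?f x))"
    unfolding dg_twist_def the by (rule fm_of_vec_finsum) (use car in auto)
  also have "\<dots> = (\<Sum>x\<in>carrier G. dg_mat V x * (dg_proj G V x * fm_of_vec v))"
  proof (rule sum.cong)
    fix x assume x: "x \<in> carrier G"
    have "dg_proj G V x * fm_of_vec v \<in> fm_carrier (dg_dim V) 1"
      by (rule fm_square_mult_carrier(1)[OF obj_proj_carrier[OF x] fm_of_vec_carrier[OF v]])
    then show "fm_of_vec (dg_act V x *\<^sub>v ?f x) = dg_mat V x * (dg_proj G V x * fm_of_vec v)"
      using x fm_of_vec_mult[OF obj_act_carrier[OF x] vec_of_fm_carrier] by (simp del: One_nat_def)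
  qed simp
  finally show "fm_of_vec (dg_twist G V v) = (\<Sum>x\<in>carrier G. dg_mat V x * dg_proj G V x) * fm_of_vec v"
    by (simp add: sum_distrib_right mult.assoc)
  show "dg_twist G V v \<in> carrier_vec (dg_dim V)"
    unfolding dg_twist_def the by (rule finsum_vec_closed) (use car in auto)
qed

text \<open>The twist is the matrix that sums \<open>dg_mat V x * dg_proj G V x\<close> over all
  degrees x. Multiplying by one projection isolates one degree.\<close>

lemma dg_twist_trivial_iff:
  "(\<forall>v\<in>carrier_vec (dg_dim V). dg_twist G V v = v) \<longleftrightarrow> (\<forall>x\<in>carrier G. dg_mat V x * dg_proj G V x = dg_proj G V x)"
proof
  let ?T = "\<Sum>x\<in>carrier G. dg_mat V x * dg_proj G V x"
  assume tw: "\<forall>v\<in>carrier_vec (dg_dim V). dg_twist G V v = v"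
  have T: "?T = fm_one (dg_dim V)"
  proof (rule fm_eq_columnI[of _ "dg_dim V" "dg_dim V"])
    fix v :: "'k fmat" assume v: "v \<in> fm_carrier (dg_dim V) 1"
    have "?T * fm_of_vec (vec_of_fm (dg_dim V) v) = fm_of_vec (vec_of_fm (dg_dim V) v)"
      using tw dg_twist_fm(1)[OF vec_of_fm_carrier] by simp
    then show "?T * v = fm_one (dg_dim V) * v" using v by (simp del: One_nat_def)
  qed auto
  show "\<forall>x\<in>carrier G. dg_mat V x * dg_proj G V x = dg_proj G V x"
  proof
    fix x assume x: "x \<in> carrier G"
    have "dg_proj G V x = ?T * dg_proj G V x" unfolding T using x by simp
    also have "\<dots> = (\<Sum>y\<in>carrier G. if y = x then dg_mat V x * dg_proj G V x else 0)"
      unfolding sum_distrib_right by (rule sum.cong) (use x in \<open>auto simp: mult.assoc obj_proj_mult\<close>)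
    also have "\<dots> = dg_mat V x * dg_proj G V x" using x by simp
    finally show "dg_mat V x * dg_proj G V x = dg_proj G V x" ..
  qed
next
  assume *: "\<forall>x\<in>carrier G. dg_mat V x * dg_proj G V x = dg_proj G V x"
  show "\<forall>v\<in>carrier_vec (dg_dim V). dg_twist G V v = v"
  proof
    fix v :: "'k vec" assume v: "v \<in> carrier_vec (dg_dim V)"
    have "fm_of_vec (dg_twist G V v) = fm_of_vec v"
      unfolding dg_twist_fm(1)[OF v] using * obj_proj_sum fm_of_vec_carrier[OF v] by (simp del: One_nat_def)
    then show "dg_twist G V v = v" by (rule fm_of_vec_eqI[OF _ dg_twist_fm(2)[OF v] v])
  qed
qed

lemma dg_subobject_fm:
  assumes "dg_subobject G V U"
  shows "fm_subobject G V (fm_of_vec ` U)"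
  unfolding fm_subobject_def
proof (intro conjI ballI)
  have U: "vsubspace (dg_dim V) U" "\<And>g u. g \<in> carrier G \<Longrightarrow> u \<in> U \<Longrightarrow> dg_act V g *\<^sub>v u \<in> U"
    "\<And>u f x. u \<in> U \<Longrightarrow> dg_decomp G V u f \<Longrightarrow> x \<in> carrier G \<Longrightarrow> f x \<in> U"
    using assms unfolding dg_subobject_def by auto
  have Uc: "u \<in> carrier_vec (dg_dim V)" if "u \<in> U" for u using U(1) that unfolding vsubspace_iff by blast
  show "fm_subspace (dg_dim V) (fm_of_vec ` U)" using U(1) by (rule vsubspace_fm_subspace)
  show "dg_mat V g * u \<in> fm_of_vec ` U" if g: "g \<in> carrier G" and u: "u \<in> fm_of_vec ` U" for g u
  proof -
    obtain u' where u': "u' \<in> U" "u = fm_of_vec u'" using u by blast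
    then show ?thesis using fm_of_vec_mult[OF obj_act_carrier[OF g] Uc[OF u'(1)]] U(2)[OF g u'(1)] by (metis image_eqI)
  qed
  show "dg_proj G V x * u \<in> fm_of_vec ` U" if x: "x \<in> carrier G" and u: "u \<in> fm_of_vec ` U" for x u
  proof -
    obtain u' where u': "u' \<in> U" "u = fm_of_vec u'" using u by blast
    let ?f = "\<lambda>x\<in>carrier G. vec_of_fm (dg_dim V) (dg_proj G V x * fm_of_vec u')"
    have "dg_decomp G V u' ?f" unfolding dg_decomp_iff[OF dg_realizes_proj[OF V] Uc[OF u'(1)]] ..
    then have "?f x \<in> U" by (rule U(3)[OF u'(1) _ x])
    then have 1: "vec_of_fm (dg_dim V) (dg_proj G V x * u) \<in> U" using x u'(2) by simp
    have "dg_proj G V x * u \<in> fm_carrier (dg_dim V) 1"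
      unfolding u'(2) by (rule fm_square_mult_carrier(1)[OF obj_proj_carrier[OF x] fm_of_vec_carrier[OF Uc[OF u'(1)]]])
    then have "fm_of_vec (vec_of_fm (dg_dim V) (dg_proj G V x * u)) = dg_proj G V x * u" by (rule fm_of_vec_of_fm)
    then show ?thesis using 1 by (metis image_eqI)
  qed
qed

lemma fm_subobject_dg:
  assumes U: "fm_subobject G V U"
  shows "dg_subobject G V {v \<in> carrier_vec (dg_dim V). fm_of_vec v \<in> U}"
  unfolding dg_subobject_def
proof (intro conjI ballI allI impI)
  show "vsubspace (dg_dim V) {v \<in> carrier_vec (dg_dim V). fm_of_vec v \<in> U}"
    using U unfolding fm_subobject_def by (intro fm_subspace_vsubspace) blast
  fix u assume "u \<in> {v \<in> carrier_vec (dg_dim V). fm_of_vec v \<in> U}"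
  then have u: "u \<in> carrier_vec (dg_dim V)" "fm_of_vec u \<in> U" by auto
  show "dg_act V g *\<^sub>v u \<in> {v \<in> carrier_vec (dg_dim V). fm_of_vec v \<in> U}" if g: "g \<in> carrier G" for g
    using U u g mult_mat_vec_carrier[OF obj_act_carrier[OF g] u(1)] fm_of_vec_mult[OF obj_act_carrier[OF g] u(1)]
    unfolding fm_subobject_def by simp
  show "f x \<in> {v \<in> carrier_vec (dg_dim V). fm_of_vec v \<in> U}" if d: "dg_decomp G V u f" and x: "x \<in> carrier G" for f x
  proof -
    have f: "f x = vec_of_fm (dg_dim V) (dg_proj G V x * fm_of_vec u)"
      using d x unfolding dg_decomp_iff[OF dg_realizes_proj[OF V] u(1)] by simp
    have "dg_proj G V x * fm_of_vec u \<in> fm_carrier (dg_dim V) 1"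
      by (rule fm_square_mult_carrier(1)[OF obj_proj_carrier[OF x] fm_of_vec_carrier[OF u(1)]])
    then show ?thesis using U u(2) x unfolding fm_subobject_def f by (simp del: One_nat_def)
  qed
qed

lemma dg_simple_iff:
  "dg_simple G V \<longleftrightarrow> dg_dim V > 0 \<and> (\<forall>U. fm_subobject G V U \<longrightarrow> U = {0} \<or> U = fm_carrier (dg_dim V) 1)"
proof -
  have top: "fm_of_vec ` carrier_vec (dg_dim V) = (fm_carrier (dg_dim V) 1 :: 'k fmat set)"
    using fm_vec_set_eq[of "fm_carrier (dg_dim V) 1" "dg_dim V"] fm_of_vec_carrier by (auto simp del: One_nat_def)
  have "(\<forall>U. dg_subobject G V U \<longrightarrow> U = {0\<^sub>v (dg_dim V)} \<or> U = carrier_vec (dg_dim V)) \<longleftrightarrow>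
     (\<forall>U. fm_subobject G V U \<longrightarrow> U = {0} \<or> U = fm_carrier (dg_dim V) 1)"
  proof (intro iffI allI impI)
    fix U assume s: "\<forall>U. dg_subobject G V U \<longrightarrow> U = {0\<^sub>v (dg_dim V)} \<or> U = carrier_vec (dg_dim V)"
      and U: "fm_subobject G V U"
    have Uc: "U \<subseteq> fm_carrier (dg_dim V) 1" using U unfolding fm_subobject_def fm_subspace_def by blast
    have "{v \<in> carrier_vec (dg_dim V). fm_of_vec v \<in> U} = {0\<^sub>v (dg_dim V)} \<or>
        {v \<in> carrier_vec (dg_dim V). fm_of_vec v \<in> U} = carrier_vec (dg_dim V)"
      using s fm_subobject_dg[OF U] by blast
    then have "fm_of_vec ` {v \<in> carrier_vec (dg_dim V). fm_of_vec v \<in> U} = fm_of_vec ` {0\<^sub>v (dg_dim V)} \<or>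
        fm_of_vec ` {v \<in> carrier_vec (dg_dim V). fm_of_vec v \<in> U} = fm_of_vec ` carrier_vec (dg_dim V)"
      by (elim disjE) (simp_all only: simp_thms)
    then have "U = fm_of_vec ` {0\<^sub>v (dg_dim V)} \<or> U = fm_of_vec ` carrier_vec (dg_dim V)"
      unfolding fm_vec_set_eq[OF Uc] .
    then show "U = {0} \<or> U = fm_carrier (dg_dim V) 1" unfolding top by simp
  next
    fix U assume s: "\<forall>U. fm_subobject G V U \<longrightarrow> U = {0} \<or> U = fm_carrier (dg_dim V) 1"
      and U: "dg_subobject G V U"
    have Uc: "U \<subseteq> carrier_vec (dg_dim V)" using U unfolding dg_subobject_def vsubspace_iff by blast
    have eqI: "U = X" if "fm_of_vec ` U = fm_of_vec ` X" "X \<subseteq> carrier_vec (dg_dim V)" for X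
      using that Uc fm_of_vec_mem_image[of U "dg_dim V"] fm_of_vec_mem_image[of X "dg_dim V"] by blast
    have "fm_of_vec ` U = {0} \<or> fm_of_vec ` U = fm_carrier (dg_dim V) 1"
      using s dg_subobject_fm[OF U] by blast
    then show "U = {0\<^sub>v (dg_dim V)} \<or> U = carrier_vec (dg_dim V)"
      using eqI[of "{0\<^sub>v (dg_dim V)}"] eqI[of "carrier_vec (dg_dim V)"] top by auto
  qed
  then show ?thesis unfolding dg_simple_def using V by blast
qed

end

lemma dg_simple_obj: "dg_simple G V \<Longrightarrow> dg_obj G V"
  unfolding dg_simple_def by blast

lemma dg_of_fm:
  fixes p r :: "'a \<Rightarrow> 'k::field fmat"
  assumes m: "dg_module G n p r"
  shows "dg_obj G (dg_of_fm n p r)"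
    and "dg_dim (dg_of_fm n p r) = n"
    and "g \<in> carrier G \<Longrightarrow> dg_mat (dg_of_fm n p r) g = r g"
    and "x \<in> carrier G \<Longrightarrow> dg_proj G (dg_of_fm n p r) x = p x"
proof -
  let ?V = "dg_of_fm n p r"
  show n: "dg_dim ?V = n" by (simp add: dg_of_fm_def)
  have rc: "r g \<in> fm_carrier n n" if "g \<in> carrier G" for g using m that unfolding dg_module_def by blast
  show mat: "dg_mat ?V g = r g" if "g \<in> carrier G" for g
    using rc[OF that] by (simp add: dg_of_fm_def)
  have "dg_module G n p (dg_mat ?V)" using m mat unfolding dg_module_def by simp
  then have real: "dg_realizes G ?V p"
    unfolding dg_realizes_def n by (simp add: dg_of_fm_def)
  then show obj: "dg_obj G ?V" by (rule dg_realizes_obj)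
  show "dg_proj G ?V x = p x" if "x \<in> carrier G"
    by (rule dg_realizes_unique[OF dg_realizes_proj[OF obj] real that])
qed

text \<open>Respecting components means that \<open>T * dg_proj G V x\<close> is fixed by
  \<open>dg_proj G W x\<close>. Inserting the sum of all projections of \<open>V\<close> turns this
  one-sided condition into commutation.\<close>

lemma dg_hom_iff:
  fixes V W :: "('a, 'k::field) dgrep"
  assumes V: "dg_obj G V" and W: "dg_obj G W"
  shows "T \<in> dg_hom G V W \<longleftrightarrow> T \<in> carrier_mat (dg_dim W) (dg_dim V) \<and> fm_of_mat T \<in> fm_hom G V W"
proof (cases "T \<in> carrier_mat (dg_dim W) (dg_dim V)")
  case T: True
  let ?T = "fm_of_mat T"
  have T': "?T \<in> fm_carrier (dg_dim W) (dg_dim V)" using T by simp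
  have "(T * dg_act V g = dg_act W g * T) \<longleftrightarrow> (?T * dg_mat V g = dg_mat W g * ?T)" if g: "g \<in> carrier G" for g
    using fm_of_mat_mult[OF T obj_act_carrier[OF V g]] fm_of_mat_mult[OF obj_act_carrier[OF W g] T]
      fm_of_mat_inj[OF mult_carrier_mat[OF T obj_act_carrier[OF V g]] mult_carrier_mat[OF obj_act_carrier[OF W g] T]]
    by simp
  moreover have "(\<forall>x\<in>carrier G. \<forall>v\<in>dg_comp V x. T *\<^sub>v v \<in> dg_comp W x) \<longleftrightarrow>
      (\<forall>x\<in>carrier G. ?T * dg_proj G V x = dg_proj G W x * ?T)"
  proof
    assume *: "\<forall>x\<in>carrier G. \<forall>v\<in>dg_comp V x. T *\<^sub>v v \<in> dg_comp W x"
    have 1: "dg_proj G W x * (?T * dg_proj G V x) = ?T * dg_proj G V x" if x: "x \<in> carrier G" for x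
    proof (rule fm_eq_columnI[of _ "dg_dim W" "dg_dim V"])
      fix v :: "'k fmat" assume v: "v \<in> fm_carrier (dg_dim V) 1"
      let ?w = "dg_proj G V x * v"
      have w: "?w \<in> fm_carrier (dg_dim V) 1" using v x V by simp
      have "vec_of_fm (dg_dim V) ?w \<in> dg_comp V x"
        using x w obj_proj_mult[OF V x x] by (simp add: obj_comp[OF V] mult.assoc[symmetric] del: One_nat_def)
      then have "T *\<^sub>v vec_of_fm (dg_dim V) ?w \<in> dg_comp W x" using * x by blast
      then have "dg_proj G W x * (?T * ?w) = ?T * ?w"
        using fm_of_vec_mult[OF T vec_of_fm_carrier] w by (simp add: obj_comp[OF W x] del: One_nat_def)
      then show "dg_proj G W x * (?T * dg_proj G V x) * v = ?T * dg_proj G V x * v" by (simp add: mult.assoc)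
    qed (use x V W T' in auto)
    show "\<forall>x\<in>carrier G. ?T * dg_proj G V x = dg_proj G W x * ?T"
    proof
      fix x assume x: "x \<in> carrier G"
      have "dg_proj G W x * ?T = dg_proj G W x * (?T * (\<Sum>y\<in>carrier G. dg_proj G V y))"
        using T' by (simp add: obj_proj_sum[OF V])
      also have "\<dots> = (\<Sum>y\<in>carrier G. dg_proj G W x * (dg_proj G W y * (?T * dg_proj G V y)))"
        using 1 by (simp add: sum_distrib_left)
      also have "\<dots> = (\<Sum>y\<in>carrier G. if y = x then ?T * dg_proj G V x else 0)"
      proof (rule sum.cong)
        fix y assume y: "y \<in> carrier G"
        show "dg_proj G W x * (dg_proj G W y * (?T * dg_proj G V y)) = (if y = x then ?T * dg_proj G V x else 0)"
          unfolding obj_proj_mult_left[OF W x y] using 1[OF x] by simp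
      qed simp
      also have "\<dots> = ?T * dg_proj G V x" using x by simp
      finally show "?T * dg_proj G V x = dg_proj G W x * ?T" ..
    qed
  next
    assume *: "\<forall>x\<in>carrier G. ?T * dg_proj G V x = dg_proj G W x * ?T"
    show "\<forall>x\<in>carrier G. \<forall>v\<in>dg_comp V x. T *\<^sub>v v \<in> dg_comp W x"
    proof (intro ballI)
      fix x v assume x: "x \<in> carrier G" and v: "v \<in> dg_comp V x"
      then have v': "v \<in> carrier_vec (dg_dim V)" "dg_proj G V x * fm_of_vec v = fm_of_vec v"
        by (auto simp: obj_comp[OF V])
      have "dg_proj G W x * (?T * fm_of_vec v) = ?T * (dg_proj G V x * fm_of_vec v)"
        using * x by (simp add: mult.assoc[symmetric])
      then show "T *\<^sub>v v \<in> dg_comp W x"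
        using v' mult_mat_vec_carrier[OF T v'(1)] by (simp add: obj_comp[OF W x] fm_of_vec_mult[OF T v'(1)])
    qed
  qed
  ultimately show ?thesis using T T' unfolding dg_hom_def fm_hom_def by blast
qed (simp add: dg_hom_def)

lemma dg_iso_iff:
  fixes V W :: "('a, 'k::field) dgrep"
  assumes V: "dg_obj G V" and W: "dg_obj G W"
  shows "dg_iso G V W \<longleftrightarrow> (\<exists>T\<in>fm_hom G V W. \<exists>S\<in>fm_hom G W V. S * T = fm_one (dg_dim V) \<and> T * S = fm_one (dg_dim W))"
proof
  assume "dg_iso G V W"
  then obtain T S where TS: "T \<in> dg_hom G V W" "S \<in> dg_hom G W V" "S * T = 1\<^sub>m (dg_dim V)" "T * S = 1\<^sub>m (dg_dim W)"
    unfolding dg_iso_def by blast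
  have T: "T \<in> carrier_mat (dg_dim W) (dg_dim V)" "fm_of_mat T \<in> fm_hom G V W" using TS(1) dg_hom_iff[OF V W] by auto
  have S: "S \<in> carrier_mat (dg_dim V) (dg_dim W)" "fm_of_mat S \<in> fm_hom G W V" using TS(2) dg_hom_iff[OF W V] by auto
  have "fm_of_mat S * fm_of_mat T = fm_one (dg_dim V)" "fm_of_mat T * fm_of_mat S = fm_one (dg_dim W)"
    using TS(3,4) fm_of_mat_mult[OF S(1) T(1)] fm_of_mat_mult[OF T(1) S(1)] by simp_all
  then show "\<exists>T\<in>fm_hom G V W. \<exists>S\<in>fm_hom G W V. S * T = fm_one (dg_dim V) \<and> T * S = fm_one (dg_dim W)"
    using T(2) S(2) by blast
next
  assume "\<exists>T\<in>fm_hom G V W. \<exists>S\<in>fm_hom G W V. S * T = fm_one (dg_dim V) \<and> T * S = fm_one (dg_dim W)"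
  then obtain T S where TS: "T \<in> fm_hom G V W" "S \<in> fm_hom G W V" "S * T = fm_one (dg_dim V)" "T * S = fm_one (dg_dim W)"
    by blast
  let ?T = "mat_of_fm (dg_dim W) (dg_dim V) T" and ?S = "mat_of_fm (dg_dim V) (dg_dim W) S"
  have c: "T \<in> fm_carrier (dg_dim W) (dg_dim V)" "S \<in> fm_carrier (dg_dim V) (dg_dim W)"
    using TS(1,2) unfolding fm_hom_def by auto
  have "?T \<in> dg_hom G V W" "?S \<in> dg_hom G W V"
    unfolding dg_hom_iff[OF V W] dg_hom_iff[OF W V] using TS(1,2) c by auto
  moreover have "?S * ?T = 1\<^sub>m (dg_dim V)"
  proof (rule fm_of_mat_eqI)
    show "fm_of_mat (?S * ?T) = fm_of_mat (1\<^sub>m (dg_dim V))"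
      unfolding fm_of_mat_mult[OF mat_of_fm_carrier mat_of_fm_carrier] using c TS(3) by simp
  qed (rule mult_carrier_mat[OF mat_of_fm_carrier mat_of_fm_carrier], simp)
  moreover have "?T * ?S = 1\<^sub>m (dg_dim W)"
  proof (rule fm_of_mat_eqI)
    show "fm_of_mat (?T * ?S) = fm_of_mat (1\<^sub>m (dg_dim W))"
      unfolding fm_of_mat_mult[OF mat_of_fm_carrier mat_of_fm_carrier] using c TS(4) by simp
  qed (rule mult_carrier_mat[OF mat_of_fm_carrier mat_of_fm_carrier], simp)
  ultimately show "dg_iso G V W" unfolding dg_iso_def by blast
qed

lemma fm_homD:
  assumes "T \<in> fm_hom G V W"
  shows "T \<in> fm_carrier (dg_dim W) (dg_dim V)"
    and "g \<in> carrier G \<Longrightarrow> T * dg_mat V g = dg_mat W g * T"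
    and "x \<in> carrier G \<Longrightarrow> T * dg_proj G V x = dg_proj G W x * T"
  using assms unfolding fm_hom_def by auto

lemma fm_hom_comp: "T \<in> fm_hom G V W \<Longrightarrow> S \<in> fm_hom G W X \<Longrightarrow> S * T \<in> fm_hom G V X"
  for V W X :: "('a, 'k::field) dgrep"
proof -
  assume T: "T \<in> fm_hom G V W" and S: "S \<in> fm_hom G W X"
  show ?thesis unfolding fm_hom_def
  proof (intro CollectI conjI ballI)
    show "S * T \<in> fm_carrier (dg_dim X) (dg_dim V)" using fm_mult_carrier[OF fm_homD(1)[OF S] fm_homD(1)[OF T]] .
    show "S * T * dg_mat V g = dg_mat X g * (S * T)" if "g \<in> carrier G" for g
      using fm_homD(2)[OF T that] fm_homD(2)[OF S that] by (metis mult.assoc)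
    show "S * T * dg_proj G V x = dg_proj G X x * (S * T)" if "x \<in> carrier G" for x
      using fm_homD(3)[OF T that] fm_homD(3)[OF S that] by (metis mult.assoc)
  qed
qed

lemma fm_hom_diff: "T \<in> fm_hom G V W \<Longrightarrow> S \<in> fm_hom G V W \<Longrightarrow> T - S \<in> fm_hom G V W"
  unfolding fm_hom_def by (simp add: ring_distribs)

lemma fm_hom_scale: "T \<in> fm_hom G V W \<Longrightarrow> fm_scale c T \<in> fm_hom G V W"
  unfolding fm_hom_def by simp

lemma fm_hom_one: "dg_obj G V \<Longrightarrow> fm_one (dg_dim V) \<in> fm_hom G V V"
  unfolding fm_hom_def by simp

lemma dg_iso_refl: "dg_obj G V \<Longrightarrow> dg_iso G V V"
  using dg_iso_iff[of V V] fm_hom_one[of V] by (metis fm_one_carrier fm_one_mult)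

lemma dg_iso_sym: "dg_iso G V W \<Longrightarrow> dg_iso G W V"
  unfolding dg_iso_def by blast

lemma dg_iso_trans:
  fixes V W X :: "('a, 'k::field) dgrep"
  assumes "dg_obj G V" "dg_obj G W" "dg_obj G X" "dg_iso G V W" "dg_iso G W X"
  shows "dg_iso G V X"
proof -
  obtain T S where 1: "T \<in> fm_hom G V W" "S \<in> fm_hom G W V" "S * T = fm_one (dg_dim V)" "T * S = fm_one (dg_dim W)"
    using assms dg_iso_iff by blast
  obtain T' S' where 2: "T' \<in> fm_hom G W X" "S' \<in> fm_hom G X W" "S' * T' = fm_one (dg_dim W)" "T' * S' = fm_one (dg_dim X)"
    using assms dg_iso_iff by blast
  have "S * S' * (T' * T) = S * (S' * T') * T" "T' * T * (S * S') = T' * (T * S) * S'" by (simp_all add: mult.assoc)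
  then have "S * S' * (T' * T) = fm_one (dg_dim V)" "T' * T * (S * S') = fm_one (dg_dim X)"
    using 1 2 fm_homD(1)[OF 1(2)] fm_homD(1)[OF 2(1)] by simp_all
  then show ?thesis using dg_iso_iff[of V X] assms fm_hom_comp[OF 1(1) 2(1)] fm_hom_comp[OF 2(2) 1(2)] by blast
qed

lemma dg_iso_dim:
  fixes V W :: "('a, 'k::field) dgrep"
  assumes "dg_obj G V" "dg_obj G W" "dg_iso G V W"
  shows "dg_dim V = dg_dim W"
proof -
  obtain T S where 1: "T \<in> fm_hom G V W" "S \<in> fm_hom G W V" "S * T = fm_one (dg_dim V)" "T * S = fm_one (dg_dim W)"
    using assms dg_iso_iff by blast
  show ?thesis
    using fm_left_inverse_le[OF fm_homD(1)[OF 1(1)] fm_homD(1)[OF 1(2)] 1(3)]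
      fm_left_inverse_le[OF fm_homD(1)[OF 1(2)] fm_homD(1)[OF 1(1)] 1(4)] by simp
qed

lemma dg_realizes_sum:
  fixes V W :: "('a, 'k::field) dgrep"
  assumes V: "dg_obj G V" and W: "dg_obj G W"
  shows "dg_realizes G (dg_sum V W) (\<lambda>x. fm_block (dg_dim V) (dg_dim W) (dg_proj G V x) (dg_proj G W x))"
    and "g \<in> carrier G \<Longrightarrow> dg_mat (dg_sum V W) g = fm_block (dg_dim V) (dg_dim W) (dg_mat V g) (dg_mat W g)"
proof -
  let ?n = "dg_dim V" and ?m = "dg_dim W"
  let ?b = "fm_block ?n ?m :: 'k fmat \<Rightarrow> 'k fmat \<Rightarrow> 'k fmat"
  let ?S = "fm_shift ?n ?m :: 'k fmat"
  have dim: "dg_dim (dg_sum V W) = ?n + ?m" by (simp add: dg_sum_def)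
  show mat: "dg_mat (dg_sum V W) g = ?b (dg_mat V g) (dg_mat W g)" if "g \<in> carrier G" for g
    using fm_of_mat_four_block[OF obj_act_carrier[OF V that] obj_act_carrier[OF W that]] by (simp add: dg_sum_def)
  show "dg_realizes G (dg_sum V W) (\<lambda>x. ?b (dg_proj G V x) (dg_proj G W x))"
    unfolding dg_realizes_def dg_module_def dim
  proof (intro conjI ballI)
    show "dg_act (dg_sum V W) g \<in> carrier_mat (?n + ?m) (?n + ?m)" if "g \<in> carrier G" for g
      using obj_act_carrier[OF V that] obj_act_carrier[OF W that] by (simp add: dg_sum_def)
    show "dg_mat (dg_sum V W) g \<in> fm_carrier (?n + ?m) (?n + ?m)" if "g \<in> carrier G" for g
      using that V W by (simp add: mat)
    show "dg_mat (dg_sum V W) \<one> = fm_one (?n + ?m)" using V W by (simp add: mat fm_block_one)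
    show "dg_mat (dg_sum V W) (g \<otimes> h) = dg_mat (dg_sum V W) g * dg_mat (dg_sum V W) h"
      if "g \<in> carrier G" "h \<in> carrier G" for g h
      using that V W by (simp add: mat fm_block_mult obj_mat_mult)
    show "?b (dg_proj G V x) (dg_proj G W x) \<in> fm_carrier (?n + ?m) (?n + ?m)" if "x \<in> carrier G" for x
      using that V W by simp
    show "?b (dg_proj G V x) (dg_proj G W x) * ?b (dg_proj G V y) (dg_proj G W y) =
      (if x = y then ?b (dg_proj G V x) (dg_proj G W x) else 0)" if "x \<in> carrier G" "y \<in> carrier G" for x y
      using that V W by (simp add: fm_block_mult obj_proj_mult)
    show "(\<Sum>x\<in>carrier G. ?b (dg_proj G V x) (dg_proj G W x)) = fm_one (?n + ?m)"
      using V W by (simp add: fm_block_sum obj_proj_sum fm_block_one)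
    show "dg_mat (dg_sum V W) g * ?b (dg_proj G V x) (dg_proj G W x) =
       ?b (dg_proj G V (conjg g x)) (dg_proj G W (conjg g x)) * dg_mat (dg_sum V W) g"
      if "g \<in> carrier G" "x \<in> carrier G" for g x
      using that V W by (simp add: mat fm_block_mult obj_mat_proj)
    show "dg_comp (dg_sum V W) x = {v \<in> carrier_vec (?n + ?m). ?b (dg_proj G V x) (dg_proj G W x) * fm_of_vec v = fm_of_vec v}"
      if x: "x \<in> carrier G" for x
    proof -
      have key: "?b (dg_proj G V x) (dg_proj G W x) * fm_of_vec (v @\<^sub>v w) = fm_of_vec (v @\<^sub>v w) \<longleftrightarrow>
          dg_proj G V x * fm_of_vec v = fm_of_vec v \<and> dg_proj G W x * fm_of_vec w = fm_of_vec w"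
        if v: "v \<in> carrier_vec ?n" and w: "w \<in> carrier_vec ?m" for v w
      proof -
        have vc: "fm_of_vec v \<in> fm_carrier ?n 1" and wc: "fm_of_vec w \<in> fm_carrier ?m 1" using v w by (auto simp del: One_nat_def)
        have pv: "dg_proj G V x * fm_of_vec v \<in> fm_carrier ?n 1" and qw: "dg_proj G W x * fm_of_vec w \<in> fm_carrier ?m 1"
          using fm_square_mult_carrier(1)[OF obj_proj_carrier[OF V x] vc] fm_square_mult_carrier(1)[OF obj_proj_carrier[OF W x] wc] by blast+
        have *: "dg_proj G V x * (?S * X) = 0" "fm_one ?n * (?S * X) = 0" "fm_transpose ?S * (?S * X) = fm_one ?m * X" for X
        proof -
          have "dg_proj G V x * ?S = 0" by (rule fm_mult_shift_zero[OF obj_proj_carrier[OF V x]])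
          moreover have "fm_one ?n * ?S = 0" by (rule fm_mult_shift_zero[OF fm_one_carrier])
          ultimately show "dg_proj G V x * (?S * X) = 0" "fm_one ?n * (?S * X) = 0"
            "fm_transpose ?S * (?S * X) = fm_one ?m * X"
            by (simp_all add: mult.assoc[symmetric] fm_transpose_shift_mult)
        qed
        have eq: "?b (dg_proj G V x) (dg_proj G W x) * fm_of_vec (v @\<^sub>v w)
            = dg_proj G V x * fm_of_vec v + ?S * (dg_proj G W x * fm_of_vec w)"
          unfolding fm_of_vec_append[OF v w] fm_block_def using vc wc
          by (simp add: ring_distribs mult.assoc * del: One_nat_def)
        \<comment> \<open>\<open>fm_one ?n\<close> cuts out the first block and the transposed shift
          the second, so a block vector determines both of its parts.\<close>
        have inj: "a = c \<and> b = d" if e: "a + ?S * b = c + ?S * d" and ac: "a \<in> fm_carrier ?n 1" "c \<in> fm_carrier ?n 1"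
          and bd: "b \<in> fm_carrier ?m 1" "d \<in> fm_carrier ?m 1" for a b c d
        proof
          have "fm_one ?n * (a + ?S * b) = fm_one ?n * (c + ?S * d)" using e by simp
          then show "a = c" using ac by (simp add: distrib_left * del: One_nat_def)
          have "fm_transpose ?S * (a + ?S * b) = fm_transpose ?S * (c + ?S * d)" using e by simp
          then show "b = d" using ac bd by (simp add: distrib_left * del: One_nat_def)
        qed
        show ?thesis unfolding eq unfolding fm_of_vec_append[OF v w]
          using inj[OF _ pv vc qw wc] by auto
      qed
      have split: "u = vec_first u ?n @\<^sub>v vec_last u ?m" if "u \<in> carrier_vec (?n + ?m)" for u :: "'k vec"
        using that by simp
      show ?thesis
      proof
        show "dg_comp (dg_sum V W) x \<subseteq> {v \<in> carrier_vec (?n + ?m). ?b (dg_proj G V x) (dg_proj G W x) * fm_of_vec v = fm_of_vec v}"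
          using key by (auto simp: dg_sum_def obj_comp[OF V x] obj_comp[OF W x])
        show "{v \<in> carrier_vec (?n + ?m). ?b (dg_proj G V x) (dg_proj G W x) * fm_of_vec v = fm_of_vec v} \<subseteq> dg_comp (dg_sum V W) x"
        proof
          fix u assume u: "u \<in> {v \<in> carrier_vec (?n + ?m). ?b (dg_proj G V x) (dg_proj G W x) * fm_of_vec v = fm_of_vec v}"
          then have u1: "u = vec_first u ?n @\<^sub>v vec_last u ?m" using split by blast
          have "vec_first u ?n \<in> dg_comp V x \<and> vec_last u ?m \<in> dg_comp W x"
            using key[of "vec_first u ?n" "vec_last u ?m"] u u1 by (auto simp: obj_comp[OF V x] obj_comp[OF W x])
          then show "u \<in> dg_comp (dg_sum V W) x" using u1 by (auto simp: dg_sum_def)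
        qed
      qed
    qed
  qed
qed

lemma dg_sum_obj: "dg_obj G V \<Longrightarrow> dg_obj G W \<Longrightarrow> dg_obj G (dg_sum V W)"
  by (rule dg_realizes_obj[OF dg_realizes_sum(1)])

lemma dg_sum_dim [simp]: "dg_dim (dg_sum V W) = dg_dim V + dg_dim W"
  by (simp add: dg_sum_def)

lemma dg_sum_proj:
  "dg_obj G V \<Longrightarrow> dg_obj G W \<Longrightarrow> x \<in> carrier G \<Longrightarrow>
    dg_proj G (dg_sum V W) x = fm_block (dg_dim V) (dg_dim W) (dg_proj G V x) (dg_proj G W x)"
  by (rule dg_realizes_unique[OF dg_realizes_proj[OF dg_sum_obj] dg_realizes_sum(1)])

lemmas dg_sum_mat = dg_realizes_sum(2)

end

section \<open>Complete reducibility and Schur's lemma\<close>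

lemma fm_trace_block:
  "D \<in> fm_carrier m m \<Longrightarrow> fm_trace (fm_block n m A D) = fm_trace A + fm_trace D" for A :: "'a::comm_ring_1 fmat"
proof -
  assume D: "D \<in> fm_carrier m m"
  have "fm_trace (fm_shift n m * D * fm_transpose (fm_shift n m)) = fm_trace (fm_transpose (fm_shift n m) * (fm_shift n m * D))"
    by (rule fm_trace_commute)
  also have "\<dots> = fm_trace D" using D by (simp add: mult.assoc[symmetric] fm_transpose_shift_mult)
  finally show ?thesis unfolding fm_block_def by (simp add: fm_trace_add)
qed

definition fm_unit :: "nat \<Rightarrow> nat \<Rightarrow> 'a::zero_neq_one fmat" where
  "fm_unit i j = fm_of_fun (Suc i) (Suc j) (\<lambda>k l. if k = i \<and> l = j then 1 else 0)"

lemma fm_nth_unit [simp]: "fm_nth (fm_unit i j) k l = (if k = i \<and> l = j then 1 else 0)"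
  by (auto simp: fm_unit_def)

lemma fm_unit_carrier [simp]: "i < n \<Longrightarrow> j < m \<Longrightarrow> fm_unit i j \<in> fm_carrier n m"
  by (auto simp: fm_carrier_def)

lemma fm_nth_mult_unit_mult: "fm_nth (A * fm_unit i j * B) k l = fm_nth A k i * fm_nth B j l"
  for A :: "'a::ring_1 fmat"
proof -
  obtain n where n: "(fm_unit i j :: 'a fmat) \<in> fm_carrier n n" "A \<in> fm_carrier n n"
    by (metis fm_carrier_ex2)
  have "fm_nth (A * fm_unit i j) k q = (\<Sum>r<n. if r = i then (if q = j then fm_nth A k i else 0) else 0)" for q
    by (subst fm_nth_times_left[OF n(2)], rule sum.cong) auto
  then have 1: "fm_nth (A * fm_unit i j) k q = (if q = j then fm_nth A k i else 0)" for q
    using fm_carrierD[OF n(2), of k i] by (auto simp: not_less)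
  have Au: "A * fm_unit i j \<in> fm_carrier n n" using n by simp
  have "fm_nth (A * fm_unit i j * B) k l = (\<Sum>r<n. if r = j then fm_nth A k i * fm_nth B j l else 0)"
    by (subst fm_nth_times_left[OF Au], rule sum.cong) (auto simp: 1)
  moreover have "j < n" using n(1) by (auto simp: fm_carrier_def split: if_splits)
  ultimately show ?thesis by simp
qed

lemma fm_trace_unit [simp]: "fm_trace (fm_unit i j) = (if i = j then 1 else (0::'a::ring_1))"
  by (subst fm_trace_carrier[of _ "Suc i" "Suc j"]) auto

text \<open>The averaging operator for modules over the double: summing over g enforces
  equivariance, and cutting with equal degrees on both sides enforces the grading. It is not divided
  by |G|.\<close>

definition dg_average :: "('g, 'b) monoid_scheme \<Rightarrow> ('g, 'k::field) dgrep \<Rightarrow> ('g, 'k) dgrep \<Rightarrow> 'k fmat \<Rightarrow> 'k fmat" where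
  "dg_average G V W X = (\<Sum>g\<in>carrier G. \<Sum>x\<in>carrier G.
     dg_proj G W x * dg_mat W g * X * (dg_mat V (inv\<^bsub>G\<^esub> g) * dg_proj G V x))"

definition dg_char :: "('g, 'b) monoid_scheme \<Rightarrow> ('g, 'k::field) dgrep \<Rightarrow> 'g \<Rightarrow> 'g \<Rightarrow> 'k" where
  "dg_char G V x g = fm_trace (dg_proj G V x * dg_mat V g)"

text \<open>The orthogonality form on characters of the double, without the factor 1/|G|. Terms in
  which g does not centralize x vanish of themselves, so g and x may run over the whole
  group.\<close>

definition dg_pairing :: "('g, 'b) monoid_scheme \<Rightarrow> ('g, 'k::field) dgrep \<Rightarrow> ('g, 'k) dgrep \<Rightarrow> 'k" where
  "dg_pairing G V W = (\<Sum>g\<in>carrier G. \<Sum>x\<in>carrier G.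
     dg_char G V x g * fm_trace (dg_mat W (inv\<^bsub>G\<^esub> g) * dg_proj G W x))"

text \<open>A direct summand up to isomorphism, given by its inclusion and projection.\<close>

definition dg_retract :: "('g, 'b) monoid_scheme \<Rightarrow> ('g, 'k::field) dgrep \<Rightarrow> ('g, 'k) dgrep \<Rightarrow> bool" where
  "dg_retract G W V \<longleftrightarrow> dg_obj G W \<and> (\<exists>a\<in>fm_hom G W V. \<exists>b\<in>fm_hom G V W. b * a = fm_one (dg_dim W))"

abbreviation dg_sums :: "('g, 'k::field) dgrep list \<Rightarrow> ('g, 'k) dgrep" where
  "dg_sums Ws \<equiv> foldr dg_sum Ws dg_zero"

section \<open>Averaging and the splitting of subobjects\<close>

context finite_group
begin

lemma card_carrier_neq_0 [simp]: "of_nat (card (carrier G)) \<noteq> (0::'k::field_char_0)"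
  using one_closed by (auto simp: card_eq_0_iff)

text \<open>Multiplication by h sends the term of g and x to the term of
  \<open>h \<otimes> g\<close> and \<open>conjg h x\<close>, and both substitutions permute the
  group. Commutation with the projections already holds term by term.\<close>

lemma dg_average_hom:
  fixes V W :: "('a, 'k::field) dgrep"
  assumes V: "dg_obj G V" and W: "dg_obj G W" and X: "X \<in> fm_carrier (dg_dim W) (dg_dim V)"
  shows "dg_average G V W X \<in> fm_hom G V W"
proof -
  define F where "F g x = dg_proj G W x * dg_mat W g * X * (dg_mat V (inv g) * dg_proj G V x)" for g x
  have avg: "dg_average G V W X = (\<Sum>g\<in>carrier G. \<Sum>x\<in>carrier G. F g x)"
    unfolding dg_average_def F_def ..
  have car: "F g x \<in> fm_carrier (dg_dim W) (dg_dim V)" if "g \<in> carrier G" "x \<in> carrier G" for g x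
    unfolding F_def using that V W X by simp
  have Fh: "dg_mat W h * F g x = F (h \<otimes> g) (conjg h x) * dg_mat V h"
    if h: "h \<in> carrier G" and g: "g \<in> carrier G" and x: "x \<in> carrier G" for g h x
  proof -
    have 1: "dg_mat W h * (dg_proj G W x * (dg_mat W g * Y)) = dg_proj G W (conjg h x) * (dg_mat W (h \<otimes> g) * Y)" for Y
    proof -
      have "dg_mat W h * (dg_proj G W x * (dg_mat W g * Y)) = dg_mat W h * dg_proj G W x * (dg_mat W g * Y)"
        by (simp add: mult.assoc)
      also have "\<dots> = dg_proj G W (conjg h x) * (dg_mat W (h \<otimes> g) * Y)"
        unfolding obj_mat_proj[OF W h x] obj_mat_mult[OF W h g] by (simp add: mult.assoc)
      finally show ?thesis .
    qed
    have "dg_mat V (inv (h \<otimes> g)) * (dg_proj G V (conjg h x) * dg_mat V h)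
        = dg_mat V (inv (h \<otimes> g)) * (dg_mat V h * dg_proj G V x)"
      using obj_mat_proj[OF V h x] by simp
    also have "\<dots> = dg_mat V (inv (h \<otimes> g) \<otimes> h) * dg_proj G V x"
      using obj_mat_mult[OF V, of "inv (h \<otimes> g)" h] h g by (simp add: mult.assoc)
    also have "inv (h \<otimes> g) \<otimes> h = inv g" using h g by (simp add: inv_mult_group m_assoc)
    finally have 2: "dg_mat V (inv (h \<otimes> g)) * (dg_proj G V (conjg h x) * dg_mat V h) = dg_mat V (inv g) * dg_proj G V x" .
    show ?thesis unfolding F_def by (simp add: mult.assoc 1 2)
  qed
  show ?thesis unfolding fm_hom_def
  proof (intro CollectI conjI ballI)
    show "dg_average G V W X \<in> fm_carrier (dg_dim W) (dg_dim V)"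
      unfolding avg by (intro fm_sum_carrier car)
    show "dg_average G V W X * dg_mat V h = dg_mat W h * dg_average G V W X" if h: "h \<in> carrier G" for h
    proof -
      have "dg_mat W h * dg_average G V W X = (\<Sum>g\<in>carrier G. \<Sum>x\<in>carrier G. F (h \<otimes> g) (conjg h x)) * dg_mat V h"
        unfolding avg by (simp add: sum_distrib_left sum_distrib_right Fh h)
      also have "(\<Sum>g\<in>carrier G. \<Sum>x\<in>carrier G. F (h \<otimes> g) (conjg h x)) = dg_average G V W X"
      proof -
        have "(\<Sum>x\<in>carrier G. F (h \<otimes> g) (conjg h x)) = (\<Sum>x\<in>carrier G. F (h \<otimes> g) x)" for g
          by (rule sum_conj[OF h])
        then show ?thesis
          unfolding avg using sum_mult_left[OF h, of "\<lambda>g. \<Sum>x\<in>carrier G. F g x"] by simp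
      qed
      finally show ?thesis ..
    qed
    show "dg_average G V W X * dg_proj G V y = dg_proj G W y * dg_average G V W X" if y: "y \<in> carrier G" for y
    proof -
      have "F g x * dg_proj G V y = dg_proj G W y * F g x" if "x \<in> carrier G" for g x
        unfolding F_def using that y obj_proj_mult[OF V that y]
        by (simp add: mult.assoc obj_proj_mult_left[OF W])
      then show ?thesis unfolding avg by (simp add: sum_distrib_left sum_distrib_right)
    qed
  qed
qed

text \<open>Maschke's argument: an arbitrary linear projection onto \<open>U\<close> is averaged.
  Each term still maps into \<open>U\<close>, and the average acts on \<open>U\<close> as
  multiplication by |G|.\<close>

lemma fm_subobject_projection:
  fixes V :: "('a, 'k::field_char_0) dgrep"
  assumes V: "dg_obj G V" and U: "fm_subobject G V U"
  shows "\<exists>E\<in>fm_hom G V V. E * E = E \<and> U = {v \<in> fm_carrier (dg_dim V) 1. E * v = v}"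
proof -
  let ?n = "dg_dim V"
  have sub: "fm_subspace ?n U" and Ug: "\<And>g u. g \<in> carrier G \<Longrightarrow> u \<in> U \<Longrightarrow> dg_mat V g * u \<in> U"
    and Ux: "\<And>x u. x \<in> carrier G \<Longrightarrow> u \<in> U \<Longrightarrow> dg_proj G V x * u \<in> U"
    using U unfolding fm_subobject_def by auto
  obtain r A B where AB: "A \<in> fm_carrier ?n r" "B \<in> fm_carrier r ?n" "B * A = fm_one r"
    and Ueq: "U = {v \<in> fm_carrier ?n 1. A * B * v = v}"
    using sub by (rule fm_subspace_factor)
  define E0 where "E0 = A * B"
  have E0: "E0 \<in> fm_carrier ?n ?n" unfolding E0_def using AB by (intro fm_mult_carrier)
  have E0U: "E0 * v \<in> U" if v: "v \<in> fm_carrier ?n 1" for v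
  proof -
    have "E0 * (E0 * v) = A * ((B * A) * (B * v))" unfolding E0_def by (simp add: mult.assoc)
    also have "\<dots> = E0 * v" unfolding AB(3) E0_def using fm_mult_one[OF AB(1)] by (simp add: mult.assoc[symmetric])
    finally show ?thesis unfolding Ueq E0_def[symmetric] using E0 v by simp
  qed
  \<comment> \<open>The factor that \<open>dg_average\<close> leaves out; it exists because the
    characteristic is zero.\<close>
  define c where "c = (1 / of_nat (card (carrier G)) :: 'k)"
  define E where "E = fm_scale c (dg_average G V V E0)"
  have hom: "E \<in> fm_hom G V V" unfolding E_def by (intro fm_hom_scale dg_average_hom V E0)
  have fix_U: "E * u = u" if u: "u \<in> U" for u
  proof -
    have uc: "u \<in> fm_carrier ?n 1" using u unfolding Ueq by blast
    have "dg_proj G V x * dg_mat V g * E0 * (dg_mat V (inv g) * dg_proj G V x) * u = dg_proj G V x * u"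
      if g: "g \<in> carrier G" and x: "x \<in> carrier G" for g x
    proof -
      have "dg_mat V (inv g) * (dg_proj G V x * u) \<in> U" using Ug[of "inv g"] Ux[OF x u] g by simp
      then have "E0 * (dg_mat V (inv g) * (dg_proj G V x * u)) = dg_mat V (inv g) * (dg_proj G V x * u)"
        unfolding Ueq E0_def by blast
      then have "dg_proj G V x * dg_mat V g * E0 * (dg_mat V (inv g) * dg_proj G V x) * u
          = dg_proj G V x * ((dg_mat V g * dg_mat V (inv g)) * (dg_proj G V x * u))" by (simp add: mult.assoc)
      also have "\<dots> = dg_proj G V x * ((fm_one ?n * dg_proj G V x) * u)"
        unfolding obj_mat_inv(1)[OF V g] by (simp add: mult.assoc)
      also have "\<dots> = dg_proj G V x * u"
        using obj_proj_carrier[OF V x] obj_proj_mult_left[OF V x x] by simp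
      finally show ?thesis .
    qed
    then have "dg_average G V V E0 * u = (\<Sum>g\<in>carrier G. \<Sum>x\<in>carrier G. dg_proj G V x * u)"
      unfolding dg_average_def by (simp add: sum_distrib_right)
    also have "(\<Sum>x\<in>carrier G. dg_proj G V x * u) = fm_scale 1 u"
      using obj_proj_sum[OF V] fm_one_mult[OF uc] by (simp add: sum_distrib_right[symmetric])
    also have "(\<Sum>g\<in>carrier G. fm_scale 1 u) = fm_scale (of_nat (card (carrier G))) u"
      unfolding fm_scale_sum_left by simp
    finally have "E * u = fm_scale (c * of_nat (card (carrier G))) u" unfolding E_def by simp
    then show ?thesis unfolding c_def
      using card_carrier_neq_0[where 'k = 'k] by (simp del: card_carrier_neq_0)
  qed
  have EU: "E * v \<in> U" if v: "v \<in> fm_carrier ?n 1" for v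
  proof -
    have "dg_proj G V x * dg_mat V g * E0 * (dg_mat V (inv g) * dg_proj G V x) * v \<in> U"
      if g: "g \<in> carrier G" and x: "x \<in> carrier G" for g x
    proof -
      have "dg_mat V (inv g) * (dg_proj G V x * v) \<in> fm_carrier ?n 1" using v V g x by simp
      then have "dg_proj G V x * (dg_mat V g * (E0 * (dg_mat V (inv g) * (dg_proj G V x * v)))) \<in> U"
        using E0U Ug[OF g] Ux[OF x] by blast
      then show ?thesis by (simp add: mult.assoc)
    qed
    then have "dg_average G V V E0 * v \<in> U"
      unfolding dg_average_def sum_distrib_right by (intro fm_subspace_sum[OF sub])
    then show ?thesis using sub unfolding E_def fm_subspace_def by simp
  qed
  have Ec: "E \<in> fm_carrier ?n ?n" using fm_homD(1)[OF hom] .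
  have "E * E = E"
  proof (rule fm_eq_columnI[of _ ?n ?n])
    show "E * E * v = E * v" if "v \<in> fm_carrier ?n 1" for v
      using fix_U[OF EU[OF that]] by (simp add: mult.assoc)
  qed (use Ec in auto)
  moreover have "U = {v \<in> fm_carrier ?n 1. E * v = v}"
  proof
    show "U \<subseteq> {v \<in> fm_carrier ?n 1. E * v = v}" using fix_U unfolding Ueq by blast
    show "{v \<in> fm_carrier ?n 1. E * v = v} \<subseteq> U" using EU by (metis (mono_tags, lifting) mem_Collect_eq subsetI)
  qed
  ultimately show ?thesis using hom by blast
qed

text \<open>The image of \<open>E\<close> gets coordinates through a factorization
  \<open>a * b = E\<close>, and group elements and projections are transported to
  \<open>b * _ * a\<close>. Products are preserved because \<open>E\<close> commutes with all of
  them and \<open>b * E = b\<close>.\<close>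

lemma fm_idempotent_split:
  fixes V :: "('a, 'k::field) dgrep"
  assumes V: "dg_obj G V" and E: "E \<in> fm_hom G V V" and EE: "E * E = E"
  shows "\<exists>W. dg_obj G W \<and> (\<exists>a\<in>fm_hom G W V. \<exists>b\<in>fm_hom G V W. b * a = fm_one (dg_dim W) \<and> a * b = E)"
proof -
  let ?n = "dg_dim V"
  obtain r a b where a: "a \<in> fm_carrier ?n r" and b: "b \<in> fm_carrier r ?n" and ba: "b * a = fm_one r" and ab: "a * b = E"
    using fm_idempotent_factor[OF fm_homD(1)[OF E] EE] by blast
  have bE: "b * E = b" unfolding ab[symmetric] using ba b by (simp add: mult.assoc[symmetric])
  have Ea: "E * a = a" unfolding ab[symmetric] using ba a by (simp add: mult.assoc)
  define p where "p x = b * dg_proj G V x * a" for x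
  define q where "q g = b * dg_mat V g * a" for g
  have Eg: "b * (dg_mat V g * (a * (b * X))) = b * (dg_mat V g * X)" if g: "g \<in> carrier G" for g X
  proof -
    have "b * (dg_mat V g * (a * (b * X))) = b * (dg_mat V g * E) * X" unfolding ab[symmetric] by (simp add: mult.assoc)
    also have "\<dots> = b * E * dg_mat V g * X" using fm_homD(2)[OF E g] by (simp add: mult.assoc)
    finally show ?thesis unfolding bE by (simp add: mult.assoc)
  qed
  have Ep: "b * (dg_proj G V x * (a * (b * X))) = b * (dg_proj G V x * X)" if x: "x \<in> carrier G" for x X
  proof -
    have "b * (dg_proj G V x * (a * (b * X))) = b * (dg_proj G V x * E) * X" unfolding ab[symmetric] by (simp add: mult.assoc)
    also have "\<dots> = b * E * dg_proj G V x * X" using fm_homD(3)[OF E x] by (simp add: mult.assoc)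
    finally show ?thesis unfolding bE by (simp add: mult.assoc)
  qed
  have m: "dg_module G r p q"
    unfolding dg_module_def
  proof (intro conjI ballI)
    show "q g \<in> fm_carrier r r" if "g \<in> carrier G" for g
      unfolding q_def using fm_mult_carrier[OF fm_mult_carrier[OF b obj_mat_carrier[OF V that]] a] .
    show "p x \<in> fm_carrier r r" if "x \<in> carrier G" for x
      unfolding p_def using fm_mult_carrier[OF fm_mult_carrier[OF b obj_proj_carrier[OF V that]] a] .
    show "q \<one> = fm_one r" unfolding q_def obj_mat_one[OF V] using fm_mult_one[OF b] ba by simp
    show "q (g \<otimes> h) = q g * q h" if "g \<in> carrier G" "h \<in> carrier G" for g h
      unfolding q_def using that by (simp add: obj_mat_mult[OF V] Eg mult.assoc)
    show "p x * p y = (if x = y then p x else 0)" if "x \<in> carrier G" "y \<in> carrier G" for x y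
      unfolding p_def using that by (simp add: obj_proj_mult_left[OF V] Ep mult.assoc)
    show "(\<Sum>x\<in>carrier G. p x) = fm_one r"
      unfolding p_def sum_distrib_right[symmetric] sum_distrib_left[symmetric] obj_proj_sum[OF V]
      using fm_mult_one[OF b] ba by simp
    show "q g * p x = p (conjg g x) * q g" if g: "g \<in> carrier G" and x: "x \<in> carrier G" for g x
    proof -
      have "q g * p x = b * (dg_mat V g * dg_proj G V x) * a" unfolding p_def q_def using g by (simp add: Eg mult.assoc)
      also have "\<dots> = p (conjg g x) * q g" unfolding obj_mat_proj[OF V g x] p_def q_def using g x by (simp add: Ep mult.assoc)
      finally show ?thesis .
    qed
  qed
  let ?W = "dg_of_fm r p q"
  note W = dg_of_fm[OF m]
  have "a \<in> fm_hom G ?W V" unfolding fm_hom_def W(2)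
  proof (intro CollectI conjI ballI)
    show "a * dg_mat ?W g = dg_mat V g * a" if g: "g \<in> carrier G" for g
    proof -
      have "a * dg_mat ?W g = E * dg_mat V g * a" unfolding W(3)[OF g] q_def ab[symmetric] by (simp add: mult.assoc)
      also have "\<dots> = dg_mat V g * (E * a)" using fm_homD(2)[OF E g] by (simp add: mult.assoc)
      finally show ?thesis unfolding Ea .
    qed
    show "a * dg_proj G ?W x = dg_proj G V x * a" if x: "x \<in> carrier G" for x
    proof -
      have "a * dg_proj G ?W x = E * dg_proj G V x * a" unfolding W(4)[OF x] p_def ab[symmetric] by (simp add: mult.assoc)
      also have "\<dots> = dg_proj G V x * (E * a)" using fm_homD(3)[OF E x] by (simp add: mult.assoc)
      finally show ?thesis unfolding Ea .
    qed
  qed (rule a)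
  moreover have "b \<in> fm_hom G V ?W" unfolding fm_hom_def W(2)
  proof (intro CollectI conjI ballI)
    show "b * dg_mat V g = dg_mat ?W g * b" if g: "g \<in> carrier G" for g
    proof -
      have "dg_mat ?W g * b = b * (dg_mat V g * E)" unfolding W(3)[OF g] q_def ab[symmetric] by (simp add: mult.assoc)
      also have "\<dots> = b * E * dg_mat V g" using fm_homD(2)[OF E g] by (simp add: mult.assoc)
      finally show ?thesis unfolding bE ..
    qed
    show "b * dg_proj G V x = dg_proj G ?W x * b" if x: "x \<in> carrier G" for x
    proof -
      have "dg_proj G ?W x * b = b * (dg_proj G V x * E)" unfolding W(4)[OF x] p_def ab[symmetric] by (simp add: mult.assoc)
      also have "\<dots> = b * E * dg_proj G V x" using fm_homD(3)[OF E x] by (simp add: mult.assoc)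
      finally show ?thesis unfolding bE ..
    qed
  qed (rule b)
  ultimately show ?thesis using W(1) W(2) ba ab by metis
qed

lemma dg_zero_realizes: "dg_realizes G (dg_zero :: ('a, 'k::field) dgrep) (\<lambda>x. 0)"
proof -
  have [simp]: "fm_of_mat (1\<^sub>m 0 :: 'k mat) = 0" by (simp only: fm_of_mat_one fm_one_zero)
  have [simp]: "fm_of_vec (vNil :: 'k vec) = 0" using fm_of_vec_zero[of 0] by simp
  have "{v \<in> carrier_vec 0. (0::'k fmat) = fm_of_vec v} = {0\<^sub>v 0}" by auto
  then show ?thesis unfolding dg_realizes_def dg_module_def by (auto simp: dg_zero_def)
qed

lemma dg_zero_obj [simp]: "dg_obj G (dg_zero :: ('a, 'k::field) dgrep)"
  by (rule dg_realizes_obj[OF dg_zero_realizes])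

lemma dg_zero_dim [simp]: "dg_dim dg_zero = 0"
  by (simp add: dg_zero_def)

lemma dg_zero_proj [simp]: "x \<in> carrier G \<Longrightarrow> dg_proj G (dg_zero :: ('a, 'k::field) dgrep) x = 0"
  by (rule dg_realizes_unique[OF dg_realizes_proj[OF dg_zero_obj] dg_zero_realizes])

lemma dg_sums_obj: "\<forall>W\<in>set Ws. dg_obj G W \<Longrightarrow> dg_obj G (dg_sums Ws)"
  by (induction Ws) (auto intro: dg_sum_obj)

lemma dg_iso_sum_right:
  fixes V W X :: "('a, 'k::field) dgrep"
  assumes V: "dg_obj G V" and W: "dg_obj G W" and X: "dg_obj G X" and iso: "dg_iso G W X"
  shows "dg_iso G (dg_sum V W) (dg_sum V X)"
proof -
  have dim: "dg_dim X = dg_dim W" using dg_iso_dim[OF W X iso] by simp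
  let ?b = "fm_block (dg_dim V) (dg_dim W) :: 'k fmat \<Rightarrow> 'k fmat \<Rightarrow> 'k fmat"
  obtain T S where TS: "T \<in> fm_hom G W X" "S \<in> fm_hom G X W" "S * T = fm_one (dg_dim W)" "T * S = fm_one (dg_dim W)"
    using iso dg_iso_iff[OF W X] dim by metis
  have c: "T \<in> fm_carrier (dg_dim W) (dg_dim W)" "S \<in> fm_carrier (dg_dim W) (dg_dim W)"
    using fm_homD(1)[OF TS(1)] fm_homD(1)[OF TS(2)] unfolding dim .
  have Xc: "dg_mat X g \<in> fm_carrier (dg_dim W) (dg_dim W)" "dg_proj G X g \<in> fm_carrier (dg_dim W) (dg_dim W)" if "g \<in> carrier G" for g
    using obj_mat_carrier[OF X that] obj_proj_carrier[OF X that] unfolding dim .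
  have "?b (fm_one (dg_dim V)) T \<in> fm_hom G (dg_sum V W) (dg_sum V X)"
    unfolding fm_hom_def using c V W Xc fm_homD(2,3)[OF TS(1)]
    by (auto simp: dim dg_sum_mat[OF V W] dg_sum_mat[OF V X] dg_sum_proj[OF V W] dg_sum_proj[OF V X] fm_block_mult)
  moreover have "?b (fm_one (dg_dim V)) S \<in> fm_hom G (dg_sum V X) (dg_sum V W)"
    unfolding fm_hom_def using c V W Xc fm_homD(2,3)[OF TS(2)]
    by (auto simp: dim dg_sum_mat[OF V W] dg_sum_mat[OF V X] dg_sum_proj[OF V W] dg_sum_proj[OF V X] fm_block_mult)
  moreover have "?b (fm_one (dg_dim V)) S * ?b (fm_one (dg_dim V)) T = fm_one (dg_dim V + dg_dim W)"
    "?b (fm_one (dg_dim V)) T * ?b (fm_one (dg_dim V)) S = fm_one (dg_dim V + dg_dim W)"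
    using c TS by (simp_all add: fm_block_mult fm_block_one)
  ultimately show ?thesis using dg_iso_iff[OF dg_sum_obj[OF V W] dg_sum_obj[OF V X]] dim by auto
qed

text \<open>The idempotents \<open>a * b\<close> and \<open>a' * b'\<close> are complementary, so
  the mixed products \<open>b * a'\<close> and \<open>b' * a\<close> vanish. The isomorphism stacks
  \<open>b\<close> over \<open>b'\<close>, and its inverse puts \<open>a\<close> beside
  \<open>a'\<close>.\<close>

lemma dg_iso_sum_complement:
  fixes V W W' :: "('a, 'k::field) dgrep"
  assumes V: "dg_obj G V" and W: "dg_obj G W" and W': "dg_obj G W'"
    and a: "a \<in> fm_hom G W V" and b: "b \<in> fm_hom G V W" and ba: "b * a = fm_one (dg_dim W)"
    and a': "a' \<in> fm_hom G W' V" and b': "b' \<in> fm_hom G V W'" and ba': "b' * a' = fm_one (dg_dim W')"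
    and sum: "a' * b' = fm_one (dg_dim V) - a * b"
  shows "dg_iso G V (dg_sum W W')"
proof -
  let ?n = "dg_dim W" and ?m = "dg_dim W'"
  let ?S = "fm_shift ?n ?m :: 'k fmat"
  note ac = fm_homD(1)[OF a] and bc = fm_homD(1)[OF b] and ac' = fm_homD(1)[OF a'] and bc' = fm_homD(1)[OF b']
  have ba'0: "b * a' = 0"
  proof -
    have "b * a' = b * (a' * b') * a'" using ba' fm_mult_one[OF ac'] by (simp add: mult.assoc)
    also have "\<dots> = (b * fm_one (dg_dim V) - (b * a) * b) * a'" unfolding sum by (simp add: right_diff_distrib mult.assoc)
    finally show ?thesis using ba bc fm_mult_one[OF bc] fm_one_mult[OF bc] by simp
  qed
  have b'a0: "b' * a = 0"
  proof -
    have "b' * a = b' * a' * (b' * a)" using ba' fm_one_mult[OF bc'] by (simp add: mult.assoc[symmetric])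
    also have "\<dots> = b' * (a' * b') * a" by (simp add: mult.assoc)
    also have "\<dots> = b' * (fm_one (dg_dim V) * a - a * (b * a))" unfolding sum by (simp add: left_diff_distrib mult.assoc)
    finally show ?thesis using ba fm_mult_one[OF ac] fm_one_mult[OF ac] by simp
  qed
  define T where "T = b + ?S * b'"
  define R where "R = a + a' * fm_transpose ?S"
  have aS: "a * (?S * X) = 0" for X using fm_mult_shift_zero[OF ac, of ?m] by (simp add: mult.assoc[symmetric])
  have Sb: "fm_transpose ?S * b = 0" by (rule fm_transpose_shift_zero[OF bc])
  have SS: "fm_transpose ?S * (?S * X) = fm_one ?m * X" for X by (simp add: mult.assoc[symmetric] fm_transpose_shift_mult)
  have Sm: "fm_transpose ?S * (dg_mat W g * X) = 0" "fm_transpose ?S * (dg_proj G W g * X) = 0" if "g \<in> carrier G" for g X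
    using fm_transpose_shift_zero[OF obj_mat_carrier[OF W that], of ?m] fm_transpose_shift_zero[OF obj_proj_carrier[OF W that], of ?m]
    by (simp_all add: mult.assoc[symmetric])
  have one_m: "fm_one ?m * (dg_mat W' g * X) = dg_mat W' g * X" "fm_one ?m * (dg_proj G W' g * X) = dg_proj G W' g * X"
    if "g \<in> carrier G" for g X
    using W' that by (simp_all add: mult.assoc[symmetric])
  have mS: "dg_mat W g * (?S * X) = 0" "dg_proj G W g * (?S * X) = 0" if "g \<in> carrier G" for g X
    using fm_mult_shift_zero[OF obj_mat_carrier[OF W that], of ?m] fm_mult_shift_zero[OF obj_proj_carrier[OF W that], of ?m]
    by (simp_all add: mult.assoc[symmetric])
  have b'1: "fm_one ?m * b' = b'" using bc' by (rule fm_one_mult)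
  have a1: "a' * (fm_one ?m * X) = a' * X" for X using fm_mult_one[OF ac'] by (simp add: mult.assoc[symmetric])
  have "T \<in> fm_hom G V (dg_sum W W')"
    unfolding fm_hom_def
  proof (intro CollectI conjI ballI)
    show "T \<in> fm_carrier (dg_dim (dg_sum W W')) (dg_dim V)"
      unfolding T_def dg_sum_dim using fm_carrier_mono[OF bc] fm_mult_carrier[OF fm_shift_carrier bc'] by simp
    show "T * dg_mat V g = dg_mat (dg_sum W W') g * T" if g: "g \<in> carrier G" for g
      unfolding T_def dg_sum_mat[OF W W' g] fm_block_def
      using fm_homD(2)[OF b g] fm_homD(2)[OF b' g]
      by (simp add: ring_distribs mult.assoc Sb mS[OF g] SS b'1)
    show "T * dg_proj G V x = dg_proj G (dg_sum W W') x * T" if x: "x \<in> carrier G" for x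
      unfolding T_def dg_sum_proj[OF W W' x] fm_block_def
      using fm_homD(3)[OF b x] fm_homD(3)[OF b' x]
      by (simp add: ring_distribs mult.assoc Sb mS[OF x] SS b'1)
  qed
  moreover have "R \<in> fm_hom G (dg_sum W W') V"
    unfolding fm_hom_def
  proof (intro CollectI conjI ballI)
    show "R \<in> fm_carrier (dg_dim V) (dg_dim (dg_sum W W'))"
      unfolding R_def dg_sum_dim using fm_carrier_mono[OF ac]
        fm_mult_carrier[OF ac' fm_transpose_carrier[OF fm_shift_carrier]] by simp
    have Smat: "fm_transpose ?S * dg_mat W g = 0" "fm_transpose ?S * dg_proj G W g = 0" if "g \<in> carrier G" for g
      by (rule fm_transpose_shift_zero[OF obj_mat_carrier[OF W that]] fm_transpose_shift_zero[OF obj_proj_carrier[OF W that]])+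
    have homX: "a * (dg_mat W g * X) = dg_mat V g * (a * X)" "a' * (dg_mat W' g * X) = dg_mat V g * (a' * X)"
      "a * (dg_proj G W g * X) = dg_proj G V g * (a * X)" "a' * (dg_proj G W' g * X) = dg_proj G V g * (a' * X)"
      if "g \<in> carrier G" for g X
      using fm_homD(2,3)[OF a that] fm_homD(2,3)[OF a' that] by (simp_all add: mult.assoc[symmetric])
    show "R * dg_mat (dg_sum W W') g = dg_mat V g * R" if g: "g \<in> carrier G" for g
      unfolding R_def dg_sum_mat[OF W W' g] fm_block_def
      using fm_homD(2)[OF a g] fm_homD(2)[OF a' g]
      by (simp add: ring_distribs mult.assoc Smat[OF g] aS SS one_m[OF g] homX[OF g])
    show "R * dg_proj G (dg_sum W W') x = dg_proj G V x * R" if x: "x \<in> carrier G" for x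
      unfolding R_def dg_sum_proj[OF W W' x] fm_block_def
      using fm_homD(3)[OF a x] fm_homD(3)[OF a' x]
      by (simp add: ring_distribs mult.assoc Smat[OF x] aS SS one_m[OF x] homX[OF x])
  qed
  moreover have "R * T = fm_one (dg_dim V)"
    unfolding R_def T_def by (simp add: ring_distribs mult.assoc aS Sb SS b'1 sum)
  moreover have "T * R = fm_one (dg_dim (dg_sum W W'))"
  proof -
    have *: "b * (a' * X) = 0" "b' * (a' * X) = fm_one ?m * X" for X
      using ba'0 ba' by (simp_all add: mult.assoc[symmetric])
    have "fm_one ?m * fm_transpose ?S = fm_transpose ?S" by (rule fm_one_mult[OF fm_transpose_carrier[OF fm_shift_carrier]])
    then show ?thesis
      unfolding R_def T_def dg_sum_dim by (simp add: ring_distribs mult.assoc b'a0 * ba fm_shift_mult_transpose)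
  qed
  ultimately show ?thesis unfolding dg_iso_iff[OF V dg_sum_obj[OF W W']] by blast
qed

section \<open>Retracts and complete reducibility\<close>

lemma dg_retract_refl: "dg_obj G V \<Longrightarrow> dg_retract G V V"
  unfolding dg_retract_def using fm_hom_one[of V] by (metis fm_one_carrier fm_one_mult)

lemma dg_retract_trans:
  fixes V W X :: "('a, 'k::field) dgrep"
  assumes "dg_retract G X W" "dg_retract G W V"
  shows "dg_retract G X V"
proof -
  obtain a b where 1: "a \<in> fm_hom G X W" "b \<in> fm_hom G W X" "b * a = fm_one (dg_dim X)" "dg_obj G X"
    using assms(1) unfolding dg_retract_def by blast
  obtain c d where 2: "c \<in> fm_hom G W V" "d \<in> fm_hom G V W" "d * c = fm_one (dg_dim W)"
    using assms(2) unfolding dg_retract_def by blast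
  have "b * d * (c * a) = b * (d * c) * a" by (simp add: mult.assoc)
  also have "\<dots> = fm_one (dg_dim X)" using 1(3) 2(3) fm_mult_one[OF fm_homD(1)[OF 1(2)]] by simp
  finally show ?thesis unfolding dg_retract_def
    using fm_hom_comp[OF 1(1) 2(1)] fm_hom_comp[OF 2(2) 1(2)] 1(4) by blast
qed

text \<open>A retract of least positive dimension is simple: any other subobject would be the image
  of an idempotent morphism and split off a nonzero retract of smaller dimension.\<close>

lemma dg_simple_retract:
  fixes V :: "('a, 'k::field_char_0) dgrep"
  assumes V: "dg_obj G V" and pos: "dg_dim V > 0"
  shows "\<exists>W. dg_simple G W \<and> dg_retract G W V"
proof -
  define P where "P n \<longleftrightarrow> n > 0 \<and> (\<exists>W. dg_retract G W V \<and> dg_dim W = n)" for n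
  have "P (dg_dim V)" unfolding P_def using pos dg_retract_refl[OF V] by blast
  then have P: "P (LEAST n. P n)" by (rule LeastI)
  then obtain W where W: "dg_retract G W V" "dg_dim W = (LEAST n. P n)" "dg_dim W > 0" unfolding P_def by auto
  have Wo: "dg_obj G W" using W(1) unfolding dg_retract_def by blast
  have "U = {0} \<or> U = fm_carrier (dg_dim W) 1" if U: "fm_subobject G W U" for U
  proof (rule ccontr)
    assume ne: "\<not> (U = {0} \<or> U = fm_carrier (dg_dim W) 1)"
    obtain E where E: "E \<in> fm_hom G W W" "E * E = E" "U = {v \<in> fm_carrier (dg_dim W) 1. E * v = v}"
      using fm_subobject_projection[OF Wo U] by blast
    obtain X a b where X: "dg_obj G X" "a \<in> fm_hom G X W" "b \<in> fm_hom G W X" "b * a = fm_one (dg_dim X)" "a * b = E"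
      using fm_idempotent_split[OF Wo E(1,2)] by blast
    have XW: "dg_retract G X W" unfolding dg_retract_def using X by blast
    have X0: "dg_dim X > 0"
    proof (rule ccontr)
      assume "\<not> dg_dim X > 0"
      then have "a = 0" using fm_homD(1)[OF X(2)] by simp
      then have "E = 0" using X(5) by simp
      then have "U = {0}" unfolding E(3) by auto
      then show False using ne by blast
    qed
    have "dg_dim X \<le> dg_dim W" using fm_left_inverse_le[OF fm_homD(1)[OF X(2)] fm_homD(1)[OF X(3)] X(4)] .
    moreover have "dg_dim X \<noteq> dg_dim W"
    proof
      assume eq: "dg_dim X = dg_dim W"
      have "a * b = fm_one (dg_dim W)"
        using fm_left_right_inverse[of a "dg_dim W" b] fm_homD(1)[OF X(2)] fm_homD(1)[OF X(3)] X(4) unfolding eq by blast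
      then have "U = fm_carrier (dg_dim W) 1" unfolding E(3) X(5)[symmetric] using fm_one_mult by auto
      then show False using ne by blast
    qed
    moreover have "P (dg_dim X)" unfolding P_def using X0 dg_retract_trans[OF XW W(1)] by blast
    then have "dg_dim W \<le> dg_dim X" unfolding W(2) by (rule Least_le)
    ultimately show False by simp
  qed
  then show ?thesis using W(1,3) dg_simple_iff[OF Wo] by blast
qed

text \<open>A simple retract is split off and the complement has smaller dimension. Each summand is
  recorded as a retract of \<open>V\<close>, so that a class of objects closed under retracts
  contains the summands of its members.\<close>

theorem dg_semisimple:
  fixes V :: "('a, 'k::field_char_0) dgrep"
  assumes "dg_obj G V"
  shows "\<exists>Ws. (\<forall>W\<in>set Ws. dg_simple G W \<and> dg_retract G W V) \<and> dg_iso G V (dg_sums Ws)"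
  using assms
proof (induction "dg_dim V" arbitrary: V rule: less_induct)
  case less
  note V = less.prems
  show ?case
  proof (cases "dg_dim V = 0")
    case True
    have "dg_iso G V dg_zero"
      unfolding dg_iso_iff[OF V dg_zero_obj] fm_hom_def using True by auto
    then show ?thesis by (intro exI[of _ "[]"]) simp
  next
    case False
    then obtain W where W: "dg_simple G W" "dg_retract G W V" using dg_simple_retract[OF V] by blast
    have Wo: "dg_obj G W" using W(1) by (rule dg_simple_obj)
    have Wpos: "dg_dim W > 0" using W(1) unfolding dg_simple_def by blast
    obtain a b where ab: "a \<in> fm_hom G W V" "b \<in> fm_hom G V W" "b * a = fm_one (dg_dim W)"
      using W(2) unfolding dg_retract_def by blast
    define F where "F = fm_one (dg_dim V) - a * b"
    have abh: "a * b \<in> fm_hom G V V" by (rule fm_hom_comp[OF ab(2,1)])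
    have F: "F \<in> fm_hom G V V" unfolding F_def by (intro fm_hom_diff fm_hom_one V abh)
    have "a * b * (a * b) = a * (b * a) * b" by (simp add: mult.assoc)
    then have "a * b * (a * b) = a * b" using ab(3) fm_mult_one[OF fm_homD(1)[OF ab(1)]] by simp
    then have FF: "F * F = F" unfolding F_def using fm_homD(1)[OF abh] by (simp add: ring_distribs)
    obtain X c d where X: "dg_obj G X" "c \<in> fm_hom G X V" "d \<in> fm_hom G V X" "d * c = fm_one (dg_dim X)" "c * d = F"
      using fm_idempotent_split[OF V F FF] by blast
    have XV: "dg_retract G X V" unfolding dg_retract_def using X by blast
    have iso: "dg_iso G V (dg_sum W X)"
      by (rule dg_iso_sum_complement[OF V Wo X(1) ab X(2-4)]) (simp add: X(5) F_def)
    have "dg_dim X < dg_dim V" using dg_iso_dim[OF V dg_sum_obj[OF Wo X(1)] iso] Wpos by simp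
    then obtain Ws where Ws: "\<forall>S\<in>set Ws. dg_simple G S \<and> dg_retract G S X" "dg_iso G X (dg_sums Ws)"
      using less.hyps X(1) by blast
    have so: "dg_obj G (dg_sums Ws)" by (rule dg_sums_obj) (use Ws(1) dg_simple_obj in blast)
    have "dg_iso G (dg_sum W X) (dg_sum W (dg_sums Ws))" by (rule dg_iso_sum_right[OF Wo X(1) so Ws(2)])
    then have "dg_iso G V (dg_sums (W # Ws))"
      using dg_iso_trans[OF V dg_sum_obj[OF Wo X(1)] dg_sum_obj[OF Wo so] iso] by simp
    then show ?thesis using W Ws(1) dg_retract_trans[OF _ XV] by (intro exI[of _ "W # Ws"]) auto
  qed
qed

text \<open>Kernel and image of a morphism are subobjects, hence zero or everything. If
  \<open>T\<close> is nonzero the kernel is zero and the image is the whole of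
  \<open>W\<close>.\<close>

lemma dg_schur:
  fixes V W :: "('a, 'k::field) dgrep"
  assumes sV: "dg_simple G V" and sW: "dg_simple G W" and T: "T \<in> fm_hom G V W" and T0: "T \<noteq> 0"
  shows "\<exists>R\<in>fm_hom G W V. R * T = fm_one (dg_dim V) \<and> T * R = fm_one (dg_dim W)"
proof -
  let ?n = "dg_dim V" and ?m = "dg_dim W"
  have V: "dg_obj G V" and W: "dg_obj G W" using sV sW by (auto dest: dg_simple_obj)
  note Tc = fm_homD(1)[OF T]
  have TX: "T * (dg_mat V g * X) = dg_mat W g * (T * X)" "T * (dg_proj G V g * X) = dg_proj G W g * (T * X)"
    if "g \<in> carrier G" for g X
    using fm_homD(2,3)[OF T that] by (simp_all add: mult.assoc[symmetric])
  define K where "K = {v \<in> fm_carrier ?n 1. T * v = 0}"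
  have "fm_subobject G V K"
    unfolding fm_subobject_def fm_subspace_def K_def using V TX by (auto simp: distrib_left simp del: One_nat_def)
  then have "K = {0} \<or> K = fm_carrier ?n 1" using sV unfolding dg_simple_iff[OF V] by blast
  moreover have "K \<noteq> fm_carrier ?n 1"
  proof
    assume "K = fm_carrier ?n 1"
    then have "T * v = 0 * v" if "v \<in> fm_carrier ?n 1" for v using that unfolding K_def by auto
    then have "T = 0" by (intro fm_eq_columnI[OF Tc]) auto
    then show False using T0 by blast
  qed
  ultimately have K0: "K = {0}" by blast
  have inj: "u = v" if u: "u \<in> fm_carrier ?n 1" and v: "v \<in> fm_carrier ?n 1" and e: "T * u = T * v" for u v
  proof -
    have "u - v \<in> K" unfolding K_def using u v e by (simp add: right_diff_distrib)
    then show ?thesis unfolding K0 by simp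
  qed
  define I where "I = (\<lambda>v. T * v) ` fm_carrier ?n 1"
  have "fm_subobject G W I"
    unfolding fm_subobject_def fm_subspace_def
  proof (intro conjI ballI allI)
    show "I \<subseteq> fm_carrier ?m 1" unfolding I_def using fm_mult_carrier[OF Tc] by blast
    show "0 \<in> I" unfolding I_def by (rule image_eqI[of _ _ 0]) auto
    show "u + v \<in> I" if uv: "u \<in> I" "v \<in> I" for u v
    proof -
      from uv obtain u' v' where "u' \<in> fm_carrier ?n 1" "v' \<in> fm_carrier ?n 1" "u = T * u'" "v = T * v'" unfolding I_def by blast
      then show ?thesis unfolding I_def by (intro image_eqI[of _ _ "u' + v'"]) (auto simp: distrib_left)
    qed
    show "fm_scale c u \<in> I" if u: "u \<in> I" for c u
    proof -
      from u obtain u' where "u' \<in> fm_carrier ?n 1" "u = T * u'" unfolding I_def by blast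
      then show ?thesis unfolding I_def by (intro image_eqI[of _ _ "fm_scale c u'"]) auto
    qed
    show "dg_mat W g * u \<in> I" if g: "g \<in> carrier G" and u: "u \<in> I" for g u
    proof -
      from u obtain u' where "u' \<in> fm_carrier ?n 1" "u = T * u'" unfolding I_def by blast
      then show ?thesis unfolding I_def using V g by (intro image_eqI[of _ _ "dg_mat V g * u'"]) (auto simp: TX)
    qed
    show "dg_proj G W g * u \<in> I" if g: "g \<in> carrier G" and u: "u \<in> I" for g u
    proof -
      from u obtain u' where "u' \<in> fm_carrier ?n 1" "u = T * u'" unfolding I_def by blast
      then show ?thesis unfolding I_def using V g by (intro image_eqI[of _ _ "dg_proj G V g * u'"]) (auto simp: TX)
    qed
  qed
  then have "I = {0} \<or> I = fm_carrier ?m 1" using sW unfolding dg_simple_iff[OF W] by blast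
  moreover have "I \<noteq> {0}"
  proof
    assume "I = {0}"
    then have "T * v = 0 * v" if "v \<in> fm_carrier ?n 1" for v using that unfolding I_def by auto
    then have "T = 0" by (intro fm_eq_columnI[OF Tc]) auto
    then show False using T0 by blast
  qed
  ultimately have I1: "I = fm_carrier ?m 1" by blast
  \<comment> \<open>The set-theoretic inverse of \<open>T\<close>; injectivity makes it linear, so
    it is given by a matrix.\<close>
  define f where "f w = (THE v. v \<in> fm_carrier ?n 1 \<and> T * v = w)" for w
  have f: "f w \<in> fm_carrier ?n 1 \<and> T * f w = w" if w: "w \<in> fm_carrier ?m 1" for w
    unfolding f_def
  proof (rule theI')
    have "w \<in> I" using w unfolding I1 .
    then show "\<exists>!v. v \<in> fm_carrier ?n 1 \<and> T * v = w" unfolding I_def using inj by blast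
  qed
  have fI: "f w = v" if "w \<in> fm_carrier ?m 1" "v \<in> fm_carrier ?n 1" "T * v = w" for v w
    using f[OF that(1)] that(2,3) inj by blast
  have "\<exists>R\<in>fm_carrier ?n ?m. \<forall>w\<in>fm_carrier ?m 1. R * w = f w"
  proof (rule fm_linear_matrix)
    show "f (u + v) = f u + f v" if "u \<in> fm_carrier ?m 1" "v \<in> fm_carrier ?m 1" for u v
      using f[OF that(1)] f[OF that(2)] that by (intro fI) (auto simp: distrib_left)
    show "f (fm_scale c v) = fm_scale c (f v)" if "v \<in> fm_carrier ?m 1" for c v
      using f[OF that] that by (intro fI) auto
  qed (use f in blast)
  then obtain R where R: "R \<in> fm_carrier ?n ?m" and Rw: "\<And>w. w \<in> fm_carrier ?m 1 \<Longrightarrow> R * w = f w" by blast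
  have TR: "T * R = fm_one ?m"
  proof (rule fm_eq_columnI[OF fm_mult_carrier[OF Tc R] fm_one_carrier])
    show "T * R * w = fm_one ?m * w" if w: "w \<in> fm_carrier ?m 1" for w
      using f[OF w] Rw[OF w] fm_one_mult[OF w] by (simp add: mult.assoc)
  qed
  have RT: "R * T = fm_one ?n"
  proof (rule fm_eq_columnI[OF fm_mult_carrier[OF R Tc] fm_one_carrier])
    show "R * T * v = fm_one ?n * v" if v: "v \<in> fm_carrier ?n 1" for v
    proof -
      have Tv: "T * v \<in> fm_carrier ?m 1" using Tc v by (rule fm_mult_carrier)
      have "f (T * v) = v" by (rule fI[OF Tv v refl])
      then show ?thesis using Rw[OF Tv] fm_one_mult[OF v] by (simp add: mult.assoc)
    qed
  qed
  \<comment> \<open>Whatever \<open>T\<close> intertwines, its inverse intertwines in the other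
    direction; this covers group elements and projections at once.\<close>
  have conv: "R * A' = A * R" if TA: "T * A = A' * T" and A: "A \<in> fm_carrier ?n ?n" and A': "A' \<in> fm_carrier ?m ?m" for A A'
  proof -
    have "R * A' = R * (A' * (T * R))" using A' TR by simp
    also have "\<dots> = R * (A' * T) * R" by (simp add: mult.assoc)
    also have "\<dots> = (R * T) * A * R" unfolding TA[symmetric] by (simp add: mult.assoc)
    finally show ?thesis using RT A by simp
  qed
  have "R \<in> fm_hom G W V" unfolding fm_hom_def
    using R conv[OF fm_homD(2)[OF T]] conv[OF fm_homD(3)[OF T]] V W by auto
  then show ?thesis using RT TR by blast
qed

text \<open>Subtracting an eigenvalue gives an endomorphism with nonzero kernel, which cannot be
  invertible and is therefore zero.\<close>

lemma dg_schur_scalar: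
  fixes V :: "('a, 'k::alg_closed_field) dgrep"
  assumes sV: "dg_simple G V" and T: "T \<in> fm_hom G V V"
  shows "\<exists>c. T = fm_scale c (fm_one (dg_dim V))"
proof -
  let ?n = "dg_dim V"
  have V: "dg_obj G V" and n: "?n > 0" using sV by (auto simp: dg_simple_def)
  obtain c v where v: "v \<in> fm_carrier ?n 1" "v \<noteq> 0" "T * v = fm_scale c v"
    using fm_eigenvector[OF fm_homD(1)[OF T] n] by blast
  define X where "X = T - fm_scale c (fm_one ?n)"
  have X: "X \<in> fm_hom G V V" unfolding X_def by (intro fm_hom_diff fm_hom_scale fm_hom_one T V)
  have Xv: "X * v = 0" unfolding X_def using v fm_one_mult[OF v(1)] by (simp add: left_diff_distrib)
  have "X = 0"
  proof (rule ccontr)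
    assume "X \<noteq> 0"
    then obtain R where "R * X = fm_one ?n" using dg_schur[OF sV sV X] by blast
    then have "fm_one ?n * v = R * (X * v)" by (simp add: mult.assoc[symmetric])
    then show False using Xv v(2) fm_one_mult[OF v(1)] by simp
  qed
  then show ?thesis unfolding X_def by (intro exI[of _ c]) simp
qed

end

section \<open>Characters and the regular object\<close>

definition fm_map :: "nat \<Rightarrow> (nat \<Rightarrow> nat) \<Rightarrow> 'a::zero_neq_one fmat" where
  "fm_map n f = fm_of_fun n n (\<lambda>i j. if i = f j then 1 else 0)"

definition fm_diag :: "nat \<Rightarrow> (nat \<Rightarrow> bool) \<Rightarrow> 'a::zero_neq_one fmat" where
  "fm_diag n P = fm_of_fun n n (\<lambda>i j. if i = j \<and> P i then 1 else 0)"

lemma fm_map_carrier [simp]: "fm_map n f \<in> fm_carrier n n"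
  and fm_diag_carrier [simp]: "fm_diag n P \<in> fm_carrier n n"
  by (simp_all add: fm_map_def fm_diag_def)

lemma fm_diag_mult_nth:
  "A \<in> fm_carrier n n \<Longrightarrow> fm_nth (fm_diag n P * A) i j = (if P i then fm_nth A i j else 0)" for A :: "'a::ring_1 fmat"
proof -
  assume A: "A \<in> fm_carrier n n"
  have "fm_nth (fm_diag n P * A) i j = (\<Sum>k<n. if k = i then (if P i then fm_nth A i j else 0) else 0)"
    by (subst fm_nth_times_left[OF fm_diag_carrier], rule sum.cong) (auto simp: fm_diag_def)
  then show ?thesis using fm_carrierD[OF A, of i j] by auto
qed

lemma fm_mult_diag_nth:
  "A \<in> fm_carrier n n \<Longrightarrow> fm_nth (A * fm_diag n P) i j = (if P j then fm_nth A i j else 0)" for A :: "'a::ring_1 fmat"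
proof -
  assume A: "A \<in> fm_carrier n n"
  have "fm_nth (A * fm_diag n P) i j = (\<Sum>k<n. if k = j then (if P j then fm_nth A i j else 0) else 0)"
    by (subst fm_nth_times_left[OF A], rule sum.cong) (auto simp: fm_diag_def)
  then show ?thesis using fm_carrierD[OF A, of i j] by auto
qed

lemma fm_map_mult:
  assumes "\<And>j. j < n \<Longrightarrow> g j < n"
  shows "fm_map n f * fm_map n g = (fm_map n (\<lambda>j. f (g j)) :: 'a::ring_1 fmat)"
proof (rule fmat_eqI)
  fix i j
  have "fm_nth (fm_map n f * fm_map n g :: 'a fmat) i j
      = (\<Sum>k<n. if k = g j then (if i < n \<and> j < n \<and> i = f (g j) then 1 else 0) else 0)"
    by (subst fm_nth_times_left[OF fm_map_carrier], rule sum.cong) (auto simp: fm_map_def)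
  then show "fm_nth (fm_map n f * fm_map n g :: 'a fmat) i j = fm_nth (fm_map n (\<lambda>j. f (g j))) i j"
    using assms by (auto simp: fm_map_def)
qed

lemma sum_list_map_filter_nth:
  "sum_list (map f (filter P xs)) = (\<Sum>i | i < length xs \<and> P (xs ! i). f (xs ! i))"
  for f :: "'b \<Rightarrow> 'c::comm_monoid_add"
proof -
  have "sum_list (map f (filter P xs)) = (\<Sum>i<length xs. if P (xs ! i) then f (xs ! i) else 0)"
    unfolding sum_list_map_filter' sum_list_sum_nth[of "map _ xs"] by (simp add: atLeast0LessThan)
  also have "\<dots> = (\<Sum>i | i \<in> {..<length xs} \<and> P (xs ! i). f (xs ! i))"
    by (rule sum.inter_filter[symmetric]) simp
  finally show ?thesis by simp
qed

section \<open>Characters and their orthogonality, the regular object, dimensions of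
  subcategories\<close>

context finite_group
begin

lemma obj_trace_proj_sum:
  fixes V :: "('a, 'k::field) dgrep"
  assumes "dg_obj G V"
  shows "(\<Sum>x\<in>carrier G. fm_trace (dg_proj G V x)) = of_nat (dg_dim V)"
  unfolding fm_trace_sum[symmetric] obj_proj_sum[OF assms] by simp

lemma dg_char_iso:
  fixes V W :: "('a, 'k::field) dgrep"
  assumes V: "dg_obj G V" and W: "dg_obj G W" and iso: "dg_iso G V W" and x: "x \<in> carrier G" and g: "g \<in> carrier G"
  shows "dg_char G V x g = dg_char G W x g"
proof -
  obtain T S where TS: "T \<in> fm_hom G V W" "S \<in> fm_hom G W V" "S * T = fm_one (dg_dim V)" "T * S = fm_one (dg_dim W)"
    using iso dg_iso_iff[OF V W] by blast
  have "dg_proj G W x * dg_mat W g = dg_proj G W x * (T * S) * dg_mat W g" using TS(4) W x by simp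
  also have "\<dots> = T * (dg_proj G V x * dg_mat V g * S)"
    using fm_homD(3)[OF TS(1) x] fm_homD(2)[OF TS(2) g] by (simp add: mult.assoc[symmetric]) (simp add: mult.assoc)
  finally have "dg_char G W x g = fm_trace (dg_proj G V x * dg_mat V g * S * T)"
    unfolding dg_char_def by (simp only: fm_trace_commute[of T])
  also have "dg_proj G V x * dg_mat V g * S * T = dg_proj G V x * dg_mat V g"
    using TS(3) V x g by (simp add: mult.assoc)
  finally show ?thesis unfolding dg_char_def by simp
qed

lemma dg_char_sum:
  fixes V W :: "('a, 'k::field) dgrep"
  assumes V: "dg_obj G V" and W: "dg_obj G W" and x: "x \<in> carrier G" and g: "g \<in> carrier G"
  shows "dg_char G (dg_sum V W) x g = dg_char G V x g + dg_char G W x g"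
  unfolding dg_char_def dg_sum_proj[OF V W x] dg_sum_mat[OF V W g] using V W x g
  by (simp add: fm_block_mult fm_trace_block)

lemma dg_char_sums:
  fixes Ws :: "('a, 'k::field) dgrep list"
  assumes "\<forall>W\<in>set Ws. dg_obj G W" and x: "x \<in> carrier G" and g: "g \<in> carrier G"
  shows "dg_char G (dg_sums Ws) x g = sum_list (map (\<lambda>W. dg_char G W x g) Ws)"
  using assms(1)
proof (induction Ws)
  case Nil
  show ?case using x by (simp add: dg_char_def)
next
  case (Cons W Ws)
  then show ?case using dg_char_sum[of W "dg_sums Ws" x g] dg_sums_obj[of Ws] x g by simp
qed

lemma dg_sums_dim: "dg_dim (dg_sums Ws) = sum_list (map dg_dim Ws)"
  by (induction Ws) auto

lemma dg_pairing_char_cong: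
  assumes "\<And>x g. x \<in> carrier G \<Longrightarrow> g \<in> carrier G \<Longrightarrow> dg_char G V x g = dg_char G V' x g"
  shows "dg_pairing G V W = dg_pairing G V' W"
  unfolding dg_pairing_def using assms by simp

lemma dg_pairing_sums:
  fixes Ws :: "('a, 'k::field) dgrep list"
  assumes "\<forall>W\<in>set Ws. dg_obj G W"
  shows "dg_pairing G (dg_sums Ws) S = sum_list (map (\<lambda>W. dg_pairing G W S) Ws)"
proof -
  have "dg_pairing G (dg_sums Ws) S = (\<Sum>g\<in>carrier G. \<Sum>x\<in>carrier G.
     sum_list (map (\<lambda>W. dg_char G W x g * fm_trace (dg_mat S (inv g) * dg_proj G S x)) Ws))"
    unfolding dg_pairing_def by (simp add: dg_char_sums[OF assms] sum_list_mult_const)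
  also have "\<dots> = sum_list (map (\<lambda>W. dg_pairing G W S) Ws)"
    unfolding dg_pairing_def by (induction Ws) (simp_all add: sum.distrib)
  finally show ?thesis .
qed

text \<open>For any A and B the product of their traces is the sum over i, j of the (i, j) entries
  of A e B, where e is the matrix unit at (i, j). The pairing thus becomes a sum of entries of
  averages, to which Schur's lemma applies.\<close>

lemma dg_pairing_average:
  fixes V W :: "('a, 'k::field) dgrep"
  assumes V: "dg_obj G V" and W: "dg_obj G W"
  shows "dg_pairing G V W = (\<Sum>i<dg_dim V. \<Sum>j<dg_dim W. fm_nth (dg_average G W V (fm_unit i j)) i j)"
proof -
  have tr: "fm_trace (dg_proj G V x * dg_mat V g) * fm_trace (dg_mat W (inv g) * dg_proj G W x) =
     (\<Sum>i<dg_dim V. \<Sum>j<dg_dim W. fm_nth (dg_proj G V x * dg_mat V g * fm_unit i j * (dg_mat W (inv g) * dg_proj G W x)) i j)"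
    if "g \<in> carrier G" "x \<in> carrier G" for g x
  proof -
    have "dg_proj G V x * dg_mat V g \<in> fm_carrier (dg_dim V) (dg_dim V)"
      "dg_mat W (inv g) * dg_proj G W x \<in> fm_carrier (dg_dim W) (dg_dim W)"
      using that V W by auto
    then show ?thesis
      unfolding fm_nth_mult_unit_mult by (simp only: fm_trace_carrier sum_product)
  qed
  have "dg_pairing G V W = (\<Sum>g\<in>carrier G. \<Sum>x\<in>carrier G. \<Sum>i<dg_dim V. \<Sum>j<dg_dim W.
     fm_nth (dg_proj G V x * dg_mat V g * fm_unit i j * (dg_mat W (inv g) * dg_proj G W x)) i j)"
    unfolding dg_pairing_def dg_char_def using tr by simp
  also have "\<dots> = (\<Sum>i<dg_dim V. \<Sum>j<dg_dim W. \<Sum>g\<in>carrier G. \<Sum>x\<in>carrier G.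
     fm_nth (dg_proj G V x * dg_mat V g * fm_unit i j * (dg_mat W (inv g) * dg_proj G W x)) i j)"
    \<comment> \<open>The order of summation g x i j passes through g i x j, i g x j and i g j x to
      i j g x.\<close>
    by (subst (2) sum.swap, subst sum.swap, subst (3) sum.swap, subst (2) sum.swap, rule refl)
  finally show ?thesis unfolding dg_average_def fm_nth_sum .
qed

text \<open>By cyclicity one of the two equal projections is absorbed by the other, the remaining
  ones add up to the identity, and conjugation by g preserves the trace; each g therefore
  contributes the trace of \<open>X\<close>.\<close>

lemma dg_average_trace:
  fixes V :: "('a, 'k::field) dgrep"
  assumes V: "dg_obj G V" and X: "X \<in> fm_carrier (dg_dim V) (dg_dim V)"
  shows "fm_trace (dg_average G V V X) = of_nat (card (carrier G)) * fm_trace X"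
proof -
  have "(\<Sum>x\<in>carrier G. fm_trace (dg_proj G V x * dg_mat V g * X * (dg_mat V (inv g) * dg_proj G V x))) = fm_trace X"
    if g: "g \<in> carrier G" for g
  proof -
    have "fm_trace (dg_proj G V x * dg_mat V g * X * (dg_mat V (inv g) * dg_proj G V x))
        = fm_trace (dg_proj G V x * (dg_mat V g * X * dg_mat V (inv g)))" if x: "x \<in> carrier G" for x
    proof -
      have "fm_trace (dg_proj G V x * (dg_mat V g * X * dg_mat V (inv g)) * dg_proj G V x)
         = fm_trace (dg_proj G V x * (dg_proj G V x * (dg_mat V g * X * dg_mat V (inv g))))"
        by (rule fm_trace_commute)
      then show ?thesis using obj_proj_mult_left[OF V x x] by (simp add: mult.assoc)
    qed
    then have "(\<Sum>x\<in>carrier G. fm_trace (dg_proj G V x * dg_mat V g * X * (dg_mat V (inv g) * dg_proj G V x)))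
       = fm_trace ((\<Sum>x\<in>carrier G. dg_proj G V x) * (dg_mat V g * X * dg_mat V (inv g)))"
      by (simp add: fm_trace_sum sum_distrib_right)
    also have "\<dots> = fm_trace (dg_mat V g * X * dg_mat V (inv g))"
      unfolding obj_proj_sum[OF V] using V X g by simp
    also have "\<dots> = fm_trace (dg_mat V (inv g) * (dg_mat V g * X))" by (rule fm_trace_commute)
    also have "\<dots> = fm_trace X"
      using obj_mat_inv(2)[OF V g] X by (simp add: mult.assoc[symmetric])
    finally show ?thesis .
  qed
  then show ?thesis unfolding dg_average_def fm_trace_sum by simp
qed

text \<open>Orthogonality of characters. Averages between non-isomorphic simple objects vanish by
  Schur's lemma; for isomorphic ones the pairing depends only on characters, so both arguments may
  be taken equal.\<close>

lemma dg_pairing_simple: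
  fixes V W :: "('a, 'k::{alg_closed_field, field_char_0}) dgrep"
  assumes sV: "dg_simple G V" and sW: "dg_simple G W"
  shows "dg_pairing G V W = (if dg_iso G V W then of_nat (card (carrier G)) else 0)"
proof -
  have V: "dg_obj G V" and W: "dg_obj G W" using sV sW by (auto dest: dg_simple_obj)
  have self: "dg_pairing G W W = of_nat (card (carrier G))"
  proof -
    let ?n = "dg_dim W" and ?c = "of_nat (card (carrier G)) :: 'k"
    have n: "of_nat ?n \<noteq> (0::'k)" using sW unfolding dg_simple_def by simp
    \<comment> \<open>The average of a matrix unit is a scalar, which its trace determines: |G| / n
      on the diagonal and 0 off it. The n diagonal positions add up to |G|.\<close>
    have "fm_nth (dg_average G W W (fm_unit i j)) i j = (if i = j then ?c / of_nat ?n else 0)" if ij: "i < ?n" "j < ?n" for i j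
    proof -
      obtain l where l: "dg_average G W W (fm_unit i j) = fm_scale l (fm_one ?n)"
        using dg_schur_scalar[OF sW dg_average_hom[OF W W]] ij by (metis fm_unit_carrier)
      have "fm_trace (dg_average G W W (fm_unit i j)) = ?c * (if i = j then 1 else 0)"
        using dg_average_trace[OF W fm_unit_carrier[OF ij]] by simp
      then have "l * of_nat ?n = ?c * (if i = j then 1 else 0)" unfolding l by simp
      then show ?thesis unfolding l using ij n by (auto simp: field_simps)
    qed
    then have "dg_pairing G W W = (\<Sum>i<?n. \<Sum>j<?n. if i = j then ?c / of_nat ?n else 0)"
      unfolding dg_pairing_average[OF W W] by simp
    also have "\<dots> = ?c" using n by simp
    finally show ?thesis .
  qed
  show ?thesis
  proof (cases "dg_iso G V W")
    case True
    have "dg_pairing G V W = dg_pairing G W W"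
      by (rule dg_pairing_char_cong) (rule dg_char_iso[OF V W True])
    then show ?thesis using True self by simp
  next
    case False
    have "dg_average G W V (fm_unit i j) = 0" if ij: "i < dg_dim V" "j < dg_dim W" for i j
    proof (rule ccontr)
      assume ne: "dg_average G W V (fm_unit i j) \<noteq> 0"
      have h: "dg_average G W V (fm_unit i j) \<in> fm_hom G W V" by (rule dg_average_hom[OF W V fm_unit_carrier[OF ij]])
      from dg_schur[OF sW sV h ne] h have "dg_iso G W V" unfolding dg_iso_iff[OF W V] by blast
      then show False using False dg_iso_sym by blast
    qed
    then show ?thesis unfolding dg_pairing_average[OF V W] using False by (simp add: zero_fmat.rep_eq)
  qed
qed

text \<open>The regular module of the double. Its basis consists of the pairs (x, h) of degree x,
  and g moves (x, h) to (g x g^-1, g h). Left translation in the second coordinate is free, so only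
  the identity fixes a basis vector, and it fixes |G| of them in each degree.\<close>

lemma dg_regular_exists:
  "\<exists>R :: ('a, 'k::field) dgrep. dg_obj G R \<and> dg_dim R = (card (carrier G))\<^sup>2 \<and>
     (\<forall>x\<in>carrier G. \<forall>g\<in>carrier G. dg_char G R x g = (if g = \<one> then of_nat (card (carrier G)) else 0))"
proof -
  let ?N = "(card (carrier G))\<^sup>2"
  have "card (carrier G \<times> carrier G) = ?N" by (simp add: card_cartesian_product power2_eq_square)
  then obtain \<phi> where \<phi>: "bij_betw \<phi> {..<?N} (carrier G \<times> carrier G)"
    using ex_bij_betw_nat_finite[of "carrier G \<times> carrier G"] by (auto simp: atLeast0LessThan)
  \<comment> \<open>\<open>\<phi>\<close> numbers the pairs and \<open>\<psi>\<close> is its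
    inverse; they turn the permutation of the pairs into a permutation of matrix indices.\<close>
  define \<psi> where "\<psi> = inv_into {..<?N} \<phi>"
  have \<phi>in: "\<phi> i \<in> carrier G \<times> carrier G" if "i < ?N" for i using bij_betwE[OF \<phi>] that by blast
  have \<psi>in: "\<psi> y < ?N" if "y \<in> carrier G \<times> carrier G" for y
    using bij_betwE[OF bij_betw_inv_into[OF \<phi>]] that unfolding \<psi>_def by blast
  have \<phi>\<psi>: "\<phi> (\<psi> y) = y" if "y \<in> carrier G \<times> carrier G" for y
    unfolding \<psi>_def using bij_betw_inv_into_right[OF \<phi> that] .
  have \<psi>\<phi>: "\<psi> (\<phi> i) = i" if "i < ?N" for i
    unfolding \<psi>_def using bij_betw_inv_into_left[OF \<phi>] that by blast
  define act where "act g y = (conjg g (fst y), g \<otimes> snd y)" for g y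
  have act_in: "act g y \<in> carrier G \<times> carrier G" if "g \<in> carrier G" "y \<in> carrier G \<times> carrier G" for g y
    using that unfolding act_def by auto
  define f where "f g j = \<psi> (act g (\<phi> j))" for g j
  have fin: "f g j < ?N" if "g \<in> carrier G" "j < ?N" for g j
    unfolding f_def by (intro \<psi>in act_in that \<phi>in)
  have \<phi>f: "\<phi> (f g j) = act g (\<phi> j)" if "g \<in> carrier G" "j < ?N" for g j
    unfolding f_def by (intro \<phi>\<psi> act_in that \<phi>in)
  have ff: "f g (f h j) = f (g \<otimes> h) j" if g: "g \<in> carrier G" and h: "h \<in> carrier G" and j: "j < ?N" for g h j
  proof -
    have "act g (act h (\<phi> j)) = act (g \<otimes> h) (\<phi> j)"
      using \<phi>in[OF j] g h unfolding act_def by (auto simp: conj_conj m_assoc inv_mult_group)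
    then show ?thesis unfolding f_def[of g] f_def[of "g \<otimes> h"] \<phi>f[OF h j] by simp
  qed
  have f1: "f \<one> j = j" if j: "j < ?N" for j
  proof -
    have "act \<one> (\<phi> j) = \<phi> j" using \<phi>in[OF j] unfolding act_def by (auto simp: mem_Times_iff prod_eq_iff)
    then show ?thesis unfolding f_def using \<psi>\<phi>[OF j] by simp
  qed
  have ffix: "f g j = j \<longleftrightarrow> g = \<one>" if g: "g \<in> carrier G" and j: "j < ?N" for g j
  proof
    assume "f g j = j"
    then have "g \<otimes> snd (\<phi> j) = snd (\<phi> j)" using \<phi>f[OF g j] unfolding act_def by (metis snd_conv)
    then show "g = \<one>" using g \<phi>in[OF j] by (auto simp: mem_Times_iff)
  qed (use f1[OF j] in simp)
  define r where "r g = (fm_map ?N (f g) :: 'k fmat)" for g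
  define p where "p x = (fm_diag ?N (\<lambda>i. fst (\<phi> i) = x) :: 'k fmat)" for x
  have m: "dg_module G ?N p r"
    unfolding dg_module_def
  proof (intro conjI ballI)
    show "r g \<in> fm_carrier ?N ?N" for g by (simp add: r_def)
    show "p x \<in> fm_carrier ?N ?N" for x by (simp add: p_def)
    show "r \<one> = fm_one ?N" by (rule fmat_eqI) (auto simp: r_def fm_map_def f1)
    show "r (g \<otimes> h) = r g * r h" if gh: "g \<in> carrier G" "h \<in> carrier G" for g h
    proof -
      have "r g * r h = fm_map ?N (\<lambda>j. f g (f h j))" unfolding r_def by (rule fm_map_mult) (rule fin[OF gh(2)])
      also have "\<dots> = r (g \<otimes> h)" by (rule fmat_eqI) (auto simp: r_def fm_map_def ff[OF gh])
      finally show ?thesis ..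
    qed
    show "p x * p y = (if x = y then p x else 0)" for x y
    proof (rule fmat_eqI)
      fix i j
      have "fm_nth (p x * p y) i j = (if fst (\<phi> i) = x then fm_nth (p y) i j else 0)"
        unfolding p_def[of x] by (rule fm_diag_mult_nth) (simp add: p_def)
      then show "fm_nth (p x * p y) i j = fm_nth (if x = y then p x else 0) i j"
        by (auto simp: p_def fm_diag_def fm_nth_simps)
    qed
    show "(\<Sum>x\<in>carrier G. p x) = fm_one ?N"
    proof (rule fmat_eqI)
      fix i j
      have "fm_nth (\<Sum>x\<in>carrier G. p x) i j = (\<Sum>x\<in>carrier G. if fst (\<phi> i) = x then (if i = j \<and> i < ?N then 1 else 0) else 0)"
        unfolding fm_nth_sum by (rule sum.cong) (auto simp: p_def fm_diag_def)
      also have "\<dots> = (if fst (\<phi> i) \<in> carrier G then (if i = j \<and> i < ?N then 1 else 0) else 0)" by simp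
      also have "\<dots> = fm_nth (fm_one ?N) i j" using \<phi>in[of i] by (auto simp: mem_Times_iff)
      finally show "fm_nth (\<Sum>x\<in>carrier G. p x) i j = fm_nth (fm_one ?N) i j" .
    qed
    show "r g * p x = p (conjg g x) * r g" if g: "g \<in> carrier G" and x: "x \<in> carrier G" for g x
    proof (rule fmat_eqI)
      fix i j
      have 1: "fm_nth (r g * p x) i j = (if fst (\<phi> j) = x then fm_nth (r g) i j else 0)"
        unfolding p_def by (rule fm_mult_diag_nth) (simp add: r_def)
      have 2: "fm_nth (p (conjg g x) * r g) i j = (if fst (\<phi> i) = conjg g x then fm_nth (r g) i j else 0)"
        unfolding p_def by (rule fm_diag_mult_nth) (simp add: r_def)
      have "fst (\<phi> j) = x \<longleftrightarrow> fst (\<phi> i) = conjg g x" if "j < ?N" "i = f g j"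
      proof -
        have "fst (\<phi> i) = conjg g (fst (\<phi> j))" using \<phi>f[OF g that(1)] that(2) unfolding act_def by simp
        then show ?thesis using \<phi>in[OF that(1)] g x conj_eq_iff[of g "fst (\<phi> j)" x] by (auto simp: mem_Times_iff)
      qed
      then show "fm_nth (r g * p x) i j = fm_nth (p (conjg g x) * r g) i j"
        unfolding 1 2 by (auto simp: r_def fm_map_def)
    qed
  qed
  let ?R = "dg_of_fm ?N p r"
  note R = dg_of_fm[OF m]
  have "dg_char G ?R x g = (if g = \<one> then of_nat (card (carrier G)) else 0)"
    if x: "x \<in> carrier G" and g: "g \<in> carrier G" for x g
  proof -
    have "dg_char G ?R x g = fm_trace (p x * r g)" unfolding dg_char_def using R(3)[OF g] R(4)[OF x] by simp
    also have "\<dots> = (\<Sum>i<?N. fm_nth (p x * r g) i i)"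
      by (rule fm_trace_carrier[of _ ?N ?N]) (simp add: p_def r_def)
    also have "\<dots> = (\<Sum>i<?N. if g = \<one> \<and> fst (\<phi> i) = x then 1 else 0)"
    proof (rule sum.cong)
      fix i assume i: "i \<in> {..<?N}"
      have "fm_nth (p x * r g) i i = (if fst (\<phi> i) = x then fm_nth (r g) i i else 0)"
        unfolding p_def by (rule fm_diag_mult_nth) (simp add: r_def)
      then show "fm_nth (p x * r g) i i = (if g = \<one> \<and> fst (\<phi> i) = x then 1 else 0)"
        using ffix[OF g, of i] i by (auto simp: r_def fm_map_def)
    qed simp
    also have "\<dots> = (if g = \<one> then of_nat (card (carrier G)) else 0)"
    proof -
      have "bij_betw \<phi> {i \<in> {..<?N}. fst (\<phi> i) = x} ({x} \<times> carrier G)"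
        unfolding bij_betw_def
      proof
        show "inj_on \<phi> {i \<in> {..<?N}. fst (\<phi> i) = x}"
          using \<phi> unfolding bij_betw_def by (auto intro: inj_on_subset)
        show "\<phi> ` {i \<in> {..<?N}. fst (\<phi> i) = x} = {x} \<times> carrier G"
        proof
          show "\<phi> ` {i \<in> {..<?N}. fst (\<phi> i) = x} \<subseteq> {x} \<times> carrier G"
          proof
            fix y assume "y \<in> \<phi> ` {i \<in> {..<?N}. fst (\<phi> i) = x}"
            then obtain i where "y = \<phi> i" "i < ?N" "fst (\<phi> i) = x" by blast
            then show "y \<in> {x} \<times> carrier G" using \<phi>in[of i] by (simp add: mem_Times_iff)
          qed
          show "{x} \<times> carrier G \<subseteq> \<phi> ` {i \<in> {..<?N}. fst (\<phi> i) = x}"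
          proof
            fix y assume "y \<in> {x} \<times> carrier G"
            then have y: "y \<in> carrier G \<times> carrier G" "fst y = x" using x by auto
            show "y \<in> \<phi> ` {i \<in> {..<?N}. fst (\<phi> i) = x}"
              using \<phi>\<psi>[OF y(1)] \<psi>in[OF y(1)] y(2) by (intro image_eqI[of _ _ "\<psi> y"]) auto
          qed
        qed
      qed
      then have "card {i \<in> {..<?N}. fst (\<phi> i) = x} = card (carrier G)"
        using bij_betw_same_card by (fastforce simp: card_cartesian_product)
      then show ?thesis by (simp add: sum.If_cases Int_def)
    qed
    finally show ?thesis .
  qed
  then show ?thesis using R(1,2) by blast
qed

lemma dg_regular_pairing:
  fixes R S :: "('a, 'k::field) dgrep"
  assumes S: "dg_obj G S"
    and R: "\<forall>x\<in>carrier G. \<forall>g\<in>carrier G. dg_char G R x g = (if g = \<one> then of_nat (card (carrier G)) else 0)"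
  shows "dg_pairing G R S = of_nat (card (carrier G)) * of_nat (dg_dim S)"
proof -
  have "dg_pairing G R S = (\<Sum>g\<in>carrier G. if g = \<one> then
     of_nat (card (carrier G)) * (\<Sum>x\<in>carrier G. fm_trace (dg_mat S (inv \<one>) * dg_proj G S x)) else 0)"
    unfolding dg_pairing_def using R by (intro sum.cong) (auto simp: sum_distrib_left)
  also have "\<dots> = of_nat (card (carrier G)) * (\<Sum>x\<in>carrier G. fm_trace (dg_proj G S x))"
    using S by simp
  finally show ?thesis unfolding obj_trace_proj_sum[OF S] .
qed

text \<open>A list instead of a set of simple objects, so that multiplicities are visible. A class
  of dimension d fills d places and contributes d * d to the total dimension |G|^2.\<close>

definition dg_decomposes_regular :: "('a, 'k::field) dgrep list \<Rightarrow> bool" where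
  "dg_decomposes_regular Ws \<longleftrightarrow> (\<forall>W\<in>set Ws. dg_simple G W) \<and>
     (\<forall>x\<in>carrier G. \<forall>g\<in>carrier G. sum_list (map (\<lambda>W. dg_char G W x g) Ws) = (if g = \<one> then of_nat (card (carrier G)) else 0)) \<and>
     (\<forall>S. dg_simple G S \<longrightarrow> length (filter (\<lambda>W. dg_iso G W S) Ws) = dg_dim S) \<and>
     sum_list (map dg_dim Ws) = (card (carrier G))\<^sup>2"

text \<open>The pairing of the regular object with a simple object S is computed twice: from its
  character as |G| times the dimension of S, and from a decomposition as |G| times the multiplicity
  of S. Cancelling |G| and passing to natural numbers uses characteristic zero.\<close>

lemma dg_decomposes_regular_exists:
  "\<exists>Ws :: ('a, 'k::{alg_closed_field, field_char_0}) dgrep list. dg_decomposes_regular Ws"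
proof -
  obtain R :: "('a, 'k) dgrep" where R: "dg_obj G R" "dg_dim R = (card (carrier G))\<^sup>2"
    and chR: "\<forall>x\<in>carrier G. \<forall>g\<in>carrier G. dg_char G R x g = (if g = \<one> then of_nat (card (carrier G)) else 0)"
    using dg_regular_exists by blast
  obtain Ws where Ws: "\<forall>W\<in>set Ws. dg_simple G W" "dg_iso G R (dg_sums Ws)"
    using dg_semisimple[OF R(1)] by blast
  have Wo: "\<forall>W\<in>set Ws. dg_obj G W" using Ws(1) dg_simple_obj by blast
  have so: "dg_obj G (dg_sums Ws)" by (rule dg_sums_obj[OF Wo])
  have ch: "dg_char G R x g = sum_list (map (\<lambda>W. dg_char G W x g) Ws)" if "x \<in> carrier G" "g \<in> carrier G" for x g
    using dg_char_iso[OF R(1) so Ws(2) that] dg_char_sums[OF Wo that] by simp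
  have "length (filter (\<lambda>W. dg_iso G W S) Ws) = dg_dim S" if S: "dg_simple G S" for S
  proof -
    let ?c = "of_nat (card (carrier G)) :: 'k"
    have "?c * of_nat (dg_dim S) = dg_pairing G R S" using dg_regular_pairing[OF dg_simple_obj[OF S] chR] by simp
    also have "\<dots> = dg_pairing G (dg_sums Ws) S"
      by (rule dg_pairing_char_cong) (rule dg_char_iso[OF R(1) so Ws(2)])
    also have "\<dots> = sum_list (map (\<lambda>W. dg_pairing G W S) Ws)" by (rule dg_pairing_sums[OF Wo])
    also have "\<dots> = sum_list (map (\<lambda>W. if dg_iso G W S then ?c else 0) Ws)"
      by (intro arg_cong[of _ _ sum_list] map_cong refl dg_pairing_simple S) (use Ws(1) in blast)
    also have "\<dots> = ?c * of_nat (length (filter (\<lambda>W. dg_iso G W S) Ws))"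
      by (induction Ws) (simp_all add: algebra_simps)
    finally have "(of_nat (dg_dim S) :: 'k) = of_nat (length (filter (\<lambda>W. dg_iso G W S) Ws))"
      using card_carrier_neq_0[where 'k = 'k] by (simp del: card_carrier_neq_0)
    then show ?thesis by (simp only: of_nat_eq_iff)
  qed
  moreover have "sum_list (map dg_dim Ws) = (card (carrier G))\<^sup>2"
    using dg_iso_dim[OF R(1) so Ws(2)] R(2) dg_sums_dim[of Ws] by simp
  moreover have "sum_list (map (\<lambda>W. dg_char G W x g) Ws) = (if g = \<one> then of_nat (card (carrier G)) else 0)"
    if "x \<in> carrier G" "g \<in> carrier G" for x g
    using ch[OF that] chR that by simp
  ultimately show ?thesis unfolding dg_decomposes_regular_def using Ws(1) by blast
qed

text \<open>Every simple object is isomorphic to some member of the list, so the positions whose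
  members lie in \<open>D\<close> map onto the isomorphism classes of \<open>D\<close>. The fibre
  over a class of dimension d has d elements of dimension d, which yields the square in
  \<open>cat_dim\<close>.\<close>

lemma cat_dim_eq:
  fixes D :: "('a, 'k::field) dgrep set"
  assumes Ws: "dg_decomposes_regular Ws" and D: "D \<subseteq> Collect (dg_obj G)"
    and closed: "\<And>V W. V \<in> D \<Longrightarrow> dg_obj G W \<Longrightarrow> dg_iso G V W \<Longrightarrow> W \<in> D"
  shows "finite (simple_classes G D)" and "cat_dim G D = sum_list (map dg_dim (filter (\<lambda>W. W \<in> D) Ws))"
proof -
  define I where "I = {i. i < length Ws \<and> Ws ! i \<in> D}"
  define c where "c V = {W \<in> D. dg_simple G W \<and> dg_iso G V W}" for V
  have sW: "dg_simple G (Ws ! i)" if "i < length Ws" for i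
    using Ws that unfolding dg_decomposes_regular_def by simp
  have mult: "card {i. i < length Ws \<and> dg_iso G (Ws ! i) S} = dg_dim S" if "dg_simple G S" for S
    using Ws that unfolding dg_decomposes_regular_def length_filter_conv_card by simp
  have cl: "simple_classes G D = {c V | V. V \<in> D \<and> dg_simple G V}"
    unfolding simple_classes_def quotient_def c_def by auto
  have ceq: "c V = c W" if "dg_obj G V" "dg_obj G W" "dg_iso G V W" for V W
  proof -
    have "dg_iso G V X \<longleftrightarrow> dg_iso G W X" if "dg_obj G X" for X
      using dg_iso_trans[of V W X] dg_iso_trans[of W V X] dg_iso_sym that
        \<open>dg_obj G V\<close> \<open>dg_obj G W\<close> \<open>dg_iso G V W\<close> by blast
    then show ?thesis unfolding c_def using D by blast
  qed
  have self: "V \<in> c V" if "V \<in> D" "dg_simple G V" for V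
    unfolding c_def using that dg_iso_refl dg_simple_obj by blast
  have ceq_iff: "c V = c W \<longleftrightarrow> dg_iso G V W" if "V \<in> D" "dg_simple G V" "W \<in> D" "dg_simple G W" for V W
    using self[OF that(3,4)] ceq[of V W] that dg_simple_obj unfolding c_def by blast
  have cdim: "the_elem (dg_dim ` c V) = dg_dim V" if "V \<in> D" "dg_simple G V" for V
  proof -
    have "dg_dim ` c V = {dg_dim V}"
      using self[OF that] dg_iso_dim[of V] D that unfolding c_def by fastforce
    then show ?thesis by simp
  qed
  have img: "simple_classes G D = (\<lambda>i. c (Ws ! i)) ` I"
  proof
    show "(\<lambda>i. c (Ws ! i)) ` I \<subseteq> simple_classes G D" unfolding cl I_def using sW by blast
    show "simple_classes G D \<subseteq> (\<lambda>i. c (Ws ! i)) ` I"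
    proof
      fix X assume "X \<in> simple_classes G D"
      then obtain V where V: "V \<in> D" "dg_simple G V" "X = c V" unfolding cl by blast
      have "card {i. i < length Ws \<and> dg_iso G (Ws ! i) V} \<noteq> 0"
        unfolding mult[OF V(2)] using V(2) unfolding dg_simple_def by simp
      then obtain i where i: "i < length Ws" "dg_iso G (Ws ! i) V"
        by (metis (mono_tags, lifting) card.empty empty_Collect_eq)
      have "Ws ! i \<in> D" using closed[OF V(1)] dg_iso_sym[OF i(2)] dg_simple_obj[OF sW[OF i(1)]] by blast
      then show "X \<in> (\<lambda>i. c (Ws ! i)) ` I"
        unfolding V(3) I_def using i ceq[OF _ _ i(2)] dg_simple_obj sW V(2) by (intro image_eqI[of _ _ i]) auto
    qed
  qed
  have finI: "finite I" unfolding I_def by simp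
  \<comment> \<open>Essential for the meaning of \<open>cat_dim\<close>: a sum over infinitely many
    classes would be 0 by convention.\<close>
  then show fin: "finite (simple_classes G D)" unfolding img by simp
  have fib: "(\<Sum>i | i \<in> I \<and> c (Ws ! i) = X. dg_dim (Ws ! i)) = (the_elem (dg_dim ` X))\<^sup>2"
    if X: "X \<in> simple_classes G D" for X
  proof -
    obtain V where V: "V \<in> D" "dg_simple G V" "X = c V" using X unfolding cl by blast
    have eq: "{i. i \<in> I \<and> c (Ws ! i) = X} = {i. i < length Ws \<and> dg_iso G (Ws ! i) V}"
    proof -
      have "i \<in> I \<and> c (Ws ! i) = X \<longleftrightarrow> dg_iso G (Ws ! i) V" if i: "i < length Ws" for i
        using ceq_iff[of "Ws ! i" V] V sW[OF i] i closed[OF V(1)] dg_iso_sym dg_simple_obj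
        unfolding I_def V(3) by blast
      then show ?thesis unfolding I_def by blast
    qed
    have "(\<Sum>i | i \<in> I \<and> c (Ws ! i) = X. dg_dim (Ws ! i)) = (\<Sum>i | i \<in> I \<and> c (Ws ! i) = X. dg_dim V)"
      unfolding eq using dg_iso_dim dg_simple_obj sW V(2) by (intro sum.cong) auto
    also have "\<dots> = dg_dim V * dg_dim V" unfolding eq using mult[OF V(2)] by simp
    finally show ?thesis unfolding V(3) cdim[OF V(1,2)] power2_eq_square .
  qed
  have "cat_dim G D = (\<Sum>X\<in>simple_classes G D. \<Sum>i | i \<in> I \<and> c (Ws ! i) = X. dg_dim (Ws ! i))"
    unfolding cat_dim_def using fib by simp
  also have "\<dots> = (\<Sum>i\<in>I. dg_dim (Ws ! i))"
    by (rule sum.group[OF finI fin]) (simp add: img)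
  also have "\<dots> = sum_list (map dg_dim (filter (\<lambda>W. W \<in> D) Ws))"
    unfolding I_def sum_list_map_filter_nth ..
  finally show "cat_dim G D = sum_list (map dg_dim (filter (\<lambda>W. W \<in> D) Ws))" .
qed

text \<open>The full list is counted here; consequently the Lagrangian condition says that a
  subcategory has dimension |G|.\<close>

lemma cat_dim_all:
  "cat_dim G (Collect (dg_obj G) :: ('a, 'k::{alg_closed_field, field_char_0}) dgrep set) = (card (carrier G))\<^sup>2"
proof -
  obtain Ws :: "('a, 'k) dgrep list" where Ws: "dg_decomposes_regular Ws" using dg_decomposes_regular_exists by blast
  have "\<forall>W\<in>set Ws. dg_obj G W" using Ws dg_simple_obj unfolding dg_decomposes_regular_def by blast
  then have "filter (\<lambda>W. W \<in> Collect (dg_obj G)) Ws = Ws" by (simp add: filter_id_conv)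
  then show ?thesis using cat_dim_eq(2)[OF Ws, of "Collect (dg_obj G)"] Ws unfolding dg_decomposes_regular_def by simp
qed

end

section \<open>Unit, dual and tensor product\<close>

text \<open>The sizes are arguments because the encoding of index pairs by division and remainder
  depends on them, and a finitely supported matrix does not carry its size.\<close>

definition fm_tensor :: "nat \<Rightarrow> nat \<Rightarrow> nat \<Rightarrow> nat \<Rightarrow> 'a::ring_1 fmat \<Rightarrow> 'a fmat \<Rightarrow> 'a fmat" where
  "fm_tensor n n' m m' A B = fm_of_fun (n * m) (n' * m')
     (\<lambda>i j. fm_nth A (i div m) (j div m') * fm_nth B (i mod m) (j mod m'))"

lemma fm_subspace_scale: "fm_subspace n U \<Longrightarrow> u \<in> U \<Longrightarrow> fm_scale c u \<in> U"
  unfolding fm_subspace_def by blast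

lemma fm_tensor_carrier [simp]: "fm_tensor n n' m m' A B \<in> fm_carrier (n * m) (n' * m')"
  by (simp add: fm_tensor_def)

lemma fm_nth_tensor: "fm_nth (fm_tensor n n' m m' A B) i j =
    (if i < n * m \<and> j < n' * m' then fm_nth A (i div m) (j div m') * fm_nth B (i mod m) (j mod m') else 0)"
  by (simp add: fm_tensor_def)

lemma sum_div_mod:
  "(\<Sum>r<k * l. F (r div l) (r mod l)) = (\<Sum>a<k. \<Sum>b<l. F a b)" for F :: "nat \<Rightarrow> nat \<Rightarrow> 'a::comm_monoid_add"
proof -
  have "(\<Sum>r<k * l. F (r div l) (r mod l)) = (\<Sum>(a, b)\<in>{..<k} \<times> {..<l}. F a b)"
  proof (rule sum.reindex_bij_witness[of _ "\<lambda>(a, b). a * l + b" "\<lambda>r. (r div l, r mod l)"])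
    fix r assume r: "r \<in> {..<k * l}"
    then have "l > 0" by (auto intro: ccontr)
    then show "(r div l, r mod l) \<in> {..<k} \<times> {..<l}" using r by (simp add: less_mult_imp_div_less)
  next
    fix y assume y: "y \<in> {..<k} \<times> {..<l}"
    then obtain a b where ab: "y = (a, b)" "a < k" "b < l" by blast
    have "a * l + b < Suc a * l" using ab by simp
    also have "\<dots> \<le> k * l" using ab by (intro mult_right_mono) auto
    finally show "(case y of (a, b) \<Rightarrow> a * l + b) \<in> {..<k * l}" using ab by simp
  qed auto
  then show ?thesis by (simp add: sum.cartesian_product)
qed

lemma fm_tensor_mult:
  fixes A B C D :: "'a::comm_ring_1 fmat"
  assumes A: "A \<in> fm_carrier n k" and B: "B \<in> fm_carrier m l"
  shows "fm_tensor n k m l A B * fm_tensor k p l q C D = fm_tensor n p m q (A * C) (B * D)"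
proof (rule fmat_eqI)
  fix i j
  let ?F = "\<lambda>a b. fm_nth A (i div m) a * fm_nth B (i mod m) b * (fm_nth C a (j div q) * fm_nth D b (j mod q))"
  show "fm_nth (fm_tensor n k m l A B * fm_tensor k p l q C D) i j = fm_nth (fm_tensor n p m q (A * C) (B * D)) i j"
  proof (cases "i < n * m \<and> j < p * q")
    case True
    have "fm_nth (fm_tensor n k m l A B * fm_tensor k p l q C D) i j = (\<Sum>r<k * l. ?F (r div l) (r mod l))"
      by (subst fm_nth_times_left[OF fm_tensor_carrier]) (use True in \<open>auto simp: fm_nth_tensor intro!: sum.cong\<close>)
    also have "\<dots> = (\<Sum>a<k. \<Sum>b<l. ?F a b)" by (rule sum_div_mod)
    also have "\<dots> = (\<Sum>a<k. fm_nth A (i div m) a * fm_nth C a (j div q)) * (\<Sum>b<l. fm_nth B (i mod m) b * fm_nth D b (j mod q))"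
      unfolding sum_product by (simp add: algebra_simps)
    also have "\<dots> = fm_nth (A * C) (i div m) (j div q) * fm_nth (B * D) (i mod m) (j mod q)"
      by (simp only: fm_nth_times_left[OF A] fm_nth_times_left[OF B])
    finally show ?thesis using True by (simp add: fm_nth_tensor)
  next
    case False
    have "fm_nth (fm_tensor n k m l A B * fm_tensor k p l q C D) i j = 0"
      using fm_carrierD[OF fm_mult_carrier[OF fm_tensor_carrier fm_tensor_carrier]] False by (metis not_less)
    then show ?thesis using False by (auto simp: fm_nth_tensor)
  qed
qed

lemma fm_tensor_one: "fm_tensor n n m m (fm_one n) (fm_one m) = (fm_one (n * m) :: 'a::ring_1 fmat)"
proof (rule fmat_eqI)
  fix i j
  show "fm_nth (fm_tensor n n m m (fm_one n) (fm_one m)) i j = fm_nth (fm_one (n * m) :: 'a fmat) i j"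
  proof (cases "i < n * m \<and> j < n * m")
    case True
    then have "m > 0" by (auto intro: ccontr)
    then have "i div m < n" "i mod m < m" using True by (simp_all add: less_mult_imp_div_less)
    moreover have "i div m = j div m \<and> i mod m = j mod m \<longleftrightarrow> i = j" by (metis div_mult_mod_eq)
    ultimately show ?thesis using True by (auto simp: fm_nth_tensor)
  next
    case False
    then show ?thesis by (auto simp: fm_nth_tensor)
  qed
qed

lemma fm_tensor_linear:
  fixes A B :: "'a::comm_ring_1 fmat"
  shows "fm_tensor n n' m m' (sum f S) B = (\<Sum>x\<in>S. fm_tensor n n' m m' (f x) B)"
    and "fm_tensor n n' m m' A (sum f S) = (\<Sum>x\<in>S. fm_tensor n n' m m' A (f x))"
    and "fm_tensor n n' m m' (fm_scale c A) B = fm_scale c (fm_tensor n n' m m' A B)"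
    and "fm_tensor n n' m m' A (fm_scale c B) = fm_scale c (fm_tensor n n' m m' A B)"
    and "fm_tensor n n' m m' 0 B = 0" and "fm_tensor n n' m m' A 0 = 0"
  by (auto intro!: fmat_eqI simp: fm_nth_tensor fm_nth_simps sum_distrib_left sum_distrib_right algebra_simps)

lemma fm_of_mat_tensor:
  assumes "A \<in> carrier_mat n n" "B \<in> carrier_mat m m"
  shows "fm_of_mat (tensor_mat A B) = fm_tensor n n m m (fm_of_mat A) (fm_of_mat B :: 'a::field fmat)"
proof (rule fmat_eqI)
  fix i j
  have "i div m < n" "i mod m < m" if "i < n * m" for i
  proof -
    have "m > 0" using that by (auto intro: ccontr)
    then show "i div m < n" "i mod m < m" using that by (simp_all add: less_mult_imp_div_less)
  qed
  then show "fm_nth (fm_of_mat (tensor_mat A B)) i j = fm_nth (fm_tensor n n m m (fm_of_mat A) (fm_of_mat B)) i j"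
    using assms by (auto simp: fm_nth_tensor fm_of_mat_def tensor_mat_def)
qed

lemma fm_of_vec_tensor:
  assumes "v \<in> carrier_vec n" "w \<in> carrier_vec m"
  shows "fm_of_vec (tensor_vec v w) = fm_tensor n 1 m 1 (fm_of_vec v) (fm_of_vec w :: 'a::field fmat)"
proof (rule fmat_eqI)
  fix i j
  have "i div m < n" "i mod m < m" if "i < n * m" for i
  proof -
    have "m > 0" using that by (auto intro: ccontr)
    then show "i div m < n" "i mod m < m" using that by (simp_all add: less_mult_imp_div_less)
  qed
  then show "fm_nth (fm_of_vec (tensor_vec v w)) i j = fm_nth (fm_tensor n 1 m 1 (fm_of_vec v) (fm_of_vec w)) i j"
    using assms by (auto simp: fm_nth_tensor fm_of_vec_def tensor_vec_def)
qed

text \<open>The products of entries of \<open>v'\<close> and \<open>w'\<close> agree with those of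
  \<open>v\<close> and \<open>w\<close>. Fixing one index where \<open>v\<close> is nonzero shows
  that \<open>w'\<close> is a multiple of \<open>w\<close>, and an index where \<open>w\<close> is
  nonzero shows the same for \<open>v'\<close>, with the inverse factor.\<close>

lemma fm_tensor_eqD:
  fixes v w v' w' :: "'a::field fmat"
  assumes v: "v \<in> fm_carrier n 1" "v' \<in> fm_carrier n 1" and w: "w \<in> fm_carrier m 1" "w' \<in> fm_carrier m 1"
    and nz: "v \<noteq> 0" "w \<noteq> 0" and eq: "fm_tensor n 1 m 1 v' w' = fm_tensor n 1 m 1 v w"
  shows "\<exists>c. c \<noteq> 0 \<and> w' = fm_scale c w \<and> v' = fm_scale (inverse c) v"
proof -
  have e: "fm_nth v' i 0 * fm_nth w' j 0 = fm_nth v i 0 * fm_nth w j 0" if "i < n" "j < m" for i j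
  proof -
    have "i * m + j < Suc i * m" using that by simp
    also have "\<dots> \<le> n * m" using that by (intro mult_right_mono) auto
    finally have "i * m + j < n * m" .
    then show ?thesis
      using arg_cong[OF eq, of "\<lambda>A. fm_nth A (i * m + j) 0"] that by (simp add: fm_nth_tensor)
  qed
  obtain i0 k where "fm_nth v i0 k \<noteq> 0" using nz(1) by (metis fmat_eqI zero_fmat.rep_eq)
  then have i0: "fm_nth v i0 0 \<noteq> 0" "i0 < n" using v(1) unfolding fm_carrier_def by auto
  obtain j0 l where "fm_nth w j0 l \<noteq> 0" using nz(2) by (metis fmat_eqI zero_fmat.rep_eq)
  then have j0: "fm_nth w j0 0 \<noteq> 0" "j0 < m" using w(1) unfolding fm_carrier_def by auto
  have nz': "fm_nth v' i0 0 \<noteq> 0" "fm_nth w' j0 0 \<noteq> 0" using e[OF i0(2) j0(2)] i0 j0 by auto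
  \<comment> \<open>\<open>v'\<close> is nonzero at \<open>i0\<close> because its product there with
    an entry of \<open>w'\<close> equals a nonzero product; the equations at row \<open>i0\<close>
    then read \<open>w' = c w\<close>.\<close>
  define c where "c = fm_nth v i0 0 / fm_nth v' i0 0"
  have c: "c \<noteq> 0" unfolding c_def using i0 nz' by simp
  have w': "fm_nth w' j 0 = c * fm_nth w j 0" for j
  proof (cases "j < m")
    case True
    then show ?thesis using e[OF i0(2) True] nz' unfolding c_def by (simp add: field_simps)
  next
    case False
    then show ?thesis using fm_carrierD[OF w(1), of j 0] fm_carrierD[OF w(2), of j 0] by simp
  qed
  have v': "fm_nth v' i 0 = inverse c * fm_nth v i 0" for i
  proof (cases "i < n")
    case True
    have "fm_nth v' i 0 * (c * fm_nth w j0 0) = fm_nth v i 0 * fm_nth w j0 0" using e[OF True j0(2)] w' by simp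
    then show ?thesis using j0(1) c by (simp add: field_simps)
  next
    case False
    then show ?thesis using fm_carrierD[OF v(1), of i 0] fm_carrierD[OF v(2), of i 0] by simp
  qed
  have ext: "A = C" if "A \<in> fm_carrier q 1" "C \<in> fm_carrier q 1" "\<And>i. fm_nth A i 0 = fm_nth C i 0" for q and A C :: "'a fmat"
  proof (rule fmat_eqI)
    show "fm_nth A i j = fm_nth C i j" for i j
      using that(3) fm_carrierD[OF that(1), of i j] fm_carrierD[OF that(2), of i j] by (cases "j = 0") auto
  qed
  have "w' = fm_scale c w" by (rule ext[of _ m]) (use w w' in auto)
  moreover have "v' = fm_scale (inverse c) v" by (rule ext[of _ n]) (use v v' in auto)
  ultimately show ?thesis using c by blast
qed

lemma fm_tensor_nonzero:
  fixes v w :: "'a::field fmat"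
  assumes v: "v \<in> fm_carrier n 1" and w: "w \<in> fm_carrier m 1" and nz: "v \<noteq> 0" "w \<noteq> 0"
  shows "fm_tensor n 1 m 1 v w \<noteq> 0"
proof
  assume "fm_tensor n 1 m 1 v w = 0"
  then have "fm_tensor n 1 m 1 0 w = fm_tensor n 1 m 1 v w" by (simp add: fm_tensor_linear)
  from fm_tensor_eqD[OF v fm_zero_carrier w w nz this] show False using nz by (auto simp: fm_scale_eq_0_iff)
qed

lemma fm_column_expansion:
  fixes u :: "'a::ring_1 fmat"
  assumes u: "u \<in> fm_carrier n 1"
  shows "u = (\<Sum>k<n. fm_scale (fm_nth u k 0) (fm_unit k 0))"
proof (rule fmat_eqI)
  fix i j
  have "fm_nth (\<Sum>k<n. fm_scale (fm_nth u k 0) (fm_unit k 0)) i j = (\<Sum>k<n. if k = i then (if j = 0 then fm_nth u i 0 else 0) else 0)"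
    unfolding fm_nth_sum by (rule sum.cong) auto
  also have "\<dots> = fm_nth u i j" using fm_carrierD[OF u, of i j] by (auto simp: not_less)
  finally show "fm_nth u i j = fm_nth (\<Sum>k<n. fm_scale (fm_nth u k 0) (fm_unit k 0)) i j" ..
qed

lemma fm_unit_tensor:
  assumes k: "k < n * m"
  shows "(fm_unit k 0 :: 'a::ring_1 fmat) = fm_tensor n 1 m 1 (fm_unit (k div m) 0) (fm_unit (k mod m) 0)"
proof (rule fmat_eqI)
  fix i j
  have "i div m = k div m \<and> i mod m = k mod m \<longleftrightarrow> i = k" by (metis div_mult_mod_eq)
  then show "fm_nth (fm_unit k 0 :: 'a fmat) i j = fm_nth (fm_tensor n 1 m 1 (fm_unit (k div m) 0) (fm_unit (k mod m) 0)) i j"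
    using k by (auto simp: fm_nth_tensor)
qed

lemma vspan_vsubspace:
  assumes "S \<subseteq> carrier_vec n"
  shows "vsubspace n (vspan n S)" and "S \<subseteq> vspan n S"
    and "vsubspace n N \<Longrightarrow> S \<subseteq> N \<Longrightarrow> vspan n S \<subseteq> (N :: 'a::field vec set)"
proof -
  interpret vec_space "TYPE('a)" n .
  have S: "S \<subseteq> carrier V" using assms by simp
  show "vsubspace n (vspan n S)" using span_is_subspace[OF assms] .
  show "S \<subseteq> vspan n S" using in_own_span[OF assms] .
  show "vspan n S \<subseteq> N" if "vsubspace n N" "S \<subseteq> N"
    using span_is_subset[OF that(2)] that(1) unfolding VectorSpace.subspace_def by blast
qed

section \<open>Projections and actions of the unit, the dual and the tensor product\<close>

context finite_group
begin

lemma dg_unit_realizes: "dg_realizes G (dg_unit G :: ('a, 'k::field) dgrep) (\<lambda>x. if x = \<one> then fm_one 1 else 0)"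
  unfolding dg_realizes_def dg_module_def
proof (intro conjI ballI)
  show "dg_comp (dg_unit G :: ('a, 'k) dgrep) x = {v \<in> carrier_vec (dg_dim (dg_unit G)). (if x = \<one> then fm_one 1 else 0) * fm_of_vec v = fm_of_vec v}"
    if "x \<in> carrier G" for x
  proof (cases "x = \<one>")
    case True
    have "fm_one 1 * fm_of_vec v = fm_of_vec v" if "v \<in> carrier_vec 1" for v :: "'k vec"
      by (rule fm_one_mult[OF fm_of_vec_carrier[OF that]])
    then show ?thesis using True by (auto simp: dg_unit_def simp del: One_nat_def)
  next
    case False
    have "v = 0\<^sub>v 1" if "v \<in> carrier_vec 1" "0 = fm_of_vec v" for v :: "'k vec"
      using that by (intro fm_of_vec_eqI[of _ _ 1]) auto
    then show ?thesis using False by (auto simp: dg_unit_def simp del: One_nat_def)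
  qed
  show "fm_of_mat (dg_act (dg_unit G :: ('a, 'k) dgrep) (g \<otimes> h)) = fm_of_mat (dg_act (dg_unit G) g) * fm_of_mat (dg_act (dg_unit G) h)" for g h
    by (simp add: dg_unit_def)
  have *: "conjg g x = \<one> \<longleftrightarrow> x = \<one>" if "g \<in> carrier G" "x \<in> carrier G" for g x
    using conj_eq_iff[OF that(1,2), of \<one>] that by simp
  show "fm_of_mat (dg_act (dg_unit G :: ('a, 'k) dgrep) g) * (if x = \<one> then fm_one 1 else 0) =
      (if conjg g x = \<one> then fm_one 1 else 0) * fm_of_mat (dg_act (dg_unit G) g)" if "g \<in> carrier G" "x \<in> carrier G" for g x
    using *[OF that] by (simp add: dg_unit_def)
qed (simp_all add: dg_unit_def del: One_nat_def)

lemma dg_unit_obj [simp]: "dg_obj G (dg_unit G :: ('a, 'k::field) dgrep)"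
  by (rule dg_realizes_obj[OF dg_unit_realizes])

lemma dg_unit_proj: "x \<in> carrier G \<Longrightarrow> dg_proj G (dg_unit G :: ('a, 'k::field) dgrep) x = (if x = \<one> then fm_one 1 else 0)"
  by (rule dg_realizes_unique[OF dg_realizes_proj[OF dg_unit_obj] dg_unit_realizes])

lemma dg_unit_mat: "dg_mat (dg_unit G :: ('a, 'k::field) dgrep) g = fm_one 1"
  by (simp add: dg_unit_def del: One_nat_def)

lemma dg_dual_mat: "dg_mat (dg_dual G V) g = fm_transpose (dg_mat V (inv g))" for V :: "('a, 'k::field) dgrep"
  by (simp add: dg_dual_def fm_of_mat_transpose)

lemma dg_dual_dim [simp]: "dg_dim (dg_dual G V) = dg_dim V"
  by (simp add: dg_dual_def)

lemma fm_scalar_prod: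
  fixes f v :: "'k::field vec"
  assumes f: "f \<in> carrier_vec n" and v: "v \<in> carrier_vec n"
  shows "f \<bullet> v = 0 \<longleftrightarrow> fm_transpose (fm_of_vec f) * fm_of_vec v = 0"
proof -
  have c: "fm_transpose (fm_of_vec f) \<in> fm_carrier 1 n" by (rule fm_transpose_carrier[OF fm_of_vec_carrier[OF f]])
  have "fm_nth (fm_transpose (fm_of_vec f) * fm_of_vec v) i j = (if i = 0 \<and> j = 0 then f \<bullet> v else 0)" for i j
    by (subst fm_nth_times_left[OF c]) (use f v in \<open>auto simp: fm_of_vec_def scalar_prod_def atLeast0LessThan intro!: sum.neutral sum.cong\<close>)
  then show ?thesis by (auto intro!: fmat_eqI simp: zero_fmat.rep_eq dest: arg_cong[of _ _ "\<lambda>A. fm_nth A 0 0"])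
qed

text \<open>A form vanishes on all components but that of degree x^-1 exactly when composing it with
  the projection onto that component changes nothing; on column vectors, composition is
  multiplication by the transpose.\<close>

lemma dg_dual_realizes:
  fixes V :: "('a, 'k::field) dgrep"
  assumes V: "dg_obj G V"
  shows "dg_realizes G (dg_dual G V) (\<lambda>x. fm_transpose (dg_proj G V (inv x)))"
  unfolding dg_realizes_def dg_module_def dg_dual_mat dg_dual_dim
proof (intro conjI ballI)
  let ?n = "dg_dim V"
  show "dg_act (dg_dual G V) g \<in> carrier_mat ?n ?n" if "g \<in> carrier G" for g
    using obj_act_carrier[OF V, of "inv g"] that by (simp add: dg_dual_def)
  show "fm_transpose (dg_mat V (inv \<one>)) = fm_one ?n" using V by simp
  show "fm_transpose (dg_mat V (inv (g \<otimes> h))) = fm_transpose (dg_mat V (inv g)) * fm_transpose (dg_mat V (inv h))"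
    if "g \<in> carrier G" "h \<in> carrier G" for g h
    using that obj_mat_mult[OF V, of "inv h" "inv g"] by (simp add: fm_transpose_mult[symmetric] inv_mult_group)
  show "fm_transpose (dg_proj G V (inv x)) * fm_transpose (dg_proj G V (inv y)) =
      (if x = y then fm_transpose (dg_proj G V (inv x)) else 0)" if "x \<in> carrier G" "y \<in> carrier G" for x y
    using that obj_proj_mult[OF V, of "inv y" "inv x"] by (auto simp: fm_transpose_mult[symmetric])
  show s: "(\<Sum>x\<in>carrier G. fm_transpose (dg_proj G V (inv x))) = fm_one ?n"
  proof -
    have "(\<Sum>x\<in>carrier G. dg_proj G V (inv x)) = (\<Sum>x\<in>carrier G. dg_proj G V x)"
      by (rule sum.reindex_bij_witness[of _ "\<lambda>x. inv x" "\<lambda>x. inv x"]) auto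
    then show ?thesis using obj_proj_sum[OF V] by (simp flip: fm_transpose_simps(4))
  qed
  show "fm_transpose (dg_mat V (inv g)) * fm_transpose (dg_proj G V (inv x)) =
     fm_transpose (dg_proj G V (inv (conjg g x))) * fm_transpose (dg_mat V (inv g))"
    if g: "g \<in> carrier G" and x: "x \<in> carrier G" for g x
  proof -
    have "dg_mat V (inv g) * dg_proj G V (conjg g (inv x)) = dg_proj G V (inv x) * dg_mat V (inv g)"
      using obj_mat_proj[OF V, of "inv g" "conjg g (inv x)"] g x by simp
    then show ?thesis using g x by (simp add: fm_transpose_mult[symmetric] conj_inv)
  qed
  show "dg_comp (dg_dual G V) x = {v \<in> carrier_vec ?n. fm_transpose (dg_proj G V (inv x)) * fm_of_vec v = fm_of_vec v}"
    if x: "x \<in> carrier G" for x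
  proof -
    have "(\<forall>y\<in>carrier G. y \<noteq> inv x \<longrightarrow> (\<forall>v\<in>dg_comp V y. f \<bullet> v = 0)) \<longleftrightarrow>
      fm_transpose (dg_proj G V (inv x)) * fm_of_vec f = fm_of_vec f" if f: "f \<in> carrier_vec ?n" for f
    proof
      let ?f = "fm_transpose (fm_of_vec f)"
      have fc: "?f \<in> fm_carrier 1 ?n" by (rule fm_transpose_carrier[OF fm_of_vec_carrier[OF f]])
      {
        assume *: "\<forall>y\<in>carrier G. y \<noteq> inv x \<longrightarrow> (\<forall>v\<in>dg_comp V y. f \<bullet> v = 0)"
        have z: "?f * dg_proj G V y = 0" if y: "y \<in> carrier G" "y \<noteq> inv x" for y
        proof (rule fm_eq_columnI[OF fm_mult_carrier[OF fc obj_proj_carrier[OF V y(1)]] fm_zero_carrier])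
          fix v :: "'k fmat" assume v: "v \<in> fm_carrier ?n 1"
          have c: "dg_proj G V y * v \<in> fm_carrier ?n 1" by (rule fm_mult_carrier[OF obj_proj_carrier[OF V y(1)] v])
          have "vec_of_fm ?n (dg_proj G V y * v) \<in> dg_comp V y"
            using c obj_proj_mult_left[OF V y(1) y(1)] by (simp add: obj_comp[OF V y(1)] del: One_nat_def)
          then have "f \<bullet> vec_of_fm ?n (dg_proj G V y * v) = 0" using * y by blast
          then have "?f * (dg_proj G V y * v) = 0"
            unfolding fm_scalar_prod[OF f vec_of_fm_carrier] fm_of_vec_of_fm[OF c] .
          then show "?f * dg_proj G V y * v = 0 * v" by (simp add: mult.assoc)
        qed
        have "?f = ?f * (\<Sum>y\<in>carrier G. dg_proj G V y)" unfolding obj_proj_sum[OF V] using fm_mult_one[OF fc] by simp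
        also have "\<dots> = (\<Sum>y\<in>carrier G. if y = inv x then ?f * dg_proj G V (inv x) else 0)"
          unfolding sum_distrib_left by (rule sum.cong) (use z in auto)
        also have "\<dots> = ?f * dg_proj G V (inv x)" using x by simp
        finally have "fm_transpose ?f = fm_transpose (?f * dg_proj G V (inv x))" by (rule arg_cong)
        then show "fm_transpose (dg_proj G V (inv x)) * fm_of_vec f = fm_of_vec f" by (simp add: fm_transpose_mult)
      next
        assume "fm_transpose (dg_proj G V (inv x)) * fm_of_vec f = fm_of_vec f"
        then have *: "?f * dg_proj G V (inv x) = ?f" by (metis fm_transpose_mult fm_transpose_simps(1))
        show "\<forall>y\<in>carrier G. y \<noteq> inv x \<longrightarrow> (\<forall>v\<in>dg_comp V y. f \<bullet> v = 0)"
        proof (intro ballI impI)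
          fix y v assume y: "y \<in> carrier G" "y \<noteq> inv x" and "v \<in> dg_comp V y"
          then have v: "v \<in> carrier_vec ?n" "dg_proj G V y * fm_of_vec v = fm_of_vec v" using obj_comp[OF V y(1)] by auto
          have "?f * fm_of_vec v = ?f * dg_proj G V (inv x) * (dg_proj G V y * fm_of_vec v)" unfolding * v(2) ..
          also have "\<dots> = 0" using x y obj_proj_mult_left[OF V, of "inv x" y] by (simp add: mult.assoc)
          finally show "f \<bullet> v = 0" unfolding fm_scalar_prod[OF f v(1)] .
        qed
      }
    qed
    then show ?thesis by (auto simp: dg_dual_def)
  qed
qed (use V in auto)

lemma dg_dual_obj: "dg_obj G V \<Longrightarrow> dg_obj G (dg_dual G V)" for V :: "('a, 'k::field) dgrep"
  by (rule dg_realizes_obj[OF dg_dual_realizes])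

lemma dg_dual_proj: "dg_obj G V \<Longrightarrow> x \<in> carrier G \<Longrightarrow> dg_proj G (dg_dual G V) x = fm_transpose (dg_proj G V (inv x))"
  for V :: "('a, 'k::field) dgrep"
  by (rule dg_realizes_unique[OF dg_realizes_proj[OF dg_dual_obj] dg_dual_realizes])

lemma dg_tensor_mat:
  "dg_obj G V \<Longrightarrow> dg_obj G W \<Longrightarrow> g \<in> carrier G \<Longrightarrow>
    dg_mat (dg_tensor G V W) g = fm_tensor (dg_dim V) (dg_dim V) (dg_dim W) (dg_dim W) (dg_mat V g) (dg_mat W g)"
  for V W :: "('a, 'k::field) dgrep"
  by (simp add: dg_tensor_def fm_of_mat_tensor[OF obj_act_carrier obj_act_carrier])

lemma dg_tensor_dim [simp]: "dg_dim (dg_tensor G V W) = dg_dim V * dg_dim W"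
  by (simp add: dg_tensor_def)

text \<open>The projection of degree z collects the products of degrees x and x^-1 z over all x. The
  delicate point is the component, defined as a span: it has to fill the whole image of this
  projection.\<close>

lemma dg_tensor_realizes:
  fixes V W :: "('a, 'k::field) dgrep"
  assumes V: "dg_obj G V" and W: "dg_obj G W"
  shows "dg_realizes G (dg_tensor G V W) (\<lambda>z. \<Sum>x\<in>carrier G.
     fm_tensor (dg_dim V) (dg_dim V) (dg_dim W) (dg_dim W) (dg_proj G V x) (dg_proj G W (inv x \<otimes> z)))"
proof -
  let ?n = "dg_dim V" and ?m = "dg_dim W"
  let ?T = "fm_tensor ?n ?n ?m ?m :: 'k fmat \<Rightarrow> 'k fmat \<Rightarrow> 'k fmat"
  let ?t = "fm_tensor ?n 1 ?m 1 :: 'k fmat \<Rightarrow> 'k fmat \<Rightarrow> 'k fmat"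
  define Q where "Q z = (\<Sum>x\<in>carrier G. ?T (dg_proj G V x) (dg_proj G W (inv x \<otimes> z)))" for z
  have TT: "?T A B * ?T C D = ?T (A * C) (B * D)" if "A \<in> fm_carrier ?n ?n" "B \<in> fm_carrier ?m ?m" for A B C D
    by (rule fm_tensor_mult[OF that])
  have Tt: "?T A B * ?t v w = ?t (A * v) (B * w)" if "A \<in> fm_carrier ?n ?n" "B \<in> fm_carrier ?m ?m" for A B v w
    by (rule fm_tensor_mult[OF that])
  have mod: "dg_module G (?n * ?m) Q (dg_mat (dg_tensor G V W))"
    unfolding dg_module_def
  proof (intro conjI ballI)
    show "dg_mat (dg_tensor G V W) g \<in> fm_carrier (?n * ?m) (?n * ?m)" if "g \<in> carrier G" for g
      unfolding dg_tensor_mat[OF V W that] by simp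
    show "dg_mat (dg_tensor G V W) \<one> = fm_one (?n * ?m)"
      using V W by (simp add: dg_tensor_mat fm_tensor_one)
    show "dg_mat (dg_tensor G V W) (g \<otimes> h) = dg_mat (dg_tensor G V W) g * dg_mat (dg_tensor G V W) h"
      if "g \<in> carrier G" "h \<in> carrier G" for g h
      using V W that by (simp add: dg_tensor_mat TT obj_mat_mult)
    show "Q z \<in> fm_carrier (?n * ?m) (?n * ?m)" for z unfolding Q_def by (intro fm_sum_carrier fm_tensor_carrier)
    show "Q z * Q z' = (if z = z' then Q z else 0)" if z: "z \<in> carrier G" "z' \<in> carrier G" for z z'
    proof -
      have "Q z * Q z' = (\<Sum>x\<in>carrier G. \<Sum>y\<in>carrier G. ?T (dg_proj G V x * dg_proj G V y) (dg_proj G W (inv x \<otimes> z) * dg_proj G W (inv y \<otimes> z')))"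
        unfolding Q_def sum_product using V W z by (simp add: TT)
      also have "\<dots> = (\<Sum>x\<in>carrier G. \<Sum>y\<in>carrier G. if y = x then ?T (dg_proj G V x) (dg_proj G W (inv x \<otimes> z) * dg_proj G W (inv x \<otimes> z')) else 0)"
        by (intro sum.cong refl) (use obj_proj_mult[OF V] in \<open>auto simp: fm_tensor_linear\<close>)
      also have "\<dots> = (\<Sum>x\<in>carrier G. ?T (dg_proj G V x) (dg_proj G W (inv x \<otimes> z) * dg_proj G W (inv x \<otimes> z')))"
        by simp
      also have "\<dots> = (if z = z' then Q z else 0)"
        using z obj_proj_mult[OF W] by (auto simp: Q_def fm_tensor_linear intro!: sum.neutral)
      finally show ?thesis .
    qed
    show "(\<Sum>z\<in>carrier G. Q z) = fm_one (?n * ?m)"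
    proof -
      have "(\<Sum>z\<in>carrier G. dg_proj G W (inv x \<otimes> z)) = fm_one ?m" if "x \<in> carrier G" for x
        using sum_mult_left[of "inv x" "dg_proj G W"] obj_proj_sum[OF W] that by simp
      then have "(\<Sum>x\<in>carrier G. \<Sum>z\<in>carrier G. ?T (dg_proj G V x) (dg_proj G W (inv x \<otimes> z))) = fm_one (?n * ?m)"
        using obj_proj_sum[OF V] by (simp flip: fm_tensor_linear(1,2)) (simp add: fm_tensor_one)
      then show ?thesis unfolding Q_def by (subst sum.swap)
    qed
    show "dg_mat (dg_tensor G V W) g * Q z = Q (conjg g z) * dg_mat (dg_tensor G V W) g"
      if g: "g \<in> carrier G" and z: "z \<in> carrier G" for g z
    proof -
      have "dg_mat (dg_tensor G V W) g * Q z =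
         (\<Sum>x\<in>carrier G. ?T (dg_mat V g * dg_proj G V x) (dg_mat W g * dg_proj G W (inv x \<otimes> z)))"
        unfolding Q_def sum_distrib_left dg_tensor_mat[OF V W g] using V W g by (simp add: TT)
      also have "\<dots> = (\<Sum>x\<in>carrier G. ?T (dg_proj G V (conjg g x)) (dg_proj G W (inv (conjg g x) \<otimes> conjg g z)) * dg_mat (dg_tensor G V W) g)"
      proof (rule sum.cong)
        fix x assume x: "x \<in> carrier G"
        have "inv (conjg g x) \<otimes> conjg g z = conjg g (inv x \<otimes> z)" unfolding conj_inv[OF g x] using conj_mult[OF g, of "inv x" z] x z by simp
        then show "?T (dg_mat V g * dg_proj G V x) (dg_mat W g * dg_proj G W (inv x \<otimes> z)) =
          ?T (dg_proj G V (conjg g x)) (dg_proj G W (inv (conjg g x) \<otimes> conjg g z)) * dg_mat (dg_tensor G V W) g"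
          using V W g x z by (simp add: dg_tensor_mat[OF V W g] TT obj_mat_proj)
      qed simp
      also have "\<dots> = Q (conjg g z) * dg_mat (dg_tensor G V W) g"
        unfolding Q_def sum_distrib_right
        by (rule sum_conj[OF g, of "\<lambda>x. ?T (dg_proj G V x) (dg_proj G W (inv x \<otimes> conjg g z)) * dg_mat (dg_tensor G V W) g"])
      finally show ?thesis .
    qed
  qed
  have comp: "dg_comp (dg_tensor G V W) z = {u \<in> carrier_vec (?n * ?m). Q z * fm_of_vec u = fm_of_vec u}"
    if z: "z \<in> carrier G" for z
  proof -
    define S where "S = {tensor_vec v w | v w x y. x \<in> carrier G \<and> y \<in> carrier G \<and> x \<otimes> y = z \<and> v \<in> dg_comp V x \<and> w \<in> dg_comp W y}"
    have eq: "dg_comp (dg_tensor G V W) z = vspan (?n * ?m) S" by (simp add: dg_tensor_def S_def)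
    define K where "K = {u \<in> carrier_vec (?n * ?m). Q z * fm_of_vec u = fm_of_vec u}"
    have Kv: "vsubspace (?n * ?m) K"
      unfolding K_def vsubspace_iff by (auto simp: fm_of_vec_add fm_of_vec_smult distrib_left)
    have SK: "S \<subseteq> K"
    proof
      fix u assume "u \<in> S"
      then obtain v w x y where u: "u = tensor_vec v w" and x: "x \<in> carrier G" and y: "y \<in> carrier G" and xy: "x \<otimes> y = z"
        and v: "v \<in> dg_comp V x" and w: "w \<in> dg_comp W y" unfolding S_def by blast
      have vc: "v \<in> carrier_vec ?n" "dg_proj G V x * fm_of_vec v = fm_of_vec v" using v obj_comp[OF V x] by auto
      have wc: "w \<in> carrier_vec ?m" "dg_proj G W y * fm_of_vec w = fm_of_vec w" using w obj_comp[OF W y] by auto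
      have uc: "u \<in> carrier_vec (?n * ?m)" unfolding u tensor_vec_def using vc(1) wc(1) by auto
      have yeq: "inv x \<otimes> z = y" unfolding xy[symmetric] using x y by (simp add: m_assoc[symmetric])
      have "Q z * fm_of_vec u = (\<Sum>x'\<in>carrier G. ?t (dg_proj G V x' * fm_of_vec v) (dg_proj G W (inv x' \<otimes> z) * fm_of_vec w))"
        unfolding Q_def sum_distrib_right u fm_of_vec_tensor[OF vc(1) wc(1)] using V W z by (simp add: Tt del: One_nat_def)
      also have "\<dots> = (\<Sum>x'\<in>carrier G. if x' = x then ?t (fm_of_vec v) (fm_of_vec w) else 0)"
      proof (rule sum.cong)
        fix x' assume x': "x' \<in> carrier G"
        have "dg_proj G V x' * fm_of_vec v = (if x' = x then fm_of_vec v else 0)"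
          using obj_proj_mult_left[OF V x' x, of "fm_of_vec v"] vc(2) by auto
        then show "?t (dg_proj G V x' * fm_of_vec v) (dg_proj G W (inv x' \<otimes> z) * fm_of_vec w) =
            (if x' = x then ?t (fm_of_vec v) (fm_of_vec w) else 0)"
          using yeq wc(2) by (auto simp: fm_tensor_linear simp del: One_nat_def)
      qed simp
      also have "\<dots> = fm_of_vec u" unfolding u fm_of_vec_tensor[OF vc(1) wc(1)] using x by simp
      finally show "u \<in> K" unfolding K_def using uc by blast
    qed
    have Sc: "S \<subseteq> carrier_vec (?n * ?m)" using SK unfolding K_def by blast
    note span = vspan_vsubspace[OF Sc]
    have "K \<subseteq> vspan (?n * ?m) S"
    proof
      fix u assume "u \<in> K"
      then have u: "u \<in> carrier_vec (?n * ?m)" "Q z * fm_of_vec u = fm_of_vec u" unfolding K_def by auto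
      let ?N = "fm_of_vec ` vspan (?n * ?m) S"
      have N: "fm_subspace (?n * ?m) ?N" by (rule vsubspace_fm_subspace[OF span(1)])
      \<comment> \<open>A unit vector of the product is a pure tensor, so each summand of the
        projection sends it to a tensor of homogeneous vectors, that is, to a generator of the span.
        All other vectors are combinations of unit vectors.\<close>
      have gen: "?T (dg_proj G V x) (dg_proj G W (inv x \<otimes> z)) * fm_unit k 0 \<in> ?N"
        if x: "x \<in> carrier G" and k: "k < ?n * ?m" for x k
      proof -
        have "?m > 0" using k by (auto intro: ccontr)
        then have kk: "k div ?m < ?n" "k mod ?m < ?m" using k by (simp_all add: less_mult_imp_div_less)
        let ?v = "dg_proj G V x * fm_unit (k div ?m) 0" and ?w = "dg_proj G W (inv x \<otimes> z) * fm_unit (k mod ?m) 0"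
        have vc: "?v \<in> fm_carrier ?n 1" by (rule fm_mult_carrier[OF obj_proj_carrier[OF V x] fm_unit_carrier]) (use kk in auto)
        have xz: "inv x \<otimes> z \<in> carrier G" using x z by simp
        have wc: "?w \<in> fm_carrier ?m 1" by (rule fm_mult_carrier[OF obj_proj_carrier[OF W xz] fm_unit_carrier]) (use kk in auto)
        have v: "vec_of_fm ?n ?v \<in> dg_comp V x"
          unfolding obj_comp[OF V x] using fm_of_vec_of_fm[OF vc] obj_proj_mult_left[OF V x x] by simp
        have w: "vec_of_fm ?m ?w \<in> dg_comp W (inv x \<otimes> z)"
          unfolding obj_comp[OF W xz] using fm_of_vec_of_fm[OF wc] obj_proj_mult_left[OF W xz xz] by simp
        have mem: "tensor_vec (vec_of_fm ?n ?v) (vec_of_fm ?m ?w) \<in> S"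
        proof -
          have "x \<otimes> (inv x \<otimes> z) = z" using x z by (simp add: m_assoc[symmetric])
          then show ?thesis unfolding S_def using v w x xz by blast
        qed
        have "fm_of_vec (tensor_vec (vec_of_fm ?n ?v) (vec_of_fm ?m ?w)) = ?t ?v ?w"
          unfolding fm_of_vec_tensor[OF vec_of_fm_carrier vec_of_fm_carrier] fm_of_vec_of_fm[OF vc] fm_of_vec_of_fm[OF wc] ..
        moreover have "?T (dg_proj G V x) (dg_proj G W (inv x \<otimes> z)) * fm_unit k 0 = ?t ?v ?w"
          unfolding fm_unit_tensor[OF k] by (rule Tt[OF obj_proj_carrier[OF V x] obj_proj_carrier[OF W xz]])
        ultimately have "?T (dg_proj G V x) (dg_proj G W (inv x \<otimes> z)) * fm_unit k 0
            = fm_of_vec (tensor_vec (vec_of_fm ?n ?v) (vec_of_fm ?m ?w))" by simp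
        then show ?thesis by (rule image_eqI[OF _ subsetD[OF span(2) mem]])
      qed
      have "Q z * fm_of_vec u \<in> ?N"
        unfolding Q_def sum_distrib_right
      proof (rule fm_subspace_sum[OF N])
        fix x assume x: "x \<in> carrier G"
        let ?A = "?T (dg_proj G V x) (dg_proj G W (inv x \<otimes> z))"
        have "?A * fm_of_vec u = ?A * (\<Sum>k<?n * ?m. fm_scale (fm_nth (fm_of_vec u) k 0) (fm_unit k 0))"
          using fm_column_expansion[OF fm_of_vec_carrier[OF u(1)]] by simp
        also have "\<dots> = (\<Sum>k<?n * ?m. fm_scale (fm_nth (fm_of_vec u) k 0) (?A * fm_unit k 0))"
          by (simp add: sum_distrib_left)
        also have "\<dots> \<in> ?N"
          by (intro fm_subspace_sum[OF N] fm_subspace_scale[OF N] gen[OF x]) simp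
        finally show "?A * fm_of_vec u \<in> ?N" .
      qed
      then have "fm_of_vec u \<in> ?N" unfolding u(2) .
      moreover have "vspan (?n * ?m) S \<subseteq> carrier_vec (?n * ?m)" using span(1) unfolding vsubspace_iff by blast
      ultimately show "u \<in> vspan (?n * ?m) S" using fm_of_vec_mem_image u(1) by blast
    qed
    then show ?thesis using span(3)[OF Kv SK] unfolding eq K_def by blast
  qed
  have act: "dg_act (dg_tensor G V W) g \<in> carrier_mat (?n * ?m) (?n * ?m)" if "g \<in> carrier G" for g
    using obj_act_carrier[OF V that] obj_act_carrier[OF W that] by (simp add: dg_tensor_def tensor_mat_def)
  show ?thesis unfolding dg_realizes_def dg_tensor_dim Q_def[symmetric] using mod comp act by blast
qed

lemma dg_tensor_obj: "dg_obj G V \<Longrightarrow> dg_obj G W \<Longrightarrow> dg_obj G (dg_tensor G V W)" for V W :: "('a, 'k::field) dgrep"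
  by (rule dg_realizes_obj[OF dg_tensor_realizes])

lemma dg_tensor_proj:
  "dg_obj G V \<Longrightarrow> dg_obj G W \<Longrightarrow> z \<in> carrier G \<Longrightarrow> dg_proj G (dg_tensor G V W) z = (\<Sum>x\<in>carrier G.
     fm_tensor (dg_dim V) (dg_dim V) (dg_dim W) (dg_dim W) (dg_proj G V x) (dg_proj G W (inv x \<otimes> z)))"
  for V W :: "('a, 'k::field) dgrep"
  using dg_realizes_unique[OF dg_realizes_proj[OF dg_tensor_obj] dg_tensor_realizes] .

lemma dg_tensor_proj_apply:
  fixes V W :: "('a, 'k::field) dgrep"
  assumes V: "dg_obj G V" and W: "dg_obj G W" and x: "x \<in> carrier G" and y: "y \<in> carrier G"
    and v: "dg_proj G V x * v = v" and w: "dg_proj G W y * w = w"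
  shows "dg_proj G (dg_tensor G V W) (x \<otimes> y) * fm_tensor (dg_dim V) 1 (dg_dim W) 1 v w
    = fm_tensor (dg_dim V) 1 (dg_dim W) 1 v w"
proof -
  let ?t = "fm_tensor (dg_dim V) 1 (dg_dim W) 1 :: 'k fmat \<Rightarrow> 'k fmat \<Rightarrow> 'k fmat"
  have "dg_proj G (dg_tensor G V W) (x \<otimes> y) * ?t v w
      = (\<Sum>x'\<in>carrier G. ?t (dg_proj G V x' * v) (dg_proj G W (inv x' \<otimes> (x \<otimes> y)) * w))"
    unfolding dg_tensor_proj[OF V W m_closed[OF x y]] sum_distrib_right
    using V W x y by (intro sum.cong refl fm_tensor_mult) auto
  also have "\<dots> = (\<Sum>x'\<in>carrier G. if x' = x then ?t v w else 0)"
  proof (rule sum.cong)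
    fix x' assume x': "x' \<in> carrier G"
    have 1: "dg_proj G V x' * v = (if x' = x then v else 0)"
      using obj_proj_mult_left[OF V x' x, of v] v by auto
    have "inv x \<otimes> (x \<otimes> y) = y" using x y by (simp add: m_assoc[symmetric])
    then show "?t (dg_proj G V x' * v) (dg_proj G W (inv x' \<otimes> (x \<otimes> y)) * w) = (if x' = x then ?t v w else 0)"
      using w unfolding 1 by (auto simp: fm_tensor_linear)
  qed simp
  also have "\<dots> = ?t v w" using x by simp
  finally show ?thesis .
qed

lemma dg_tensor_mat_apply:
  fixes V W :: "('a, 'k::field) dgrep"
  assumes V: "dg_obj G V" and W: "dg_obj G W" and g: "g \<in> carrier G"
  shows "dg_mat (dg_tensor G V W) g * fm_tensor (dg_dim V) 1 (dg_dim W) 1 v w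
    = fm_tensor (dg_dim V) 1 (dg_dim W) 1 (dg_mat V g * v) (dg_mat W g * w)"
  unfolding dg_tensor_mat[OF V W g] by (rule fm_tensor_mult) (use V W g in auto)

end

section \<open>The category attached to a bicharacter\<close>

lemma fm_block_inj:
  fixes A D :: "'a::comm_ring_1 fmat"
  assumes c: "A \<in> fm_carrier n n" "A' \<in> fm_carrier n n" "D \<in> fm_carrier m m" "D' \<in> fm_carrier m m"
    and eq: "fm_block n m A D = fm_block n m A' D'"
  shows "A = A'" and "D = D'"
proof -
  let ?S = "fm_shift n m :: 'a fmat"
  have o: "fm_one n * (?S * X) = 0" for X
  proof -
    have "fm_one n * ?S = 0" by (rule fm_mult_shift_zero[OF fm_one_carrier])
    then show ?thesis by (simp add: mult.assoc[symmetric])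
  qed
  have A: "fm_one n * fm_block n m B E = B" if "B \<in> fm_carrier n n" for B E :: "'a fmat"
    using that unfolding fm_block_def by (simp add: distrib_left mult.assoc o)
  show "A = A'" using A[OF c(1), of D] A[OF c(2), of D'] eq by simp
  have D: "fm_transpose ?S * fm_block n m B E * ?S = E" if "B \<in> fm_carrier n n" "E \<in> fm_carrier m m" for B E :: "'a fmat"
  proof -
    have "fm_transpose ?S * fm_block n m B E * ?S = (fm_transpose ?S * ?S) * E * (fm_transpose ?S * ?S)"
      using fm_transpose_shift_zero[OF that(1), of m] unfolding fm_block_def
      by (simp add: ring_distribs mult.assoc[symmetric])
    then show ?thesis using that(2) by (simp add: fm_transpose_shift_mult)
  qed
  show "D = D'" using D[OF c(1,3)] D[OF c(2,4)] eq by simp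
qed

lemma fm_block_scale: "fm_block n m (fm_scale c A) (fm_scale c D) = fm_scale c (fm_block n m A D)"
  for A :: "'a::comm_ring_1 fmat"
  unfolding fm_block_def by (simp add: fm_scale_add)

text \<open>In characteristic zero the rank of an idempotent is its trace.\<close>

lemma fm_idempotent_trace_one:
  fixes E :: "'k::field_char_0 fmat"
  assumes E: "E \<in> fm_carrier n n" and EE: "E * E = E" and tr: "fm_trace E = of_nat n"
  shows "E = fm_one n"
proof -
  obtain r A B where AB: "A \<in> fm_carrier n r" "B \<in> fm_carrier r n" "B * A = fm_one r" "A * B = E"
    using E EE by (rule fm_idempotent_factor)
  have "fm_trace E = fm_trace (B * A)" unfolding AB(4)[symmetric] by (rule fm_trace_commute)
  then have "r = n" using tr AB(3) by simp
  then show ?thesis using fm_left_right_inverse[of A n B] AB by simp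
qed

text \<open>The subcategory attached to (H, B), described without class representatives or
  characters; \<open>bichar_subcategory_eq\<close> identifies it with the one generated by labelled
  simple objects.\<close>

definition bichar_objects :: "('g, 'b) monoid_scheme \<Rightarrow> 'g set \<Rightarrow> ('g \<times> 'g \<Rightarrow> 'k::field) \<Rightarrow> ('g, 'k) dgrep set" where
  "bichar_objects G H B = {V. dg_obj G V \<and>
     (\<forall>x\<in>carrier G - H. dg_proj G V x = 0) \<and>
     (\<forall>x\<in>H. \<forall>h\<in>H. dg_mat V h * dg_proj G V x = fm_scale (B (x, h)) (dg_proj G V x))}"

section \<open>Closure properties of the objects on which H acts through B, and their
  dimension\<close>

locale normal_bichar = finite_group G for G :: "('a, 'b) monoid_scheme" (structure) +
  fixes H :: "'a set" and B :: "'a \<times> 'a \<Rightarrow> 'k::{alg_closed_field, field_char_0}"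
  assumes normal: "H \<lhd> G" and comm: "comm_group (G\<lparr>carrier := H\<rparr>)"
    and alternating: "alternating_bichar G H B" and invariant: "invariant_bichar G H B"
begin

lemma H_subgroup: "subgroup H G"
  by (rule normal_imp_subgroup[OF normal])

lemma H_carrier [simp]: "x \<in> H \<Longrightarrow> x \<in> carrier G"
  using subgroup.subset[OF H_subgroup] by blast

lemma H_closed [simp]: "\<one> \<in> H" "x \<in> H \<Longrightarrow> y \<in> H \<Longrightarrow> x \<otimes> y \<in> H" "x \<in> H \<Longrightarrow> inv x \<in> H"
  using subgroup.one_closed[OF H_subgroup] subgroup.m_closed[OF H_subgroup] subgroup.m_inv_closed[OF H_subgroup] by auto

lemma H_conj [simp]: "g \<in> carrier G \<Longrightarrow> x \<in> H \<Longrightarrow> conjg g x \<in> H"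
  using normal.inv_op_closed2[OF normal] by blast

lemma H_conj_inv [simp]: "g \<in> carrier G \<Longrightarrow> x \<in> H \<Longrightarrow> inv g \<otimes> x \<otimes> g \<in> H"
  using H_conj[of "inv g" x] by simp

lemma H_comm: "x \<in> H \<Longrightarrow> y \<in> H \<Longrightarrow> x \<otimes> y = y \<otimes> x"
  using comm_monoid.m_comm[OF comm_group.axioms(1)[OF comm]] by simp

lemma H_conj_H: "x \<in> H \<Longrightarrow> h \<in> H \<Longrightarrow> conjg h x = x"
  using H_comm[of h x] by (simp add: m_assoc)

lemma finite_H [simp]: "finite H"
  by (rule finite_subset[OF subgroup.subset[OF H_subgroup] finite_carrier])

lemma card_H [simp]: "of_nat (card H) \<noteq> (0::'k)"
proof -
  have "H \<noteq> {}" using H_closed(1) by blast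
  then show ?thesis by simp
qed

lemma B_nz [simp]: "x \<in> H \<Longrightarrow> y \<in> H \<Longrightarrow> B (x, y) \<noteq> 0"
  and B_mult1: "x \<in> H \<Longrightarrow> y \<in> H \<Longrightarrow> z \<in> H \<Longrightarrow> B (x \<otimes> y, z) = B (x, z) * B (y, z)"
  and B_mult2: "x \<in> H \<Longrightarrow> y \<in> H \<Longrightarrow> z \<in> H \<Longrightarrow> B (x, y \<otimes> z) = B (x, y) * B (x, z)"
  and B_self [simp]: "x \<in> H \<Longrightarrow> B (x, x) = 1"
  using alternating unfolding alternating_bichar_def by (auto simp: PiE_def Pi_def)

lemma B_conj: "g \<in> carrier G \<Longrightarrow> x \<in> H \<Longrightarrow> y \<in> H \<Longrightarrow> B (conjg g x, conjg g y) = B (x, y)"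
  using invariant unfolding invariant_bichar_def by blast

lemma B_one [simp]: "x \<in> H \<Longrightarrow> B (x, \<one>) = 1" "x \<in> H \<Longrightarrow> B (\<one>, x) = 1"
  using B_mult2[of x \<one> \<one>] B_mult1[of \<one> \<one> x] by auto

lemma B_inv: "x \<in> H \<Longrightarrow> y \<in> H \<Longrightarrow> B (inv x, inv y) = B (x, y)"
proof -
  assume xy: "x \<in> H" "y \<in> H"
  have "B (x, inv y) * B (inv x, inv y) = 1" using B_mult1[of x "inv x" "inv y"] xy by simp
  moreover have "B (x, y) * B (x, inv y) = 1" using B_mult2[of x y "inv y"] xy by simp
  ultimately show ?thesis by (metis mult.assoc mult.commute mult_1_left)
qed

lemma sum_H_mult: "h \<in> H \<Longrightarrow> (\<Sum>x\<in>H. f (h \<otimes> x)) = (\<Sum>x\<in>H. f x)"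
  by (rule sum.reindex_bij_witness[of _ "\<lambda>x. inv h \<otimes> x" "\<lambda>x. h \<otimes> x"]) (auto simp: m_assoc[symmetric])

lemma sum_H_conj: "g \<in> carrier G \<Longrightarrow> (\<Sum>x\<in>H. f (conjg g x)) = (\<Sum>x\<in>H. f x)"
  by (rule sum.reindex_bij_witness[of _ "conjg (inv g)" "conjg g"]) auto

abbreviation L :: "('a, 'k) dgrep set" where
  "L \<equiv> bichar_objects G H B"

lemma L_obj: "V \<in> L \<Longrightarrow> dg_obj G V"
  and L_proj: "V \<in> L \<Longrightarrow> x \<in> carrier G \<Longrightarrow> x \<notin> H \<Longrightarrow> dg_proj G V x = 0"
  and L_mat: "V \<in> L \<Longrightarrow> x \<in> H \<Longrightarrow> h \<in> H \<Longrightarrow> dg_mat V h * dg_proj G V x = fm_scale (B (x, h)) (dg_proj G V x)"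
  unfolding bichar_objects_def by auto

text \<open>The projections of a retract are \<open>b * dg_proj G V x * a\<close>, so both
  conditions are inherited by multiplying with \<open>b\<close> and \<open>a\<close>.\<close>

lemma L_retract:
  assumes V: "V \<in> L" and W: "dg_retract G W V"
  shows "W \<in> L"
proof -
  obtain a b where a: "a \<in> fm_hom G W V" and b: "b \<in> fm_hom G V W" and ba: "b * a = fm_one (dg_dim W)" and Wo: "dg_obj G W"
    using W unfolding dg_retract_def by blast
  have P: "dg_proj G W x = b * dg_proj G V x * a" if "x \<in> carrier G" for x
  proof -
    have "dg_proj G W x = dg_proj G W x * (b * a)" unfolding ba using Wo that by simp
    then show ?thesis using fm_homD(3)[OF b that] by (simp add: mult.assoc[symmetric])
  qed
  show ?thesis unfolding bichar_objects_def
  proof (intro CollectI conjI ballI)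
    show "dg_proj G W x = 0" if "x \<in> carrier G - H" for x using P L_proj[OF V] that by simp
    show "dg_mat W h * dg_proj G W x = fm_scale (B (x, h)) (dg_proj G W x)" if x: "x \<in> H" and h: "h \<in> H" for x h
    proof -
      have "dg_mat W h * dg_proj G W x = b * (dg_mat V h * dg_proj G V x) * a"
        using P[of x] fm_homD(2)[OF b, of h] x h by (simp add: mult.assoc[symmetric])
      then show ?thesis unfolding L_mat[OF V x h] using P[of x] x by simp
    qed
  qed (rule Wo)
qed

lemma dg_iso_retract: "dg_obj G V \<Longrightarrow> dg_obj G W \<Longrightarrow> dg_iso G V W \<Longrightarrow> dg_retract G W V"
  for V W :: "('a, 'k) dgrep"
  unfolding dg_retract_def dg_iso_iff by blast

lemma L_iso: "V \<in> L \<Longrightarrow> dg_obj G W \<Longrightarrow> dg_iso G V W \<Longrightarrow> W \<in> L"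
  using L_retract dg_iso_retract L_obj by blast

lemma L_sum_iff:
  assumes V: "dg_obj G V" and W: "dg_obj G W"
  shows "dg_sum V W \<in> L \<longleftrightarrow> V \<in> L \<and> W \<in> L"
proof -
  let ?b = "fm_block (dg_dim V) (dg_dim W) :: 'k fmat \<Rightarrow> 'k fmat \<Rightarrow> 'k fmat"
  have inj: "?b A D = ?b A' D' \<longleftrightarrow> A = A' \<and> D = D'"
    if "A \<in> fm_carrier (dg_dim V) (dg_dim V)" "A' \<in> fm_carrier (dg_dim V) (dg_dim V)"
      "D \<in> fm_carrier (dg_dim W) (dg_dim W)" "D' \<in> fm_carrier (dg_dim W) (dg_dim W)" for A A' D D'
    using fm_block_inj[OF that] by blast
  have 1: "dg_proj G (dg_sum V W) x = 0 \<longleftrightarrow> dg_proj G V x = 0 \<and> dg_proj G W x = 0" if "x \<in> carrier G" for x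
    using inj[OF obj_proj_carrier[OF V that] fm_zero_carrier obj_proj_carrier[OF W that] fm_zero_carrier]
    unfolding dg_sum_proj[OF V W that] fm_block_zero .
  have 2: "dg_mat (dg_sum V W) h * dg_proj G (dg_sum V W) x = fm_scale c (dg_proj G (dg_sum V W) x) \<longleftrightarrow>
     dg_mat V h * dg_proj G V x = fm_scale c (dg_proj G V x) \<and> dg_mat W h * dg_proj G W x = fm_scale c (dg_proj G W x)"
    if x: "x \<in> carrier G" and h: "h \<in> carrier G" for x h c
    unfolding dg_sum_proj[OF V W x] dg_sum_mat[OF V W h] fm_block_scale[symmetric]
    using V W x h by (simp add: fm_block_mult inj)
  show ?thesis
    unfolding bichar_objects_def using V W dg_sum_obj[OF V W] 1 2 by (simp) blast
qed

text \<open>The degree-z part of the product is built from degrees x and x^-1 z, both in H, on which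
  h acts by B (x, h) and B (x^-1 z, h); multiplicativity in the first variable gives B (z,
  h).\<close>

lemma L_tensor:
  assumes V: "V \<in> L" and W: "W \<in> L"
  shows "dg_tensor G V W \<in> L"
proof -
  note Vo = L_obj[OF V] and Wo = L_obj[OF W]
  let ?T = "fm_tensor (dg_dim V) (dg_dim V) (dg_dim W) (dg_dim W) :: 'k fmat \<Rightarrow> 'k fmat \<Rightarrow> 'k fmat"
  show ?thesis unfolding bichar_objects_def
  proof (intro CollectI conjI ballI)
    show "dg_obj G (dg_tensor G V W)" by (rule dg_tensor_obj[OF Vo Wo])
    show "dg_proj G (dg_tensor G V W) z = 0" if z: "z \<in> carrier G - H" for z
    proof -
      have "?T (dg_proj G V x) (dg_proj G W (inv x \<otimes> z)) = 0" if x: "x \<in> carrier G" for x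
      proof (cases "x \<in> H")
        case True
        have "inv x \<otimes> z \<notin> H"
        proof
          assume "inv x \<otimes> z \<in> H"
          then have "x \<otimes> (inv x \<otimes> z) \<in> H" using True by simp
          then show False using x z by (simp add: m_assoc[symmetric])
        qed
        then have "dg_proj G W (inv x \<otimes> z) = 0" using L_proj[OF W] x z by simp
        then show ?thesis by (simp add: fm_tensor_linear)
      next
        case False
        then show ?thesis using L_proj[OF V x] by (simp add: fm_tensor_linear)
      qed
      then show ?thesis using dg_tensor_proj[OF Vo Wo, of z] z by simp
    qed
    show "dg_mat (dg_tensor G V W) h * dg_proj G (dg_tensor G V W) z = fm_scale (B (z, h)) (dg_proj G (dg_tensor G V W) z)"
      if z: "z \<in> H" and h: "h \<in> H" for z h
    proof -
      have "dg_mat (dg_tensor G V W) h * ?T (dg_proj G V x) (dg_proj G W (inv x \<otimes> z)) =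
         fm_scale (B (z, h)) (?T (dg_proj G V x) (dg_proj G W (inv x \<otimes> z)))" if x: "x \<in> carrier G" for x
      proof (cases "x \<in> H")
        case True
        then have xz: "inv x \<otimes> z \<in> H" using z by simp
        have B: "B (z, h) = B (x, h) * B (inv x \<otimes> z, h)"
          using B_mult1[OF True xz h] True z by (simp add: m_assoc[symmetric])
        have "dg_mat (dg_tensor G V W) h * ?T (dg_proj G V x) (dg_proj G W (inv x \<otimes> z))
           = ?T (dg_mat V h * dg_proj G V x) (dg_mat W h * dg_proj G W (inv x \<otimes> z))"
          unfolding dg_tensor_mat[OF Vo Wo H_carrier[OF h]] by (rule fm_tensor_mult) (use Vo Wo h in auto)
        also have "\<dots> = fm_scale (B (z, h)) (?T (dg_proj G V x) (dg_proj G W (inv x \<otimes> z)))"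
          unfolding L_mat[OF V True h] L_mat[OF W xz h] B by (simp add: fm_tensor_linear mult.commute)
        finally show ?thesis .
      next
        case False
        then show ?thesis using L_proj[OF V x] by (simp add: fm_tensor_linear)
      qed
      then show ?thesis
        unfolding dg_tensor_proj[OF Vo Wo H_carrier[OF z]] by (simp add: sum_distrib_left fm_scale_sum)
    qed
  qed
qed

text \<open>Passing to the dual inverts both the degree and the acting element, and B takes the same
  value on the two inverses.\<close>

lemma L_dual:
  assumes V: "V \<in> L"
  shows "dg_dual G V \<in> L"
  unfolding bichar_objects_def
proof (intro CollectI conjI ballI)
  note Vo = L_obj[OF V]
  show "dg_obj G (dg_dual G V)" by (rule dg_dual_obj[OF Vo])
  show "dg_proj G (dg_dual G V) x = 0" if x: "x \<in> carrier G - H" for x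
  proof -
    have "inv x \<notin> H" using x H_closed(3)[of "inv x"] by auto
    then show ?thesis using dg_dual_proj[OF Vo] x L_proj[OF V] by simp
  qed
  show "dg_mat (dg_dual G V) h * dg_proj G (dg_dual G V) x = fm_scale (B (x, h)) (dg_proj G (dg_dual G V) x)"
    if x: "x \<in> H" and h: "h \<in> H" for x h
  proof -
    have "dg_proj G V (inv x) * dg_mat V (inv h) = dg_mat V (inv h) * dg_proj G V (inv x)"
      using obj_mat_proj[OF Vo, of "inv h" "inv x"] H_conj_H[of "inv x" "inv h"] x h by simp
    also have "\<dots> = fm_scale (B (x, h)) (dg_proj G V (inv x))" using L_mat[OF V, of "inv x" "inv h"] x h by (simp add: B_inv)
    finally show ?thesis using x by (simp add: dg_dual_mat dg_dual_proj[OF Vo] fm_transpose_mult[symmetric])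
  qed
qed

lemma L_unit: "dg_unit G \<in> L"
  unfolding bichar_objects_def by (auto simp: dg_unit_proj dg_unit_mat simp del: One_nat_def)

lemma L_zero: "dg_zero \<in> L"
  unfolding bichar_objects_def by auto

lemma L_sums: "\<forall>W\<in>set Ws. W \<in> L \<Longrightarrow> dg_sums Ws \<in> L"
  by (induction Ws) (auto simp: L_zero L_sum_iff L_obj)

text \<open>The twist on degree x is the action of x itself, that is, the scalar B (x, x), which is
  1 because B is alternating.\<close>

lemma L_isotropic: "isotropic G L"
  unfolding isotropic_def fusion_subcategory_def
proof (intro conjI ballI allI impI)
  show "L \<subseteq> Collect (dg_obj G)" using L_obj by blast
  show "dg_twist G V v = v" if V: "V \<in> L" and v: "v \<in> carrier_vec (dg_dim V)" for V v
  proof -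
    have "\<forall>x\<in>carrier G. dg_mat V x * dg_proj G V x = dg_proj G V x"
    proof
      fix x assume "x \<in> carrier G"
      then show "dg_mat V x * dg_proj G V x = dg_proj G V x"
        using L_mat[OF V, of x x] L_proj[OF V, of x] by (cases "x \<in> H") auto
    qed
    then show ?thesis using dg_twist_trivial_iff[OF L_obj[OF V]] v by blast
  qed
  show "W \<in> L" if "V \<in> L \<and> dg_obj G W \<and> dg_iso G V W" for V W using that L_iso by blast
  show "dg_sum V W \<in> L" if "V \<in> L" "W \<in> L" for V W using that L_sum_iff[OF L_obj L_obj] by blast
  show "V \<in> L" "W \<in> L" if "dg_obj G V \<and> dg_obj G W \<and> dg_sum V W \<in> L" for V W
    using that L_sum_iff by blast+
qed (rule L_tensor L_dual L_unit; assumption?)+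

text \<open>The projection of the component of degree \<open>a\<close> onto the part on which \<open>H\<close> acts through \<open>B (a, _)\<close>.\<close>

definition iso_proj :: "('a, 'k) dgrep \<Rightarrow> 'a \<Rightarrow> 'k fmat" where
  "iso_proj V a = fm_scale (1 / of_nat (card H)) (\<Sum>h\<in>H. fm_scale (inverse (B (a, h))) (dg_mat V h * dg_proj G V a))"

context
  fixes V :: "('a, 'k) dgrep"
  assumes V: "dg_obj G V"
begin

lemma mat_proj_commute: "a \<in> H \<Longrightarrow> h \<in> H \<Longrightarrow> dg_mat V h * dg_proj G V a = dg_proj G V a * dg_mat V h"
  using obj_mat_proj[OF V, of h a] H_conj_H by simp

lemma iso_proj_carrier: "a \<in> H \<Longrightarrow> iso_proj V a \<in> fm_carrier (dg_dim V) (dg_dim V)"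
  unfolding iso_proj_def using V by (intro fm_scale_carrier fm_sum_carrier) auto

lemma iso_proj_mult_proj: "a \<in> H \<Longrightarrow> x \<in> carrier G \<Longrightarrow> iso_proj V a * dg_proj G V x = (if a = x then iso_proj V a else 0)"
  unfolding iso_proj_def by (auto simp: sum_distrib_right mult.assoc obj_proj_mult[OF V])

lemma proj_mult_iso_proj: "a \<in> H \<Longrightarrow> x \<in> carrier G \<Longrightarrow> dg_proj G V x * iso_proj V a = (if a = x then iso_proj V a else 0)"
  unfolding iso_proj_def by (auto simp: sum_distrib_left mat_proj_commute obj_proj_mult_left[OF V])

lemma mat_mult_iso_proj: "a \<in> H \<Longrightarrow> h \<in> H \<Longrightarrow> dg_mat V h * iso_proj V a = fm_scale (B (a, h)) (iso_proj V a)"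
proof -
  assume a: "a \<in> H" and h: "h \<in> H"
  define f where "f k = fm_scale (inverse (B (a, k))) (dg_mat V k * dg_proj G V a)" for k
  have "dg_mat V h * f k = fm_scale (B (a, h)) (f (h \<otimes> k))" if k: "k \<in> H" for k
  proof -
    have "inverse (B (a, k)) = B (a, h) * inverse (B (a, h \<otimes> k))" using a h k by (simp add: B_mult2)
    then show ?thesis unfolding f_def using obj_mat_mult[OF V, of h k] a h k by (simp add: mult.assoc)
  qed
  then have "dg_mat V h * (\<Sum>k\<in>H. f k) = fm_scale (B (a, h)) (\<Sum>k\<in>H. f (h \<otimes> k))"
    by (simp add: sum_distrib_left fm_scale_sum)
  then show ?thesis unfolding iso_proj_def f_def[symmetric] sum_H_mult[OF h, of f] by (simp add: mult.commute)
qed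

lemma iso_proj_idem: "a \<in> H \<Longrightarrow> iso_proj V a * iso_proj V a = iso_proj V a"
proof -
  assume a: "a \<in> H"
  have "(\<Sum>h\<in>H. fm_scale (inverse (B (a, h))) (dg_mat V h * dg_proj G V a)) * iso_proj V a
      = (\<Sum>h\<in>H. fm_scale (inverse (B (a, h))) (dg_mat V h * iso_proj V a))"
    using a by (simp add: sum_distrib_right mult.assoc proj_mult_iso_proj)
  also have "\<dots> = (\<Sum>h\<in>H. fm_scale 1 (iso_proj V a))" using a by (simp add: mat_mult_iso_proj)
  also have "\<dots> = fm_scale (of_nat (card H)) (iso_proj V a)" unfolding fm_scale_sum_left by simp
  finally have "iso_proj V a * iso_proj V a = fm_scale (1 / of_nat (card H) * of_nat (card H)) (iso_proj V a)"
    by (subst (1) iso_proj_def) simp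
  then show ?thesis using card_H by (simp del: card_H)
qed

text \<open>Invariance of B enters here: g carries the part of degree a on which H acts through B
  (a, _) to the corresponding part of degree g a g^-1. Hence the sum over all a in H is an
  endomorphism.\<close>

lemma mat_iso_proj: "g \<in> carrier G \<Longrightarrow> a \<in> H \<Longrightarrow> dg_mat V g * iso_proj V a = iso_proj V (conjg g a) * dg_mat V g"
proof -
  assume g: "g \<in> carrier G" and a: "a \<in> H"
  define f where "f k = fm_scale (inverse (B (conjg g a, k))) (dg_mat V k * dg_proj G V (conjg g a))" for k
  have "dg_mat V g * fm_scale (inverse (B (a, h))) (dg_mat V h * dg_proj G V a) = f (conjg g h) * dg_mat V g" if h: "h \<in> H" for h
  proof -
    have "dg_mat V g * (dg_mat V h * dg_proj G V a) = dg_mat V (g \<otimes> h) * dg_proj G V a"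
      using obj_mat_mult[OF V, of g h] g h by (simp add: mult.assoc)
    also have "g \<otimes> h = conjg g h \<otimes> g" using g h by (simp add: m_assoc)
    also have "dg_mat V (conjg g h \<otimes> g) * dg_proj G V a = dg_mat V (conjg g h) * (dg_mat V g * dg_proj G V a)"
      using obj_mat_mult[OF V, of "conjg g h" g] g h by (simp add: mult.assoc)
    also have "\<dots> = dg_mat V (conjg g h) * dg_proj G V (conjg g a) * dg_mat V g"
      using obj_mat_proj[OF V g, of a] a by (simp add: mult.assoc)
    finally show ?thesis unfolding f_def using B_conj[OF g a h] by simp
  qed
  then have "dg_mat V g * (\<Sum>h\<in>H. fm_scale (inverse (B (a, h))) (dg_mat V h * dg_proj G V a)) = (\<Sum>h\<in>H. f (conjg g h)) * dg_mat V g"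
    by (simp add: sum_distrib_left sum_distrib_right)
  then show ?thesis unfolding iso_proj_def f_def[symmetric] sum_H_conj[OF g, of f] by simp
qed

lemma sum_iso_proj_hom: "(\<Sum>a\<in>H. iso_proj V a) \<in> fm_hom G V V"
  unfolding fm_hom_def
proof (intro CollectI conjI ballI)
  show "(\<Sum>a\<in>H. iso_proj V a) \<in> fm_carrier (dg_dim V) (dg_dim V)" by (intro fm_sum_carrier iso_proj_carrier)
  show "(\<Sum>a\<in>H. iso_proj V a) * dg_mat V g = dg_mat V g * (\<Sum>a\<in>H. iso_proj V a)" if g: "g \<in> carrier G" for g
  proof -
    have "dg_mat V g * (\<Sum>a\<in>H. iso_proj V a) = (\<Sum>a\<in>H. iso_proj V (conjg g a)) * dg_mat V g"
      by (simp add: sum_distrib_left sum_distrib_right mat_iso_proj g)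
    then show ?thesis unfolding sum_H_conj[OF g, of "iso_proj V"] ..
  qed
  show "(\<Sum>a\<in>H. iso_proj V a) * dg_proj G V x = dg_proj G V x * (\<Sum>a\<in>H. iso_proj V a)" if x: "x \<in> carrier G" for x
    unfolding sum_distrib_left sum_distrib_right
    by (rule sum.cong) (use x in \<open>auto simp: iso_proj_mult_proj proj_mult_iso_proj\<close>)
qed

lemma iso_proj_mult: "a \<in> H \<Longrightarrow> b \<in> H \<Longrightarrow> iso_proj V a * iso_proj V b = (if a = b then iso_proj V a else 0)"
proof -
  assume a: "a \<in> H" and b: "b \<in> H"
  have "iso_proj V a * iso_proj V b = iso_proj V a * (dg_proj G V a * iso_proj V b)"
    using iso_proj_mult_proj[OF a, of a] a by (simp add: mult.assoc[symmetric])
  then show ?thesis using proj_mult_iso_proj[OF b, of a] iso_proj_idem[OF a] a by auto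
qed

lemma fm_trace_iso_proj:
  "a \<in> H \<Longrightarrow> fm_trace (iso_proj V a) = 1 / of_nat (card H) * (\<Sum>h\<in>H. inverse (B (a, h)) * dg_char G V a h)"
  unfolding iso_proj_def dg_char_def by (simp add: fm_trace_sum mat_proj_commute)

end

lemma iso_proj_in_L:
  assumes V: "V \<in> L" and a: "a \<in> H"
  shows "iso_proj V a = dg_proj G V a"
proof -
  have "(\<Sum>h\<in>H. fm_scale (inverse (B (a, h))) (dg_mat V h * dg_proj G V a)) = (\<Sum>h\<in>H. fm_scale 1 (dg_proj G V a))"
    using L_mat[OF V a] a by simp
  also have "\<dots> = fm_scale (of_nat (card H)) (dg_proj G V a)" unfolding fm_scale_sum_left by simp
  finally have "iso_proj V a = fm_scale (1 / of_nat (card H) * of_nat (card H)) (dg_proj G V a)"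
    unfolding iso_proj_def by simp
  then show ?thesis using card_H by (simp del: card_H)
qed

text \<open>The sum \<open>e\<close> of all these projections is an idempotent endomorphism, hence
  the scalar 0 or 1 on a simple object. The value 1 would mean that the object is supported on H
  with H acting through B.\<close>

lemma iso_proj_not_in_L:
  assumes sV: "dg_simple G V" and nL: "V \<notin> L" and a: "a \<in> H"
  shows "iso_proj V a = 0"
proof -
  let ?n = "dg_dim V"
  define e where "e = (\<Sum>a\<in>H. iso_proj V a)"
  have V: "dg_obj G V" and n: "?n > 0" using sV by (auto simp: dg_simple_def)
  obtain c where c: "e = fm_scale c (fm_one ?n)"
    using dg_schur_scalar[OF sV sum_iso_proj_hom[OF V]] unfolding e_def by blast
  have ea: "e * iso_proj V a = iso_proj V a" if "a \<in> H" for a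
    unfolding e_def sum_distrib_right using that by (simp add: iso_proj_mult[OF V] cong: sum.cong)
  have ep: "e * dg_proj G V x = (if x \<in> H then iso_proj V x else 0)" if "x \<in> carrier G" for x
    unfolding e_def sum_distrib_right using that by (simp add: iso_proj_mult_proj[OF V] cong: sum.cong)
  have "c = 0"
  proof (rule ccontr)
    assume c0: "c \<noteq> 0"
    have "e * e = e" unfolding e_def[symmetric] by (subst (2) e_def) (simp add: sum_distrib_left ea, simp add: e_def)
    then have "fm_scale (c * c - c) (fm_one ?n) = (0::'k fmat)"
      unfolding c by (auto intro!: fmat_eqI simp: fm_nth_simps algebra_simps dest: arg_cong[of _ _ "\<lambda>A. fm_nth A _ _"])
    then have "c * c - c = 0" using n by (simp add: fm_scale_eq_0_iff)
    then have "c = 1" using c0 by simp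
    then have e1: "e = fm_one ?n" unfolding c by simp
    have "V \<in> L" unfolding bichar_objects_def
    proof (intro CollectI conjI ballI V)
      show "dg_proj G V x = 0" if "x \<in> carrier G - H" for x
        using ep[of x] that V unfolding e1 by simp
      show "dg_mat V h * dg_proj G V x = fm_scale (B (x, h)) (dg_proj G V x)" if x: "x \<in> H" and h: "h \<in> H" for x h
        using ep[of x] x mat_mult_iso_proj[OF V x h] V unfolding e1 by simp
    qed
    then show False using nL by blast
  qed
  then show ?thesis using ea[OF a] unfolding c by simp
qed

text \<open>Both claims rest on one number, the total trace of \<open>iso_proj _ a\<close> over a
  decomposition of the regular object. Summed over a in H it is the dimension; nonzero for a single
  a, it forces a summand in \<open>L\<close> with a nonzero component of degree a.\<close>

lemma L_cat_dim: "cat_dim G L = card (carrier G)"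
  and L_support: "a \<in> H \<Longrightarrow> \<exists>V\<in>L. dg_proj G V a \<noteq> 0"
proof -
  obtain Ws :: "('a, 'k) dgrep list" where Ws: "dg_decomposes_regular Ws" using dg_decomposes_regular_exists by blast
  have sW: "dg_simple G W" if "W \<in> set Ws" for W using Ws that unfolding dg_decomposes_regular_def by blast
  have Wo: "dg_obj G W" if "W \<in> set Ws" for W using sW[OF that] by (rule dg_simple_obj)
  let ?c = "of_nat (card (carrier G)) :: 'k"
  have swap: "sum_list (map (\<lambda>W. \<Sum>h\<in>S. F h W) Us) = (\<Sum>h\<in>S. sum_list (map (F h) Us))"
    for S :: "'a set" and F :: "'a \<Rightarrow> ('a, 'k) dgrep \<Rightarrow> 'k" and Us
    by (induction Us) (simp_all add: sum.distrib)
  have tr: "sum_list (map (\<lambda>W. fm_trace (iso_proj W a)) Ws) = ?c / of_nat (card H)" if a: "a \<in> H" for a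
  proof -
    have "sum_list (map (\<lambda>W. fm_trace (iso_proj W a)) Ws) =
       sum_list (map (\<lambda>W. \<Sum>h\<in>H. 1 / of_nat (card H) * inverse (B (a, h)) * dg_char G W a h) Ws)"
      using fm_trace_iso_proj[OF Wo a] by (intro arg_cong[of _ _ sum_list] map_cong refl) (simp add: sum_distrib_left mult.assoc)
    also have "\<dots> = (\<Sum>h\<in>H. 1 / of_nat (card H) * inverse (B (a, h)) * sum_list (map (\<lambda>W. dg_char G W a h) Ws))"
      unfolding swap by (simp only: sum_list_const_mult)
    \<comment> \<open>The regular character vanishes away from the identity, and B (a, 1) = 1 in the
      term that remains.\<close>
    also have "\<dots> = (\<Sum>h\<in>H. if h = \<one> then ?c / of_nat (card H) else 0)"
      using Ws a unfolding dg_decomposes_regular_def by (intro sum.cong) auto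
    also have "\<dots> = ?c / of_nat (card H)" by simp
    finally show ?thesis .
  qed
  show "\<exists>V\<in>L. dg_proj G V a \<noteq> 0" if a: "a \<in> H"
  proof (rule ccontr)
    assume "\<not> (\<exists>V\<in>L. dg_proj G V a \<noteq> 0)"
    then have "iso_proj W a = 0" if "W \<in> set Ws" for W
      using iso_proj_in_L[of W a] iso_proj_not_in_L[OF sW[OF that], of a] a by (cases "W \<in> L") auto
    then have "sum_list (map (\<lambda>W. fm_trace (iso_proj W a)) Ws) = sum_list (map (\<lambda>W. 0) Ws)"
      by (intro arg_cong[of _ _ sum_list] map_cong) auto
    then show False unfolding tr[OF a] using card_carrier_neq_0[where 'k = 'k] card_H
      by (simp del: card_carrier_neq_0 card_H)
  qed
  have dimL: "(\<Sum>a\<in>H. fm_trace (iso_proj W a)) = (if W \<in> L then of_nat (dg_dim W) else 0)" if W: "W \<in> set Ws" for W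
  proof (cases "W \<in> L")
    case True
    have "(\<Sum>a\<in>H. fm_trace (iso_proj W a)) = (\<Sum>a\<in>H. fm_trace (dg_proj G W a))"
      using iso_proj_in_L[OF True] by simp
    also have "\<dots> = (\<Sum>a\<in>carrier G. fm_trace (dg_proj G W a))"
      by (rule sum.mono_neutral_left) (use L_proj[OF True] in auto)
    also have "\<dots> = of_nat (dg_dim W)" by (rule obj_trace_proj_sum[OF Wo[OF W]])
    finally show ?thesis using True by simp
  next
    case False
    then show ?thesis using iso_proj_not_in_L[OF sW[OF W] False] by simp
  qed
  have "(of_nat (sum_list (map dg_dim (filter (\<lambda>W. W \<in> L) Ws))) :: 'k) = sum_list (map (\<lambda>W. if W \<in> L then of_nat (dg_dim W) else 0) Ws)"
    by (induction Ws) auto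
  also have "\<dots> = sum_list (map (\<lambda>W. \<Sum>a\<in>H. fm_trace (iso_proj W a)) Ws)"
    using dimL by (intro arg_cong[of _ _ sum_list] map_cong) auto
  also have "\<dots> = (\<Sum>a\<in>H. ?c / of_nat (card H))" unfolding swap using tr by simp
  also have "\<dots> = ?c" using card_H by (simp del: card_H)
  finally have "sum_list (map dg_dim (filter (\<lambda>W. W \<in> L) Ws)) = card (carrier G)" by (simp only: of_nat_eq_iff)
  moreover have "L \<subseteq> Collect (dg_obj G)" using L_obj by blast
  ultimately show "cat_dim G L = card (carrier G)"
    using cat_dim_eq(2)[OF Ws _ L_iso] by simp
qed

lemma L_lagrangian: "lagrangian G L"
  unfolding lagrangian_def L_cat_dim cat_dim_all using L_isotropic by simp

end

section \<open>Labels of simple objects\<close>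

context finite_group
begin

lemma simple_proj_nonzero:
  fixes W :: "('a, 'k::field) dgrep"
  assumes W: "dg_obj G W" and n: "dg_dim W > 0"
  shows "\<exists>x\<in>carrier G. dg_proj G W x \<noteq> 0"
proof (rule ccontr)
  assume "\<not> (\<exists>x\<in>carrier G. dg_proj G W x \<noteq> 0)"
  then have "(\<Sum>x\<in>carrier G. dg_proj G W x) = 0" by (intro sum.neutral) auto
  then show False using n unfolding obj_proj_sum[OF W] by simp
qed

lemma conj_class_self: "a \<in> carrier G \<Longrightarrow> a \<in> conj_class G a"
  unfolding conj_class_def by (auto intro!: exI[of _ \<one>])

lemma conj_class_conj: "a \<in> carrier G \<Longrightarrow> g \<in> carrier G \<Longrightarrow> x \<in> carrier G \<Longrightarrow> conjg g x \<in> conj_class G a \<Longrightarrow> x \<in> conj_class G a"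
proof -
  assume a: "a \<in> carrier G" and g: "g \<in> carrier G" and x: "x \<in> carrier G" and "conjg g x \<in> conj_class G a"
  then obtain h where h: "h \<in> carrier G" "conjg g x = conjg h a" unfolding conj_class_def by blast
  have "x = conjg (inv g) (conjg g x)" using g x by simp
  also have "\<dots> = conjg (inv g \<otimes> h) a" unfolding h(2) using conj_conj[of "inv g" h a] g h a by simp
  finally show ?thesis unfolding conj_class_def using g h by blast
qed

text \<open>The vectors without components outside the class of a form a subobject, since
  conjugation preserves the class. It contains the nonzero component of degree a, so it is
  everything.\<close>

lemma simple_support:
  fixes W :: "('a, 'k::field) dgrep"
  assumes sW: "dg_simple G W" and a: "a \<in> carrier G" and Pa: "dg_proj G W a \<noteq> 0"
    and x: "x \<in> carrier G" "x \<notin> conj_class G a"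
  shows "dg_proj G W x = 0"
proof -
  let ?n = "dg_dim W"
  have W: "dg_obj G W" using sW by (rule dg_simple_obj)
  define U where "U = {v \<in> fm_carrier ?n 1. \<forall>x\<in>carrier G - conj_class G a. dg_proj G W x * v = 0}"
  have "fm_subobject G W U"
    unfolding fm_subobject_def fm_subspace_def
  proof (intro conjI ballI allI)
    show "dg_mat W g * u \<in> U" if g: "g \<in> carrier G" and u: "u \<in> U" for g u
    proof -
      have "dg_proj G W x * (dg_mat W g * u) = 0" if x: "x \<in> carrier G - conj_class G a" for x
      proof -
        let ?y = "conjg (inv g) x"
        have y: "?y \<in> carrier G" "conjg g ?y = x" using x g by auto
        have "?y \<notin> conj_class G a" using conj_class_conj[OF a, of "inv g" x] conj_class_conj[OF a inv_closed[OF g], of x] x g by blast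
        then have "dg_proj G W ?y * u = 0" using u y unfolding U_def by blast
        moreover have "dg_proj G W x * (dg_mat W g * u) = dg_mat W g * (dg_proj G W ?y * u)"
          using obj_mat_proj[OF W g y(1)] unfolding y(2) by (simp only: mult.assoc[symmetric])
        ultimately show ?thesis by simp
      qed
      then show ?thesis using u W g unfolding U_def by simp
    qed
    show "dg_proj G W y * u \<in> U" if y: "y \<in> carrier G" and u: "u \<in> U" for y u
      using u W y unfolding U_def by (auto simp: obj_proj_mult_left[OF W])
  qed (auto simp: U_def distrib_left)
  then have "U = {0} \<or> U = fm_carrier ?n 1" using sW unfolding dg_simple_iff[OF W] by blast
  moreover have "U \<noteq> {0}"
  proof
    assume U0: "U = {0}"
    have "dg_proj G W a * v = 0 * v" if v: "v \<in> fm_carrier ?n 1" for v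
    proof -
      have "dg_proj G W a * v \<in> U"
        unfolding U_def using W a v conj_class_self[OF a] by (auto simp: obj_proj_mult_left[OF W])
      then show ?thesis unfolding U0 by simp
    qed
    then have "dg_proj G W a = 0" by (intro fm_eq_columnI[OF obj_proj_carrier[OF W a]]) auto
    then show False using Pa by blast
  qed
  ultimately have U1: "U = fm_carrier ?n 1" by blast
  have "dg_proj G W x * v = 0 * v" if "v \<in> fm_carrier ?n 1" for v
    using that x unfolding U1[symmetric] unfolding U_def by auto
  then show ?thesis by (intro fm_eq_columnI[OF obj_proj_carrier[OF W x(1)]]) auto
qed

lemma centralizer_carrier: "g \<in> centralizer G a \<Longrightarrow> g \<in> carrier G"
  unfolding centralizer_def by blast

lemma centralizer_conj: "a \<in> carrier G \<Longrightarrow> g \<in> carrier G \<Longrightarrow> g \<in> centralizer G a \<longleftrightarrow> conjg g a = a"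
  unfolding centralizer_def
proof
  assume a: "a \<in> carrier G" and g: "g \<in> carrier G"
  {
    assume "g \<in> {g \<in> carrier G. g \<otimes> a = a \<otimes> g}"
    then show "conjg g a = a" using a g by (simp add: m_assoc)
  next
    assume "conjg g a = a"
    then have "conjg g a \<otimes> g = a \<otimes> g" by simp
    then show "g \<in> {g \<in> carrier G. g \<otimes> a = a \<otimes> g}" using a g by (simp add: m_assoc)
  }
qed

text \<open>Factoring the projection onto the component as \<open>A * B\<close> gives a basis of it,
  in which the centralizer acts by \<open>\<theta> g = B * dg_mat W g * A\<close>. Irreducibility is
  obtained by extending an invariant subspace of the component to a subobject of
  \<open>W\<close>.\<close>

lemma simple_affords:
  fixes W :: "('a, 'k::field) dgrep"
  assumes sW: "dg_simple G W" and a: "a \<in> carrier G" and Pa: "dg_proj G W a \<noteq> 0"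
  shows "\<exists>\<chi>\<in>irr_chars G (centralizer G a). comp_affords G W a \<chi> \<and>
     (\<forall>g\<in>centralizer G a. \<chi> g = fm_trace (dg_mat W g * dg_proj G W a))"
proof -
  let ?n = "dg_dim W" and ?P = "dg_proj G W a" and ?C = "centralizer G a"
  have W: "dg_obj G W" using sW by (rule dg_simple_obj)
  have P: "?P \<in> fm_carrier ?n ?n" using W a by simp
  have PP: "?P * ?P = ?P" using obj_proj_mult[OF W a a] by simp
  obtain m A B where A: "A \<in> fm_carrier ?n m" and B: "B \<in> fm_carrier m ?n" and BA: "B * A = fm_one m" and AB: "A * B = ?P"
    using P PP by (rule fm_idempotent_factor)
  have BP: "B * (?P * X) = B * X" for X
    using BA fm_one_mult[OF B] unfolding AB[symmetric] by (simp add: mult.assoc[symmetric])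
  have PA: "?P * A = A" using BA fm_mult_one[OF A] unfolding AB[symmetric] by (simp add: mult.assoc)
  define \<theta> where "\<theta> g = B * dg_mat W g * A" for g
  have \<theta>c: "\<theta> g \<in> fm_carrier m m" if "g \<in> carrier G" for g
    unfolding \<theta>_def using fm_mult_carrier[OF fm_mult_carrier[OF B obj_mat_carrier[OF W that]] A] .
  define \<tau> where "\<tau> g = mat_of_fm m m (\<theta> g)" for g
  define T where "T = mat_of_fm ?n m A"
  have Tc: "T \<in> carrier_mat ?n m" and Tf: "fm_of_mat T = A" unfolding T_def using A by auto
  have \<tau>c: "\<tau> g \<in> carrier_mat m m" for g unfolding \<tau>_def by simp
  have \<tau>f: "fm_of_mat (\<tau> g) = \<theta> g" if "g \<in> ?C" for g
    unfolding \<tau>_def using \<theta>c[OF centralizer_carrier[OF that]] by simp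
  have comm: "dg_mat W g * ?P = ?P * dg_mat W g" if "g \<in> ?C" for g
    using obj_mat_proj[OF W centralizer_carrier[OF that] a] centralizer_conj[OF a centralizer_carrier[OF that]] that by simp
  have \<theta>mult: "\<theta> (g \<otimes> h) = \<theta> g * \<theta> h" if g: "g \<in> ?C" and h: "h \<in> ?C" for g h
  proof -
    have "\<theta> g * \<theta> h = B * (dg_mat W g * ?P) * dg_mat W h * A" unfolding \<theta>_def AB[symmetric] by (simp add: mult.assoc)
    also have "\<dots> = B * (dg_mat W g * (dg_mat W h * A))" unfolding comm[OF g] by (simp add: mult.assoc BP)
    also have "\<dots> = \<theta> (g \<otimes> h)" unfolding \<theta>_def using obj_mat_mult[OF W, of g h] centralizer_carrier g h by (simp add: mult.assoc)
    finally show ?thesis ..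
  qed
  have one_C: "\<one> \<in> ?C" unfolding centralizer_def using a by simp
  have mult_C: "g \<otimes> h \<in> ?C" if g: "g \<in> ?C" and h: "h \<in> ?C" for g h
    using centralizer_conj[OF a, of g] centralizer_conj[OF a, of h] centralizer_conj[OF a, of "g \<otimes> h"] conj_conj[of g h a]
      centralizer_carrier[OF g] centralizer_carrier[OF h] g h a by simp
  have rep: "mat_rep G ?C m \<tau>"
    unfolding mat_rep_def
  proof (intro conjI ballI \<tau>c)
    have "fm_of_mat (\<tau> \<one>) = fm_of_mat (1\<^sub>m m)" unfolding \<tau>f[OF one_C] \<theta>_def obj_mat_one[OF W] using fm_mult_one[OF B] BA by simp
    then show "\<tau> \<one> = 1\<^sub>m m" by (rule fm_of_mat_eqI[OF _ \<tau>c one_carrier_mat])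
    show "\<tau> (g \<otimes> h) = \<tau> g * \<tau> h" if g: "g \<in> ?C" and h: "h \<in> ?C" for g h
    proof (rule fm_of_mat_eqI[OF _ \<tau>c mult_carrier_mat[OF \<tau>c \<tau>c]])
      show "fm_of_mat (\<tau> (g \<otimes> h)) = fm_of_mat (\<tau> g * \<tau> h)"
        unfolding fm_of_mat_mult[OF \<tau>c \<tau>c] \<tau>f[OF g] \<tau>f[OF h] \<tau>f[OF mult_C[OF g h]] by (rule \<theta>mult[OF g h])
    qed
  qed
  have bij: "bij_betw (\<lambda>v. T *\<^sub>v v) (carrier_vec m) (dg_comp W a)"
    unfolding bij_betw_def
  proof
    have Tv: "fm_of_vec (T *\<^sub>v v) = A * fm_of_vec v" if "v \<in> carrier_vec m" for v
      using fm_of_vec_mult[OF Tc that] Tf by simp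
    show "inj_on (\<lambda>v. T *\<^sub>v v) (carrier_vec m)"
    proof (rule inj_onI)
      fix u v :: "'k vec" assume uv: "u \<in> carrier_vec m" "v \<in> carrier_vec m" "T *\<^sub>v u = T *\<^sub>v v"
      have "B * (A * fm_of_vec u) = B * (A * fm_of_vec v)" using uv Tv by metis
      then have "fm_of_vec u = fm_of_vec v"
        using BA fm_one_mult[OF fm_of_vec_carrier[OF uv(1)]] fm_one_mult[OF fm_of_vec_carrier[OF uv(2)]]
        by (simp add: mult.assoc[symmetric])
      then show "u = v" by (rule fm_of_vec_eqI[OF _ uv(1,2)])
    qed
    show "(\<lambda>v. T *\<^sub>v v) ` carrier_vec m = dg_comp W a"
    proof
      show "(\<lambda>v. T *\<^sub>v v) ` carrier_vec m \<subseteq> dg_comp W a"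
      proof
        fix w assume "w \<in> (\<lambda>v. T *\<^sub>v v) ` carrier_vec m"
        then obtain v where v: "v \<in> carrier_vec m" "w = T *\<^sub>v v" by blast
        have "w \<in> carrier_vec ?n" unfolding v(2) by (rule mult_mat_vec_carrier[OF Tc v(1)])
        moreover have "?P * fm_of_vec w = fm_of_vec w" unfolding v(2) Tv[OF v(1)] using PA by (simp add: mult.assoc[symmetric])
        ultimately show "w \<in> dg_comp W a" unfolding obj_comp[OF W a] by blast
      qed
      show "dg_comp W a \<subseteq> (\<lambda>v. T *\<^sub>v v) ` carrier_vec m"
      proof
        fix w assume "w \<in> dg_comp W a"
        then have w: "w \<in> carrier_vec ?n" "?P * fm_of_vec w = fm_of_vec w" unfolding obj_comp[OF W a] by auto
        let ?v = "vec_of_fm m (B * fm_of_vec w)"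
        have Bw: "B * fm_of_vec w \<in> fm_carrier m 1" by (rule fm_mult_carrier[OF B fm_of_vec_carrier[OF w(1)]])
        have "fm_of_vec (T *\<^sub>v ?v) = fm_of_vec w"
          unfolding Tv[OF vec_of_fm_carrier] fm_of_vec_of_fm[OF Bw] using w(2) unfolding AB[symmetric] by (simp add: mult.assoc)
        then have "T *\<^sub>v ?v = w" by (rule fm_of_vec_eqI[OF _ mult_mat_vec_carrier[OF Tc vec_of_fm_carrier] w(1)])
        then show "w \<in> (\<lambda>v. T *\<^sub>v v) ` carrier_vec m" by (intro image_eqI[of _ _ ?v]) auto
      qed
    qed
  qed
  have inter: "dg_act W g * T = T * \<tau> g" if g: "g \<in> ?C" for g
  proof (rule fm_of_mat_eqI)
    have gc: "g \<in> carrier G" using g by (rule centralizer_carrier)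
    have "A * \<theta> g = (?P * dg_mat W g) * A" unfolding \<theta>_def AB[symmetric] by (simp add: mult.assoc)
    also have "\<dots> = dg_mat W g * A" unfolding comm[OF g, symmetric] using PA by (simp add: mult.assoc)
    finally show "fm_of_mat (dg_act W g * T) = fm_of_mat (T * \<tau> g)"
      unfolding fm_of_mat_mult[OF obj_act_carrier[OF W gc] Tc] fm_of_mat_mult[OF Tc \<tau>c] Tf \<tau>f[OF g] ..
    show "dg_act W g * T \<in> carrier_mat ?n m" by (rule mult_carrier_mat[OF obj_act_carrier[OF W gc] Tc])
    show "T * \<tau> g \<in> carrier_mat ?n m" by (rule mult_carrier_mat[OF Tc \<tau>c])
  qed
  define \<chi> where "\<chi> = rep_char ?C \<tau>"
  have aff: "comp_affords G W a \<chi>"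
    unfolding comp_affords_def \<chi>_def using rep Tc bij inter by blast
  have m0: "m > 0"
  proof (rule ccontr)
    assume "\<not> m > 0"
    then have "A = 0" using A by simp
    then show False using AB Pa by simp
  qed
  have irr: "irr_mat_rep G ?C m \<tau>"
    unfolding irr_mat_rep_def
  proof (intro conjI allI impI rep m0)
    fix U assume U: "vsubspace m U \<and> (\<forall>g\<in>?C. \<forall>u\<in>U. \<tau> g *\<^sub>v u \<in> U)"
    define U1 where "U1 = fm_of_vec ` U"
    have U1s: "fm_subspace m U1" unfolding U1_def using U by (intro vsubspace_fm_subspace) blast
    have Uc: "U \<subseteq> carrier_vec m" using U unfolding vsubspace_iff by blast
    have U1\<theta>: "\<theta> g * u \<in> U1" if g: "g \<in> ?C" and u: "u \<in> U1" for g u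
    proof -
      obtain w where w: "w \<in> U" "u = fm_of_vec w" using u unfolding U1_def by blast
      have "\<theta> g * u = fm_of_vec (\<tau> g *\<^sub>v w)"
        using fm_of_vec_mult[OF \<tau>c, of w g] w Uc \<tau>f[OF g] by auto
      then show ?thesis unfolding U1_def using U g w(1) by blast
    qed
    \<comment> \<open>The largest subobject with component of degree a inside the given subspace:
      all translates of its vectors have their part of degree a there. This avoids choosing coset
      representatives of the centralizer.\<close>
    define Z where "Z = {v \<in> fm_carrier ?n 1. \<forall>g\<in>carrier G. B * (?P * (dg_mat W g * v)) \<in> U1}"
    have add: "u + v \<in> U1" if "u \<in> U1" "v \<in> U1" for u v using U1s that unfolding fm_subspace_def by blast
    have zero: "0 \<in> U1" using U1s unfolding fm_subspace_def by blast
    have "fm_subobject G W Z"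
      unfolding fm_subobject_def fm_subspace_def
    proof (intro conjI ballI allI)
      show "dg_mat W h * u \<in> Z" if h: "h \<in> carrier G" and u: "u \<in> Z" for h u
      proof -
        have "B * (?P * (dg_mat W g * (dg_mat W h * u))) \<in> U1" if g: "g \<in> carrier G" for g
          using u g h obj_mat_mult[OF W g h] unfolding Z_def by (auto simp: mult.assoc dest!: bspec[of _ _ "g \<otimes> h"])
        then show ?thesis using u W h unfolding Z_def by simp
      qed
      show "dg_proj G W x * u \<in> Z" if x: "x \<in> carrier G" and u: "u \<in> Z" for x u
      proof -
        have "B * (?P * (dg_mat W g * (dg_proj G W x * u))) \<in> U1" if g: "g \<in> carrier G" for g
        proof -
          have gx: "conjg g x \<in> carrier G" using g x by simp
          have "?P * (dg_mat W g * (dg_proj G W x * u)) = ?P * (dg_proj G W (conjg g x) * (dg_mat W g * u))"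
            using obj_mat_proj[OF W g x] by (simp add: mult.assoc[symmetric])
          also have "\<dots> = (if a = conjg g x then ?P * (dg_mat W g * u) else 0)"
            by (rule obj_proj_mult_left[OF W a gx])
          finally have eq: "?P * (dg_mat W g * (dg_proj G W x * u)) = (if a = conjg g x then ?P * (dg_mat W g * u) else 0)" .
          have "B * (?P * (dg_mat W g * u)) \<in> U1" using u g unfolding Z_def by blast
          then have "B * (if c then ?P * (dg_mat W g * u) else 0) \<in> U1" for c using zero by simp
          then show ?thesis unfolding eq .
        qed
        then show ?thesis using u W x unfolding Z_def by simp
      qed
    qed (auto simp: Z_def zero distrib_left add fm_subspace_scale[OF U1s])
    then have "Z = {0} \<or> Z = fm_carrier ?n 1" using sW unfolding dg_simple_iff[OF W] by blast
    then show "U = {0\<^sub>v m} \<or> U = carrier_vec m"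
    proof
      assume Z0: "Z = {0}"
      have "u = 0\<^sub>v m" if u: "u \<in> U" for u
      proof -
        have uc: "u \<in> carrier_vec m" using u Uc by blast
        have uc': "fm_of_vec u \<in> fm_carrier m 1" by (rule fm_of_vec_carrier[OF uc])
        have u1: "fm_of_vec u \<in> U1" unfolding U1_def using u by blast
        \<comment> \<open>\<open>A * fm_of_vec u\<close> has degree a, so its translate by g has
          degree g a g^-1. The part of degree a is therefore zero unless g centralizes a, and then
          it stays in the subspace by invariance.\<close>
        have "B * (?P * (dg_mat W g * (A * fm_of_vec u))) \<in> U1" if g: "g \<in> carrier G" for g
        proof -
          have "?P * (dg_mat W g * (A * fm_of_vec u)) = ?P * (dg_mat W g * ?P) * (A * fm_of_vec u)"
            using PA by (simp add: mult.assoc) (simp add: mult.assoc[symmetric])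
          also have "\<dots> = ?P * (dg_proj G W (conjg g a) * (dg_mat W g * (A * fm_of_vec u)))"
            unfolding obj_mat_proj[OF W g a] by (simp add: mult.assoc)
          also have "\<dots> = (if a = conjg g a then ?P * (dg_mat W g * (A * fm_of_vec u)) else 0)"
            by (rule obj_proj_mult_left[OF W a]) (use g a in simp)
          finally have eq: "?P * (dg_mat W g * (A * fm_of_vec u)) = (if a = conjg g a then ?P * (dg_mat W g * (A * fm_of_vec u)) else 0)" .
          show ?thesis
          proof (cases "a = conjg g a")
            case True
            then have gC: "g \<in> ?C" using centralizer_conj[OF a g] by simp
            have "B * (?P * (dg_mat W g * (A * fm_of_vec u))) = \<theta> g * fm_of_vec u" unfolding BP \<theta>_def by (simp add: mult.assoc)
            then show ?thesis using U1\<theta>[OF gC u1] by simp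
          next
            case False
            then have "?P * (dg_mat W g * (A * fm_of_vec u)) = 0" using eq by simp
            then show ?thesis using zero by simp
          qed
        qed
        then have "A * fm_of_vec u \<in> Z" unfolding Z_def using fm_mult_carrier[OF A uc'] by blast
        then have "B * (A * fm_of_vec u) = 0" unfolding Z0 by simp
        then have "fm_of_vec u = fm_of_vec (0\<^sub>v m)" using BA fm_one_mult[OF uc'] by (simp add: mult.assoc[symmetric])
        then show ?thesis by (rule fm_of_vec_eqI[OF _ uc zero_carrier_vec])
      qed
      then show ?thesis using U unfolding vsubspace_iff by blast
    next
      assume Z1: "Z = fm_carrier ?n 1"
      have "u \<in> U" if uc: "u \<in> carrier_vec m" for u
      proof -
        have uc': "fm_of_vec u \<in> fm_carrier m 1" by (rule fm_of_vec_carrier[OF uc])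
        have Auc: "A * fm_of_vec u \<in> fm_carrier ?n 1" by (rule fm_mult_carrier[OF A uc'])
        then have "A * fm_of_vec u \<in> Z" unfolding Z1 .
        then have "B * (?P * (dg_mat W \<one> * (A * fm_of_vec u))) \<in> U1" unfolding Z_def by blast
        moreover have "B * (?P * (dg_mat W \<one> * (A * fm_of_vec u))) = fm_of_vec u"
          unfolding BP obj_mat_one[OF W] fm_one_mult[OF Auc] using BA fm_one_mult[OF uc'] by (simp add: mult.assoc[symmetric])
        ultimately have "fm_of_vec u \<in> fm_of_vec ` U" unfolding U1_def by simp
        then show ?thesis using fm_of_vec_mem_image[OF Uc uc] by blast
      qed
      then show ?thesis using Uc by blast
    qed
  qed
  have "\<chi> \<in> irr_chars G ?C" unfolding irr_chars_def \<chi>_def using irr by blast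
  moreover have "\<chi> g = fm_trace (dg_mat W g * ?P)" if g: "g \<in> ?C" for g
  proof -
    have "\<chi> g = fm_trace (\<theta> g)"
      unfolding \<chi>_def rep_char_def using g fm_trace_of_mat[OF \<tau>c, of g] \<tau>f[OF g] by simp
    also have "\<dots> = fm_trace (A * (B * dg_mat W g))" unfolding \<theta>_def by (rule fm_trace_commute)
    also have "\<dots> = fm_trace (?P * dg_mat W g)" unfolding AB[symmetric] by (simp add: mult.assoc)
    finally show ?thesis unfolding comm[OF g] .
  qed
  ultimately show ?thesis using aff by blast
qed

end

section \<open>Labels of the simple objects in the subcategory of (H, B)\<close>

context normal_bichar
begin

lemma H_centralizer: "a \<in> H \<Longrightarrow> h \<in> H \<Longrightarrow> h \<in> centralizer G a"
  unfolding centralizer_def using H_comm by simp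

text \<open>A degree that occurs is conjugate to a representative a, which then occurs too and lies
  in H. Its component affords an irreducible character, and the scalar action of H on that component
  becomes the required equation after taking traces.\<close>

lemma L_simple_label:
  assumes R: "conj_class_reps G R" and sW: "dg_simple G W" and W: "W \<in> L"
  shows "\<exists>l\<in>bichar_labels G R H B. has_label G W l"
proof -
  have Wo: "dg_obj G W" and n: "dg_dim W > 0" using sW by (auto simp: dg_simple_def)
  obtain x where x: "x \<in> carrier G" "dg_proj G W x \<noteq> 0" using simple_proj_nonzero[OF Wo n] by blast
  obtain a where a: "a \<in> R" "x \<in> conj_class G a" and RG: "R \<subseteq> carrier G" using R x(1) unfolding conj_class_reps_def by blast
  have ac: "a \<in> carrier G" using a RG by blast
  obtain g where g: "g \<in> carrier G" "x = conjg g a" using a(2) unfolding conj_class_def by blast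
  have Pa: "dg_proj G W a \<noteq> 0" using obj_proj_zero_conj[OF Wo g(1) ac] x(2) g(2) by auto
  have aH: "a \<in> H" using L_proj[OF W ac] Pa by blast
  obtain \<chi> where \<chi>: "\<chi> \<in> irr_chars G (centralizer G a)" "comp_affords G W a \<chi>"
    "\<And>g. g \<in> centralizer G a \<Longrightarrow> \<chi> g = fm_trace (dg_mat W g * dg_proj G W a)"
    using simple_affords[OF sW ac Pa] by blast
  have lab: "has_label G W (a, \<chi>)"
    unfolding has_label_def using sW \<chi>(2) simple_support[OF sW ac Pa] comp_eq_zero_iff[OF Wo] by auto
  have deg: "char_deg G \<chi> = fm_trace (dg_proj G W a)"
    unfolding char_deg_def \<chi>(3)[OF H_centralizer[OF aH H_closed(1)]] obj_mat_one[OF Wo]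
    using Wo ac by simp
  have "\<chi> h = B (a, h) * char_deg G \<chi>" if h: "h \<in> H" for h
    unfolding deg \<chi>(3)[OF H_centralizer[OF aH h]] L_mat[OF W aH h] by simp
  then have "(a, \<chi>) \<in> bichar_labels G R H B"
    unfolding bichar_labels_def simple_labels_def using a(1) aH \<chi>(1) by simp
  then show ?thesis using lab by blast
qed

text \<open>A label only prescribes the traces of H on the component of degree a. They force H to
  act there by scalars, and conjugation by G together with invariance of B carries this to the other
  degrees.\<close>

lemma L_label:
  assumes l: "l \<in> bichar_labels G R H B" and lab: "has_label G W l"
  shows "W \<in> L"
proof -
  obtain a \<chi> where l_eq: "l = (a, \<chi>)" by (cases l)
  have aH: "a \<in> H" and \<chi>h: "\<And>h. h \<in> H \<Longrightarrow> \<chi> h = B (a, h) * char_deg G \<chi>"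
    using l unfolding l_eq bichar_labels_def by auto
  have sW: "dg_simple G W" and supp: "\<And>x. x \<in> carrier G \<Longrightarrow> x \<notin> conj_class G a \<Longrightarrow> dg_comp W x = {0\<^sub>v (dg_dim W)}"
    and aff: "comp_affords G W a \<chi>" using lab unfolding l_eq has_label_def by auto
  have W: "dg_obj G W" using sW by (rule dg_simple_obj)
  have ac: "a \<in> carrier G" using aH by simp
  let ?n = "dg_dim W" and ?C = "centralizer G a"
  obtain m \<tau> T where rep: "mat_rep G ?C m \<tau>" and T: "T \<in> carrier_mat ?n m"
    and bij: "bij_betw (\<lambda>v. T *\<^sub>v v) (carrier_vec m) (dg_comp W a)"
    and inter: "\<And>g. g \<in> ?C \<Longrightarrow> dg_act W g * T = T * \<tau> g" and \<chi>: "\<chi> = rep_char ?C \<tau>"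
    using aff unfolding comp_affords_def by blast
  let ?t = "fm_of_mat T"
  define \<theta> where "\<theta> g = fm_of_mat (\<tau> g)" for g
  have HC: "h \<in> ?C" if "h \<in> H" for h by (rule H_centralizer[OF aH that])
  have \<tau>c: "\<tau> h \<in> carrier_mat m m" if "h \<in> H" for h using rep HC[OF that] unfolding mat_rep_def by blast
  have \<theta>c: "\<theta> h \<in> fm_carrier m m" if "h \<in> H" for h unfolding \<theta>_def using \<tau>c[OF that] by simp
  have \<theta>1: "\<theta> \<one> = fm_one m" using rep unfolding \<theta>_def mat_rep_def by simp
  have \<theta>m: "\<theta> (g \<otimes> h) = \<theta> g * \<theta> h" if "g \<in> H" "h \<in> H" for g h
    unfolding \<theta>_def fm_of_mat_mult[OF \<tau>c[OF that(1)] \<tau>c[OF that(2)], symmetric]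
    using rep HC[OF that(1)] HC[OF that(2)] unfolding mat_rep_def by simp
  have tr\<theta>: "fm_trace (\<theta> h) = B (a, h) * of_nat m" if h: "h \<in> H" for h
  proof -
    have tr: "\<chi> k = fm_trace (\<theta> k)" if k: "k \<in> H" for k
      unfolding \<chi> rep_char_def \<theta>_def using HC[OF k] fm_trace_of_mat[OF \<tau>c[OF k]] by simp
    have "char_deg G \<chi> = of_nat m" unfolding char_deg_def tr[OF H_closed(1)] \<theta>1 by simp
    then show ?thesis using \<chi>h[OF h] tr[OF h] by simp
  qed
  \<comment> \<open>The projection onto the part of the representation on which H acts through B (a,
    _). The prescribed traces give it trace m, so it is the identity and each h acts as B (a,
    h).\<close>
  define E where "E = fm_scale (1 / of_nat (card H)) (\<Sum>h\<in>H. fm_scale (inverse (B (a, h))) (\<theta> h))"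
  have Ec: "E \<in> fm_carrier m m" unfolding E_def by (intro fm_scale_carrier fm_sum_carrier \<theta>c)
  have \<theta>E: "\<theta> h * E = fm_scale (B (a, h)) E" if h: "h \<in> H" for h
  proof -
    define f where "f k = fm_scale (inverse (B (a, k))) (\<theta> k)" for k
    have "\<theta> h * f k = fm_scale (B (a, h)) (f (h \<otimes> k))" if k: "k \<in> H" for k
    proof -
      have "inverse (B (a, k)) = B (a, h) * inverse (B (a, h \<otimes> k))" using aH h k by (simp add: B_mult2)
      then show ?thesis unfolding f_def using \<theta>m[OF h k] by simp
    qed
    then have "\<theta> h * (\<Sum>k\<in>H. f k) = fm_scale (B (a, h)) (\<Sum>k\<in>H. f (h \<otimes> k))"
      by (simp add: sum_distrib_left fm_scale_sum)
    then show ?thesis unfolding E_def f_def[symmetric] sum_H_mult[OF h, of f] by (simp add: mult.commute)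
  qed
  have "(\<Sum>h\<in>H. fm_scale (inverse (B (a, h))) (\<theta> h)) * E = (\<Sum>h\<in>H. fm_scale 1 E)"
    using aH by (simp add: sum_distrib_right \<theta>E)
  then have "E * E = fm_scale (1 / of_nat (card H) * of_nat (card H)) E"
    by (subst (1) E_def) (simp only: fm_scale_sum_left fm_scale_simps sum_constant mult_1_right)
  then have EE: "E * E = E" using card_H by (simp del: card_H)
  have "fm_trace E = 1 / of_nat (card H) * (\<Sum>h\<in>H. of_nat m)"
    unfolding E_def using aH by (simp add: fm_trace_sum tr\<theta> flip: mult.assoc)
  then have "fm_trace E = of_nat m" using card_H by (simp del: card_H)
  then have E1: "E = fm_one m" by (rule fm_idempotent_trace_one[OF Ec EE])
  have \<theta>s: "\<theta> h = fm_scale (B (a, h)) (fm_one m)" if h: "h \<in> H" for h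
    using \<theta>E[OF h] \<theta>c[OF h] unfolding E1 by simp
  have key: "dg_mat W h * dg_proj G W a = fm_scale (B (a, h)) (dg_proj G W a)" if h: "h \<in> H" for h
  proof (rule fm_eq_columnI[of _ ?n ?n])
    fix v :: "'k fmat" assume v: "v \<in> fm_carrier ?n 1"
    let ?w = "dg_proj G W a * v"
    have w: "?w \<in> fm_carrier ?n 1" by (rule fm_mult_carrier[OF obj_proj_carrier[OF W ac] v])
    have "vec_of_fm ?n ?w \<in> dg_comp W a"
      unfolding obj_comp[OF W ac] using fm_of_vec_of_fm[OF w] obj_proj_mult_left[OF W ac ac] by simp
    then obtain u where u: "u \<in> carrier_vec m" "T *\<^sub>v u = vec_of_fm ?n ?w" using bij unfolding bij_betw_def by (metis imageE)
    have wu: "?w = ?t * fm_of_vec u" using fm_of_vec_mult[OF T u(1)] fm_of_vec_of_fm[OF w] unfolding u(2) by simp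
    have "dg_mat W h * ?t = ?t * \<theta> h"
      using arg_cong[OF inter[OF HC[OF h]], of fm_of_mat]
      unfolding fm_of_mat_mult[OF obj_act_carrier[OF W H_carrier[OF h]] T] fm_of_mat_mult[OF T \<tau>c[OF h]] \<theta>_def .
    then have "dg_mat W h * ?w = ?t * (\<theta> h * fm_of_vec u)" unfolding wu by (simp add: mult.assoc[symmetric])
    also have "\<dots> = fm_scale (B (a, h)) ?w"
      unfolding \<theta>s[OF h] wu using fm_one_mult[OF fm_of_vec_carrier[OF u(1)]] by simp
    finally show "dg_mat W h * dg_proj G W a * v = fm_scale (B (a, h)) (dg_proj G W a) * v" by (simp add: mult.assoc)
  qed (use W ac h in auto)
  show ?thesis unfolding bichar_objects_def
  proof (intro CollectI conjI ballI W)
    have z: "dg_proj G W x = 0" if "x \<in> carrier G" "x \<notin> conj_class G a" for x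
      using supp[OF that] comp_eq_zero_iff[OF W that(1)] by blast
    show "dg_proj G W x = 0" if x: "x \<in> carrier G - H" for x
    proof -
      have "x \<notin> conj_class G a" using x aH H_conj unfolding conj_class_def by blast
      then show ?thesis using z x by blast
    qed
    show "dg_mat W h * dg_proj G W x = fm_scale (B (x, h)) (dg_proj G W x)" if x: "x \<in> H" and h: "h \<in> H" for x h
    proof (cases "x \<in> conj_class G a")
      case False
      then show ?thesis using z x by simp
    next
      case True
      then obtain g where g: "g \<in> carrier G" "x = conjg g a" unfolding conj_class_def by blast
      \<comment> \<open>On degree x = g a g^-1 the element h acts as g k g^-1, where k is a
        conjugate of h acting on degree a.\<close>
      let ?k = "conjg (inv g) h"
      have k: "?k \<in> H" "conjg g ?k = h" using g h by auto
      have Bk: "B (x, h) = B (a, ?k)" using B_conj[OF g(1) aH k(1)] unfolding k(2) g(2)[symmetric] .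
      have P: "dg_proj G W x = dg_mat W g * dg_proj G W a * dg_mat W (inv g)"
        unfolding obj_mat_proj[OF W g(1) ac] g(2)[symmetric]
        using obj_mat_inv(1)[OF W g(1)] W x by (simp add: mult.assoc)
      have hg: "h \<otimes> g = g \<otimes> ?k"
      proof -
        have "g \<otimes> ?k = conjg g ?k \<otimes> g" using g h by (simp add: m_assoc)
        then show ?thesis unfolding k(2) ..
      qed
      have "dg_mat W h * dg_proj G W x = dg_mat W (h \<otimes> g) * dg_proj G W a * dg_mat W (inv g)"
        unfolding P using obj_mat_mult[OF W, of h g] g h by (simp add: mult.assoc)
      also have "\<dots> = dg_mat W g * (dg_mat W ?k * dg_proj G W a) * dg_mat W (inv g)"
        unfolding hg using obj_mat_mult[OF W g(1) H_carrier[OF k(1)]] by (simp add: mult.assoc)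
      also have "\<dots> = fm_scale (B (x, h)) (dg_proj G W x)" unfolding key[OF k(1)] Bk P by simp
      finally show ?thesis .
    qed
  qed
qed

text \<open>Complete reducibility with retracts as summands: an object of \<open>L\<close> is a sum
  of simple objects that again lie in \<open>L\<close> and hence have labels; conversely
  \<open>L\<close> contains all labelled simple objects and their sums.\<close>

lemma bichar_subcategory_eq:
  assumes R: "conj_class_reps G R"
  shows "bichar_subcategory G R H B = L"
proof
  show "bichar_subcategory G R H B \<subseteq> L"
  proof
    fix V assume "V \<in> bichar_subcategory G R H B"
    then obtain Ws where V: "dg_obj G V" and Ws: "\<forall>W\<in>set Ws. \<exists>l\<in>bichar_labels G R H B. has_label G W l"
      and iso: "dg_iso G V (dg_sums Ws)" unfolding bichar_subcategory_def by blast
    have "\<forall>W\<in>set Ws. W \<in> L" using Ws L_label by blast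
    then have "dg_sums Ws \<in> L" by (rule L_sums)
    then show "V \<in> L" using L_iso[OF _ V dg_iso_sym[OF iso]] by blast
  qed
  show "L \<subseteq> bichar_subcategory G R H B"
  proof
    fix V assume V: "V \<in> L"
    obtain Ws where Ws: "\<forall>W\<in>set Ws. dg_simple G W \<and> dg_retract G W V" "dg_iso G V (dg_sums Ws)"
      using dg_semisimple[OF L_obj[OF V]] by blast
    have "\<forall>W\<in>set Ws. \<exists>l\<in>bichar_labels G R H B. has_label G W l"
      using Ws(1) L_simple_label[OF R] L_retract[OF V] by blast
    then show "V \<in> bichar_subcategory G R H B"
      unfolding bichar_subcategory_def using L_obj[OF V] Ws(2) by blast
  qed
qed

end

section \<open>Lagrangian subcategories\<close>

locale lagrangian_subcategory = finite_group G for G :: "('a, 'b) monoid_scheme" (structure) +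
  fixes D :: "('a, 'k::{alg_closed_field, field_char_0}) dgrep set"
  assumes lagrangian: "lagrangian G D"
begin

lemma D_fusion: "fusion_subcategory G D"
  using lagrangian unfolding lagrangian_def isotropic_def by blast

lemma D_obj: "V \<in> D \<Longrightarrow> dg_obj G V"
  and D_iso: "V \<in> D \<Longrightarrow> dg_obj G W \<Longrightarrow> dg_iso G V W \<Longrightarrow> W \<in> D"
  and D_sum: "V \<in> D \<Longrightarrow> W \<in> D \<Longrightarrow> dg_sum V W \<in> D"
  and D_summand: "dg_obj G V \<Longrightarrow> dg_obj G W \<Longrightarrow> dg_sum V W \<in> D \<Longrightarrow> W \<in> D"
  and D_tensor: "V \<in> D \<Longrightarrow> W \<in> D \<Longrightarrow> dg_tensor G V W \<in> D"
  and D_dual: "V \<in> D \<Longrightarrow> dg_dual G V \<in> D"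
  and D_unit: "dg_unit G \<in> D"
  using D_fusion unfolding fusion_subcategory_def by blast+

lemma D_twist: "V \<in> D \<Longrightarrow> x \<in> carrier G \<Longrightarrow> dg_mat V x * dg_proj G V x = dg_proj G V x"
  using lagrangian dg_twist_trivial_iff[OF D_obj, of V] unfolding lagrangian_def isotropic_def by blast

text \<open>Fusion subcategories are asked to contain the unit, not the zero object; but the unit is
  isomorphic to its sum with zero, so zero is a summand. It is the end of every iterated sum
  \<open>dg_sums\<close>.\<close>

lemma D_zero: "dg_zero \<in> D"
proof -
  let ?U = "dg_unit G :: ('a, 'k) dgrep" and ?Z = "dg_zero :: ('a, 'k) dgrep"
  have o: "dg_obj G (dg_sum ?U ?Z)" by (intro dg_sum_obj dg_unit_obj dg_zero_obj)
  have "dg_iso G ?U (dg_sum ?U ?Z)"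
  proof (rule dg_iso_sum_complement)
    show "fm_one (dg_dim ?U) \<in> fm_hom G ?U ?U" by (rule fm_hom_one[OF dg_unit_obj])
    then show "fm_one (dg_dim ?U) \<in> fm_hom G ?U ?U" .
    show "0 \<in> fm_hom G ?Z ?U" "0 \<in> fm_hom G ?U ?Z" by (simp_all add: fm_hom_def)
  qed simp_all
  then have "dg_sum ?U ?Z \<in> D" by (rule D_iso[OF D_unit o])
  then show ?thesis using D_summand[OF dg_unit_obj dg_zero_obj] by blast
qed

lemma D_sums: "\<forall>W\<in>set Ws. W \<in> D \<Longrightarrow> dg_sums Ws \<in> D"
  by (induction Ws) (auto simp: D_zero D_sum)

lemma comp_vector:
  assumes "dg_obj G V" "x \<in> carrier G" "dg_proj G V x \<noteq> 0"
  obtains v where "v \<in> fm_carrier (dg_dim V) 1" "v \<noteq> 0" "dg_proj G V x * v = v"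
proof -
  have "\<exists>v\<in>fm_carrier (dg_dim V) 1. dg_proj G V x * v \<noteq> 0"
  proof (rule ccontr)
    assume "\<not> ?thesis"
    then have "dg_proj G V x * v = 0 * v" if "v \<in> fm_carrier (dg_dim V) 1" for v using that by auto
    then have "dg_proj G V x = 0" by (intro fm_eq_columnI[OF obj_proj_carrier[OF assms(1,2)]]) auto
    then show False using assms(3) by blast
  qed
  then obtain v where v: "v \<in> fm_carrier (dg_dim V) 1" "dg_proj G V x * v \<noteq> 0" by blast
  show ?thesis
    by (rule that[OF fm_mult_carrier[OF obj_proj_carrier[OF assms(1,2)] v(1)] v(2)])
      (simp add: obj_proj_mult_left[OF assms(1,2,2)])
qed

text \<open>The twist is trivial on \<open>V\<close>, \<open>W\<close> and their tensor product, so the double braiding of \<open>V\<close> and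
  \<open>W\<close> is trivial: \<open>y v \<otimes> x w = v \<otimes> w\<close> for \<open>v\<close> of degree \<open>x\<close> and \<open>w\<close> of degree \<open>y\<close>.\<close>

lemma D_centralize:
  assumes V: "V \<in> D" and W: "W \<in> D" and x: "x \<in> carrier G" and y: "y \<in> carrier G"
    and v: "v \<in> fm_carrier (dg_dim V) 1" "v \<noteq> 0" "dg_proj G V x * v = v"
    and w: "w \<in> fm_carrier (dg_dim W) 1" "w \<noteq> 0" "dg_proj G W y * w = w"
  shows "x \<otimes> y = y \<otimes> x \<and> (\<exists>c. c \<noteq> 0 \<and> dg_mat W x * w = fm_scale c w \<and> dg_mat V y * v = fm_scale (inverse c) v)"
proof -
  note Vo = D_obj[OF V] and Wo = D_obj[OF W]
  let ?X = "dg_tensor G V W" and ?t = "fm_tensor (dg_dim V) 1 (dg_dim W) 1 :: 'k fmat \<Rightarrow> 'k fmat \<Rightarrow> 'k fmat"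
  let ?z = "x \<otimes> y" and ?y = "conjg x y"
  have z: "?z \<in> carrier G" using x y by simp
  have yc: "?y \<in> carrier G" using x y by simp
  have tw_v: "dg_mat V x * v = v"
  proof -
    have "dg_mat V x * (dg_proj G V x * v) = dg_proj G V x * v" using D_twist[OF V x] by (simp add: mult.assoc[symmetric])
    then show ?thesis unfolding v(3) .
  qed
  have tw_w: "dg_mat W y * w = w"
  proof -
    have "dg_mat W y * (dg_proj G W y * w) = dg_proj G W y * w" using D_twist[OF W y] by (simp add: mult.assoc[symmetric])
    then show ?thesis unfolding w(3) .
  qed
  \<comment> \<open>Only x is known to fix \<open>v\<close>, so \<open>x \<otimes> y\<close> is
    rewritten with x on the right, at the price of replacing y by its conjugate.\<close>
  have zv: "dg_mat V ?z * v = dg_mat V ?y * v"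
  proof -
    have "?z = ?y \<otimes> x" using x y by (simp add: m_assoc)
    then have "dg_mat V ?z * v = dg_mat V ?y * (dg_mat V x * v)" using obj_mat_mult[OF Vo yc x] by (simp add: mult.assoc)
    then show ?thesis unfolding tw_v .
  qed
  have zw: "dg_mat W ?z * w = dg_mat W x * w"
    using obj_mat_mult[OF Wo x y] tw_w by (simp add: mult.assoc)
  \<comment> \<open>The pure tensor has degree \<open>x \<otimes> y\<close>, so the twist acts on it
    by that element, and it is trivial because the tensor product lies in \<open>D\<close>.\<close>
  have "?t (dg_mat V ?y * v) (dg_mat W x * w) = dg_mat ?X ?z * ?t v w"
    unfolding dg_tensor_mat_apply[OF Vo Wo z] zv zw ..
  also have "\<dots> = dg_mat ?X ?z * dg_proj G ?X ?z * ?t v w"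
    using dg_tensor_proj_apply[OF Vo Wo x y v(3) w(3)] by (simp add: mult.assoc)
  also have "\<dots> = ?t v w"
    unfolding D_twist[OF D_tensor[OF V W] z] by (rule dg_tensor_proj_apply[OF Vo Wo x y v(3) w(3)])
  finally have eq: "?t (dg_mat V ?y * v) (dg_mat W x * w) = ?t v w" .
  obtain c where c: "c \<noteq> 0" "dg_mat W x * w = fm_scale c w" "dg_mat V ?y * v = fm_scale (inverse c) v"
    using fm_tensor_eqD[OF v(1) fm_mult_carrier[OF obj_mat_carrier[OF Vo yc] v(1)]
        w(1) fm_mult_carrier[OF obj_mat_carrier[OF Wo x] w(1)] v(2) w(2) eq] by blast
  \<comment> \<open>\<open>dg_mat W x * w\<close> has degree x y x^-1 and is a nonzero multiple of
    \<open>w\<close>, which has degree y.\<close>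
  have "?y = y"
  proof (rule ccontr)
    assume ne: "?y \<noteq> y"
    have "dg_proj G W ?y * (dg_mat W x * w) = dg_mat W x * (dg_proj G W y * w)"
      using obj_mat_proj[OF Wo x y] by (simp add: mult.assoc[symmetric])
    then have 1: "fm_scale c (dg_proj G W ?y * w) = fm_scale c w" unfolding c(2) w(3) by simp
    have "dg_proj G W ?y * (dg_proj G W y * w) = 0" using obj_proj_mult_left[OF Wo yc y] ne by simp
    then have "dg_proj G W ?y * w = 0" unfolding w(3) .
    then have "fm_scale c w = 0" using 1 by simp
    then show False using c(1) w(2) by (simp add: fm_scale_eq_0_iff)
  qed
  moreover from this have "x \<otimes> y = y \<otimes> x" using centralizer_conj[OF y x] unfolding centralizer_def by simp
  ultimately show ?thesis using c by auto
qed

section \<open>The support and the bicharacter of a Lagrangian subcategory\<close>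

definition support :: "'a set" where
  "support = {x \<in> carrier G. \<exists>V\<in>D. dg_proj G V x \<noteq> 0}"

lemma support_carrier: "x \<in> support \<Longrightarrow> x \<in> carrier G"
  unfolding support_def by blast

text \<open>One vector \<open>w\<close> of degree y is fixed. For every \<open>V\<close> in
  \<open>D\<close> and every vector of degree x, the scalar of y is the inverse of the scalar by
  which x acts on \<open>w\<close>, and the latter does not involve \<open>V\<close>.\<close>

lemma support_scalar:
  assumes x: "x \<in> support" and y: "y \<in> support"
  shows "\<exists>b. b \<noteq> 0 \<and> (\<forall>V\<in>D. dg_mat V y * dg_proj G V x = fm_scale b (dg_proj G V x))"
proof -
  have xc: "x \<in> carrier G" and yc: "y \<in> carrier G" using x y by (auto dest: support_carrier)
  obtain W where W: "W \<in> D" "dg_proj G W y \<noteq> 0" using y unfolding support_def by blast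
  obtain w where w: "w \<in> fm_carrier (dg_dim W) 1" "w \<noteq> 0" "dg_proj G W y * w = w"
    using comp_vector[OF D_obj[OF W(1)] yc W(2)] .
  obtain V0 where V0: "V0 \<in> D" "dg_proj G V0 x \<noteq> 0" using x unfolding support_def by blast
  obtain v0 where v0: "v0 \<in> fm_carrier (dg_dim V0) 1" "v0 \<noteq> 0" "dg_proj G V0 x * v0 = v0"
    using comp_vector[OF D_obj[OF V0(1)] xc V0(2)] .
  obtain c where c: "c \<noteq> 0" "dg_mat W x * w = fm_scale c w"
    using D_centralize[OF V0(1) W(1) xc yc v0 w] by blast
  have "dg_mat V y * dg_proj G V x = fm_scale (inverse c) (dg_proj G V x)" if V: "V \<in> D" for V
  proof (rule fm_eq_columnI[of _ "dg_dim V" "dg_dim V"])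
    note Vo = D_obj[OF V]
    fix u :: "'k fmat" assume u: "u \<in> fm_carrier (dg_dim V) 1"
    let ?v = "dg_proj G V x * u"
    have "dg_mat V y * ?v = fm_scale (inverse c) ?v"
    proof (cases "?v = 0")
      case False
      have v1: "?v \<in> fm_carrier (dg_dim V) 1" by (rule fm_mult_carrier[OF obj_proj_carrier[OF Vo xc] u])
      have v3: "dg_proj G V x * ?v = ?v" using obj_proj_mult_left[OF Vo xc xc] by simp
      obtain d where d: "d \<noteq> 0" "dg_mat W x * w = fm_scale d w" "dg_mat V y * ?v = fm_scale (inverse d) ?v"
        using D_centralize[OF V W(1) xc yc v1 False v3 w] by blast
      have "fm_scale (d - c) w = fm_scale d w - fm_scale c w"
        by (rule fmat_eqI) (simp add: fm_nth_simps left_diff_distrib)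
      then have "d = c" using c(2) d(2) w(2) by (simp add: fm_scale_eq_0_iff)
      then show ?thesis using d(3) by simp
    qed simp
    then show "dg_mat V y * dg_proj G V x * u = fm_scale (inverse c) (dg_proj G V x) * u" by (simp add: mult.assoc)
  qed (use D_obj[OF V] xc yc in auto)
  then show ?thesis using c(1) by (intro exI[of _ "inverse c"]) auto
qed

definition bichar :: "'a \<times> 'a \<Rightarrow> 'k" where
  "bichar = (\<lambda>(x, y) \<in> support \<times> support.
     SOME b. b \<noteq> 0 \<and> (\<forall>V\<in>D. dg_mat V y * dg_proj G V x = fm_scale b (dg_proj G V x)))"

lemma bichar_nz: "x \<in> support \<Longrightarrow> y \<in> support \<Longrightarrow> bichar (x, y) \<noteq> 0"
  and bichar_mat: "x \<in> support \<Longrightarrow> y \<in> support \<Longrightarrow> V \<in> D \<Longrightarrow>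
    dg_mat V y * dg_proj G V x = fm_scale (bichar (x, y)) (dg_proj G V x)"
  using someI_ex[OF support_scalar[of x y]] unfolding bichar_def by auto

text \<open>A single nonzero homogeneous vector of a single object determines the scalar, so every
  identity for \<open>bichar\<close> is checked on one convenient vector.\<close>

lemma bichar_eqI:
  assumes x: "x \<in> support" and y: "y \<in> support" and V: "V \<in> D" and ne: "dg_proj G V x * u \<noteq> 0"
    and eq: "dg_mat V y * (dg_proj G V x * u) = fm_scale b (dg_proj G V x * u)"
  shows "bichar (x, y) = b"
proof -
  have "dg_mat V y * (dg_proj G V x * u) = fm_scale (bichar (x, y)) (dg_proj G V x * u)"
    using bichar_mat[OF x y V] by (simp add: mult.assoc[symmetric])
  then have "fm_scale (bichar (x, y)) (dg_proj G V x * u) = fm_scale b (dg_proj G V x * u)" using eq by simp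
  moreover have "fm_scale (bichar (x, y) - b) (dg_proj G V x * u)
      = fm_scale (bichar (x, y)) (dg_proj G V x * u) - fm_scale b (dg_proj G V x * u)"
    by (rule fmat_eqI) (simp add: fm_nth_simps left_diff_distrib)
  ultimately show ?thesis using ne by (simp add: fm_scale_eq_0_iff)
qed

lemma support_vector:
  assumes x: "x \<in> support"
  obtains V v where "V \<in> D" "v \<in> fm_carrier (dg_dim V) 1" "v \<noteq> 0" "dg_proj G V x * v = v"
proof -
  obtain V where V: "V \<in> D" "dg_proj G V x \<noteq> 0" using x unfolding support_def by blast
  show ?thesis using comp_vector[OF D_obj[OF V(1)] support_carrier[OF x] V(2)] that[OF V(1)] by blast
qed

lemma support_tensor:
  assumes x: "x \<in> support" and y: "y \<in> support"
  obtains V W v w where "V \<in> D" "W \<in> D" "v \<in> fm_carrier (dg_dim V) 1" "w \<in> fm_carrier (dg_dim W) 1"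
    "dg_proj G V x * v = v" "dg_proj G W y * w = w" "fm_tensor (dg_dim V) 1 (dg_dim W) 1 v w \<noteq> 0"
    "dg_proj G (dg_tensor G V W) (x \<otimes> y) * fm_tensor (dg_dim V) 1 (dg_dim W) 1 v w = fm_tensor (dg_dim V) 1 (dg_dim W) 1 v w"
proof -
  obtain V v where V: "V \<in> D" "v \<in> fm_carrier (dg_dim V) 1" "v \<noteq> 0" "dg_proj G V x * v = v"
    using x by (rule support_vector)
  obtain W w where W: "W \<in> D" "w \<in> fm_carrier (dg_dim W) 1" "w \<noteq> 0" "dg_proj G W y * w = w"
    using y by (rule support_vector)
  show ?thesis
    by (rule that[OF V(1) W(1) V(2) W(2) V(4) W(4) fm_tensor_nonzero[OF V(2) W(2) V(3) W(3)]
      dg_tensor_proj_apply[OF D_obj[OF V(1)] D_obj[OF W(1)] support_carrier[OF x] support_carrier[OF y] V(4) W(4)]])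
qed

lemma support_mult: "x \<in> support \<Longrightarrow> y \<in> support \<Longrightarrow> x \<otimes> y \<in> support"
proof -
  assume x: "x \<in> support" and y: "y \<in> support"
  obtain V W v w where VW: "V \<in> D" "W \<in> D" and nz: "fm_tensor (dg_dim V) 1 (dg_dim W) 1 v w \<noteq> 0"
    and P: "dg_proj G (dg_tensor G V W) (x \<otimes> y) * fm_tensor (dg_dim V) 1 (dg_dim W) 1 v w = fm_tensor (dg_dim V) 1 (dg_dim W) 1 v w"
    using support_tensor[OF x y] by metis
  have "dg_proj G (dg_tensor G V W) (x \<otimes> y) \<noteq> 0" using nz P by (metis mult_zero_left)
  then show ?thesis unfolding support_def using D_tensor[OF VW] support_carrier x y by blast
qed

lemma support_inv: "x \<in> support \<Longrightarrow> inv x \<in> support"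
proof -
  assume x: "x \<in> support"
  obtain V where V: "V \<in> D" "dg_proj G V x \<noteq> 0" using x unfolding support_def by blast
  have xc: "x \<in> carrier G" using x by (rule support_carrier)
  have "dg_proj G (dg_dual G V) (inv x) = fm_transpose (dg_proj G V x)"
    using dg_dual_proj[OF D_obj[OF V(1)], of "inv x"] xc by simp
  moreover have "fm_transpose (dg_proj G V x) \<noteq> 0" using V(2) by (metis fm_transpose_simps(1,3))
  ultimately show ?thesis unfolding support_def using D_dual[OF V(1)] xc
    by (intro CollectI conjI bexI[of _ "dg_dual G V"]) auto
qed

lemma support_one: "\<one> \<in> support"
  unfolding support_def using D_unit dg_unit_proj[OF one_closed, where 'k = 'k]
  by (auto intro!: bexI[of _ "dg_unit G"] simp del: One_nat_def)

lemma support_conj: "g \<in> carrier G \<Longrightarrow> x \<in> support \<Longrightarrow> conjg g x \<in> support"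
proof -
  assume g: "g \<in> carrier G" and x: "x \<in> support"
  obtain V where V: "V \<in> D" "dg_proj G V x \<noteq> 0" using x unfolding support_def by blast
  have xc: "x \<in> carrier G" using x by (rule support_carrier)
  have "dg_proj G V (conjg g x) \<noteq> 0"
    using obj_proj_zero_conj[OF D_obj[OF V(1)], of "inv g" "conjg g x"] V(2) g xc by auto
  then show ?thesis unfolding support_def using V(1) g xc by auto
qed

lemma support_comm: "x \<in> support \<Longrightarrow> y \<in> support \<Longrightarrow> x \<otimes> y = y \<otimes> x"
proof -
  assume x: "x \<in> support" and y: "y \<in> support"
  obtain V v where V: "V \<in> D" "v \<in> fm_carrier (dg_dim V) 1" "v \<noteq> 0" "dg_proj G V x * v = v"
    using x by (rule support_vector)
  obtain W w where W: "W \<in> D" "w \<in> fm_carrier (dg_dim W) 1" "w \<noteq> 0" "dg_proj G W y * w = w"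
    using y by (rule support_vector)
  show ?thesis using D_centralize[OF V(1) W(1) support_carrier[OF x] support_carrier[OF y] V(2-4) W(2-4)] by blast
qed

lemma support_subgroup: "subgroup support G"
  by (rule subgroup.intro) (auto simp: support_carrier support_mult support_one support_inv)

lemma bichar_mult_right:
  assumes x: "x \<in> support" and y: "y \<in> support" and z: "z \<in> support"
  shows "bichar (x, y \<otimes> z) = bichar (x, y) * bichar (x, z)"
proof -
  obtain V v where V: "V \<in> D" "v \<in> fm_carrier (dg_dim V) 1" "v \<noteq> 0" "dg_proj G V x * v = v"
    using x by (rule support_vector)
  have m: "dg_mat V h * v = fm_scale (bichar (x, h)) v" if "h \<in> support" for h
    using arg_cong[OF bichar_mat[OF x that V(1)], of "\<lambda>A. A * v"] V(4) by (simp add: mult.assoc)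
  show ?thesis
  proof (rule bichar_eqI[OF x support_mult[OF y z] V(1)])
    show "dg_proj G V x * v \<noteq> 0" using V by simp
    show "dg_mat V (y \<otimes> z) * (dg_proj G V x * v) = fm_scale (bichar (x, y) * bichar (x, z)) (dg_proj G V x * v)"
      unfolding V(4) using obj_mat_mult[OF D_obj[OF V(1)] support_carrier[OF y] support_carrier[OF z]]
      by (simp add: mult.assoc m[OF y] m[OF z] mult.commute[of "bichar (x, y)"])
  qed
qed

text \<open>Tested on a pure tensor of vectors of degrees x and y, which is nonzero, has degree
  \<open>x \<otimes> y\<close>, and on which z acts diagonally.\<close>

lemma bichar_mult_left:
  assumes x: "x \<in> support" and y: "y \<in> support" and z: "z \<in> support"
  shows "bichar (x \<otimes> y, z) = bichar (x, z) * bichar (y, z)"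
proof -
  obtain V W v w where VW: "V \<in> D" "W \<in> D" and v: "dg_proj G V x * v = v" and w: "dg_proj G W y * w = w"
    and nz: "fm_tensor (dg_dim V) 1 (dg_dim W) 1 v w \<noteq> 0"
    and P: "dg_proj G (dg_tensor G V W) (x \<otimes> y) * fm_tensor (dg_dim V) 1 (dg_dim W) 1 v w = fm_tensor (dg_dim V) 1 (dg_dim W) 1 v w"
    using support_tensor[OF x y] by metis
  have mv: "dg_mat V z * v = fm_scale (bichar (x, z)) v"
    using arg_cong[OF bichar_mat[OF x z VW(1)], of "\<lambda>A. A * v"] v by (simp add: mult.assoc)
  have mw: "dg_mat W z * w = fm_scale (bichar (y, z)) w"
    using arg_cong[OF bichar_mat[OF y z VW(2)], of "\<lambda>A. A * w"] w by (simp add: mult.assoc)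
  show ?thesis
  proof (rule bichar_eqI[OF support_mult[OF x y] z D_tensor[OF VW]])
    show "dg_proj G (dg_tensor G V W) (x \<otimes> y) * fm_tensor (dg_dim V) 1 (dg_dim W) 1 v w \<noteq> 0" unfolding P by (rule nz)
    show "dg_mat (dg_tensor G V W) z * (dg_proj G (dg_tensor G V W) (x \<otimes> y) * fm_tensor (dg_dim V) 1 (dg_dim W) 1 v w) =
      fm_scale (bichar (x, z) * bichar (y, z)) (dg_proj G (dg_tensor G V W) (x \<otimes> y) * fm_tensor (dg_dim V) 1 (dg_dim W) 1 v w)"
      unfolding P dg_tensor_mat_apply[OF D_obj[OF VW(1)] D_obj[OF VW(2)] support_carrier[OF z]] mv mw
      by (simp add: fm_tensor_linear mult.commute)
  qed
qed

lemma bichar_self: "x \<in> support \<Longrightarrow> bichar (x, x) = 1"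
proof -
  assume x: "x \<in> support"
  obtain V v where V: "V \<in> D" "v \<in> fm_carrier (dg_dim V) 1" "v \<noteq> 0" "dg_proj G V x * v = v"
    using x by (rule support_vector)
  show ?thesis
  proof (rule bichar_eqI[OF x x V(1)])
    show "dg_proj G V x * v \<noteq> 0" using V by simp
    show "dg_mat V x * (dg_proj G V x * v) = fm_scale 1 (dg_proj G V x * v)"
      using D_twist[OF V(1) support_carrier[OF x]] by (simp add: mult.assoc[symmetric])
  qed
qed

text \<open>Tested on \<open>dg_mat V g * v\<close>, a nonzero vector of degree g x g^-1: moving g y
  g^-1 past g leaves y acting on \<open>v\<close>.\<close>

lemma bichar_conj:
  assumes g: "g \<in> carrier G" and x: "x \<in> support" and y: "y \<in> support"
  shows "bichar (conjg g x, conjg g y) = bichar (x, y)"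
proof -
  obtain V v where V: "V \<in> D" "v \<in> fm_carrier (dg_dim V) 1" "v \<noteq> 0" "dg_proj G V x * v = v"
    using x by (rule support_vector)
  note Vo = D_obj[OF V(1)]
  have xc: "x \<in> carrier G" and yc: "y \<in> carrier G" using x y by (auto dest: support_carrier)
  have gv: "dg_proj G V (conjg g x) * (dg_mat V g * v) = dg_mat V g * v"
  proof -
    have "dg_proj G V (conjg g x) * (dg_mat V g * v) = dg_mat V g * (dg_proj G V x * v)"
      using obj_mat_proj[OF Vo g xc] by (simp add: mult.assoc[symmetric])
    then show ?thesis unfolding V(4) .
  qed
  show ?thesis
  proof (rule bichar_eqI[OF support_conj[OF g x] support_conj[OF g y] V(1)])
    have "dg_mat V (inv g) * (dg_mat V g * v) = v"
      using obj_mat_inv(2)[OF Vo g] fm_one_mult[OF V(2)] by (simp add: mult.assoc[symmetric])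
    then show "dg_proj G V (conjg g x) * (dg_mat V g * v) \<noteq> 0" unfolding gv using V(3) by auto
    have "conjg g y \<otimes> g = g \<otimes> y" using g yc by (simp add: m_assoc)
    then have "dg_mat V (conjg g y) * (dg_mat V g * v) = dg_mat V g * (dg_mat V y * v)"
      using obj_mat_mult[OF Vo, of "conjg g y" g] obj_mat_mult[OF Vo g yc] g yc by (simp add: mult.assoc[symmetric])
    also have "dg_mat V y * v = fm_scale (bichar (x, y)) v"
      using arg_cong[OF bichar_mat[OF x y V(1)], of "\<lambda>A. A * v"] V(4) by (simp add: mult.assoc)
    finally show "dg_mat V (conjg g y) * (dg_proj G V (conjg g x) * (dg_mat V g * v)) =
        fm_scale (bichar (x, y)) (dg_proj G V (conjg g x) * (dg_mat V g * v))"
      unfolding gv by simp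
  qed
qed

text \<open>From here on \<open>L\<close> is the category attached to the support and the
  bicharacter of \<open>D\<close>, and its dimension |G| is available for comparison.\<close>

sublocale normal_bichar G support bichar
proof (intro normal_bichar.intro normal_bichar_axioms.intro finite_group_axioms)
  show "support \<lhd> G"
    unfolding normal_inv_iff using support_subgroup support_conj by blast
  show "comm_group (G\<lparr>carrier := support\<rparr>)"
    by (rule group.group_comm_groupI[OF subgroup.subgroup_is_group[OF support_subgroup is_group]])
      (auto simp: support_comm)
  show "alternating_bichar G support bichar"
    unfolding alternating_bichar_def
  proof (intro conjI ballI)
    show "bichar \<in> support \<times> support \<rightarrow>\<^sub>E UNIV - {0}"
    proof (rule PiE_I)
      show "bichar p \<in> UNIV - {0}" if "p \<in> support \<times> support" for p using that bichar_nz by auto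
      show "bichar p = undefined" if "p \<notin> support \<times> support" for p unfolding bichar_def using that by simp
    qed
  qed (simp_all add: bichar_mult_left bichar_mult_right bichar_self)
  show "invariant_bichar G support bichar"
    unfolding invariant_bichar_def using bichar_conj by blast
qed

lemma D_subset_L: "D \<subseteq> L"
  unfolding bichar_objects_def using D_obj bichar_mat unfolding support_def by blast

lemma D_cat_dim: "cat_dim G D = card (carrier G)"
proof -
  have "(cat_dim G D)\<^sup>2 = (card (carrier G))\<^sup>2"
    using lagrangian unfolding lagrangian_def cat_dim_all by blast
  then show ?thesis by simp
qed

text \<open>The two dimensions are sums over nested sets of positions in one decomposition of the
  regular object, with positive terms. Being equal, they run over the same positions, so both
  categories have the same simple objects, and complete reducibility does the rest.\<close>

lemma D_eq_L: "D = L"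
proof
  show "L \<subseteq> D"
  proof
    obtain Ws :: "('a, 'k) dgrep list" where Ws: "dg_decomposes_regular Ws" using dg_decomposes_regular_exists by blast
    have Dd: "cat_dim G D = (\<Sum>i | i < length Ws \<and> Ws ! i \<in> D. dg_dim (Ws ! i))"
    proof -
      have "D \<subseteq> Collect (dg_obj G)" using D_obj by blast
      from cat_dim_eq(2)[OF Ws this D_iso] show ?thesis unfolding sum_list_map_filter_nth .
    qed
    have Ld: "cat_dim G L = (\<Sum>i | i < length Ws \<and> Ws ! i \<in> L. dg_dim (Ws ! i))"
    proof -
      have "L \<subseteq> Collect (dg_obj G)" using L_obj by blast
      from cat_dim_eq(2)[OF Ws this L_iso] show ?thesis unfolding sum_list_map_filter_nth .
    qed
    have sub: "{i. i < length Ws \<and> Ws ! i \<in> D} \<subseteq> {i. i < length Ws \<and> Ws ! i \<in> L}" using D_subset_L by blast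
    \<comment> \<open>The excess of the dimension of \<open>L\<close> over that of
      \<open>D\<close>.\<close>
    have "(\<Sum>i\<in>{i. i < length Ws \<and> Ws ! i \<in> L} - {i. i < length Ws \<and> Ws ! i \<in> D}. dg_dim (Ws ! i)) = 0"
      using sum.subset_diff[OF sub, of "\<lambda>i. dg_dim (Ws ! i)"] Dd Ld D_cat_dim L_cat_dim by simp
    then have zero: "dg_dim (Ws ! i) = 0" if "i < length Ws" "Ws ! i \<in> L" "Ws ! i \<notin> D" for i
      using that by auto
    \<comment> \<open>The multiplicity of S in the list is its dimension, hence positive, so some
      member of the list is isomorphic to S and transfers membership.\<close>
    have simple: "S \<in> D" if S: "dg_simple G S" "S \<in> L" for S
    proof -
      have "length (filter (\<lambda>W. dg_iso G W S) Ws) = dg_dim S" using Ws S(1) unfolding dg_decomposes_regular_def by blast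
      then have "filter (\<lambda>W. dg_iso G W S) Ws \<noteq> []" using S(1) unfolding dg_simple_def by auto
      then obtain i where i: "i < length Ws" "dg_iso G (Ws ! i) S" by (auto simp: filter_empty_conv in_set_conv_nth)
      have sW: "dg_simple G (Ws ! i)" using Ws i(1) unfolding dg_decomposes_regular_def by simp
      have "Ws ! i \<in> L" using L_iso[OF S(2) dg_simple_obj[OF sW] dg_iso_sym[OF i(2)]] .
      then have "Ws ! i \<in> D" using zero[OF i(1)] sW unfolding dg_simple_def by auto
      then show ?thesis using D_iso[OF _ dg_simple_obj[OF S(1)] i(2)] by blast
    qed
    fix V assume V: "V \<in> L"
    obtain Us where Us: "\<forall>W\<in>set Us. dg_simple G W \<and> dg_retract G W V" "dg_iso G V (dg_sums Us)"
      using dg_semisimple[OF L_obj[OF V]] by blast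
    have "\<forall>W\<in>set Us. W \<in> D" using Us(1) simple L_retract[OF V] by blast
    then have "dg_sums Us \<in> D" by (rule D_sums)
    then show "V \<in> D" using D_iso[OF _ L_obj[OF V] dg_iso_sym[OF Us(2)]] by blast
  qed
qed (rule D_subset_L)

end

text \<open>H is the set of degrees that occur in the category, and a nonzero component of degree x
  shows the scalars B (x, h).\<close>

lemma bichar_objects_inj:
  fixes B B' :: "'a \<times> 'a \<Rightarrow> 'k::{alg_closed_field, field_char_0}"
  assumes HB: "normal_bichar G H B" and HB': "normal_bichar G H' B'"
    and eq: "bichar_objects G H B = bichar_objects G H' B'"
  shows "H = H' \<and> B = B'"
proof -
  interpret one: normal_bichar G H B by (rule HB)
  interpret two: normal_bichar G H' B' by (rule HB')
  have H: "H = H'"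
  proof
    show "H \<subseteq> H'" using one.L_support two.L_proj eq one.H_carrier by blast
    show "H' \<subseteq> H" using two.L_support one.L_proj eq two.H_carrier by blast
  qed
  have "B (x, h) = B' (x, h)" if x: "x \<in> H" and h: "h \<in> H" for x h
  proof -
    obtain V where V: "V \<in> bichar_objects G H B" "dg_proj G V x \<noteq> 0" using one.L_support[OF x] by blast
    have "fm_scale (B (x, h)) (dg_proj G V x) = fm_scale (B' (x, h)) (dg_proj G V x)"
      using one.L_mat[OF V(1) x h] two.L_mat[of V x h] V(1) eq x h unfolding H by simp
    moreover have "fm_scale (B (x, h) - B' (x, h)) (dg_proj G V x)
        = fm_scale (B (x, h)) (dg_proj G V x) - fm_scale (B' (x, h)) (dg_proj G V x)"
      by (rule fmat_eqI) (simp add: fm_nth_simps left_diff_distrib)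
    ultimately show ?thesis using V(2) by (simp add: fm_scale_eq_0_iff)
  qed
  \<comment> \<open>Agreement on H x H suffices because both functions are \<open>undefined\<close>
    elsewhere.\<close>
  moreover have "B \<in> extensional (H \<times> H)" "B' \<in> extensional (H \<times> H)"
    using one.alternating two.alternating unfolding alternating_bichar_def H PiE_def by auto
  ultimately have "B = B'" by (intro extensionalityI[of _ "H \<times> H"]) auto
  then show ?thesis using H by blast
qed

theorem theorem1p1:
  fixes G :: "('g, 'b) monoid_scheme" and R :: "'g set"
  assumes "group G" and "finite (carrier G)" and "conj_class_reps G R"
  shows "bij_betw
    (\<lambda>(H, B). bichar_subcategory G R H B :: ('g, 'k::{alg_closed_field, field_char_0}) dgrep set)
    {(H, B). H \<lhd> G \<and> comm_group (G\<lparr>carrier := H\<rparr>) \<and>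
             alternating_bichar G H B \<and> invariant_bichar G H B}
    {D. lagrangian G D}"
proof -
  interpret finite_group G using assms(1,2) by (simp add: finite_group_def finite_group_axioms_def)
  let ?S = "{(H, B :: 'g \<times> 'g \<Rightarrow> 'k). H \<lhd> G \<and> comm_group (G\<lparr>carrier := H\<rparr>) \<and>
    alternating_bichar G H B \<and> invariant_bichar G H B}"
  have S: "(H, B) \<in> ?S \<longleftrightarrow> normal_bichar G H B" for H B
    unfolding normal_bichar_def normal_bichar_axioms_def using finite_group_axioms by simp
  have eq: "bichar_subcategory G R H B = bichar_objects G H B" if "(H, B) \<in> ?S" for H B
    using normal_bichar.bichar_subcategory_eq[OF _ assms(3)] that unfolding S by blast
  show ?thesis
    unfolding bij_betw_def
  proof
    show "inj_on (\<lambda>(H, B). bichar_subcategory G R H B) ?S"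
    proof (rule inj_onI)
      fix p q assume p: "p \<in> ?S" and q: "q \<in> ?S"
        and e: "(\<lambda>(H, B). bichar_subcategory G R H B) p = (\<lambda>(H, B). bichar_subcategory G R H B) q"
      obtain H B where p': "p = (H, B)" by (cases p)
      obtain H' B' where q': "q = (H', B')" by (cases q)
      have "bichar_objects G H B = bichar_objects G H' B'"
        using e eq[of H B] eq[of H' B'] p q unfolding p' q' by simp
      then show "p = q" unfolding p' q'
        using bichar_objects_inj[of G H B H' B'] S[of H B] S[of H' B'] p q unfolding p' q' by blast
    qed
    show "(\<lambda>(H, B). bichar_subcategory G R H B) ` ?S = {D. lagrangian G D}"
    proof
      show "(\<lambda>(H, B). bichar_subcategory G R H B) ` ?S \<subseteq> {D. lagrangian G D}"
      proof
        fix D assume "D \<in> (\<lambda>(H, B). bichar_subcategory G R H B) ` ?S"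
        then obtain H B where HB: "(H, B) \<in> ?S" "D = bichar_subcategory G R H B" by blast
        then show "D \<in> {D. lagrangian G D}"
          using eq[OF HB(1)] normal_bichar.L_lagrangian[of G H B] S[of H B] by simp
      qed
      show "{D. lagrangian G D} \<subseteq> (\<lambda>(H, B). bichar_subcategory G R H B) ` ?S"
      proof
        fix D :: "('g, 'k) dgrep set" assume "D \<in> {D. lagrangian G D}"
        then interpret D: lagrangian_subcategory G D by unfold_locales simp
        have HB: "(D.support, D.bichar) \<in> ?S" unfolding S by (rule D.normal_bichar_axioms)
        have "D = bichar_subcategory G R D.support D.bichar" unfolding eq[OF HB] by (rule D.D_eq_L)
        then show "D \<in> (\<lambda>(H, B). bichar_subcategory G R H B) ` ?S"
          using HB by (intro image_eqI[of _ _ "(D.support, D.bichar)"]) auto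
      qed
    qed
  qed
qed

end
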